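(* Let $\Lambda=KQ/I$ be a gentle algebra and let $M,N$ be indecomposable string modules over $\Lambda$. Let $\Omega^1(M)=L_0\oplus\cdots\oplus L_k$ be a decomposition with $k\ge 1$ in which $L_i$ is projective for $i=1,\dots,k-1$ and each of $L_0$ and $L_k$ is uniserial or zero. Then $$\operatorname{Ext}_\Lambda^2(M,N)\cong\operatorname{Ext}_\Lambda^1(L_0,N)\oplus \operatorname{Ext}_\Lambda^1(L_k,N).$$ More generally, for $n\ge 2$, $$\operatorname{Ext}_\Lambda^n(M,N)\cong\operatorname{Ext}_\Lambda^1(\Omega^{n-2}(L_0),N)\oplus \operatorname{Ext}_\Lambda^1(\Omega^{n-2}(L_k),N),$$ where for $i\in\{0,k\}$ the module $\Omega^{n-2}(L_i)$ is either $0$ or of the form $R(\alpha)$ for some arrow $\alpha$. In particular, if $\Lambda=\Lambda(T)$ is the gentle algebra of a triangulation $T$ of a surface, then for $n\ge 2$ $$\operatorname{Ext}_\Lambda^{n}(M,N)\cong\operatorname{Ext}_\Lambda^{n+3}(M,N).$$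
   Context: $K$ is an algebraically closed field. A finite dimensional algebra $\Lambda=KQ/I$, $I$ admissible, is gentle if: (1) at every vertex of $Q$ at most two arrows start and at most two arrows end; (2) for every arrow $\alpha$ there is at most one arrow $\beta$ (with $t(\alpha)=s(\beta)$) such that $\alpha\beta\notin I$ and at most one arrow $\gamma$ (with $t(\gamma)=s(\alpha)$) such that $\gamma\alpha\notin I$; (3) for every arrow $\alpha$ there is at most one arrow $\beta$ with $t(\alpha)=s(\beta)$ and $\alpha\beta\in I$ and at most one arrow $\gamma$ with $t(\gamma)=s(\alpha)$ and $\gamma\alpha\in I$; (4) $I$ is generated by paths of length two. Here $s(\alpha),t(\alpha)$ are the start and end of an arrow, paths are composed from left to right, and modules are finitely generated right modules. A string is a word in arrows and formal inverse arrows (with $s(\alpha^{-1})=t(\alpha)$, $t(\alpha^{-1})=s(\alpha)$), each letter starting where the previous one ends, with no letter followed by its inverse and such that no two consecutive arrows have product in $I$ and no two consecutive inverse arrows $\beta^{-1}\alpha^{-1}$ have $\alpha\beta\in I$; strings of length $0$ are the trivial strings $e_v$ at vertices $v$. String modules are the modules $M(w)$ associated to strings $w$. $\Omega^0(X)=X$; $\Omega^1(X)$ is the kernel of the projective cover $P(X)\to X$, and $\Omega^j(X)=\Omega^1(\Omega^{j-1}(X))$. For an arrow $\alpha$, $R(\alpha)=\alpha\Lambda$, a uniserial module. For every indecomposable string module $M$, a decomposition of $\Omega^1(M)$ of the stated form exists. Gentle algebra of a triangulation: let $T$ be an ideal triangulation of an oriented surface with boundary and marked points, all marked points lying on the (non-empty)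 boundary. $\Lambda(T)=KQ(T)/I$, where the vertices of $Q(T)$ are the arcs of $T$ (boundary segments not included), for each triangle of $T$ and each pair of its sides $i,j$ that are arcs of $T$ there is an arrow $i\to j$ whenever $j$ is the immediate successor of $i$ in the cyclic order on the sides of the triangle given by the orientation of the surface, and $I$ is generated by the compositions of any two consecutive arrows inside an internal triangle (a triangle all of whose sides are arcs of $T$). *)

theory Defs
  imports
    "Graph_Theory.Graph_Theory"
    "HOL-Complex_Analysis.Complex_Analysis"
    "HOL-Algebra.Algebraic_Closure_Type"
begin

section \<open>Right modules\<close>

text \<open>
  A right \<open>R\<close>-module is stored in the module record of HOL-Algebra, whose locale \<open>module\<close> only
  covers commutative rings: \<open>r \<odot>\<^bsub>M\<^esub> x\<close> stands for the right action \<open>x r\<close>, hence the order of the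
  factors in \<open>act_mult\<close>. The ring operations \<open>mult\<close> and \<open>one\<close> of a module record are irrelevant
  unless the record is an algebra.
\<close>

locale right_module = R?: ring R + M?: abelian_group M
  for R :: "('r, 'y) ring_scheme" (structure) and M :: "('r, 'm, 'z) module_scheme" (structure) +
  assumes act_closed:
      "\<lbrakk>r \<in> carrier R; x \<in> carrier M\<rbrakk> \<Longrightarrow> r \<odot>\<^bsub>M\<^esub> x \<in> carrier M"
    and act_add_scalar:
      "\<lbrakk>r \<in> carrier R; s \<in> carrier R; x \<in> carrier M\<rbrakk> \<Longrightarrow>
        (r \<oplus>\<^bsub>R\<^esub> s) \<odot>\<^bsub>M\<^esub> x = r \<odot>\<^bsub>M\<^esub> x \<oplus>\<^bsub>M\<^esub> s \<odot>\<^bsub>M\<^esub> x"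
    and act_add:
      "\<lbrakk>r \<in> carrier R; x \<in> carrier M; y \<in> carrier M\<rbrakk> \<Longrightarrow>
        r \<odot>\<^bsub>M\<^esub> (x \<oplus>\<^bsub>M\<^esub> y) = r \<odot>\<^bsub>M\<^esub> x \<oplus>\<^bsub>M\<^esub> r \<odot>\<^bsub>M\<^esub> y"
    and act_mult:
      "\<lbrakk>r \<in> carrier R; s \<in> carrier R; x \<in> carrier M\<rbrakk> \<Longrightarrow>
        (r \<otimes>\<^bsub>R\<^esub> s) \<odot>\<^bsub>M\<^esub> x = s \<odot>\<^bsub>M\<^esub> (r \<odot>\<^bsub>M\<^esub> x)"
    and act_one:
      "x \<in> carrier M \<Longrightarrow> \<one>\<^bsub>R\<^esub> \<odot>\<^bsub>M\<^esub> x = x"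

definition fg_module :: "('r, 'y) ring_scheme \<Rightarrow> ('r, 'm) module \<Rightarrow> bool" where
  "fg_module R M \<longleftrightarrow> right_module R M \<and>
     (\<exists>S. finite S \<and> S \<subseteq> carrier M \<and> (\<forall>U. submodule U R M \<and> S \<subseteq> U \<longrightarrow> U = carrier M))"

definition zero_module :: "('r, 'm) module \<Rightarrow> bool" where
  "zero_module M \<longleftrightarrow> carrier M = {\<zero>\<^bsub>M\<^esub>}"

definition mod_hom :: "('r, 'y) ring_scheme \<Rightarrow> ('r, 'm) module \<Rightarrow> ('r, 'n) module \<Rightarrow> ('m \<Rightarrow> 'n) set" where
  "mod_hom R M N = {f \<in> carrier M \<rightarrow>\<^sub>E carrier N.
     (\<forall>x\<in>carrier M. \<forall>y\<in>carrier M. f (x \<oplus>\<^bsub>M\<^esub> y) = f x \<oplus>\<^bsub>N\<^esub> f y) \<and>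
     (\<forall>r\<in>carrier R. \<forall>x\<in>carrier M. f (r \<odot>\<^bsub>M\<^esub> x) = r \<odot>\<^bsub>N\<^esub> f x)}"

definition mod_isomorphic :: "('r, 'y) ring_scheme \<Rightarrow> ('r, 'm) module \<Rightarrow> ('r, 'n) module \<Rightarrow> bool" where
  "mod_isomorphic R M N \<longleftrightarrow> (\<exists>f\<in>mod_hom R M N. bij_betw f (carrier M) (carrier N))"

definition indecomposable :: "('r, 'y) ring_scheme \<Rightarrow> ('r, 'm) module \<Rightarrow> bool" where
  "indecomposable R M \<longleftrightarrow> \<not> zero_module M \<and>
     \<not> (\<exists>U V. submodule U R M \<and> submodule V R M \<and> U \<noteq> {\<zero>\<^bsub>M\<^esub>} \<and> V \<noteq> {\<zero>\<^bsub>M\<^esub>} \<and>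
            U \<inter> V = {\<zero>\<^bsub>M\<^esub>} \<and> U <+>\<^bsub>M\<^esub> V = carrier M)"

definition uniserial :: "('r, 'y) ring_scheme \<Rightarrow> ('r, 'm) module \<Rightarrow> bool" where
  "uniserial R M \<longleftrightarrow> \<not> zero_module M \<and>
     (\<forall>U V. submodule U R M \<and> submodule V R M \<longrightarrow> U \<subseteq> V \<or> V \<subseteq> U)"

definition mod_family_sum :: "nat set \<Rightarrow> (nat \<Rightarrow> ('r, 'm) module) \<Rightarrow> ('r, nat \<Rightarrow> 'm) module" where
  "mod_family_sum J L =
     \<lparr>carrier = (\<Pi>\<^sub>E i\<in>J. carrier (L i)), mult = undefined, one = undefined,
      ring.zero = (\<lambda>i\<in>J. \<zero>\<^bsub>L i\<^esub>), ring.add = (\<lambda>x y. \<lambda>i\<in>J. x i \<oplus>\<^bsub>L i\<^esub> y i),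
      smult = (\<lambda>r x. \<lambda>i\<in>J. r \<odot>\<^bsub>L i\<^esub> x i)\<rparr>"

definition mod_sum :: "('r, 'm) module \<Rightarrow> ('r, 'n) module \<Rightarrow> ('r, 'm \<times> 'n) module" where
  "mod_sum M N =
     \<lparr>carrier = carrier M \<times> carrier N, mult = undefined, one = undefined,
      ring.zero = (\<zero>\<^bsub>M\<^esub>, \<zero>\<^bsub>N\<^esub>), ring.add = (\<lambda>(x, y) (x', y'). (x \<oplus>\<^bsub>M\<^esub> x', y \<oplus>\<^bsub>N\<^esub> y')),
      smult = (\<lambda>r (x, y). (r \<odot>\<^bsub>M\<^esub> x, r \<odot>\<^bsub>N\<^esub> y))\<rparr>"

text \<open>Quotient of an algebra by an ideal, and of a vector space by a subspace.\<close>

definition quot_alg :: "('k, 'b) module \<Rightarrow> 'b set \<Rightarrow> ('k, 'b set) module" where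
  "quot_alg V B =
     \<lparr>carrier = carrier (V Quot B), mult = (\<otimes>\<^bsub>V Quot B\<^esub>), one = \<one>\<^bsub>V Quot B\<^esub>,
      ring.zero = \<zero>\<^bsub>V Quot B\<^esub>, ring.add = (\<oplus>\<^bsub>V Quot B\<^esub>),
      smult = (\<lambda>c C. \<Union>x\<in>C. B +>\<^bsub>V\<^esub> (c \<odot>\<^bsub>V\<^esub> x))\<rparr>"

section \<open>Projective modules, syzygies and Ext\<close>

text \<open>
  Every finitely generated right \<open>R\<close>-module is a quotient of some \<open>R\<^sup>n\<close>, so (choosing coset
  representatives) it has an isomorphic copy whose elements have type \<open>nat \<Rightarrow> 'r\<close>. Choices of
  modules and quantifications over all finitely generated modules are made inside this type.
\<close>

type_synonym 'r univ = "nat \<Rightarrow> 'r"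

definition projective :: "('r, 'y) ring_scheme \<Rightarrow> ('r, 'm) module \<Rightarrow> bool" where
  "projective R P \<longleftrightarrow> fg_module R P \<and>
     (\<forall>(E :: ('r, 'r univ) module) (F :: ('r, 'r univ) module).
        \<forall>g\<in>mod_hom R E F. \<forall>f\<in>mod_hom R P F.
          fg_module R E \<and> fg_module R F \<and> g ` carrier E = carrier F \<longrightarrow>
          (\<exists>h\<in>mod_hom R P E. \<forall>x\<in>carrier P. g (h x) = f x))"

text \<open>A projective cover is an essential epimorphism from a projective module.\<close>

definition proj_cover ::
  "('r, 'y) ring_scheme \<Rightarrow> ('r, 'm) module \<Rightarrow> ('r, 'n) module \<Rightarrow> ('n \<Rightarrow> 'm) \<Rightarrow> bool" where
  "proj_cover R M P p \<longleftrightarrow> projective R P \<and> p \<in> mod_hom R P M \<and> p ` carrier P = carrier M \<and>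
     (\<forall>U. submodule U R P \<and> p ` U = carrier M \<longrightarrow> U = carrier P)"

definition syzygy :: "('r, 'y) ring_scheme \<Rightarrow> ('r, 'm) module \<Rightarrow> ('r, 'r univ) module" where
  "syzygy R M =
     (let (P, p) = (SOME (P, p). proj_cover R M P p)
      in P\<lparr>carrier := {x \<in> carrier P. p x = \<zero>\<^bsub>M\<^esub>}\<rparr>)"

definition syzygy_pow ::
  "('r, 'y) ring_scheme \<Rightarrow> nat \<Rightarrow> ('r, 'r univ) module \<Rightarrow> ('r, 'r univ) module" where
  "syzygy_pow R j M = (syzygy R ^^ j) M"

definition proj_resolution ::
  "('r, 'y) ring_scheme \<Rightarrow> ('r, 'm) module \<Rightarrow> (nat \<Rightarrow> ('r, 'n) module) \<Rightarrow>
    (nat \<Rightarrow> 'n \<Rightarrow> 'n) \<Rightarrow> ('n \<Rightarrow> 'm) \<Rightarrow> bool" where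
  "proj_resolution R M P d e \<longleftrightarrow>
     (\<forall>i. projective R (P i) \<and> d i \<in> mod_hom R (P (Suc i)) (P i)) \<and>
     e \<in> mod_hom R (P 0) M \<and> e ` carrier (P 0) = carrier M \<and>
     d 0 ` carrier (P 1) = {x \<in> carrier (P 0). e x = \<zero>\<^bsub>M\<^esub>} \<and>
     (\<forall>i. d (Suc i) ` carrier (P (Suc (Suc i))) = {x \<in> carrier (P (Suc i)). d i x = \<zero>\<^bsub>P i\<^esub>})"

text \<open>
  The space of \<open>A\<close>-homomorphisms for a \<open>K\<close>-algebra \<open>A\<close>: a scalar \<open>c\<close> acts on a module through
  the element \<open>c 1\<close> of \<open>A\<close>.
\<close>

definition hom_space ::
  "('k, 'r) module \<Rightarrow> ('r, 'm) module \<Rightarrow> ('r, 'n) module \<Rightarrow> ('k, 'm \<Rightarrow> 'n) module" where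
  "hom_space A M N =
     \<lparr>carrier = mod_hom A M N, mult = undefined, one = undefined,
      ring.zero = (\<lambda>x\<in>carrier M. \<zero>\<^bsub>N\<^esub>),
      ring.add = (\<lambda>f g. \<lambda>x\<in>carrier M. f x \<oplus>\<^bsub>N\<^esub> g x),
      smult = (\<lambda>c f. \<lambda>x\<in>carrier M. (c \<odot>\<^bsub>A\<^esub> \<one>\<^bsub>A\<^esub>) \<odot>\<^bsub>N\<^esub> f x)\<rparr>"

text \<open>
  The \<open>n\<close>-th cohomology of the complex of homomorphisms from a chosen projective resolution
  of \<open>M\<close> to \<open>N\<close>.
\<close>

definition Ext ::
  "('k, 'r) module \<Rightarrow> nat \<Rightarrow> ('r, 'm) module \<Rightarrow> ('r, 'n) module \<Rightarrow>
    ('k, ('r univ \<Rightarrow> 'n) set) module" where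
  "Ext A n M N =
     (let (P, d) = (SOME (P, d). \<exists>e. proj_resolution A M P d e);
          Z = {f \<in> mod_hom A (P n) N. \<forall>x\<in>carrier (P (Suc n)). f (d n x) = \<zero>\<^bsub>N\<^esub>};
          B = (case n of
                 0 \<Rightarrow> {\<zero>\<^bsub>hom_space A (P n) N\<^esub>}
               | Suc m \<Rightarrow> (\<lambda>g. compose (carrier (P n)) g (d m)) ` mod_hom A (P m) N)
      in quot_alg ((hom_space A (P n) N)\<lparr>carrier := Z\<rparr>) B)"

definition vs_isomorphic :: "('k :: field, 'm) module \<Rightarrow> ('k, 'n) module \<Rightarrow> bool" where
  "vs_isomorphic V W \<longleftrightarrow> mod_isomorphic (ring_of_type_algebra :: 'k ring) V W"

section \<open>Bound quivers\<close>

text \<open>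
  A quiver is a digraph in the sense of the theory Digraph (loops and multiple arrows are
  allowed). A path is a pair of its start vertex and its list of arrows, from left to right;
  elements of the path algebra are finitely supported functions on paths.
\<close>

definition qpaths :: "('v, 'a) pre_digraph \<Rightarrow> ('v \<times> 'a list) set" where
  "qpaths Q = {(v, p). \<exists>u. pre_digraph.awalk Q v p u}"

definition path_algebra ::
  "('v, 'a) pre_digraph \<Rightarrow> ('k :: field, 'v \<times> 'a list \<Rightarrow> 'k) module" where
  "path_algebra Q =
     \<lparr>carrier = {x. finite {p. x p \<noteq> 0} \<and> {p. x p \<noteq> 0} \<subseteq> qpaths Q},
      mult = (\<lambda>x y (v, p). \<Sum>i\<le>length p.
                x (v, take i p) * y (last (pre_digraph.awalk_verts Q v (take i p)), drop i p)),
      one = (\<lambda>(v, p). if v \<in> verts Q \<and> p = [] then 1 else 0),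
      ring.zero = (\<lambda>p. 0),
      ring.add = (\<lambda>x y p. x p + y p),
      smult = (\<lambda>c x p. c * x p)\<rparr>"

definition path_elt :: "'v \<times> 'a list \<Rightarrow> 'v \<times> 'a list \<Rightarrow> 'k :: field" where
  "path_elt p = (\<lambda>q. if q = p then 1 else 0)"

abbreviation arrow_prod :: "('v, 'a) pre_digraph \<Rightarrow> 'a \<Rightarrow> 'a \<Rightarrow> 'v \<times> 'a list \<Rightarrow> 'k :: field" where
  "arrow_prod Q \<alpha> \<beta> \<equiv> path_elt (tail Q \<alpha>, [\<alpha>, \<beta>])"

text \<open>The \<open>m\<close>-th power of the ideal generated by the arrows.\<close>

definition arrow_ideal_pow ::
  "('v, 'a) pre_digraph \<Rightarrow> nat \<Rightarrow> ('v \<times> 'a list \<Rightarrow> 'k :: field) set" where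
  "arrow_ideal_pow Q m = Idl\<^bsub>path_algebra Q\<^esub> (path_elt ` {p \<in> qpaths Q. length (snd p) = m})"

definition admissible ::
  "('v, 'a) pre_digraph \<Rightarrow> ('v \<times> 'a list \<Rightarrow> 'k :: field) set \<Rightarrow> bool" where
  "admissible Q I \<longleftrightarrow> ideal I (path_algebra Q) \<and> I \<subseteq> arrow_ideal_pow Q 2 \<and>
     (\<exists>m\<ge>2. arrow_ideal_pow Q m \<subseteq> I)"

definition bound_algebra ::
  "('v, 'a) pre_digraph \<Rightarrow> ('v \<times> 'a list \<Rightarrow> 'k :: field) set \<Rightarrow>
    ('k, ('v \<times> 'a list \<Rightarrow> 'k) set) module" where
  "bound_algebra Q I = quot_alg (path_algebra Q) I"

text \<open>
  Finite-dimensionality of \<open>KQ/I\<close> is part of this definition, because the quiver is finite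
  and \<open>I\<close> is admissible.
\<close>

definition gentle :: "('v, 'a) pre_digraph \<Rightarrow> ('v \<times> 'a list \<Rightarrow> 'k :: field) set \<Rightarrow> bool" where
  "gentle Q I \<longleftrightarrow> fin_digraph Q \<and> admissible Q I \<and>
     (\<forall>v\<in>verts Q. card {\<alpha>\<in>arcs Q. tail Q \<alpha> = v} \<le> 2 \<and> card {\<alpha>\<in>arcs Q. head Q \<alpha> = v} \<le> 2) \<and>
     (\<forall>\<alpha>\<in>arcs Q.
        card {\<beta>\<in>arcs Q. head Q \<alpha> = tail Q \<beta> \<and> arrow_prod Q \<alpha> \<beta> \<notin> I} \<le> 1 \<and>
        card {\<gamma>\<in>arcs Q. head Q \<gamma> = tail Q \<alpha> \<and> arrow_prod Q \<gamma> \<alpha> \<notin> I} \<le> 1) \<and>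
     (\<forall>\<alpha>\<in>arcs Q.
        card {\<beta>\<in>arcs Q. head Q \<alpha> = tail Q \<beta> \<and> arrow_prod Q \<alpha> \<beta> \<in> I} \<le> 1 \<and>
        card {\<gamma>\<in>arcs Q. head Q \<gamma> = tail Q \<alpha> \<and> arrow_prod Q \<gamma> \<alpha> \<in> I} \<le> 1) \<and>
     (\<exists>S \<subseteq> {p \<in> qpaths Q. length (snd p) = 2}. I = Idl\<^bsub>path_algebra Q\<^esub> (path_elt ` S))"

text \<open>The right module \<open>R(\<alpha>) = \<alpha>\<Lambda>\<close>, a submodule of the right regular module.\<close>

definition right_ideal_gen :: "('k, 'r) module \<Rightarrow> 'r \<Rightarrow> ('r, 'r) module" where
  "right_ideal_gen A a =
     \<lparr>carrier = {a \<otimes>\<^bsub>A\<^esub> r | r. r \<in> carrier A}, mult = undefined, one = undefined,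
      ring.zero = \<zero>\<^bsub>A\<^esub>, ring.add = (\<oplus>\<^bsub>A\<^esub>), smult = (\<lambda>r x. x \<otimes>\<^bsub>A\<^esub> r)\<rparr>"

definition arrow_module ::
  "('v, 'a) pre_digraph \<Rightarrow> ('v \<times> 'a list \<Rightarrow> 'k :: field) set \<Rightarrow> 'a \<Rightarrow>
    (('v \<times> 'a list \<Rightarrow> 'k) set, ('v \<times> 'a list \<Rightarrow> 'k) set) module" where
  "arrow_module Q I \<alpha> =
     right_ideal_gen (bound_algebra Q I) (I +>\<^bsub>path_algebra Q\<^esub> path_elt (tail Q \<alpha>, [\<alpha>]))"

text \<open>Renaming of vertices and arrows that carries one ideal of relations to the other.\<close>

definition bound_quiver_iso ::
  "('v, 'a) pre_digraph \<Rightarrow> ('v \<times> 'a list \<Rightarrow> 'k :: field) set \<Rightarrow>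
    ('w, 'b) pre_digraph \<Rightarrow> ('w \<times> 'b list \<Rightarrow> 'k) set \<Rightarrow> bool" where
  "bound_quiver_iso Q I Q' I' \<longleftrightarrow>
     (\<exists>h. pre_digraph.digraph_isomorphism Q h \<and> app_iso h Q = Q' \<and>
        I = {x \<in> carrier (path_algebra Q).
               \<exists>y\<in>I'. \<forall>(v, p)\<in>qpaths Q. x (v, p) = y (iso_verts h v, map (iso_arcs h) p)})"

section \<open>Strings and string modules\<close>

datatype 'a letter = Arr 'a | Inv 'a

fun letter_arrow :: "'a letter \<Rightarrow> 'a" where
  "letter_arrow (Arr \<alpha>) = \<alpha>"
| "letter_arrow (Inv \<alpha>) = \<alpha>"

fun letter_inv :: "'a letter \<Rightarrow> 'a letter" where
  "letter_inv (Arr \<alpha>) = Inv \<alpha>"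
| "letter_inv (Inv \<alpha>) = Arr \<alpha>"

fun letter_start :: "('v, 'a) pre_digraph \<Rightarrow> 'a letter \<Rightarrow> 'v" where
  "letter_start Q (Arr \<alpha>) = tail Q \<alpha>"
| "letter_start Q (Inv \<alpha>) = head Q \<alpha>"

definition letter_end :: "('v, 'a) pre_digraph \<Rightarrow> 'a letter \<Rightarrow> 'v" where
  "letter_end Q l = letter_start Q (letter_inv l)"

text \<open>
  A word is given by its start vertex \<open>v\<close> and its list \<open>w\<close> of letters. It visits the vertices
  \<open>word_vertex Q v w i\<close> for \<open>i \<le> length w\<close>, and the letter \<open>w ! i\<close> leads from the \<open>i\<close>-th
  to the next one.
\<close>

definition word_vertex :: "('v, 'a) pre_digraph \<Rightarrow> 'v \<Rightarrow> 'a letter list \<Rightarrow> nat \<Rightarrow> 'v" where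
  "word_vertex Q v w i = (case i of 0 \<Rightarrow> v | Suc j \<Rightarrow> letter_end Q (w ! j))"

definition is_string ::
  "('v, 'a) pre_digraph \<Rightarrow> ('v \<times> 'a list \<Rightarrow> 'k :: field) set \<Rightarrow> 'v \<Rightarrow> 'a letter list \<Rightarrow> bool" where
  "is_string Q I v w \<longleftrightarrow> v \<in> verts Q \<and>
     (\<forall>i<length w. letter_arrow (w ! i) \<in> arcs Q \<and> letter_start Q (w ! i) = word_vertex Q v w i) \<and>
     (\<forall>i. Suc i < length w \<longrightarrow>
        w ! Suc i \<noteq> letter_inv (w ! i) \<and>
        (\<forall>\<alpha> \<beta>. w ! i = Arr \<alpha> \<and> w ! Suc i = Arr \<beta> \<longrightarrow> arrow_prod Q \<alpha> \<beta> \<notin> I) \<and>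
        (\<forall>\<alpha> \<beta>. w ! i = Inv \<beta> \<and> w ! Suc i = Inv \<alpha> \<longrightarrow> arrow_prod Q \<alpha> \<beta> \<notin> I))"

text \<open>
  The string module of \<open>w\<close> has a basis \<open>z\<^sub>0, \<dots>, z\<^sub>n\<close> with \<open>n = length w\<close>, where \<open>z\<^sub>i\<close> lies at the
  \<open>i\<close>-th vertex of \<open>w\<close>. If the letter leading from \<open>i\<close> to \<open>i + 1\<close> is \<open>\<alpha>\<close>, then \<open>z\<^sub>i \<alpha> = z\<^sub>i\<^sub>+\<^sub>1\<close>; if
  it is the inverse of \<open>\<alpha>\<close>, then \<open>z\<^sub>i\<^sub>+\<^sub>1 \<alpha> = z\<^sub>i\<close>; all other products of a basis element with
  an arrow vanish. An element is given by its coordinates.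
\<close>

definition string_vertex_act ::
  "('v, 'a) pre_digraph \<Rightarrow> 'v \<Rightarrow> 'a letter list \<Rightarrow> 'v \<Rightarrow> (nat \<Rightarrow> 'k :: field) \<Rightarrow> nat \<Rightarrow> 'k" where
  "string_vertex_act Q v w u m =
     (\<lambda>j. if j \<le> length w \<and> word_vertex Q v w j = u then m j else 0)"

definition string_arrow_act ::
  "'a letter list \<Rightarrow> 'a \<Rightarrow> (nat \<Rightarrow> 'k :: field) \<Rightarrow> nat \<Rightarrow> 'k" where
  "string_arrow_act w \<alpha> m =
     (\<lambda>j. (if 0 < j \<and> j \<le> length w \<and> w ! (j - 1) = Arr \<alpha> then m (j - 1) else 0) +
          (if j < length w \<and> w ! j = Inv \<alpha> then m (j + 1) else 0))"

definition string_act ::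
  "('v, 'a) pre_digraph \<Rightarrow> 'v \<Rightarrow> 'a letter list \<Rightarrow> ('v \<times> 'a list \<Rightarrow> 'k :: field) \<Rightarrow>
    (nat \<Rightarrow> 'k) \<Rightarrow> nat \<Rightarrow> 'k" where
  "string_act Q v w x m =
     (\<lambda>j. \<Sum>(u, p)\<in>{q. x q \<noteq> 0}. x (u, p) * fold (string_arrow_act w) p (string_vertex_act Q v w u m) j)"

text \<open>
  A coset in \<open>KQ/I\<close> acts through any of its representatives: if \<open>w\<close> is a string over a gentle
  algebra, then \<open>I\<close> acts as zero.
\<close>

definition string_module ::
  "('v, 'a) pre_digraph \<Rightarrow> 'v \<Rightarrow> 'a letter list \<Rightarrow>
    (('v \<times> 'a list \<Rightarrow> 'k :: field) set, nat \<Rightarrow> 'k) module" where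
  "string_module Q v w =
     \<lparr>carrier = {m. \<forall>j>length w. m j = 0}, mult = undefined, one = undefined,
      ring.zero = (\<lambda>j. 0), ring.add = (\<lambda>m m' j. m j + m' j),
      smult = (\<lambda>C m. string_act Q v w (SOME x. x \<in> C) m)\<rparr>"

definition is_string_module ::
  "('v, 'a) pre_digraph \<Rightarrow> ('v \<times> 'a list \<Rightarrow> 'k :: field) set \<Rightarrow>
    (('v \<times> 'a list \<Rightarrow> 'k) set, 'm) module \<Rightarrow> bool" where
  "is_string_module Q I M \<longleftrightarrow> right_module (bound_algebra Q I) M \<and>
     (\<exists>v w. is_string Q I v w \<and> mod_isomorphic (bound_algebra Q I) M (string_module Q v w))"

section \<open>Oriented surfaces with boundary\<close>

text \<open>
  A topological embedding \<open>f\<close> of an open subset \<open>W\<close> of the plane into the plane preserves the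
  orientation iff the image of every small counterclockwise circle winds counterclockwise
  around the image of the centre.
\<close>

definition orientation_preserving :: "complex set \<Rightarrow> (complex \<Rightarrow> complex) \<Rightarrow> bool" where
  "orientation_preserving W f \<longleftrightarrow>
     (\<forall>z r. 0 < r \<and> cball z r \<subseteq> W \<longrightarrow> winding_number (f \<circ> circlepath z r) (f z) = 1)"

type_synonym 's atlas = "('s set \<times> ('s \<Rightarrow> complex)) set"

definition half_plane_chart :: "'s topology \<Rightarrow> 's set \<Rightarrow> ('s \<Rightarrow> complex) \<Rightarrow> bool" where
  "half_plane_chart S U \<phi> \<longleftrightarrow> openin S U \<and> openin (top_of_set {z. 0 \<le> Im z}) (\<phi> ` U) \<and>
     homeomorphic_map (subtopology S U) (top_of_set (\<phi> ` U)) \<phi>"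

definition surface_boundary :: "'s topology \<Rightarrow> 's atlas \<Rightarrow> 's set" where
  "surface_boundary S A = {x \<in> topspace S. \<exists>(U, \<phi>)\<in>A. x \<in> U \<and> Im (\<phi> x) = 0}"

definition oriented_surface :: "'s topology \<Rightarrow> 's atlas \<Rightarrow> bool" where
  "oriented_surface S A \<longleftrightarrow> Hausdorff_space S \<and> second_countable S \<and> compact_space S \<and>
     (\<forall>(U, \<phi>)\<in>A. half_plane_chart S U \<phi>) \<and> (\<Union>(U, \<phi>)\<in>A. U) = topspace S \<and>
     (\<forall>(U, \<phi>)\<in>A. \<forall>(V, \<psi>)\<in>A.
        orientation_preserving (interior (\<phi> ` (U \<inter> V))) (\<psi> \<circ> inv_into U \<phi>))"

section \<open>Ideal triangulations and their gentle algebras\<close>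

text \<open>
  The standard triangle. Its vertices, and hence its sides, are numbered counterclockwise and
  with period 3.
\<close>

definition tri_vertex :: "nat \<Rightarrow> complex" where
  "tri_vertex l = cis (2 * pi * real l / 3)"

definition std_triangle :: "complex set" where
  "std_triangle = convex hull {tri_vertex 0, tri_vertex 1, tri_vertex 2}"

definition tri_side :: "nat \<Rightarrow> complex set" where
  "tri_side l = open_segment (tri_vertex l) (tri_vertex (Suc l))"

text \<open>
  An arc is represented by a curve without its end points, that is, by a set of interior points
  of the surface. \<open>T\<close> is a finite set of pairwise non-crossing arcs, and the triangles of \<open>T\<close>
  are the components into which the arcs cut the interior of the surface.
\<close>

definition is_arc :: "'s topology \<Rightarrow> 's atlas \<Rightarrow> 's set \<Rightarrow> 's set \<Rightarrow> bool" where
  "is_arc S A Mk a \<longleftrightarrow> a \<subseteq> topspace S - surface_boundary S A \<and>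
     (\<exists>\<gamma>. pathin S \<gamma> \<and> \<gamma> 0 \<in> Mk \<and> \<gamma> 1 \<in> Mk \<and> inj_on \<gamma> {0<..<1} \<and> a = \<gamma> ` {0<..<1})"

definition boundary_segments :: "'s topology \<Rightarrow> 's atlas \<Rightarrow> 's set \<Rightarrow> 's set set" where
  "boundary_segments S A Mk = connected_components_of (subtopology S (surface_boundary S A - Mk))"

definition triangles :: "'s topology \<Rightarrow> 's atlas \<Rightarrow> 's set set \<Rightarrow> 's set set" where
  "triangles S A T =
     connected_components_of (subtopology S (topspace S - surface_boundary S A - \<Union>T))"

text \<open>
  A parametrisation of the component \<open>D\<close> as a triangle with sides \<open>f ` tri_side l\<close>. As \<open>f\<close>
  preserves the orientation, the side \<open>Suc l\<close> is the immediate successor of the side \<open>l\<close> in the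
  cyclic order given by the orientation of the surface.
\<close>

definition triangle_map ::
  "'s topology \<Rightarrow> 's atlas \<Rightarrow> 's set \<Rightarrow> 's set set \<Rightarrow> 's set \<Rightarrow> (complex \<Rightarrow> 's) \<Rightarrow> bool" where
  "triangle_map S A Mk T D f \<longleftrightarrow>
     continuous_map (top_of_set std_triangle) S f \<and>
     homeomorphic_map (top_of_set (interior std_triangle)) (subtopology S D) f \<and>
     (\<forall>(U, \<phi>)\<in>A. orientation_preserving (interior std_triangle \<inter> f -` U) (\<phi> \<circ> f)) \<and>
     (\<forall>l. f (tri_vertex l) \<in> Mk \<and> inj_on f (tri_side l) \<and>
          f ` tri_side l \<in> T \<union> boundary_segments S A Mk)"

definition ideal_triangulation ::
  "'s topology \<Rightarrow> 's atlas \<Rightarrow> 's set \<Rightarrow> 's set set \<Rightarrow> bool" where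
  "ideal_triangulation S A Mk T \<longleftrightarrow>
     oriented_surface S A \<and> surface_boundary S A \<noteq> {} \<and>
     finite Mk \<and> Mk \<subseteq> surface_boundary S A \<and>
     finite T \<and> (\<forall>a\<in>T. is_arc S A Mk a) \<and> disjoint T \<and>
     (\<forall>D\<in>triangles S A T. \<exists>f. triangle_map S A Mk T D f)"

text \<open>The arrow from the side \<open>i\<close> to the side \<open>j\<close> in the triangle \<open>D\<close> is the triple \<open>(D, i, j)\<close>.\<close>

definition tri_quiver ::
  "'s topology \<Rightarrow> 's atlas \<Rightarrow> 's set \<Rightarrow> 's set set \<Rightarrow>
    ('s set, 's set \<times> 's set \<times> 's set) pre_digraph" where
  "tri_quiver S A Mk T =
     \<lparr>verts = T,
      arcs = {(D, i, j). D \<in> triangles S A T \<and> i \<in> T \<and> j \<in> T \<and>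
               (\<exists>f l. triangle_map S A Mk T D f \<and> i = f ` tri_side l \<and> j = f ` tri_side (Suc l))},
      tail = (\<lambda>(D, i, j). i),
      head = (\<lambda>(D, i, j). j)\<rparr>"

definition tri_relations ::
  "'s topology \<Rightarrow> 's atlas \<Rightarrow> 's set \<Rightarrow> 's set set \<Rightarrow>
    ('s set \<times> ('s set \<times> 's set \<times> 's set) list) set" where
  "tri_relations S A Mk T =
     {(i, [(D, i, j), (D, j, k)]) | D i j k. D \<in> triangles S A T \<and>
        (\<exists>f l. triangle_map S A Mk T D f \<and> (\<forall>m. f ` tri_side m \<in> T) \<and>
           i = f ` tri_side l \<and> j = f ` tri_side (Suc l) \<and> k = f ` tri_side (Suc (Suc l)))}"

definition tri_ideal ::
  "'s topology \<Rightarrow> 's atlas \<Rightarrow> 's set \<Rightarrow> 's set set \<Rightarrow>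
    ('s set \<times> ('s set \<times> 's set \<times> 's set) list \<Rightarrow> 'k :: field) set" where
  "tri_ideal S A Mk T =
     Idl\<^bsub>path_algebra (tri_quiver S A Mk T)\<^esub> (path_elt ` tri_relations S A Mk T)"

end

theory Submission
  imports Defs
begin

text \<open>
  Two modules are stably equivalent if they become isomorphic modulo homomorphisms that factor
  through projective modules. The proof combines three facts.

  The groups \<open>Ext\<^sup>n(M, N)\<close> with \<open>n \<ge> 2\<close> depend only on the stable class of the syzygy \<open>\<Omega>(M)\<close>: by
  Schanuel's lemma (\<open>stably_equivalent_syzygy\<close>) this class determines the stable classes of all
  later syzygies, and \<open>Ext\<^sup>1\<close> of a module, computed from two steps of a projective resolution,
  depends only on the stable class of the module (\<open>ext_quot_stable\<close>). The projective summands
  \<open>L\<^sub>1, \<dots>, L\<^sub>k\<^sub>-\<^sub>1\<close> are stably zero and Ext is additive, so dimension shifting yields the two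
  summands that belong to \<open>L\<^sub>0\<close> and \<open>L\<^sub>k\<close> (\<open>Ext_split\<close>).

  Over a gentle algebra \<open>\<Lambda>\<close>, every submodule of the radical of a projective module is a direct sum
  of modules \<open>e\<^sub>v\<Lambda>\<close> and \<open>R(\<alpha>)\<close> (\<open>radical_submodule_decomposition\<close>). To see this, consider
  generators of two kinds, combinations of paths that end with the same arrow and combinations of
  paths that end at the same vertex. Choose as few generators as possible, where those of the
  second kind count twice. A relation between them other than the obvious ones would make one of
  them redundant, or would allow one to replace a generator of the second kind by one of the
  first. It follows that a uniserial submodule of the radical, such as \<open>L\<^sub>0\<close> or \<open>L\<^sub>k\<close> if
  not zero, is some \<open>R(\<alpha>)\<close>. The kernel of the projective cover of \<open>R(\<alpha>)\<close>, which is left multiplication by \<open>\<alpha>\<close>, is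
  \<open>R(\<beta>)\<close> if there is a relation \<open>\<alpha>\<beta>\<close>, and zero otherwise; by gentleness \<open>\<beta>\<close> is unique. So all
  syzygies of \<open>R(\<alpha>)\<close> are zero or again of this form (\<open>arrow_or_zero_syzygy\<close>).

  The relations of a triangulation occur in triples \<open>\<alpha>\<beta>\<close>, \<open>\<beta>\<gamma>\<close>, \<open>\<gamma>\<alpha>\<close>, one for each internal
  triangle. Hence \<open>R(\<alpha>)\<close> is its own third syzygy if a relation starts with \<open>\<alpha>\<close>, and is projective
  otherwise. By the decomposition above, \<open>\<Omega>(M)\<close> and \<open>\<Omega>\<^sup>4(M)\<close> are therefore stably equivalent, which
  makes \<open>Ext\<^sup>n(M, N)\<close> periodic in \<open>n \<ge> 2\<close> with period three (\<open>Ext_periodic\<close>,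
  \<open>Ext_three_periodic\<close>).
\<close>

section \<open>Right modules and their homomorphisms\<close>

context right_module
begin

declare act_closed [simp, intro]

lemma act_zero_scalar [simp]: "x \<in> carrier M \<Longrightarrow> \<zero>\<^bsub>R\<^esub> \<odot>\<^bsub>M\<^esub> x = \<zero>\<^bsub>M\<^esub>"
  using act_add_scalar[of "\<zero>\<^bsub>R\<^esub>" "\<zero>\<^bsub>R\<^esub>" x]
  by (metis M.add.r_cancel_one' R.add.l_one R.zero_closed act_closed)

lemma act_zero [simp]: "r \<in> carrier R \<Longrightarrow> r \<odot>\<^bsub>M\<^esub> \<zero>\<^bsub>M\<^esub> = \<zero>\<^bsub>M\<^esub>"
  using act_add[of r "\<zero>\<^bsub>M\<^esub>" "\<zero>\<^bsub>M\<^esub>"]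
  by (metis M.add.r_cancel_one' M.add.l_one M.zero_closed act_closed)

lemma act_minus_scalar:
  assumes "r \<in> carrier R" "x \<in> carrier M"
  shows "(\<ominus>\<^bsub>R\<^esub> r) \<odot>\<^bsub>M\<^esub> x = \<ominus>\<^bsub>M\<^esub> (r \<odot>\<^bsub>M\<^esub> x)"
proof -
  have "(\<ominus>\<^bsub>R\<^esub> r) \<odot>\<^bsub>M\<^esub> x \<oplus>\<^bsub>M\<^esub> r \<odot>\<^bsub>M\<^esub> x = (\<ominus>\<^bsub>R\<^esub> r \<oplus>\<^bsub>R\<^esub> r) \<odot>\<^bsub>M\<^esub> x"
    using assms by (simp add: act_add_scalar)
  also have "\<dots> = \<zero>\<^bsub>M\<^esub>" using assms by (simp add: R.l_neg)
  finally show ?thesis using assms by (simp add: M.minus_equality)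
qed

lemma act_minus:
  assumes "r \<in> carrier R" "x \<in> carrier M"
  shows "r \<odot>\<^bsub>M\<^esub> (\<ominus>\<^bsub>M\<^esub> x) = \<ominus>\<^bsub>M\<^esub> (r \<odot>\<^bsub>M\<^esub> x)"
proof -
  have "r \<odot>\<^bsub>M\<^esub> (\<ominus>\<^bsub>M\<^esub> x) \<oplus>\<^bsub>M\<^esub> r \<odot>\<^bsub>M\<^esub> x = r \<odot>\<^bsub>M\<^esub> (\<ominus>\<^bsub>M\<^esub> x \<oplus>\<^bsub>M\<^esub> x)"
    using assms by (simp add: act_add)
  also have "\<dots> = \<zero>\<^bsub>M\<^esub>" using assms by (simp add: M.l_neg)
  finally show ?thesis using assms by (simp add: M.minus_equality)
qed

lemma minus_one_act: "x \<in> carrier M \<Longrightarrow> (\<ominus>\<^bsub>R\<^esub> \<one>\<^bsub>R\<^esub>) \<odot>\<^bsub>M\<^esub> x = \<ominus>\<^bsub>M\<^esub> x"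
  by (simp add: act_minus_scalar act_one)

lemma act_finsum:
  assumes "r \<in> carrier R" "finite J" "f \<in> J \<rightarrow> carrier M"
  shows "r \<odot>\<^bsub>M\<^esub> (finsum M f J) = finsum M (\<lambda>i. r \<odot>\<^bsub>M\<^esub> f i) J"
  using assms(2,3)
proof (induction J)
  case empty then show ?case using assms(1) by simp
next
  case (insert j J)
  then show ?case using assms(1)
    by (simp add: act_add M.finsum_insert Pi_iff)
qed

lemma is_submoduleI:
  assumes "U \<subseteq> carrier M" "\<zero>\<^bsub>M\<^esub> \<in> U"
    and "\<And>x y. x \<in> U \<Longrightarrow> y \<in> U \<Longrightarrow> x \<oplus>\<^bsub>M\<^esub> y \<in> U"
    and "\<And>r x. r \<in> carrier R \<Longrightarrow> x \<in> U \<Longrightarrow> r \<odot>\<^bsub>M\<^esub> x \<in> U"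
  shows "submodule U R M"
proof -
  have "\<ominus>\<^bsub>M\<^esub> x \<in> U" if "x \<in> U" for x
    using assms(4)[of "\<ominus>\<^bsub>R\<^esub> \<one>\<^bsub>R\<^esub>" x] that assms(1) by (metis R.add.inv_closed R.one_closed minus_one_act subsetD)
  then show ?thesis
    using assms by (intro submodule.intro subgroup.intro submodule_axioms.intro)
      (auto simp: a_inv_def)
qed

lemmas module_facts = M.zero_closed M.a_closed act_closed M.a_inv_closed M.l_zero M.r_zero M.l_neg M.r_neg
  act_zero M.minus_add act_minus M.a_assoc M.a_comm act_add_scalar act_add act_mult act_one M.a_lcomm

lemma carrier_submodule: "submodule (carrier M) R M"
  by (rule is_submoduleI) auto

lemma zero_submodule: "submodule {\<zero>\<^bsub>M\<^esub>} R M"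
  by (rule is_submoduleI) auto

end

lemma submoduleD:
  assumes "submodule U R M"
  shows submodule_subset: "U \<subseteq> carrier M"
    and submodule_zero: "\<zero>\<^bsub>M\<^esub> \<in> U"
    and submodule_add: "\<And>x y. x \<in> U \<Longrightarrow> y \<in> U \<Longrightarrow> x \<oplus>\<^bsub>M\<^esub> y \<in> U"
    and submodule_act: "\<And>r x. r \<in> carrier R \<Longrightarrow> x \<in> U \<Longrightarrow> r \<odot>\<^bsub>M\<^esub> x \<in> U"
    and submodule_minus: "\<And>x. x \<in> U \<Longrightarrow> \<ominus>\<^bsub>M\<^esub> x \<in> U"
proof -
  interpret submodule U R M by fact
  show "U \<subseteq> carrier M" using subset by simp
  show "\<zero>\<^bsub>M\<^esub> \<in> U" using one_closed by simp
  show "\<And>x y. x \<in> U \<Longrightarrow> y \<in> U \<Longrightarrow> x \<oplus>\<^bsub>M\<^esub> y \<in> U" using m_closed by simp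
  show "\<And>r x. r \<in> carrier R \<Longrightarrow> x \<in> U \<Longrightarrow> r \<odot>\<^bsub>M\<^esub> x \<in> U" by simp
  show "\<And>x. x \<in> U \<Longrightarrow> \<ominus>\<^bsub>M\<^esub> x \<in> U" using m_inv_closed by (simp add: a_inv_def)
qed

lemma submodule_finsum:
  assumes "right_module R M" "submodule U R M" "\<And>i. i \<in> J \<Longrightarrow> f i \<in> U"
  shows "finsum M f J \<in> U"
proof (cases "finite J")
  case True
  interpret right_module R M by fact
  from True show ?thesis using assms(3)
  proof (induction J)
    case empty then show ?case using submodule_zero[OF assms(2)] by simp
  next
    case (insert j J)
    moreover have "f i \<in> carrier M" if "i \<in> insert j J" for i
      using insert.prems[OF that] submodule_subset[OF assms(2)] by auto
    ultimately show ?case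
      using submodule_add[OF assms(2)] by (simp add: M.finsum_insert Pi_iff)
  qed
next
  case False
  interpret right_module R M by fact
  show ?thesis using False submodule_zero[OF assms(2)] by (simp add: M.finsum_infinite)
qed

lemma submodule_inter:
  assumes "right_module R M" "submodule U R M" "submodule V R M"
  shows "submodule (U \<inter> V) R M"
proof -
  interpret right_module R M by fact
  show ?thesis
    using submoduleD[OF assms(2)] submoduleD[OF assms(3)]
    by (intro is_submoduleI) auto
qed

lemma right_moduleI:
  assumes "ring R"
    and "\<zero>\<^bsub>M\<^esub> \<in> carrier M"
    and "\<And>x y. \<lbrakk>x \<in> carrier M; y \<in> carrier M\<rbrakk> \<Longrightarrow> x \<oplus>\<^bsub>M\<^esub> y \<in> carrier M"
    and "\<And>x y z. \<lbrakk>x \<in> carrier M; y \<in> carrier M; z \<in> carrier M\<rbrakk> \<Longrightarrow>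
           (x \<oplus>\<^bsub>M\<^esub> y) \<oplus>\<^bsub>M\<^esub> z = x \<oplus>\<^bsub>M\<^esub> (y \<oplus>\<^bsub>M\<^esub> z)"
    and "\<And>x y. \<lbrakk>x \<in> carrier M; y \<in> carrier M\<rbrakk> \<Longrightarrow> x \<oplus>\<^bsub>M\<^esub> y = y \<oplus>\<^bsub>M\<^esub> x"
    and "\<And>x. x \<in> carrier M \<Longrightarrow> \<zero>\<^bsub>M\<^esub> \<oplus>\<^bsub>M\<^esub> x = x"
    and "\<And>x. x \<in> carrier M \<Longrightarrow> \<exists>y\<in>carrier M. y \<oplus>\<^bsub>M\<^esub> x = \<zero>\<^bsub>M\<^esub>"
    and "\<And>r x. \<lbrakk>r \<in> carrier R; x \<in> carrier M\<rbrakk> \<Longrightarrow> r \<odot>\<^bsub>M\<^esub> x \<in> carrier M"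
    and "\<And>r s x. \<lbrakk>r \<in> carrier R; s \<in> carrier R; x \<in> carrier M\<rbrakk> \<Longrightarrow>
        (r \<oplus>\<^bsub>R\<^esub> s) \<odot>\<^bsub>M\<^esub> x = r \<odot>\<^bsub>M\<^esub> x \<oplus>\<^bsub>M\<^esub> s \<odot>\<^bsub>M\<^esub> x"
    and "\<And>r x y. \<lbrakk>r \<in> carrier R; x \<in> carrier M; y \<in> carrier M\<rbrakk> \<Longrightarrow>
        r \<odot>\<^bsub>M\<^esub> (x \<oplus>\<^bsub>M\<^esub> y) = r \<odot>\<^bsub>M\<^esub> x \<oplus>\<^bsub>M\<^esub> r \<odot>\<^bsub>M\<^esub> y"
    and "\<And>r s x. \<lbrakk>r \<in> carrier R; s \<in> carrier R; x \<in> carrier M\<rbrakk> \<Longrightarrow>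
        (r \<otimes>\<^bsub>R\<^esub> s) \<odot>\<^bsub>M\<^esub> x = s \<odot>\<^bsub>M\<^esub> (r \<odot>\<^bsub>M\<^esub> x)"
    and "\<And>x. x \<in> carrier M \<Longrightarrow> \<one>\<^bsub>R\<^esub> \<odot>\<^bsub>M\<^esub> x = x"
  shows "right_module R M"
  by (intro right_module.intro assms(1) abelian_groupI right_module_axioms.intro)
    (use assms in auto)

lemma right_module_submodule:
  assumes "right_module R M" "submodule U R M"
  shows "right_module R (M\<lparr>carrier := U\<rparr>)"
proof -
  interpret right_module R M by fact
  note U = submoduleD[OF assms(2)]
  show ?thesis
    using U(1) by (intro right_moduleI)
      (auto simp: U(2-4) M.a_ac act_add_scalar act_add act_mult act_one subset_iff M.l_neg
        M.r_neg intro!: bexI[OF _ U(5)] R.ring_axioms)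
qed

lemma mod_homI:
  assumes "f \<in> carrier M \<rightarrow>\<^sub>E carrier N"
    and "\<And>x y. x \<in> carrier M \<Longrightarrow> y \<in> carrier M \<Longrightarrow> f (x \<oplus>\<^bsub>M\<^esub> y) = f x \<oplus>\<^bsub>N\<^esub> f y"
    and "\<And>r x. r \<in> carrier R \<Longrightarrow> x \<in> carrier M \<Longrightarrow> f (r \<odot>\<^bsub>M\<^esub> x) = r \<odot>\<^bsub>N\<^esub> f x"
  shows "f \<in> mod_hom R M N"
  using assms by (auto simp: mod_hom_def)

lemma mod_homD:
  assumes "f \<in> mod_hom R M N"
  shows hom_funcset: "f \<in> carrier M \<rightarrow>\<^sub>E carrier N"
    and hom_closed: "\<And>x. x \<in> carrier M \<Longrightarrow> f x \<in> carrier N"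
    and hom_add: "\<And>x y. x \<in> carrier M \<Longrightarrow> y \<in> carrier M \<Longrightarrow> f (x \<oplus>\<^bsub>M\<^esub> y) = f x \<oplus>\<^bsub>N\<^esub> f y"
    and hom_act: "\<And>r x. r \<in> carrier R \<Longrightarrow> x \<in> carrier M \<Longrightarrow> f (r \<odot>\<^bsub>M\<^esub> x) = r \<odot>\<^bsub>N\<^esub> f x"
  using assms by (auto simp: mod_hom_def)

lemma mod_hom_eqI:
  assumes "f \<in> mod_hom R M N" "g \<in> mod_hom R M N" "\<And>x. x \<in> carrier M \<Longrightarrow> f x = g x"
  shows "f = g"
  using assms by (auto simp: mod_hom_def intro: PiE_ext)

lemma hom_zero:
  assumes "right_module R M" "right_module R N" "f \<in> mod_hom R M N"
  shows "f \<zero>\<^bsub>M\<^esub> = \<zero>\<^bsub>N\<^esub>"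
proof -
  interpret M: right_module R M by fact
  interpret N: right_module R N by fact
  have "f (\<zero>\<^bsub>R\<^esub> \<odot>\<^bsub>M\<^esub> \<zero>\<^bsub>M\<^esub>) = \<zero>\<^bsub>R\<^esub> \<odot>\<^bsub>N\<^esub> f \<zero>\<^bsub>M\<^esub>"
    by (rule hom_act[OF assms(3)]) auto
  then show ?thesis using hom_closed[OF assms(3), of "\<zero>\<^bsub>M\<^esub>"] by simp
qed

lemma hom_minus:
  assumes "right_module R M" "right_module R N" "f \<in> mod_hom R M N" "x \<in> carrier M"
  shows "f (\<ominus>\<^bsub>M\<^esub> x) = \<ominus>\<^bsub>N\<^esub> f x"
proof -
  interpret M: right_module R M by fact
  interpret N: right_module R N by fact
  have "f ((\<ominus>\<^bsub>R\<^esub> \<one>\<^bsub>R\<^esub>) \<odot>\<^bsub>M\<^esub> x) = (\<ominus>\<^bsub>R\<^esub> \<one>\<^bsub>R\<^esub>) \<odot>\<^bsub>N\<^esub> f x"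
    by (rule hom_act[OF assms(3)]) (auto simp: assms)
  then show ?thesis
    using assms(4) hom_closed[OF assms(3,4)] by (simp add: M.minus_one_act N.minus_one_act)
qed

lemma hom_finsum:
  assumes "right_module R M" "right_module R N" "f \<in> mod_hom R M N"
    and "finite J" "\<And>i. i \<in> J \<Longrightarrow> g i \<in> carrier M"
  shows "f (finsum M g J) = finsum N (\<lambda>i. f (g i)) J"
proof -
  interpret M: right_module R M by fact
  interpret N: right_module R N by fact
  show ?thesis using assms(4,5)
  proof (induction J)
    case empty show ?case using hom_zero[OF assms(1-3)] by simp
  next
    case (insert j J)
    then show ?case
      using hom_closed[OF assms(3)]
      by (simp add: M.finsum_insert N.finsum_insert Pi_iff hom_add[OF assms(3)])
  qed
qed

lemma hom_id: "(\<lambda>x\<in>carrier M. x) \<in> mod_hom R M M" if "right_module R M"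
proof -
  interpret right_module R M by fact
  show ?thesis by (rule mod_homI) auto
qed

lemma hom_zero_map:
  assumes "right_module R M" "right_module R N"
  shows "(\<lambda>x\<in>carrier M. \<zero>\<^bsub>N\<^esub>) \<in> mod_hom R M N"
proof -
  interpret M: right_module R M by fact
  interpret N: right_module R N by fact
  show ?thesis by (rule mod_homI) auto
qed

lemma hom_comp:
  assumes "right_module R L" "f \<in> mod_hom R L M" "g \<in> mod_hom R M N"
  shows "compose (carrier L) g f \<in> mod_hom R L N"
proof -
  interpret L: right_module R L by fact
  show ?thesis
    by (rule mod_homI)
      (auto simp: compose_eq hom_add[OF assms(2)] hom_add[OF assms(3)] hom_act[OF assms(2)]
        hom_act[OF assms(3)] hom_closed[OF assms(2)] hom_closed[OF assms(3)] compose_def)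
qed

lemma hom_sum:
  assumes "right_module R M" "right_module R N" "f \<in> mod_hom R M N" "g \<in> mod_hom R M N"
  shows "(\<lambda>x\<in>carrier M. f x \<oplus>\<^bsub>N\<^esub> g x) \<in> mod_hom R M N"
proof -
  interpret M: right_module R M by fact
  interpret N: right_module R N by fact
  note [simp] = hom_closed[OF assms(3)] hom_closed[OF assms(4)] hom_add[OF assms(3)]
    hom_add[OF assms(4)] hom_act[OF assms(3)] hom_act[OF assms(4)]
  show ?thesis
    by (rule mod_homI) (auto simp: N.act_add N.M.a_ac)
qed

lemma hom_neg:
  assumes "right_module R M" "right_module R N" "f \<in> mod_hom R M N"
  shows "(\<lambda>x\<in>carrier M. \<ominus>\<^bsub>N\<^esub> f x) \<in> mod_hom R M N"
proof -
  interpret M: right_module R M by fact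
  interpret N: right_module R N by fact
  note [simp] = hom_closed[OF assms(3)] hom_add[OF assms(3)] hom_act[OF assms(3)]
  show ?thesis
    by (rule mod_homI) (auto simp: N.act_minus N.M.minus_add)
qed

lemma hom_diff:
  assumes "right_module R M" "right_module R N" "f \<in> mod_hom R M N" "g \<in> mod_hom R M N"
  shows "(\<lambda>x\<in>carrier M. f x \<ominus>\<^bsub>N\<^esub> g x) \<in> mod_hom R M N"
proof -
  have "(\<lambda>x\<in>carrier M. f x \<oplus>\<^bsub>N\<^esub> (\<lambda>x\<in>carrier M. \<ominus>\<^bsub>N\<^esub> g x) x) \<in> mod_hom R M N"
    by (intro hom_sum hom_neg assms)
  moreover have "(\<lambda>x\<in>carrier M. f x \<oplus>\<^bsub>N\<^esub> (\<lambda>x\<in>carrier M. \<ominus>\<^bsub>N\<^esub> g x) x)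
     = (\<lambda>x\<in>carrier M. f x \<ominus>\<^bsub>N\<^esub> g x)"
    by (auto simp: a_minus_def)
  ultimately show ?thesis by simp
qed

lemma hom_restrict_domain:
  assumes "submodule U R M" "f \<in> mod_hom R M N"
  shows "restrict f U \<in> mod_hom R (M\<lparr>carrier := U\<rparr>) N"
  using submoduleD[OF assms(1)] mod_homD[OF assms(2)]
  by (intro mod_homI) (auto simp: subset_iff)

lemma hom_codomain:
  assumes "f \<in> mod_hom R M N" "\<And>x. x \<in> carrier M \<Longrightarrow> f x \<in> U"
  shows "f \<in> mod_hom R M (N\<lparr>carrier := U\<rparr>)"
  using assms by (auto simp: mod_hom_def)

lemma hom_codomainD:
  assumes "f \<in> mod_hom R M (N\<lparr>carrier := U\<rparr>)" "U \<subseteq> carrier N"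
  shows "f \<in> mod_hom R M N"
  using assms by (auto simp: mod_hom_def)

lemma hom_incl:
  assumes "right_module R M" "submodule U R M"
  shows "(\<lambda>x\<in>U. x) \<in> mod_hom R (M\<lparr>carrier := U\<rparr>) M"
  using submoduleD[OF assms(2)] by (intro mod_homI) auto

definition kernel_module :: "('r, 'm) module \<Rightarrow> ('m \<Rightarrow> 'n) \<Rightarrow> ('r, 'n) module \<Rightarrow> ('r, 'm) module" where
  "kernel_module M f N = M\<lparr>carrier := {x \<in> carrier M. f x = \<zero>\<^bsub>N\<^esub>}\<rparr>"

lemma carrier_kernel_module: "carrier (kernel_module M f N) = {x \<in> carrier M. f x = \<zero>\<^bsub>N\<^esub>}"
  by (simp add: kernel_module_def)

lemma kernel_submodule:
  assumes "right_module R M" "right_module R N" "f \<in> mod_hom R M N"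
  shows "submodule {x \<in> carrier M. f x = \<zero>\<^bsub>N\<^esub>} R M"
proof -
  interpret M: right_module R M by fact
  interpret N: right_module R N by fact
  show ?thesis
    by (rule M.is_submoduleI)
      (auto simp: hom_zero[OF assms] hom_add[OF assms(3)] hom_act[OF assms(3)])
qed

lemma image_submodule:
  assumes "right_module R M" "right_module R N" "f \<in> mod_hom R M N" "submodule U R M"
  shows "submodule (f ` U) R N"
proof -
  interpret M: right_module R M by fact
  interpret N: right_module R N by fact
  note U = submoduleD[OF assms(4)] and f = mod_homD[OF assms(3)]
  show ?thesis
  proof (rule N.is_submoduleI)
    show "f ` U \<subseteq> carrier N" using U(1) f(2) by auto
    show "\<zero>\<^bsub>N\<^esub> \<in> f ` U" using U(2) hom_zero[OF assms(1-3)] by (metis imageI)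
  next
    fix x y assume "x \<in> f ` U" "y \<in> f ` U"
    then obtain a b where "a \<in> U" "b \<in> U" "x = f a" "y = f b" by auto
    then show "x \<oplus>\<^bsub>N\<^esub> y \<in> f ` U"
      using f(3)[of a b] U(1,3) by (metis imageI subsetD)
  next
    fix r x assume "r \<in> carrier R" "x \<in> f ` U"
    then obtain a where "a \<in> U" "x = f a" by auto
    then show "r \<odot>\<^bsub>N\<^esub> x \<in> f ` U"
      using f(4)[of r a] U(1,4) \<open>r \<in> carrier R\<close> by (metis imageI subsetD)
  qed
qed

lemma preimage_submodule:
  assumes "right_module R M" "right_module R N" "f \<in> mod_hom R M N" "submodule U R N"
  shows "submodule {x \<in> carrier M. f x \<in> U} R M"
proof -
  interpret M: right_module R M by fact
  interpret N: right_module R N by fact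
  note U = submoduleD[OF assms(4)] and f = mod_homD[OF assms(3)]
  show ?thesis
    using U f hom_zero[OF assms(1-3)] by (intro M.is_submoduleI) auto
qed

lemma hom_inj_if_kernel_zero:
  assumes "right_module R M" "right_module R N" "f \<in> mod_hom R M N"
    and "\<And>x. x \<in> carrier M \<Longrightarrow> f x = \<zero>\<^bsub>N\<^esub> \<Longrightarrow> x = \<zero>\<^bsub>M\<^esub>"
  shows "inj_on f (carrier M)"
proof (rule inj_onI)
  interpret M: right_module R M by fact
  interpret N: right_module R N by fact
  fix x y assume xy: "x \<in> carrier M" "y \<in> carrier M" "f x = f y"
  have "f (x \<oplus>\<^bsub>M\<^esub> \<ominus>\<^bsub>M\<^esub> y) = \<zero>\<^bsub>N\<^esub>"
    using xy hom_closed[OF assms(3) xy(2)]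
    by (simp add: hom_add[OF assms(3)] hom_minus[OF assms(1-3)] N.M.r_neg)
  then have "x \<oplus>\<^bsub>M\<^esub> \<ominus>\<^bsub>M\<^esub> y = \<zero>\<^bsub>M\<^esub>" using assms(4) xy by simp
  then show "x = y" using xy by (metis M.M.minus_equality M.M.minus_minus M.M.add.inv_closed)
qed

text \<open>
  Two preimages of an element differ by an element of the kernel, so the value does not depend on
  the chosen preimage.
\<close>

lemma hom_factor:
  assumes "right_module R P" "right_module R Z" "right_module R Y"
    and p: "p \<in> mod_hom R P Z" "p ` carrier P = carrier Z" and f: "f \<in> mod_hom R P Y"
    and ker: "\<And>x. x \<in> carrier P \<Longrightarrow> p x = \<zero>\<^bsub>Z\<^esub> \<Longrightarrow> f x = \<zero>\<^bsub>Y\<^esub>"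
  obtains g where "g \<in> mod_hom R Z Y" "\<And>x. x \<in> carrier P \<Longrightarrow> g (p x) = f x"
proof -
  interpret P: right_module R P by fact
  interpret Z: right_module R Z by fact
  interpret Y: right_module R Y by fact
  define s where "s = (\<lambda>x\<in>carrier Z. f (SOME a. a \<in> carrier P \<and> p a = x))"
  have eq: "f a = f b" if ab: "a \<in> carrier P" "b \<in> carrier P" "p a = p b" for a b
  proof -
    have "f (a \<oplus>\<^bsub>P\<^esub> \<ominus>\<^bsub>P\<^esub> b) = \<zero>\<^bsub>Y\<^esub>"
      using ab hom_closed[OF p(1) ab(2)]
      by (intro ker) (simp_all add: hom_add[OF p(1)] hom_minus[OF assms(1,2) p(1)] Z.M.r_neg)
    then have "f a \<oplus>\<^bsub>Y\<^esub> \<ominus>\<^bsub>Y\<^esub> f b = \<zero>\<^bsub>Y\<^esub>"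
      using ab by (simp add: hom_add[OF f] hom_minus[OF assms(1,3) f])
    then show ?thesis
      using hom_closed[OF f ab(1)] hom_closed[OF f ab(2)]
      by (metis Y.M.minus_equality Y.M.minus_minus Y.M.add.inv_closed)
  qed
  have s: "s (p a) = f a" if "a \<in> carrier P" for a
  proof -
    have "\<exists>b. b \<in> carrier P \<and> p b = p a" using that by auto
    from someI_ex[OF this] have "f (SOME b. b \<in> carrier P \<and> p b = p a) = f a"
      using eq that by blast
    then show ?thesis using hom_closed[OF p(1) that] by (simp add: s_def)
  qed
  have "s \<in> mod_hom R Z Y"
  proof (rule mod_homI)
    have "s x \<in> carrier Y" if "x \<in> carrier Z" for x
    proof -
      from that p(2) obtain a where "a \<in> carrier P" "x = p a" by auto
      then show ?thesis using s hom_closed[OF f] by simp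
    qed
    then show "s \<in> carrier Z \<rightarrow>\<^sub>E carrier Y" by (auto simp: s_def)
  next
    fix x y assume "x \<in> carrier Z" "y \<in> carrier Z"
    then obtain a b where ab: "a \<in> carrier P" "x = p a" "b \<in> carrier P" "y = p b"
      using p(2) by (metis imageE)
    then have "s (x \<oplus>\<^bsub>Z\<^esub> y) = s (p (a \<oplus>\<^bsub>P\<^esub> b))" by (simp add: hom_add[OF p(1)])
    also have "\<dots> = s x \<oplus>\<^bsub>Y\<^esub> s y" using ab by (simp add: s hom_add[OF f])
    finally show "s (x \<oplus>\<^bsub>Z\<^esub> y) = s x \<oplus>\<^bsub>Y\<^esub> s y" .
  next
    fix r x assume r: "r \<in> carrier R" and "x \<in> carrier Z"
    then obtain a where a: "a \<in> carrier P" "x = p a" using p(2) by (metis imageE)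
    then have "s (r \<odot>\<^bsub>Z\<^esub> x) = s (p (r \<odot>\<^bsub>P\<^esub> a))" using r by (simp add: hom_act[OF p(1)])
    also have "\<dots> = r \<odot>\<^bsub>Y\<^esub> s x" using a r by (simp add: s hom_act[OF f])
    finally show "s (r \<odot>\<^bsub>Z\<^esub> x) = r \<odot>\<^bsub>Y\<^esub> s x" .
  qed
  then show thesis using s by (rule that)
qed

lemma iso_inverse:
  assumes "right_module R M" "right_module R N" "f \<in> mod_hom R M N" "bij_betw f (carrier M) (carrier N)"
  obtains g where "g \<in> mod_hom R N M" "bij_betw g (carrier N) (carrier M)"
    "\<And>x. x \<in> carrier M \<Longrightarrow> g (f x) = x" "\<And>y. y \<in> carrier N \<Longrightarrow> f (g y) = y"
proof -
  interpret M: right_module R M by fact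
  interpret N: right_module R N by fact
  have surj: "f ` carrier M = carrier N" and inj: "inj_on f (carrier M)"
    using assms(4) by (auto simp: bij_betw_def)
  obtain g where g: "g \<in> mod_hom R N M" "\<And>x. x \<in> carrier M \<Longrightarrow> g (f x) = (\<lambda>x\<in>carrier M. x) x"
  proof (rule hom_factor[OF assms(1,2,1,3) surj hom_id[OF assms(1)]])
    fix x assume "x \<in> carrier M" "f x = \<zero>\<^bsub>N\<^esub>"
    then have "x = \<zero>\<^bsub>M\<^esub>"
      using inj hom_zero[OF assms(1-3)] by (metis M.M.zero_closed inj_onD)
    then show "(\<lambda>x\<in>carrier M. x) x = \<zero>\<^bsub>M\<^esub>" by simp
  qed auto
  have gf: "g (f x) = x" if "x \<in> carrier M" for x using g(2)[OF that] that by simp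
  have fg: "f (g y) = y" if "y \<in> carrier N" for y
    using surj gf that by (metis imageE)
  have "bij_betw g (carrier N) (carrier M)"
    by (rule bij_betw_byWitness[where f' = f])
      (use gf fg hom_closed[OF g(1)] hom_closed[OF assms(3)] in auto)
  with g(1) gf fg show thesis using that by blast
qed

lemma mod_isomorphic_refl: "right_module R M \<Longrightarrow> mod_isomorphic R M M"
  unfolding mod_isomorphic_def
  by (rule bexI[OF _ hom_id]) (auto simp: bij_betw_def inj_on_def)

lemma mod_isomorphic_sym:
  assumes "right_module R M" "right_module R N" "mod_isomorphic R M N"
  shows "mod_isomorphic R N M"
  using assms(3) iso_inverse[OF assms(1,2)] unfolding mod_isomorphic_def by metis

lemma mod_isomorphic_trans:
  assumes "right_module R L" "mod_isomorphic R L M" "mod_isomorphic R M N"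
  shows "mod_isomorphic R L N"
proof -
  obtain f g where f: "f \<in> mod_hom R L M" "bij_betw f (carrier L) (carrier M)"
    and g: "g \<in> mod_hom R M N" "bij_betw g (carrier M) (carrier N)"
    using assms by (auto simp: mod_isomorphic_def)
  have "bij_betw (compose (carrier L) g f) (carrier L) (carrier N)"
    using bij_betw_trans[OF f(2) g(2)] by (rule bij_betw_cong[THEN iffD1, rotated]) (simp add: compose_eq)
  then show ?thesis
    using hom_comp[OF assms(1) f(1) g(1)] by (auto simp: mod_isomorphic_def)
qed

lemma mod_isomorphicI:
  assumes "right_module R M" "right_module R N" "f \<in> mod_hom R M N" "f ` carrier M = carrier N"
    and "\<And>x. x \<in> carrier M \<Longrightarrow> f x = \<zero>\<^bsub>N\<^esub> \<Longrightarrow> x = \<zero>\<^bsub>M\<^esub>"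
  shows "mod_isomorphic R M N"
  using assms hom_inj_if_kernel_zero[OF assms(1-3,5)] by (auto simp: mod_isomorphic_def bij_betw_def)

lemma zero_module_iso:
  assumes "right_module R M" "right_module R N" "mod_isomorphic R M N" "zero_module M"
  shows "zero_module N"
proof -
  obtain f where f: "f \<in> mod_hom R M N" "bij_betw f (carrier M) (carrier N)"
    using assms(3) by (auto simp: mod_isomorphic_def)
  then have "carrier N = f ` {\<zero>\<^bsub>M\<^esub>}"
    using assms(4) by (simp add: zero_module_def bij_betw_def)
  then show ?thesis using hom_zero[OF assms(1,2) f(1)] by (simp add: zero_module_def)
qed

section \<open>Quotients and finite direct sums\<close>

text \<open>
  Both \<open>KQ/I\<close> and Ext are given by \<open>quot_alg\<close>. Forgetting the
  multiplication, they are quotients of a vector space by a subspace.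
\<close>

locale module_quotient = V: right_module R V
  for R :: "('r, 'y) ring_scheme" and V :: "('r, 'm) module" +
  fixes B assumes B: "submodule B R V"
begin

sublocale cosets: abelian_subgroup B V
proof (rule abelian_subgroupI3)
  show "additive_subgroup B V"
    using B by (simp add: additive_subgroup_def submodule_def)
  show "abelian_group V" by (rule V.M.abelian_group_axioms)
qed

lemma carrier_quot: "carrier (quot_alg V B) = (\<lambda>x. B +>\<^bsub>V\<^esub> x) ` carrier V"
  by (auto simp: quot_alg_def FactRing_def A_RCOSETS_defs a_r_coset_def)

lemma add_quot:
  "x \<in> carrier V \<Longrightarrow> y \<in> carrier V \<Longrightarrow>
    (B +>\<^bsub>V\<^esub> x) \<oplus>\<^bsub>quot_alg V B\<^esub> (B +>\<^bsub>V\<^esub> y) = B +>\<^bsub>V\<^esub> (x \<oplus>\<^bsub>V\<^esub> y)"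
  by (simp add: quot_alg_def FactRing_def cosets.a_rcos_sum)

lemma zero_quot: "\<zero>\<^bsub>quot_alg V B\<^esub> = B"
  by (simp add: quot_alg_def FactRing_def)

lemma coset_eq_iff:
  assumes "x \<in> carrier V" "y \<in> carrier V"
  shows "B +>\<^bsub>V\<^esub> x = B +>\<^bsub>V\<^esub> y \<longleftrightarrow> x \<ominus>\<^bsub>V\<^esub> y \<in> B"
  using assms
  by (metis V.M.a_repr_independence cosets.a_subgroup cosets.a_rcos_module_minus
    cosets.a_rcos_self V.R.ring_axioms V.M.abelian_group_axioms cosets.a_rcos_module a_minus_def)

lemma coset_zero_iff: "x \<in> carrier V \<Longrightarrow> B +>\<^bsub>V\<^esub> x = B \<longleftrightarrow> x \<in> B"
  by (metis V.M.a_coset_join1 V.M.a_coset_join2 cosets.a_subgroup)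

lemma act_quot:
  assumes "r \<in> carrier R" "x \<in> carrier V"
  shows "r \<odot>\<^bsub>quot_alg V B\<^esub> (B +>\<^bsub>V\<^esub> x) = B +>\<^bsub>V\<^esub> (r \<odot>\<^bsub>V\<^esub> x)"
proof -
  have *: "B +>\<^bsub>V\<^esub> (r \<odot>\<^bsub>V\<^esub> y) = B +>\<^bsub>V\<^esub> (r \<odot>\<^bsub>V\<^esub> x)" if "y \<in> B +>\<^bsub>V\<^esub> x" for y
  proof -
    from that obtain b where b: "b \<in> B" "y = b \<oplus>\<^bsub>V\<^esub> x"
      by (auto simp: a_r_coset_def r_coset_def)
    have bV: "b \<in> carrier V" using b submodule_subset[OF B] by auto
    have "r \<odot>\<^bsub>V\<^esub> y \<ominus>\<^bsub>V\<^esub> r \<odot>\<^bsub>V\<^esub> x = r \<odot>\<^bsub>V\<^esub> b"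
      using assms b bV by (simp add: V.act_add a_minus_def V.M.a_assoc V.M.r_neg)
    then show ?thesis
      using assms b bV submodule_act[OF B] by (simp add: coset_eq_iff)
  qed
  have "x \<in> B +>\<^bsub>V\<^esub> x" using assms cosets.a_rcos_self by simp
  then have "(\<Union>y\<in>B +>\<^bsub>V\<^esub> x. B +>\<^bsub>V\<^esub> (r \<odot>\<^bsub>V\<^esub> y)) = B +>\<^bsub>V\<^esub> (r \<odot>\<^bsub>V\<^esub> x)"
    using * by blast
  then show ?thesis by (simp add: quot_alg_def)
qed

lemma right_module_quot: "right_module R (quot_alg V B)"
proof (rule right_moduleI)
  have B0: "B = B +>\<^bsub>V\<^esub> \<zero>\<^bsub>V\<^esub>"
    using coset_zero_iff[of "\<zero>\<^bsub>V\<^esub>"] submodule_zero[OF B] by simp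
  show "\<zero>\<^bsub>quot_alg V B\<^esub> \<in> carrier (quot_alg V B)"
    unfolding zero_quot carrier_quot using B0 by blast
  show "\<exists>y\<in>carrier (quot_alg V B). y \<oplus>\<^bsub>quot_alg V B\<^esub> x = \<zero>\<^bsub>quot_alg V B\<^esub>"
    if "x \<in> carrier (quot_alg V B)" for x
  proof -
    from that obtain a where a: "a \<in> carrier V" "x = B +>\<^bsub>V\<^esub> a" by (auto simp: carrier_quot)
    then have "(B +>\<^bsub>V\<^esub> (\<ominus>\<^bsub>V\<^esub> a)) \<oplus>\<^bsub>quot_alg V B\<^esub> x = \<zero>\<^bsub>quot_alg V B\<^esub>"
      using B0 by (simp add: add_quot zero_quot V.M.l_neg)
    then show ?thesis using a by (auto simp: carrier_quot)
  qed
  show "\<zero>\<^bsub>quot_alg V B\<^esub> \<oplus>\<^bsub>quot_alg V B\<^esub> x = x" if "x \<in> carrier (quot_alg V B)" for x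
  proof -
    from that obtain a where a: "a \<in> carrier V" "x = B +>\<^bsub>V\<^esub> a" by (auto simp: carrier_quot)
    then show ?thesis using add_quot[of "\<zero>\<^bsub>V\<^esub>" a] B0 by (simp add: zero_quot)
  qed
qed (auto simp: carrier_quot add_quot act_quot V.M.a_ac V.act_add_scalar V.act_add V.act_mult
    V.act_one V.R.ring_axioms)

lemma hom_quot: "(\<lambda>x\<in>carrier V. B +>\<^bsub>V\<^esub> x) \<in> mod_hom R V (quot_alg V B)"
  by (rule mod_homI) (auto simp: carrier_quot add_quot act_quot)

lemma first_isomorphism:
  assumes "right_module R W" "f \<in> mod_hom R V W" "f ` carrier V = carrier W"
    and ker: "\<And>x. x \<in> carrier V \<Longrightarrow> f x = \<zero>\<^bsub>W\<^esub> \<longleftrightarrow> x \<in> B"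
  shows "mod_isomorphic R (quot_alg V B) W"
proof -
  let ?q = "\<lambda>x\<in>carrier V. B +>\<^bsub>V\<^esub> x"
  obtain g where g: "g \<in> mod_hom R (quot_alg V B) W" "\<And>x. x \<in> carrier V \<Longrightarrow> g (?q x) = f x"
    by (rule hom_factor[OF V.right_module_axioms right_module_quot assms(1) hom_quot _ assms(2)])
      (auto simp: carrier_quot zero_quot coset_zero_iff ker)
  then have g': "g (B +>\<^bsub>V\<^esub> x) = f x" if "x \<in> carrier V" for x using that by simp
  show ?thesis
  proof (rule mod_isomorphicI[OF right_module_quot assms(1) g(1)])
    show "g ` carrier (quot_alg V B) = carrier W"
      unfolding carrier_quot image_image assms(3)[symmetric]
      by (rule image_cong) (simp_all add: g')
    fix x assume "x \<in> carrier (quot_alg V B)" "g x = \<zero>\<^bsub>W\<^esub>"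
    then obtain a where a: "a \<in> carrier V" "x = B +>\<^bsub>V\<^esub> a" by (auto simp: carrier_quot)
    with \<open>g x = \<zero>\<^bsub>W\<^esub>\<close> g' ker have "a \<in> B" by simp
    with a show "x = \<zero>\<^bsub>quot_alg V B\<^esub>" by (simp add: zero_quot coset_zero_iff)
  qed
qed

end

lemma right_module_family:
  assumes "ring R" "\<And>i. i \<in> J \<Longrightarrow> right_module R (L i)"
  shows "right_module R (mod_family_sum J L)"
proof (rule right_moduleI[OF assms(1)])
  let ?S = "mod_family_sum J L"
  note m = right_module.module_facts[OF assms(2)]
  show "\<exists>y\<in>carrier ?S. y \<oplus>\<^bsub>?S\<^esub> x = \<zero>\<^bsub>?S\<^esub>" if "x \<in> carrier ?S" for x
    using that
    by (intro bexI[of _ "\<lambda>i\<in>J. \<ominus>\<^bsub>L i\<^esub> x i"]) (auto simp: mod_family_sum_def m PiE_iff intro!: restrict_ext)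
qed (auto simp: mod_family_sum_def right_module.module_facts[OF assms(2)] PiE_iff extensional_def
    fun_eq_iff restrict_def)

lemma family_cong:
  assumes "\<And>i. i \<in> J \<Longrightarrow> L i = L' i"
  shows "mod_family_sum J L = mod_family_sum J L'"
  using assms by (simp add: mod_family_sum_def cong: PiE_cong restrict_cong)

lemma family_sum_simps:
  shows carrier_family: "carrier (mod_family_sum J L) = (\<Pi>\<^sub>E i\<in>J. carrier (L i))"
    and zero_family: "\<zero>\<^bsub>mod_family_sum J L\<^esub> = (\<lambda>i\<in>J. \<zero>\<^bsub>L i\<^esub>)"
    and add_family: "x \<oplus>\<^bsub>mod_family_sum J L\<^esub> y = (\<lambda>i\<in>J. x i \<oplus>\<^bsub>L i\<^esub> y i)"
    and act_family: "r \<odot>\<^bsub>mod_family_sum J L\<^esub> x = (\<lambda>i\<in>J. r \<odot>\<^bsub>L i\<^esub> x i)"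
  by (simp_all add: mod_family_sum_def)

lemma family_memD: "x \<in> carrier (mod_family_sum J L) \<Longrightarrow> i \<in> J \<Longrightarrow> x i \<in> carrier (L i)"
  by (auto simp: carrier_family)

lemma family_eqI:
  assumes "x \<in> carrier (mod_family_sum J L)" "y \<in> carrier (mod_family_sum J L)"
    and "\<And>i. i \<in> J \<Longrightarrow> x i = y i"
  shows "x = y"
  using assms by (auto simp: carrier_family intro: PiE_ext)

definition family_in :: "nat set \<Rightarrow> (nat \<Rightarrow> ('r, 'm) module) \<Rightarrow> nat \<Rightarrow> 'm \<Rightarrow> nat \<Rightarrow> 'm" where
  "family_in J L j = (\<lambda>x\<in>carrier (L j). \<lambda>i\<in>J. if i = j then x else \<zero>\<^bsub>L i\<^esub>)"

definition family_out :: "nat set \<Rightarrow> (nat \<Rightarrow> ('r, 'm) module) \<Rightarrow> nat \<Rightarrow> (nat \<Rightarrow> 'm) \<Rightarrow> 'm" where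
  "family_out J L j = (\<lambda>x\<in>carrier (mod_family_sum J L). x j)"

definition family_cotuple ::
  "nat set \<Rightarrow> (nat \<Rightarrow> ('r, 'm) module) \<Rightarrow> ('r, 'n) module \<Rightarrow> (nat \<Rightarrow> 'm \<Rightarrow> 'n) \<Rightarrow> (nat \<Rightarrow> 'm) \<Rightarrow> 'n" where
  "family_cotuple J L Y f = (\<lambda>x\<in>carrier (mod_family_sum J L). finsum Y (\<lambda>i. f i (x i)) J)"

lemma hom_family_out:
  assumes "ring R" "\<And>i. i \<in> J \<Longrightarrow> right_module R (L i)" "j \<in> J"
  shows "family_out J L j \<in> mod_hom R (mod_family_sum J L) (L j)"
proof -
  interpret S: right_module R "mod_family_sum J L" by (rule right_module_family[OF assms(1,2)])
  note S.M.a_closed[unfolded add_family, simp] S.act_closed[unfolded act_family, simp]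
  show ?thesis
    unfolding family_out_def
    by (rule mod_homI) (use assms(3) in \<open>auto simp: add_family act_family family_memD\<close>)
qed

lemma hom_family_in:
  assumes "ring R" "\<And>i. i \<in> J \<Longrightarrow> right_module R (L i)" "j \<in> J"
  shows "family_in J L j \<in> mod_hom R (L j) (mod_family_sum J L)"
proof -
  note m = right_module.module_facts[OF assms(2)]
  show ?thesis
    unfolding family_in_def
    by (rule mod_homI)
      (use assms(3) in \<open>auto simp: carrier_family add_family act_family m(1-3,5,9) intro!: restrict_ext\<close>)
qed

lemma hom_family_cotuple:
  assumes "ring R" "right_module R Y" "\<And>i. i \<in> J \<Longrightarrow> right_module R (L i)"
    and f: "\<And>i. i \<in> J \<Longrightarrow> f i \<in> mod_hom R (L i) Y" and J: "finite J"
  shows "family_cotuple J L Y f \<in> mod_hom R (mod_family_sum J L) Y"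
proof -
  interpret Y: right_module R Y by fact
  interpret S: right_module R "mod_family_sum J L" by (rule right_module_family[OF assms(1,3)])
  let ?f = "\<lambda>x\<in>carrier (mod_family_sum J L). \<Oplus>\<^bsub>Y\<^esub>i\<in>J. f i (x i)"
  have fx: "f i (x i) \<in> carrier Y" if "x \<in> carrier (mod_family_sum J L)" "i \<in> J" for x i
    using hom_closed[OF f] family_memD that by metis
  show ?thesis
    unfolding family_cotuple_def
  proof (rule mod_homI)
    fix x y assume xy: "x \<in> carrier (mod_family_sum J L)" "y \<in> carrier (mod_family_sum J L)"
    have "(\<Oplus>\<^bsub>Y\<^esub>i\<in>J. f i ((x \<oplus>\<^bsub>mod_family_sum J L\<^esub> y) i)) = (\<Oplus>\<^bsub>Y\<^esub>i\<in>J. f i (x i) \<oplus>\<^bsub>Y\<^esub> f i (y i))"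
      using xy by (intro Y.M.finsum_cong')
        (auto simp: add_family hom_add[OF f] family_memD fx)
    then show "(?f) (x \<oplus>\<^bsub>mod_family_sum J L\<^esub> y) =
      (?f) x \<oplus>\<^bsub>Y\<^esub>
      (?f) y"
      using xy fx by (simp add: Y.M.finsum_addf Pi_iff)
  next
    fix r x assume r: "r \<in> carrier R" "x \<in> carrier (mod_family_sum J L)"
    have "(\<Oplus>\<^bsub>Y\<^esub>i\<in>J. f i ((r \<odot>\<^bsub>mod_family_sum J L\<^esub> x) i)) = (\<Oplus>\<^bsub>Y\<^esub>i\<in>J. r \<odot>\<^bsub>Y\<^esub> f i (x i))"
      using r by (intro Y.M.finsum_cong') (auto simp: act_family hom_act[OF f] family_memD fx)
    then show "(?f) (r \<odot>\<^bsub>mod_family_sum J L\<^esub> x) =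
      r \<odot>\<^bsub>Y\<^esub> (?f) x"
      using r fx J by (simp add: Y.act_finsum Pi_iff)
  qed (use fx in \<open>auto intro!: Y.M.finsum_closed\<close>)
qed

lemma family_finsum_apply:
  assumes "ring R" "\<And>i. i \<in> J \<Longrightarrow> right_module R (L i)"
    and "finite K" "\<And>k. k \<in> K \<Longrightarrow> g k \<in> carrier (mod_family_sum J L)" "i \<in> J"
  shows "finsum (mod_family_sum J L) g K i = finsum (L i) (\<lambda>k. g k i) K"
proof -
  have S: "right_module R (mod_family_sum J L)" by (rule right_module_family[OF assms(1,2)])
  interpret S: right_module R "mod_family_sum J L" by fact
  have "finsum (mod_family_sum J L) g K \<in> carrier (mod_family_sum J L)"
    using assms(4) by (intro S.M.finsum_closed) auto
  then have "finsum (mod_family_sum J L) g K i = family_out J L i (finsum (mod_family_sum J L) g K)"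
    by (simp add: family_out_def)
  also have "\<dots> = finsum (L i) (\<lambda>k. family_out J L i (g k)) K"
    by (rule hom_finsum[OF S _ hom_family_out]) (use assms in auto)
  also have "\<dots> = finsum (L i) (\<lambda>k. g k i) K"
  proof -
    interpret Li: right_module R "L i" using assms by blast
    show ?thesis
      using assms(4,5) by (intro Li.M.finsum_cong') (auto simp: family_out_def intro: family_memD)
  qed
  finally show ?thesis .
qed

lemma family_decomp:
  assumes "ring R" "\<And>i. i \<in> J \<Longrightarrow> right_module R (L i)" "finite J"
    and x: "x \<in> carrier (mod_family_sum J L)"
  shows "x = finsum (mod_family_sum J L) (\<lambda>i. family_in J L i (x i)) J"
proof (rule family_eqI[OF x])
  interpret S: right_module R "mod_family_sum J L" by (rule right_module_family[OF assms(1,2)])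
  have mem: "family_in J L k (x k) \<in> carrier (mod_family_sum J L)" if "k \<in> J" for k
    by (rule hom_closed[OF hom_family_in]) (use assms(1,2) family_memD[OF x that] that in auto)
  show "finsum (mod_family_sum J L) (\<lambda>i. family_in J L i (x i)) J \<in> carrier (mod_family_sum J L)"
    using mem by (intro S.M.finsum_closed) auto
  fix i assume i: "i \<in> J"
  interpret Li: right_module R "L i" using assms i by blast
  have "finsum (mod_family_sum J L) (\<lambda>i. family_in J L i (x i)) J i
      = finsum (L i) (\<lambda>k. family_in J L k (x k) i) J"
    using mem i by (intro family_finsum_apply[OF assms(1,2,3)]) auto
  also have "\<dots> = finsum (L i) (\<lambda>k. if i = k then x i else \<zero>\<^bsub>L i\<^esub>) J"
    using i family_memD[OF x] by (intro Li.M.finsum_cong') (auto simp: family_in_def)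
  also have "\<dots> = x i"
    using i assms(3) family_memD[OF x]
    by (subst Li.M.finsum_singleton[where f = "\<lambda>_. x i"]) auto
  finally show "x i = finsum (mod_family_sum J L) (\<lambda>i. family_in J L i (x i)) J i" by (rule sym)
qed

lemma family_cotuple_in:
  assumes "ring R" "right_module R Y" "\<And>i. i \<in> J \<Longrightarrow> right_module R (L i)" "finite J"
    and f: "\<And>i. i \<in> J \<Longrightarrow> f i \<in> mod_hom R (L i) Y" and i: "i \<in> J" "x \<in> carrier (L i)"
  shows "family_cotuple J L Y f (family_in J L i x) = f i x"
proof -
  interpret Y: right_module R Y by fact
  have inx: "family_in J L i x \<in> carrier (mod_family_sum J L)"
    by (rule hom_closed[OF hom_family_in]) (use assms in auto)
  have "family_cotuple J L Y f (family_in J L i x) = finsum Y (\<lambda>k. f k (family_in J L i x k)) J"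
    using inx by (simp add: family_cotuple_def)
  also have "\<dots> = finsum Y (\<lambda>k. if i = k then f i x else \<zero>\<^bsub>Y\<^esub>) J"
  proof (rule Y.M.finsum_cong')
    fix k assume k: "k \<in> J"
    show "f k (family_in J L i x k) = (if i = k then f i x else \<zero>\<^bsub>Y\<^esub>)"
      using i k hom_zero[OF assms(3)[OF k] assms(2) f[OF k]] by (simp add: family_in_def)
  qed (use hom_closed[OF f[OF i(1)] i(2)] in auto)
  also have "\<dots> = f i x"
    using i assms(4) hom_closed[OF f[OF i(1)] i(2)]
    by (subst Y.M.finsum_singleton[where f = "\<lambda>_. f i x"]) auto
  finally show ?thesis .
qed

lemma hom_family_eqI:
  assumes "ring R" "right_module R Y" "\<And>i. i \<in> J \<Longrightarrow> right_module R (L i)" "finite J"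
    and f: "f \<in> mod_hom R (mod_family_sum J L) Y" and g: "g \<in> mod_hom R (mod_family_sum J L) Y"
    and eq: "\<And>i x. i \<in> J \<Longrightarrow> x \<in> carrier (L i) \<Longrightarrow> f (family_in J L i x) = g (family_in J L i x)"
  shows "f = g"
proof (rule mod_hom_eqI[OF f g])
  fix x assume x: "x \<in> carrier (mod_family_sum J L)"
  interpret Y: right_module R Y by fact
  have e: "family_in J L i (x i) \<in> carrier (mod_family_sum J L)" if "i \<in> J" for i
    by (rule hom_closed[OF hom_family_in]) (use assms(1,3) family_memD[OF x that] that in auto)
  have sum: "h x = finsum Y (\<lambda>i. h (family_in J L i (x i))) J"
    if h: "h \<in> mod_hom R (mod_family_sum J L) Y" for h
  proof -
    have "h (finsum (mod_family_sum J L) (\<lambda>i. family_in J L i (x i)) J) = finsum Y (\<lambda>i. h (family_in J L i (x i))) J"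
      by (rule hom_finsum[OF right_module_family[OF assms(1,3)] assms(2) h assms(4) e])
    then show ?thesis by (simp only: family_decomp[OF assms(1,3,4) x, symmetric])
  qed
  show "f x = g x"
    unfolding sum[OF f] sum[OF g]
    by (intro Y.M.finsum_cong' refl) (use eq family_memD[OF x] hom_closed[OF g e] in auto)
qed

section \<open>Finitely generated modules\<close>

lemma fg_moduleI:
  assumes "right_module R M" "finite S" "S \<subseteq> carrier M"
    and "\<And>U. submodule U R M \<Longrightarrow> S \<subseteq> U \<Longrightarrow> carrier M \<subseteq> U"
  shows "fg_module R M"
proof -
  have "U = carrier M" if "submodule U R M" "S \<subseteq> U" for U
    using assms(4)[OF that] submodule_subset[OF that(1)] by (rule equalityI[rotated])
  then show ?thesis using assms(1-3) unfolding fg_module_def by metis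
qed

lemma fg_moduleE:
  assumes "fg_module R M"
  obtains S where "right_module R M" "finite S" "S \<subseteq> carrier M"
    "\<And>U. submodule U R M \<Longrightarrow> S \<subseteq> U \<Longrightarrow> U = carrier M"
proof -
  from assms obtain S where "right_module R M" "finite S" "S \<subseteq> carrier M"
    "\<forall>U. submodule U R M \<and> S \<subseteq> U \<longrightarrow> U = carrier M"
    unfolding fg_module_def by (elim conjE exE)
  then show thesis by (intro that[of S]) simp_all
qed

lemma fg_right_module: "fg_module R M \<Longrightarrow> right_module R M"
  by (simp add: fg_module_def)

lemma submodule_within:
  assumes "submodule W R M" "W \<subseteq> U" "right_module R (M\<lparr>carrier := U\<rparr>)"
  shows "submodule W R (M\<lparr>carrier := U\<rparr>)"
proof -
  interpret right_module R "M\<lparr>carrier := U\<rparr>" by fact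
  show ?thesis using submoduleD[OF assms(1)] assms(2) by (intro is_submoduleI) auto
qed

lemma submodule_of_submodule:
  assumes "right_module R M" "submodule U R M" "submodule W R (M\<lparr>carrier := U\<rparr>)"
  shows "submodule W R M"
proof -
  interpret right_module R M by fact
  show ?thesis
    using submoduleD[OF assms(2)] submoduleD[OF assms(3)] by (intro is_submoduleI) auto
qed

lemma fg_submoduleI:
  assumes "right_module R M" "submodule U R M" "finite T" "T \<subseteq> U"
    and "\<And>W. submodule W R M \<Longrightarrow> T \<subseteq> W \<Longrightarrow> U \<subseteq> W"
  shows "fg_module R (M\<lparr>carrier := U\<rparr>)"
  using assms submodule_of_submodule[OF assms(1,2)]
  by (intro fg_moduleI[of _ _ T] right_module_submodule) auto

lemma fg_submoduleE:
  assumes "right_module R M" "submodule U R M" "fg_module R (M\<lparr>carrier := U\<rparr>)"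
  obtains T where "finite T" "T \<subseteq> U" "\<And>W. submodule W R M \<Longrightarrow> T \<subseteq> W \<Longrightarrow> U \<subseteq> W"
proof -
  obtain T where T: "finite T" "T \<subseteq> U"
    "\<And>W. submodule W R (M\<lparr>carrier := U\<rparr>) \<Longrightarrow> T \<subseteq> W \<Longrightarrow> W = U"
    using assms(3) by (auto simp: fg_module_def)
  have "U \<subseteq> W" if W: "submodule W R M" "T \<subseteq> W" for W
  proof -
    have "submodule (W \<inter> U) R (M\<lparr>carrier := U\<rparr>)"
      by (rule submodule_within[OF submodule_inter[OF assms(1) W(1) assms(2)] _
            fg_right_module[OF assms(3)]]) simp
    from T(3)[OF this] T(2) W(2) show ?thesis by auto
  qed
  with T show thesis using that by blast
qed

lemma fg_image:
  assumes "fg_module R M" "right_module R N" "f \<in> mod_hom R M N" "f ` carrier M = carrier N"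
  shows "fg_module R N"
proof -
  obtain S where S: "right_module R M" "finite S" "S \<subseteq> carrier M"
    "\<And>U. submodule U R M \<Longrightarrow> S \<subseteq> U \<Longrightarrow> U = carrier M"
    using fg_moduleE[OF assms(1)] by metis
  show ?thesis
  proof (rule fg_moduleI[of R N "f ` S"])
    show "finite (f ` S)" "f ` S \<subseteq> carrier N" using S assms(4) by auto
    fix U assume U: "submodule U R N" "f ` S \<subseteq> U"
    have "{x \<in> carrier M. f x \<in> U} = carrier M"
      by (rule S(4)[OF preimage_submodule[OF S(1) assms(2,3) U(1)]]) (use U S in auto)
    then show "carrier N \<subseteq> U" unfolding assms(4)[symmetric] by auto
  qed fact
qed

lemma fg_iso:
  assumes "fg_module R M" "right_module R N" "mod_isomorphic R M N"
  shows "fg_module R N"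
  using assms fg_image by (auto simp: mod_isomorphic_def bij_betw_def)

lemma fg_family:
  assumes "ring R" "finite J" "\<And>i. i \<in> J \<Longrightarrow> fg_module R (L i)"
  shows "fg_module R (mod_family_sum J L)"
proof -
  have L: "right_module R (L i)" if "i \<in> J" for i using assms(3) that by (simp add: fg_right_module)
  have S: "right_module R (mod_family_sum J L)" by (rule right_module_family[OF assms(1) L])
  have "\<forall>i\<in>J. \<exists>T. finite T \<and> T \<subseteq> carrier (L i) \<and> (\<forall>U. submodule U R (L i) \<and> T \<subseteq> U \<longrightarrow> U = carrier (L i))"
    using assms(3) by (simp add: fg_module_def)
  from bchoice[OF this] obtain T where T': "\<forall>i\<in>J. finite (T i) \<and> T i \<subseteq> carrier (L i) \<and>
    (\<forall>U. submodule U R (L i) \<and> T i \<subseteq> U \<longrightarrow> U = carrier (L i))" by (elim exE)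
  have T: "finite (T i)" "T i \<subseteq> carrier (L i)"
    "\<And>U. submodule U R (L i) \<Longrightarrow> T i \<subseteq> U \<Longrightarrow> U = carrier (L i)" if "i \<in> J" for i
    using T'[rule_format, OF that] by simp_all
  show ?thesis
  proof (rule fg_moduleI[OF S, of "\<Union>i\<in>J. family_in J L i ` T i"])
    show "finite (\<Union>i\<in>J. family_in J L i ` T i)" using assms(2) T(1) by auto
    show "(\<Union>i\<in>J. family_in J L i ` T i) \<subseteq> carrier (mod_family_sum J L)"
    proof (intro UN_least image_subsetI)
      fix i y assume "i \<in> J" "y \<in> T i"
      then show "family_in J L i y \<in> carrier (mod_family_sum J L)"
        by (intro hom_closed[OF hom_family_in]) (use assms(1) L T(2) in auto)
    qed
    fix U assume U: "submodule U R (mod_family_sum J L)" "(\<Union>i\<in>J. family_in J L i ` T i) \<subseteq> U"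
    have *: "family_in J L i y \<in> U" if i: "i \<in> J" "y \<in> carrier (L i)" for i y
    proof -
      have "{y \<in> carrier (L i). family_in J L i y \<in> U} = carrier (L i)"
      proof (rule T(3)[OF i(1) preimage_submodule[OF L[OF i(1)] S _ U(1)]])
        show "family_in J L i \<in> mod_hom R (L i) (mod_family_sum J L)"
          by (rule hom_family_in) (use assms(1) L i(1) in auto)
        show "T i \<subseteq> {y \<in> carrier (L i). family_in J L i y \<in> U}"
          using U(2) T(2)[OF i(1)] i(1) by auto
      qed
      then show ?thesis using i(2) by auto
    qed
    show "carrier (mod_family_sum J L) \<subseteq> U"
    proof
      fix x assume x: "x \<in> carrier (mod_family_sum J L)"
      have "finsum (mod_family_sum J L) (\<lambda>i. family_in J L i (x i)) J \<in> U"
        by (rule submodule_finsum[OF S U(1)]) (use * family_memD[OF x] in auto)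
      then show "x \<in> U" by (simp only: family_decomp[OF assms(1) L assms(2) x, symmetric])
    qed
  qed
qed

text \<open>Used to replace a module by a copy whose elements have a prescribed type.\<close>

lemma transport_module:
  fixes c :: "'m \<Rightarrow> 'n" and M :: "('r, 'm) module"
  assumes "right_module R M" "inj_on c (carrier M)"
  obtains E :: "('r, 'n) module" where "right_module R E" "mod_isomorphic R M E"
proof -
  interpret M: right_module R M by fact
  define d where "d = inv_into (carrier M) c"
  have d [simp]: "d (c x) = x" if "x \<in> carrier M" for x using that assms(2) by (simp add: d_def)
  define E :: "('r, 'n) module" where "E = \<lparr>carrier = c ` carrier M, mult = undefined, one = undefined,
    ring.zero = c \<zero>\<^bsub>M\<^esub>, ring.add = (\<lambda>a b. c (d a \<oplus>\<^bsub>M\<^esub> d b)), smult = (\<lambda>r a. c (r \<odot>\<^bsub>M\<^esub> d a))\<rparr>"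
  have rm: "right_module R E"
  proof (rule right_moduleI)
    show "\<exists>y\<in>carrier E. y \<oplus>\<^bsub>E\<^esub> x = \<zero>\<^bsub>E\<^esub>" if "x \<in> carrier E" for x
      using that by (auto simp: E_def M.M.l_neg intro!: bexI[of _ "\<ominus>\<^bsub>M\<^esub> _"])
  qed (auto simp: E_def M.M.a_ac M.act_add_scalar M.act_add M.act_mult M.act_one
      M.R.ring_axioms)
  have "restrict c (carrier M) \<in> mod_hom R M E"
    by (rule mod_homI) (auto simp: E_def)
  moreover have "bij_betw (restrict c (carrier M)) (carrier M) (carrier E)"
    using assms(2) by (auto simp: bij_betw_def E_def inj_on_def)
  ultimately have "mod_isomorphic R M E" unfolding mod_isomorphic_def by blast
  with rm show thesis by (rule that)
qed

section \<open>Cyclic right ideals and projective modules\<close>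

lemma right_ideal_simps [simp]:
  shows "\<zero>\<^bsub>right_ideal_gen R a\<^esub> = \<zero>\<^bsub>R\<^esub>"
    and "x \<oplus>\<^bsub>right_ideal_gen R a\<^esub> y = x \<oplus>\<^bsub>R\<^esub> y"
    and "r \<odot>\<^bsub>right_ideal_gen R a\<^esub> x = x \<otimes>\<^bsub>R\<^esub> r"
  by (simp_all add: right_ideal_gen_def)

lemma carrier_right_ideal: "carrier (right_ideal_gen R a) = {a \<otimes>\<^bsub>R\<^esub> r | r. r \<in> carrier R}"
  by (simp add: right_ideal_gen_def)

lemma right_ideal_mem: "r \<in> carrier R \<Longrightarrow> a \<otimes>\<^bsub>R\<^esub> r \<in> carrier (right_ideal_gen R a)"
  by (auto simp: carrier_right_ideal)

lemma right_ideal_subset: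
  assumes "ring R" "a \<in> carrier R" "x \<in> carrier (right_ideal_gen R a)"
  shows "x \<in> carrier R"
proof -
  interpret ring R by fact
  show ?thesis using assms by (auto simp: carrier_right_ideal)
qed

lemma right_module_right_ideal:
  assumes "ring R" "a \<in> carrier R"
  shows "right_module R (right_ideal_gen R a)"
proof -
  interpret ring R by fact
  show ?thesis
  proof (rule right_moduleI[OF assms(1)])
    show "\<zero>\<^bsub>right_ideal_gen R a\<^esub> \<in> carrier (right_ideal_gen R a)"
      using assms(2) by (auto simp: carrier_right_ideal intro!: exI[of _ "\<zero>\<^bsub>R\<^esub>"])
    show "x \<oplus>\<^bsub>right_ideal_gen R a\<^esub> y \<in> carrier (right_ideal_gen R a)"
      if "x \<in> carrier (right_ideal_gen R a)" "y \<in> carrier (right_ideal_gen R a)" for x y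
      using that assms(2) by (auto simp: carrier_right_ideal r_distr[symmetric])
    show "r \<odot>\<^bsub>right_ideal_gen R a\<^esub> x \<in> carrier (right_ideal_gen R a)"
      if "r \<in> carrier R" "x \<in> carrier (right_ideal_gen R a)" for r x
      using that assms(2) by (auto simp: carrier_right_ideal m_assoc)
    show "\<exists>y\<in>carrier (right_ideal_gen R a). y \<oplus>\<^bsub>right_ideal_gen R a\<^esub> x = \<zero>\<^bsub>right_ideal_gen R a\<^esub>"
      if "x \<in> carrier (right_ideal_gen R a)" for x
    proof -
      from that obtain r where r: "r \<in> carrier R" "x = a \<otimes>\<^bsub>R\<^esub> r" by (auto simp: carrier_right_ideal)
      then have "a \<otimes>\<^bsub>R\<^esub> (\<ominus>\<^bsub>R\<^esub> r) \<oplus>\<^bsub>R\<^esub> x = \<zero>\<^bsub>R\<^esub>"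
        using assms(2) by (simp add: r_distr[symmetric] l_neg)
      then show ?thesis using r right_ideal_mem[of "\<ominus>\<^bsub>R\<^esub> r" R a]
        by (intro bexI[of _ "a \<otimes>\<^bsub>R\<^esub> (\<ominus>\<^bsub>R\<^esub> r)"]) auto
    qed
  qed (use right_ideal_subset[OF assms] in
      \<open>auto simp: a_ac m_assoc r_distr l_distr\<close>)
qed

lemma fg_right_ideal:
  assumes "ring R" "a \<in> carrier R"
  shows "fg_module R (right_ideal_gen R a)"
proof -
  interpret ring R by fact
  have aa: "a \<in> carrier (right_ideal_gen R a)"
    using right_ideal_mem[of "\<one>\<^bsub>R\<^esub>" R a] assms(2) by simp
  show ?thesis
  proof (rule fg_moduleI[of _ _ "{a}"])
    fix U assume U: "submodule U R (right_ideal_gen R a)" "{a} \<subseteq> U"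
    show "carrier (right_ideal_gen R a) \<subseteq> U"
      using submodule_act[OF U(1)] U(2) by (auto simp: carrier_right_ideal)
  qed (use aa right_module_right_ideal[OF assms] in auto)
qed

lemma hom_act_on:
  assumes "right_module R M" "a \<in> carrier R" "m \<in> carrier M"
  shows "(\<lambda>x\<in>carrier (right_ideal_gen R a). x \<odot>\<^bsub>M\<^esub> m) \<in> mod_hom R (right_ideal_gen R a) M"
proof -
  interpret right_module R M by fact
  interpret I: right_module R "right_ideal_gen R a"
    by (rule right_module_right_ideal) (use assms R.ring_axioms in auto)
  note [simp] = right_ideal_subset[OF R.ring_axioms assms(2)]
  have [simp]: "x \<oplus>\<^bsub>R\<^esub> y \<in> carrier (right_ideal_gen R a)"
    if "x \<in> carrier (right_ideal_gen R a)" "y \<in> carrier (right_ideal_gen R a)" for x y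
    using I.M.a_closed[OF that] by simp
  have [simp]: "x \<otimes>\<^bsub>R\<^esub> r \<in> carrier (right_ideal_gen R a)"
    if "x \<in> carrier (right_ideal_gen R a)" "r \<in> carrier R" for x r
    using I.act_closed[of r x] that by simp
  show ?thesis
    by (rule mod_homI) (auto simp: act_add_scalar act_mult assms)
qed

lemma right_ideal_idem:
  assumes "ring R" "e \<in> carrier R" "e \<otimes>\<^bsub>R\<^esub> e = e" "x \<in> carrier (right_ideal_gen R e)"
  shows "e \<otimes>\<^bsub>R\<^esub> x = x"
proof -
  interpret ring R by fact
  show ?thesis using assms by (auto simp: carrier_right_ideal m_assoc[symmetric])
qed

lemma projective_fg: "projective R P \<Longrightarrow> fg_module R P"
  by (simp add: projective_def)

lemma projectiveD:
  fixes E F :: "('r, 'r univ) module"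
  assumes "projective R P" "fg_module R E" "fg_module R F"
    "g \<in> mod_hom R E F" "g ` carrier E = carrier F" "f \<in> mod_hom R P F"
  obtains h where "h \<in> mod_hom R P E" "\<And>x. x \<in> carrier P \<Longrightarrow> g (h x) = f x"
proof -
  have "\<forall>(E :: ('r, 'r univ) module) (F :: ('r, 'r univ) module).
        \<forall>g\<in>mod_hom R E F. \<forall>f\<in>mod_hom R P F.
          fg_module R E \<and> fg_module R F \<and> g ` carrier E = carrier F \<longrightarrow>
          (\<exists>h\<in>mod_hom R P E. \<forall>x\<in>carrier P. g (h x) = f x)"
    using assms(1) by (simp add: projective_def)
  from this[rule_format, OF assms(4,6)] assms(2,3,5)
  have "\<exists>h\<in>mod_hom R P E. \<forall>x\<in>carrier P. g (h x) = f x" by simp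
  then show thesis using that by auto
qed

lemma projective_right_ideal_idem:
  fixes R :: "('k, 'r) module"
  assumes "ring R" "e \<in> carrier R" "e \<otimes>\<^bsub>R\<^esub> e = e"
  shows "projective R (right_ideal_gen R e)"
  unfolding projective_def
proof (intro conjI allI ballI impI, goal_cases)
  case 1 show ?case by (rule fg_right_ideal[OF assms(1,2)])
next
  case (2 E F g f)
  let ?P = "right_ideal_gen R e"
  interpret ring R by fact
  have rm: "right_module R E" "right_module R F" using 2 by (auto intro: fg_right_module)
  have e: "e \<in> carrier ?P" using right_ideal_mem[of "\<one>\<^bsub>R\<^esub>" R e] assms by simp
  obtain y where y: "y \<in> carrier E" "g y = f e"
    using hom_closed[OF 2(2) e] 2(3) by (metis imageE)
  show ?case
  proof (intro bexI[OF _ hom_act_on[OF rm(1) assms(2) y(1)]] ballI)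
    fix x assume x: "x \<in> carrier ?P"
    have "g (x \<odot>\<^bsub>E\<^esub> y) = x \<odot>\<^bsub>F\<^esub> f e"
      using hom_act[OF 2(1) _ y(1)] right_ideal_subset[OF assms(1,2) x] y(2) by simp
    also have "\<dots> = f (x \<odot>\<^bsub>?P\<^esub> e)"
      using hom_act[OF 2(2) right_ideal_subset[OF assms(1,2) x] e] by simp
    also have "\<dots> = f x" using right_ideal_idem[OF assms x] by simp
    finally show "g ((\<lambda>x\<in>carrier ?P. x \<odot>\<^bsub>E\<^esub> y) x) = f x" using x by simp
  qed
qed

lemma projective_family:
  fixes R :: "('r, 'y) ring_scheme"
  assumes "ring R" "finite J" "\<And>i. i \<in> J \<Longrightarrow> projective R (L i)"
  shows "projective R (mod_family_sum J L)"
  unfolding projective_def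
proof (intro conjI allI ballI impI, goal_cases)
  case 1 show ?case by (rule fg_family[OF assms(1,2)]) (use assms(3) projective_fg in blast)
next
  case (2 E F g f)
  have L: "right_module R (L i)" if "i \<in> J" for i
    using assms(3) that by (simp add: fg_right_module projective_fg)
  let ?S = "mod_family_sum J L"
  have S: "right_module R ?S" by (rule right_module_family[OF assms(1) L])
  have rm: "right_module R E" "right_module R F" using 2 by (auto intro: fg_right_module)
  have "\<forall>i\<in>J. \<exists>h. h \<in> mod_hom R (L i) E \<and> (\<forall>x\<in>carrier (L i). g (h x) = f (family_in J L i x))"
  proof
    fix i assume i: "i \<in> J"
    have "compose (carrier (L i)) f (family_in J L i) \<in> mod_hom R (L i) F"
      by (rule hom_comp[OF L[OF i] hom_family_in[OF assms(1) L i] 2(2)])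
    from projectiveD[OF assms(3)[OF i] _ _ 2(1) _ this] 2(3)
    obtain h where "h \<in> mod_hom R (L i) E"
      "\<And>x. x \<in> carrier (L i) \<Longrightarrow> g (h x) = compose (carrier (L i)) f (family_in J L i) x"
      by blast
    then show "\<exists>h. h \<in> mod_hom R (L i) E \<and> (\<forall>x\<in>carrier (L i). g (h x) = f (family_in J L i x))"
      by (auto simp: compose_eq)
  qed
  then obtain h where h: "\<And>i. i \<in> J \<Longrightarrow> h i \<in> mod_hom R (L i) E"
    "\<And>i x. i \<in> J \<Longrightarrow> x \<in> carrier (L i) \<Longrightarrow> g (h i x) = f (family_in J L i x)"
    by metis
  let ?c = "family_cotuple J L E h"
  have c: "?c \<in> mod_hom R ?S E" by (rule hom_family_cotuple[OF assms(1) rm(1) L h(1) assms(2)])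
  have "compose (carrier ?S) g ?c = f"
  proof (rule hom_family_eqI[OF assms(1) rm(2) L assms(2) hom_comp[OF S c 2(1)] 2(2)])
    fix i x assume i: "i \<in> J" "x \<in> carrier (L i)"
    have "family_in J L i \<in> mod_hom R (L i) ?S" by (rule hom_family_in[OF assms(1) L i(1)])
    from hom_closed[OF this i(2)] i
    show "compose (carrier ?S) g ?c (family_in J L i x) = f (family_in J L i x)"
      by (simp add: compose_eq family_cotuple_in[OF assms(1) rm(1) L assms(2) h(1)] h(2))
  qed
  then have "g (?c x) = f x" if "x \<in> carrier ?S" for x using that by (metis compose_eq)
  with c show ?case by blast
qed

text \<open>The map \<open>\<Oplus> e\<^sub>iR \<rightarrow> M\<close> with \<open>(r\<^sub>i) \<mapsto> \<Sum> x\<^sub>ir\<^sub>i\<close>.\<close>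

definition generator_map ::
  "('k, 'r) module \<Rightarrow> ('r, 'm) module \<Rightarrow> nat set \<Rightarrow> (nat \<Rightarrow> 'r) \<Rightarrow> (nat \<Rightarrow> 'm) \<Rightarrow> (nat \<Rightarrow> 'r) \<Rightarrow> 'm" where
  "generator_map R M J e x = family_cotuple J (\<lambda>i. right_ideal_gen R (e i)) M
     (\<lambda>i. \<lambda>r\<in>carrier (right_ideal_gen R (e i)). r \<odot>\<^bsub>M\<^esub> x i)"

lemma generator_map_apply:
  fixes R :: "('k, 'r) module"
  assumes "right_module R M" "\<And>i. i \<in> J \<Longrightarrow> e i \<in> carrier R" "\<And>i. i \<in> J \<Longrightarrow> x i \<in> carrier M"
    and r: "r \<in> carrier (mod_family_sum J (\<lambda>i. right_ideal_gen R (e i)))"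
  shows "generator_map R M J e x r = finsum M (\<lambda>i. r i \<odot>\<^bsub>M\<^esub> x i) J"
proof -
  interpret M: right_module R M by fact
  show ?thesis
    unfolding generator_map_def family_cotuple_def using r
    by (simp, intro M.M.finsum_cong')
      (auto simp: assms(2,3) family_memD[OF r]
        intro!: M.act_closed right_ideal_subset[OF M.R.ring_axioms assms(2) family_memD[OF r]])
qed

lemma hom_generator_map:
  fixes R :: "('k, 'r) module"
  assumes "right_module R M" "finite J" "\<And>i. i \<in> J \<Longrightarrow> e i \<in> carrier R" "\<And>i. i \<in> J \<Longrightarrow> x i \<in> carrier M"
  shows "generator_map R M J e x \<in> mod_hom R (mod_family_sum J (\<lambda>i. right_ideal_gen R (e i))) M"
proof -
  interpret M: right_module R M by fact
  show ?thesis
    unfolding generator_map_def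
    by (intro hom_family_cotuple M.R.ring_axioms assms right_module_right_ideal hom_act_on)
qed

lemma generator_map_generator:
  fixes R :: "('k, 'r) module"
  assumes "right_module R M" "finite J" "\<And>i. i \<in> J \<Longrightarrow> e i \<in> carrier R" "\<And>i. i \<in> J \<Longrightarrow> x i \<in> carrier M"
    and i: "i \<in> J" "e i \<odot>\<^bsub>M\<^esub> x i = x i"
  shows "x i \<in> generator_map R M J e x ` carrier (mod_family_sum J (\<lambda>i. right_ideal_gen R (e i)))"
proof -
  interpret M: right_module R M by fact
  let ?L = "\<lambda>i. right_ideal_gen R (e i)"
  have L: "right_module R (?L i)" if "i \<in> J" for i
    by (rule right_module_right_ideal) (use M.R.ring_axioms assms(3) that in auto)
  have ei: "e i \<in> carrier (?L i)" using right_ideal_mem[of "\<one>\<^bsub>R\<^esub>" R "e i"] assms(3) i by simp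
  have mem: "family_in J ?L i (e i) \<in> carrier (mod_family_sum J ?L)"
    by (rule hom_closed[OF hom_family_in]) (use M.R.ring_axioms L i(1) ei in auto)
  have "generator_map R M J e x (family_in J ?L i (e i)) = x i"
  proof -
    let ?f = "\<lambda>i. \<lambda>r\<in>carrier (?L i). r \<odot>\<^bsub>M\<^esub> x i"
    have fh: "?f k \<in> mod_hom R (?L k) M" if "k \<in> J" for k
      by (rule hom_act_on[OF assms(1) assms(3)[OF that] assms(4)[OF that]])
    have "family_cotuple J ?L M ?f (family_in J ?L i (e i)) = ?f i (e i)"
      by (rule family_cotuple_in[where f = ?f, OF M.R.ring_axioms assms(1) L assms(2) fh i(1) ei])
    then show ?thesis using ei i by (simp add: generator_map_def)
  qed
  then show ?thesis using mem by (metis imageI)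
qed

lemma generator_map_surj:
  fixes R :: "('k, 'r) module"
  assumes "right_module R M" "finite J" "\<And>i. i \<in> J \<Longrightarrow> e i \<in> carrier R" "\<And>i. i \<in> J \<Longrightarrow> x i \<in> carrier M"
    and "\<And>i. i \<in> J \<Longrightarrow> e i \<odot>\<^bsub>M\<^esub> x i = x i"
    and gen: "\<And>U. submodule U R M \<Longrightarrow> x ` J \<subseteq> U \<Longrightarrow> carrier M \<subseteq> U"
  shows "generator_map R M J e x ` carrier (mod_family_sum J (\<lambda>i. right_ideal_gen R (e i))) = carrier M"
proof
  interpret M: right_module R M by fact
  let ?L = "\<lambda>i. right_ideal_gen R (e i)"
  have S: "right_module R (mod_family_sum J ?L)"
    by (intro right_module_family right_module_right_ideal M.R.ring_axioms assms)
  interpret S: right_module R "mod_family_sum J ?L" by fact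
  note hom = hom_generator_map[OF assms(1-4)]
  show "generator_map R M J e x ` carrier (mod_family_sum J ?L) \<subseteq> carrier M"
    using hom_closed[OF hom] by auto
  show "carrier M \<subseteq> generator_map R M J e x ` carrier (mod_family_sum J ?L)"
    by (intro gen image_submodule[OF S assms(1) hom] S.carrier_submodule image_subsetI
        generator_map_generator[OF assms(1-4)] assms(5))
qed

lemma fg_free_cover:
  fixes R :: "('k, 'r) module"
  assumes "fg_module R M"
  obtains P :: "('r, 'r univ) module" and p where "projective R P" "p \<in> mod_hom R P M"
    "p ` carrier P = carrier M"
proof -
  obtain S where S: "right_module R M" "finite S" "S \<subseteq> carrier M"
    "\<And>U. submodule U R M \<Longrightarrow> S \<subseteq> U \<Longrightarrow> U = carrier M"
    using fg_moduleE[OF assms(1)] by metis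
  interpret M: right_module R M by fact
  obtain x and n :: nat where x: "S = x ` {i. i < n}"
    using finite_imp_nat_seg_image_inj_on[OF S(2)] by blast
  let ?P = "mod_family_sum {i. i < n} (\<lambda>i. right_ideal_gen R \<one>\<^bsub>R\<^esub>)"
  let ?p = "generator_map R M {i. i < n} (\<lambda>i. \<one>\<^bsub>R\<^esub>) x"
  show thesis
  proof (rule that[of ?P ?p])
    show "projective R ?P"
      by (intro projective_family projective_right_ideal_idem) (auto intro: M.R.ring_axioms)
    show "?p \<in> mod_hom R ?P M"
      by (rule hom_generator_map) (use S x in auto)
    show "?p ` carrier ?P = carrier M"
      by (rule generator_map_surj) (use S x M.act_one in auto)
  qed
qed

text \<open>
  Choosing preimages under an epimorphism \<open>R\<^sup>n \<rightarrow> M\<close> embeds the set \<open>M\<close> into the type of \<open>R\<^sup>n\<close>.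
\<close>

lemma fg_copy:
  fixes R :: "('k, 'r) module"
  assumes "fg_module R M"
  obtains E :: "('r, 'r univ) module" where "fg_module R E" "mod_isomorphic R M E"
proof -
  have M: "right_module R M" using assms by (rule fg_right_module)
  obtain P :: "('r, 'r univ) module" and p where "p ` carrier P = carrier M"
    using fg_free_cover[OF assms] by metis
  then have "inj_on (inv_into (carrier P) p) (carrier M)" by (metis inj_on_inv_into subset_refl)
  from transport_module[OF M this]
  obtain E :: "('r, 'r univ) module" where "right_module R E" "mod_isomorphic R M E" by blast
  then show thesis using fg_iso[OF assms] that by blast
qed

text \<open>
  By definition, a projective module has the lifting property for epimorphisms between modules of
  one particular type. Source and target of any other epimorphism can be replaced by isomorphic
  copies of that type.
\<close>

lemma projective_lift:
  fixes R :: "('k, 'r) module"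
  assumes "projective R P" "fg_module R E" "fg_module R F"
    and g: "g \<in> mod_hom R E F" "g ` carrier E = carrier F" and f: "f \<in> mod_hom R P F"
  obtains h where "h \<in> mod_hom R P E" "\<And>x. x \<in> carrier P \<Longrightarrow> g (h x) = f x"
proof -
  have rm: "right_module R P" "right_module R E" "right_module R F"
    using assms(1-3) by (auto intro: fg_right_module projective_fg)
  obtain E' :: "('r, 'r univ) module" where E': "fg_module R E'" "mod_isomorphic R E E'"
    using fg_copy[OF assms(2)] by blast
  obtain F' :: "('r, 'r univ) module" where F': "fg_module R F'" "mod_isomorphic R F F'"
    using fg_copy[OF assms(3)] by blast
  have rm': "right_module R E'" "right_module R F'" using E' F' by (auto intro: fg_right_module)
  obtain a where a: "a \<in> mod_hom R E E'" "bij_betw a (carrier E) (carrier E')"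
    using E' by (auto simp: mod_isomorphic_def)
  obtain a' where a': "a' \<in> mod_hom R E' E" "bij_betw a' (carrier E') (carrier E)"
    using iso_inverse[OF rm(2) rm'(1) a] by metis
  obtain b where b: "b \<in> mod_hom R F F'" "bij_betw b (carrier F) (carrier F')"
    using F' by (auto simp: mod_isomorphic_def)
  let ?g = "compose (carrier E') b (compose (carrier E') g a')"
  have g': "?g \<in> mod_hom R E' F'"
    by (rule hom_comp[OF rm'(1) hom_comp[OF rm'(1) a'(1) g(1)] b(1)])
  have "?g ` carrier E' = b ` g ` a' ` carrier E'" by (auto simp: compose_eq image_image)
  then have g's: "?g ` carrier E' = carrier F'"
    using a'(2) g(2) b(2) by (simp add: bij_betw_def)
  have f': "compose (carrier P) b f \<in> mod_hom R P F'" by (rule hom_comp[OF rm(1) f b(1)])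
  obtain h where h: "h \<in> mod_hom R P E'" "\<And>x. x \<in> carrier P \<Longrightarrow> ?g (h x) = compose (carrier P) b f x"
    using projectiveD[OF assms(1) E'(1) F'(1) g' g's f'] by metis
  show thesis
  proof (rule that[OF hom_comp[OF rm(1) h(1) a'(1)]])
    fix x assume x: "x \<in> carrier P"
    have hx: "h x \<in> carrier E'" using hom_closed[OF h(1) x] .
    have "b (g (a' (h x))) = b (f x)" using h(2)[OF x] x hx by (simp add: compose_eq)
    moreover have "g (a' (h x)) \<in> carrier F" "f x \<in> carrier F"
      using hom_closed[OF g(1)] hom_closed[OF a'(1) hx] hom_closed[OF f x] by auto
    ultimately have "g (a' (h x)) = f x" using b(2) by (auto simp: bij_betw_def dest: inj_onD)
    then show "g (compose (carrier P) a' h x) = f x" using x by (simp add: compose_eq)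
  qed
qed

lemma projective_iso:
  fixes R :: "('k, 'r) module"
  assumes "projective R P" "right_module R P'" "mod_isomorphic R P P'"
  shows "projective R P'"
  unfolding projective_def
proof (intro conjI allI ballI impI, goal_cases)
  case 1 show ?case by (rule fg_iso[OF projective_fg[OF assms(1)] assms(2,3)])
next
  case (2 E F g f)
  have P: "right_module R P" using assms(1) by (simp add: fg_right_module projective_fg)
  obtain a where a: "a \<in> mod_hom R P P'" "bij_betw a (carrier P) (carrier P')"
    using assms(3) by (auto simp: mod_isomorphic_def)
  obtain a' where a': "a' \<in> mod_hom R P' P" "\<And>y. y \<in> carrier P' \<Longrightarrow> a (a' y) = y"
    using iso_inverse[OF P assms(2) a] by metis
  obtain h where h: "h \<in> mod_hom R P E" "\<And>x. x \<in> carrier P \<Longrightarrow> g (h x) = compose (carrier P) f a x"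
    using projective_lift[OF assms(1) _ _ 2(1) _ hom_comp[OF P a(1) 2(2)]] 2(3) by metis
  show ?case
  proof (intro bexI[OF _ hom_comp[OF assms(2) a'(1) h(1)]] ballI)
    fix y assume y: "y \<in> carrier P'"
    then show "g (compose (carrier P') h a' y) = f y"
      using h(2)[OF hom_closed[OF a'(1) y]] hom_closed[OF a'(1) y] a'(2) by (simp add: compose_eq)
  qed
qed

section \<open>Finite dimensional algebras\<close>

abbreviation base_field :: "'k :: field ring" where
  "base_field \<equiv> ring_of_type_algebra"

lemma base_field_simps [simp]:
  shows "carrier (base_field :: 'k :: field ring) = UNIV"
    and "x \<otimes>\<^bsub>base_field\<^esub> y = x * y"
    and "\<one>\<^bsub>base_field\<^esub> = (1 :: 'k)"
    and "\<zero>\<^bsub>base_field\<^esub> = (0 :: 'k)"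
    and "x \<oplus>\<^bsub>base_field\<^esub> y = x + y"
  by (simp_all add: ring_of_type_algebra_def)

text \<open>
  Induction over a finite spanning set: when a generator \<open>s\<close> is added, a subspace needs at most
  one further generator, namely any of its elements in which \<open>s\<close> occurs with a nonzero
  coefficient.
\<close>

lemma vector_subspace_fg:
  fixes V :: "('k :: field, 'm) module"
  assumes "fg_module base_field V" "submodule U base_field V"
  shows "fg_module base_field (V\<lparr>carrier := U\<rparr>)"
proof -
  have V: "right_module base_field V" using assms(1) by (rule fg_right_module)
  interpret V: right_module base_field V by fact
  define gen where "gen S = \<Inter>{W. submodule W base_field V \<and> S \<subseteq> W}" for S
  have gen_sub: "gen S \<subseteq> W" if "submodule W base_field V" "S \<subseteq> W" for S W
    using that by (auto simp: gen_def)
  have sup_gen: "S \<subseteq> gen S" for S by (auto simp: gen_def)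
  have gen_submodule: "submodule (gen S) base_field V" if "S \<subseteq> carrier V" for S
  proof (rule V.is_submoduleI)
    show "gen S \<subseteq> carrier V" by (rule gen_sub[OF V.carrier_submodule that])
    show "\<zero>\<^bsub>V\<^esub> \<in> gen S"
      unfolding gen_def by (intro InterI) (elim CollectE conjE, rule submodule_zero)
    show "x \<oplus>\<^bsub>V\<^esub> y \<in> gen S" if "x \<in> gen S" "y \<in> gen S" for x y
    proof -
      have "x \<oplus>\<^bsub>V\<^esub> y \<in> W" if W: "submodule W base_field V" "S \<subseteq> W" for W
        by (rule submodule_add[OF W(1)])
          (use \<open>x \<in> gen S\<close> \<open>y \<in> gen S\<close> W in \<open>simp_all add: gen_def\<close>)
      then show ?thesis by (simp add: gen_def)
    qed
    show "r \<odot>\<^bsub>V\<^esub> x \<in> gen S" if "r \<in> carrier base_field" "x \<in> gen S" for r x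
    proof -
      have "r \<odot>\<^bsub>V\<^esub> x \<in> W" if W: "submodule W base_field V" "S \<subseteq> W" for W
        by (rule submodule_act[OF W(1)]) (use \<open>x \<in> gen S\<close> W in \<open>simp_all add: gen_def\<close>)
      then show ?thesis by (simp add: gen_def)
    qed
  qed
  have main: "\<exists>T. finite T \<and> T \<subseteq> U \<and> (\<forall>W. submodule W base_field V \<and> T \<subseteq> W \<longrightarrow> U \<subseteq> W)"
    if "finite S" "S \<subseteq> carrier V" "submodule U base_field V" "U \<subseteq> gen S" for S U
    using that
  proof (induction S arbitrary: U)
    case empty
    have "gen {} \<subseteq> {\<zero>\<^bsub>V\<^esub>}" by (rule gen_sub[OF V.zero_submodule]) simp
    then have "U \<subseteq> W" if "submodule W base_field V" for W
      using empty(3) submodule_zero[OF that] by auto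
    then show ?case by (intro exI[of _ "{}"]) simp
  next
    case (insert s S)
    have s: "s \<in> carrier V" and S: "S \<subseteq> carrier V" using insert.prems by auto
    note gS = submoduleD[OF gen_submodule[OF S]]
    show ?case
    proof (cases "U \<subseteq> gen S")
      case True
      then show ?thesis by (rule insert.IH[OF S insert.prems(2)])
    next
      case False
      \<comment> \<open>The span of \<open>s\<close> and \<open>S\<close>.\<close>
      let ?G = "{c \<odot>\<^bsub>V\<^esub> s \<oplus>\<^bsub>V\<^esub> y | c y. y \<in> gen S}"
      have "submodule ?G base_field V"
      proof (rule V.is_submoduleI)
        show "?G \<subseteq> carrier V" using s gS(1) by auto
        show "\<zero>\<^bsub>V\<^esub> \<in> ?G"
          using s gS(2) V.act_zero_scalar[OF s]
          by (intro CollectI exI[of _ 0] exI[of _ "\<zero>\<^bsub>V\<^esub>"]) simp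
      next
        fix x y assume "x \<in> ?G" "y \<in> ?G"
        then obtain c a d b where xy: "x = c \<odot>\<^bsub>V\<^esub> s \<oplus>\<^bsub>V\<^esub> a" "a \<in> gen S"
          "y = d \<odot>\<^bsub>V\<^esub> s \<oplus>\<^bsub>V\<^esub> b" "b \<in> gen S" by blast
        have "a \<in> carrier V" "b \<in> carrier V" using xy gS(1) by auto
        then have "x \<oplus>\<^bsub>V\<^esub> y = (c + d) \<odot>\<^bsub>V\<^esub> s \<oplus>\<^bsub>V\<^esub> (a \<oplus>\<^bsub>V\<^esub> b)"
          using s V.act_add_scalar[of c d s] by (simp add: xy V.M.a_ac)
        then show "x \<oplus>\<^bsub>V\<^esub> y \<in> ?G" using gS(3)[OF xy(2,4)] by blast
      next
        fix r x assume "x \<in> ?G"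
        then obtain c a where x: "x = c \<odot>\<^bsub>V\<^esub> s \<oplus>\<^bsub>V\<^esub> a" "a \<in> gen S" by blast
        have "a \<in> carrier V" using x gS(1) by auto
        then have "r \<odot>\<^bsub>V\<^esub> x = (c * r) \<odot>\<^bsub>V\<^esub> s \<oplus>\<^bsub>V\<^esub> r \<odot>\<^bsub>V\<^esub> a"
          using s V.act_mult[of c r s] by (simp add: x V.act_add)
        then show "r \<odot>\<^bsub>V\<^esub> x \<in> ?G" using gS(4)[of r a] x(2) by auto
      qed
      moreover have "insert s S \<subseteq> ?G"
      proof
        fix x assume "x \<in> insert s S"
        then consider "x = s" | "x \<in> S" by auto
        then show "x \<in> ?G"
        proof cases
          case 1
          then show ?thesis using s gS(2) V.act_one[OF s]
            by (intro CollectI exI[of _ 1] exI[of _ "\<zero>\<^bsub>V\<^esub>"]) simp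
        next
          case 2
          then have "x \<in> carrier V" "x \<in> gen S" using S sup_gen by auto
          then show ?thesis using s V.act_zero_scalar[OF s]
            by (intro CollectI exI[of _ 0] exI[of _ x]) simp
        qed
      qed
      ultimately have "gen (insert s S) \<subseteq> ?G" by (rule gen_sub)
      with insert.prems(3) have UG: "U \<subseteq> ?G" by (rule subset_trans)
      obtain v where v: "v \<in> U" "v \<notin> gen S" using False by blast
      from subsetD[OF UG v(1)] obtain c y where cy: "v = c \<odot>\<^bsub>V\<^esub> s \<oplus>\<^bsub>V\<^esub> y" "y \<in> gen S"
        unfolding mem_Collect_eq by (elim exE conjE)
      have yV: "y \<in> carrier V" using cy gS(1) by auto
      have c: "c \<noteq> 0"
        using v(2) cy V.act_zero_scalar[OF s] yV by auto
      note U = submoduleD[OF insert.prems(2)]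
      have vV: "v \<in> carrier V" using v U(1) by auto
      have "submodule (U \<inter> gen S) base_field V"
        by (rule submodule_inter[OF V insert.prems(2) gen_submodule[OF S]])
      from insert.IH[OF S this Int_lower2] obtain T where T: "finite T" "T \<subseteq> U \<inter> gen S"
        "\<forall>W. submodule W base_field V \<and> T \<subseteq> W \<longrightarrow> U \<inter> gen S \<subseteq> W"
        by (elim exE conjE)
      have "U \<subseteq> W" if W: "submodule W base_field V" "insert v T \<subseteq> W" for W
      proof
        fix u assume u: "u \<in> U"
        from subsetD[OF UG u] obtain d z where dz: "u = d \<odot>\<^bsub>V\<^esub> s \<oplus>\<^bsub>V\<^esub> z" "z \<in> gen S"
          unfolding mem_Collect_eq by (elim exE conjE)
        have zV: "z \<in> carrier V" using dz gS(1) by auto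
        have "(d / c) \<odot>\<^bsub>V\<^esub> v = d \<odot>\<^bsub>V\<^esub> s \<oplus>\<^bsub>V\<^esub> (d / c) \<odot>\<^bsub>V\<^esub> y"
          using s yV c V.act_mult[of c "d / c" s] by (simp add: cy V.act_add)
        then have "u \<ominus>\<^bsub>V\<^esub> (d / c) \<odot>\<^bsub>V\<^esub> v = z \<ominus>\<^bsub>V\<^esub> (d / c) \<odot>\<^bsub>V\<^esub> y"
          using s yV zV
          by (simp add: dz a_minus_def V.M.minus_add V.M.a_ac)
             (simp add: V.M.a_assoc[symmetric] V.M.r_neg V.M.a_comm[of z])
        moreover have "z \<ominus>\<^bsub>V\<^esub> (d / c) \<odot>\<^bsub>V\<^esub> y \<in> gen S"
          unfolding a_minus_def by (intro gS(3,5) dz(2)) (use gS(4)[of "d / c" y] cy in auto)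
        moreover have "u \<ominus>\<^bsub>V\<^esub> (d / c) \<odot>\<^bsub>V\<^esub> v \<in> U"
          unfolding a_minus_def by (intro U(3,5) u) (use U(4)[of "d / c" v] v in auto)
        ultimately have "u \<ominus>\<^bsub>V\<^esub> (d / c) \<odot>\<^bsub>V\<^esub> v \<in> W" using T(3)[rule_format, of W] W by auto
        then have "(u \<ominus>\<^bsub>V\<^esub> (d / c) \<odot>\<^bsub>V\<^esub> v) \<oplus>\<^bsub>V\<^esub> (d / c) \<odot>\<^bsub>V\<^esub> v \<in> W"
          using submodule_add[OF W(1)] submodule_act[OF W(1), of "d / c" v] W(2) by auto
        moreover have "(u \<ominus>\<^bsub>V\<^esub> (d / c) \<odot>\<^bsub>V\<^esub> v) \<oplus>\<^bsub>V\<^esub> (d / c) \<odot>\<^bsub>V\<^esub> v = u"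
          using u U(1) vV by (auto simp: a_minus_def V.M.a_assoc V.M.l_neg)
        ultimately show "u \<in> W" by simp
      qed
      moreover have "finite (insert v T)" "insert v T \<subseteq> U" using T v by auto
      ultimately show ?thesis by (intro exI[of _ "insert v T"]) simp
    qed
  qed
  obtain S where S: "finite S" "S \<subseteq> carrier V"
    "\<And>U. submodule U base_field V \<Longrightarrow> S \<subseteq> U \<Longrightarrow> U = carrier V"
    using fg_moduleE[OF assms(1)] by metis
  have "U \<subseteq> gen S"
    using S(3)[OF gen_submodule[OF S(2)] sup_gen] submodule_subset[OF assms(2)] by simp
  from main[OF S(1,2) assms(2) this] obtain T where "finite T" "T \<subseteq> U"
    "\<forall>W. submodule W base_field V \<and> T \<subseteq> W \<longrightarrow> U \<subseteq> W" by (elim exE conjE)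
  then show ?thesis by (intro fg_submoduleI[OF V assms(2), of T]) simp_all
qed

definition restrict_scalars :: "('k, 'r) module \<Rightarrow> ('r, 'm) module \<Rightarrow> ('k, 'm) module" where
  "restrict_scalars R M = \<lparr>carrier = carrier M, mult = undefined, one = undefined,
     ring.zero = \<zero>\<^bsub>M\<^esub>, ring.add = (\<oplus>\<^bsub>M\<^esub>), smult = (\<lambda>c x. (c \<odot>\<^bsub>R\<^esub> \<one>\<^bsub>R\<^esub>) \<odot>\<^bsub>M\<^esub> x)\<rparr>"

locale fd_algebra =
  fixes R :: "('k :: field, 'r) module"
  assumes ring: "ring R"
    and fin_dim: "fg_module base_field R"
    and smult_left: "\<lbrakk>x \<in> carrier R; y \<in> carrier R\<rbrakk> \<Longrightarrow> c \<odot>\<^bsub>R\<^esub> (x \<otimes>\<^bsub>R\<^esub> y) = (c \<odot>\<^bsub>R\<^esub> x) \<otimes>\<^bsub>R\<^esub> y"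
    and smult_right: "\<lbrakk>x \<in> carrier R; y \<in> carrier R\<rbrakk> \<Longrightarrow> c \<odot>\<^bsub>R\<^esub> (x \<otimes>\<^bsub>R\<^esub> y) = x \<otimes>\<^bsub>R\<^esub> (c \<odot>\<^bsub>R\<^esub> y)"
begin

sublocale R: ring R by (rule ring)

sublocale VR: right_module base_field R by (rule fg_right_module[OF fin_dim])

abbreviation scal :: "'k \<Rightarrow> 'r" where "scal c \<equiv> c \<odot>\<^bsub>R\<^esub> \<one>\<^bsub>R\<^esub>"

lemma smult_closed [simp]: "x \<in> carrier R \<Longrightarrow> c \<odot>\<^bsub>R\<^esub> x \<in> carrier R"
  by (rule VR.act_closed) simp_all

lemma scal_mult: "x \<in> carrier R \<Longrightarrow> scal c \<otimes>\<^bsub>R\<^esub> x = c \<odot>\<^bsub>R\<^esub> x"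
  using smult_left[of "\<one>\<^bsub>R\<^esub>" x c] by simp

lemma mult_scal: "x \<in> carrier R \<Longrightarrow> x \<otimes>\<^bsub>R\<^esub> scal c = c \<odot>\<^bsub>R\<^esub> x"
  using smult_right[of x "\<one>\<^bsub>R\<^esub>" c] by simp

lemma scal_add: "scal (c + d) = scal c \<oplus>\<^bsub>R\<^esub> scal d"
  using VR.act_add_scalar[of c d "\<one>\<^bsub>R\<^esub>"] by simp

lemma scal_prod: "scal (c * d) = scal c \<otimes>\<^bsub>R\<^esub> scal d"
  using VR.act_mult[of c d "\<one>\<^bsub>R\<^esub>"] by (simp add: mult_scal)

lemma scal_one [simp]: "scal 1 = \<one>\<^bsub>R\<^esub>"
  using VR.act_one[of "\<one>\<^bsub>R\<^esub>"] by simp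

lemma scal_act_comm:
  assumes "right_module R M" "r \<in> carrier R" "x \<in> carrier M"
  shows "r \<odot>\<^bsub>M\<^esub> (scal c \<odot>\<^bsub>M\<^esub> x) = scal c \<odot>\<^bsub>M\<^esub> (r \<odot>\<^bsub>M\<^esub> x)"
proof -
  interpret M: right_module R M by fact
  have "r \<odot>\<^bsub>M\<^esub> (scal c \<odot>\<^bsub>M\<^esub> x) = (scal c \<otimes>\<^bsub>R\<^esub> r) \<odot>\<^bsub>M\<^esub> x" using assms by (simp add: M.act_mult)
  also have "\<dots> = (r \<otimes>\<^bsub>R\<^esub> scal c) \<odot>\<^bsub>M\<^esub> x" using assms by (simp add: scal_mult mult_scal)
  also have "\<dots> = scal c \<odot>\<^bsub>M\<^esub> (r \<odot>\<^bsub>M\<^esub> x)" using assms by (simp add: M.act_mult)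
  finally show ?thesis .
qed

lemma right_module_restrict_scalars:
  assumes "right_module R M"
  shows "right_module base_field (restrict_scalars R M)"
proof -
  interpret M: right_module R M by fact
  show ?thesis
  proof (rule right_moduleI)
    show "ring (base_field :: 'k ring)" by (rule ring_from_type_algebra)
    show "\<exists>y\<in>carrier (restrict_scalars R M). y \<oplus>\<^bsub>restrict_scalars R M\<^esub> x = \<zero>\<^bsub>restrict_scalars R M\<^esub>"
      if "x \<in> carrier (restrict_scalars R M)" for x
      using that by (intro bexI[of _ "\<ominus>\<^bsub>M\<^esub> x"]) (auto simp: restrict_scalars_def M.M.l_neg)
  qed (auto simp: restrict_scalars_def M.M.a_ac scal_add M.act_add_scalar M.act_add scal_prod
      M.act_mult M.act_one)
qed

lemma submodule_restrict_scalars: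
  assumes "right_module R M" "submodule U R M"
  shows "submodule U base_field (restrict_scalars R M)"
proof -
  interpret V: right_module base_field "restrict_scalars R M"
    by (rule right_module_restrict_scalars[OF assms(1)])
  show ?thesis
    using submoduleD[OF assms(2)] by (intro V.is_submoduleI) (auto simp: restrict_scalars_def)
qed

lemma fg_restrict_scalars:
  assumes "fg_module R M"
  shows "fg_module base_field (restrict_scalars R M)"
proof -
  let ?V = "restrict_scalars R M"
  obtain S where S: "right_module R M" "finite S" "S \<subseteq> carrier M"
    "\<And>U. submodule U R M \<Longrightarrow> S \<subseteq> U \<Longrightarrow> U = carrier M"
    using fg_moduleE[OF assms] by metis
  obtain B where B: "finite B" "B \<subseteq> carrier R"
    "\<And>U. submodule U base_field R \<Longrightarrow> B \<subseteq> U \<Longrightarrow> U = carrier R"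
    using fg_moduleE[OF fin_dim] by metis
  interpret M: right_module R M by fact
  show ?thesis
  proof (rule fg_moduleI[OF right_module_restrict_scalars[OF S(1)], of "(\<lambda>(b, s). b \<odot>\<^bsub>M\<^esub> s) ` (B \<times> S)"])
    show "finite ((\<lambda>(b, s). b \<odot>\<^bsub>M\<^esub> s) ` (B \<times> S))" using S B by auto
    show "(\<lambda>(b, s). b \<odot>\<^bsub>M\<^esub> s) ` (B \<times> S) \<subseteq> carrier ?V"
      using S(3) B(2) by (auto simp: restrict_scalars_def)
    fix W assume W: "submodule W base_field ?V" "(\<lambda>(b, s). b \<odot>\<^bsub>M\<^esub> s) ` (B \<times> S) \<subseteq> W"
    have W': "W \<subseteq> carrier M" "\<zero>\<^bsub>M\<^esub> \<in> W" "\<And>x y. x \<in> W \<Longrightarrow> y \<in> W \<Longrightarrow> x \<oplus>\<^bsub>M\<^esub> y \<in> W"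
      "\<And>c x. x \<in> W \<Longrightarrow> scal c \<odot>\<^bsub>M\<^esub> x \<in> W"
      using submodule_subset[OF W(1)] submodule_zero[OF W(1)] submodule_add[OF W(1)]
        submodule_act[OF W(1)] by (simp_all add: restrict_scalars_def)
    have sW: "r \<odot>\<^bsub>M\<^esub> s \<in> W" if "s \<in> S" "r \<in> carrier R" for r s
    proof -
      have s: "s \<in> carrier M" using that S(3) by auto
      let ?Y = "{r \<in> carrier R. r \<odot>\<^bsub>M\<^esub> s \<in> W}"
      have "?Y = carrier R"
      proof (rule B(3)[OF VR.is_submoduleI])
        fix c r assume "r \<in> ?Y"
        then have r: "r \<in> carrier R" "r \<odot>\<^bsub>M\<^esub> s \<in> W" by auto
        have "(c \<odot>\<^bsub>R\<^esub> r) \<odot>\<^bsub>M\<^esub> s = (r \<otimes>\<^bsub>R\<^esub> scal c) \<odot>\<^bsub>M\<^esub> s"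
          by (simp only: mult_scal[OF r(1)])
        also have "\<dots> = scal c \<odot>\<^bsub>M\<^esub> (r \<odot>\<^bsub>M\<^esub> s)" by (rule M.act_mult) (use r s in simp_all)
        finally show "c \<odot>\<^bsub>R\<^esub> r \<in> ?Y"
          using W'(4)[OF r(2), of c] r(1) by simp
      next
        show "\<zero>\<^bsub>R\<^esub> \<in> ?Y" using s W'(2) by simp
        show "B \<subseteq> ?Y" using W(2) B(2) \<open>s \<in> S\<close> by auto
        show "x \<oplus>\<^bsub>R\<^esub> y \<in> ?Y"
          if "x \<in> ?Y" "y \<in> ?Y" for x y
          using that s W'(3) by (simp add: M.act_add_scalar)
      qed auto
      then show ?thesis using that by auto
    qed
    let ?X = "{x \<in> W. \<forall>r\<in>carrier R. r \<odot>\<^bsub>M\<^esub> x \<in> W}"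
    have "?X = carrier M"
    proof (rule S(4)[OF M.is_submoduleI])
      show "S \<subseteq> ?X"
      proof
        fix s assume s: "s \<in> S"
        then have "s \<in> W" using sW[OF s R.one_closed] S(3) M.act_one[of s] by auto
        then show "s \<in> ?X" using sW[OF s] by simp
      qed
      fix r x assume r: "r \<in> carrier R" and x: "x \<in> ?X"
      have "s \<odot>\<^bsub>M\<^esub> (r \<odot>\<^bsub>M\<^esub> x) = (r \<otimes>\<^bsub>R\<^esub> s) \<odot>\<^bsub>M\<^esub> x" if "s \<in> carrier R" for s
        using r x W'(1) that by (auto simp: M.act_mult)
      then show "r \<odot>\<^bsub>M\<^esub> x \<in> ?X" using r x by auto
    next
      show "?X \<subseteq> carrier M" using W'(1) by auto
      show "\<zero>\<^bsub>M\<^esub> \<in> ?X" using W'(2) by simp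
      fix x y assume xy: "x \<in> ?X"
        "y \<in> ?X"
      then have "x \<in> carrier M" "y \<in> carrier M" using W'(1) by auto
      with xy show "x \<oplus>\<^bsub>M\<^esub> y \<in> ?X"
        using W'(3) by (simp add: M.act_add)
    qed
    then show "carrier ?V \<subseteq> W" by (auto simp: restrict_scalars_def)
  qed
qed

text \<open>
  A finite dimensional algebra is noetherian, because submodules are in particular subspaces.
\<close>

lemma fg_submodule:
  assumes "fg_module R M" "submodule U R M"
  shows "fg_module R (M\<lparr>carrier := U\<rparr>)"
proof -
  have M: "right_module R M" using assms(1) by (rule fg_right_module)
  have sub: "submodule U base_field (restrict_scalars R M)"
    by (rule submodule_restrict_scalars[OF M assms(2)])
  obtain T where T: "finite T" "T \<subseteq> U"
    "\<And>W. submodule W base_field (restrict_scalars R M) \<Longrightarrow> T \<subseteq> W \<Longrightarrow> U \<subseteq> W"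
    using fg_submoduleE[OF right_module_restrict_scalars[OF M] sub
        vector_subspace_fg[OF fg_restrict_scalars[OF assms(1)] sub]] by metis
  show ?thesis
    by (rule fg_submoduleI[OF M assms(2) T(1,2)]) (rule T(3)[OF submodule_restrict_scalars[OF M]])
qed

lemma fg_kernel:
  assumes "fg_module R M" "right_module R N" "f \<in> mod_hom R M N"
  shows "fg_module R (kernel_module M f N)"
  unfolding kernel_module_def
  by (rule fg_submodule[OF assms(1) kernel_submodule[OF fg_right_module[OF assms(1)] assms(2,3)]])

end

section \<open>Projective presentations, syzygies and resolutions\<close>

definition presents ::
  "('r, 'y) ring_scheme \<Rightarrow> ('r, 'p) module \<Rightarrow> ('p \<Rightarrow> 'm) \<Rightarrow> ('r, 'm) module \<Rightarrow> bool" where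
  "presents R P p M \<longleftrightarrow> projective R P \<and> p \<in> mod_hom R P M \<and> p ` carrier P = carrier M"

text \<open>
  A syzygy in the weak sense: the presentation need not be a projective cover, so the module is
  determined only up to projective summands.
\<close>

definition syzygy_of :: "('r, 'y) ring_scheme \<Rightarrow> ('r, 'm) module \<Rightarrow> ('r, 'p) module \<Rightarrow> bool" where
  "syzygy_of R M Y \<longleftrightarrow> (\<exists>P p. presents R P p M \<and> Y = kernel_module P p M)"

text \<open>
  The first two steps of a projective resolution of \<open>M\<close>; the first Ext group depends on nothing
  else.
\<close>

definition two_presents ::
  "('r, 'y) ring_scheme \<Rightarrow> ('r, 'q) module \<Rightarrow> ('q \<Rightarrow> 'p) \<Rightarrow> ('r, 'p) module \<Rightarrow> ('p \<Rightarrow> 'm) \<Rightarrow>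
    ('r, 'm) module \<Rightarrow> bool" where
  "two_presents R Q d P p M \<longleftrightarrow> presents R P p M \<and> projective R Q \<and> d \<in> mod_hom R Q P \<and>
     d ` carrier Q = {x \<in> carrier P. p x = \<zero>\<^bsub>M\<^esub>}"

lemma presentsD:
  assumes "presents R P p M"
  shows "projective R P" "fg_module R P" "right_module R P" "p \<in> mod_hom R P M" "p ` carrier P = carrier M"
  using assms by (auto simp: presents_def projective_fg fg_right_module)

text \<open>The image of the \<open>n\<close>-th differential of a resolution is the syzygy of index \<open>n + 1\<close>.\<close>

definition res_syzygy :: "(nat \<Rightarrow> ('r, 'n) module) \<Rightarrow> (nat \<Rightarrow> 'n \<Rightarrow> 'n) \<Rightarrow> nat \<Rightarrow> ('r, 'n) module" where
  "res_syzygy P d n = (P n)\<lparr>carrier := d n ` carrier (P (Suc n))\<rparr>"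

context
  fixes R :: "('r, 'y) ring_scheme" and M :: "('r, 'm) module" and P :: "nat \<Rightarrow> ('r, 'n) module" and d e
  assumes res: "proj_resolution R M P d e"
begin

lemma res_projective: "projective R (P n)"
  and res_hom: "d n \<in> mod_hom R (P (Suc n)) (P n)"
  and res_presents: "presents R (P 0) e M"
  and res_exact0: "d 0 ` carrier (P (Suc 0)) = {x \<in> carrier (P 0). e x = \<zero>\<^bsub>M\<^esub>}"
  and res_exact: "d (Suc n) ` carrier (P (Suc (Suc n))) = {x \<in> carrier (P (Suc n)). d n x = \<zero>\<^bsub>P n\<^esub>}"
  using res by (auto simp: proj_resolution_def presents_def)

lemma res_syzygy_0: "syzygy_of R M (res_syzygy P d 0)"
  unfolding syzygy_of_def
  by (rule exI[of _ "P 0"], rule exI[of _ e])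
    (simp add: res_presents res_exact0 res_syzygy_def kernel_module_def)

lemma res_syzygy_presents: "presents R (P (Suc n)) (d n) (res_syzygy P d n)"
  using res_projective res_hom[of n] by (auto simp: presents_def res_syzygy_def mod_hom_def)

lemma res_syzygy_Suc: "syzygy_of R (res_syzygy P d n) (res_syzygy P d (Suc n))"
  unfolding syzygy_of_def
  by (rule exI[of _ "P (Suc n)"], rule exI[of _ "d n"])
    (simp add: res_syzygy_presents, simp add: res_syzygy_def kernel_module_def res_exact)

lemma res_two_presents_0: "two_presents R (P (Suc 0)) (d 0) (P 0) e M"
  using res_presents res_projective res_hom res_exact0 by (simp add: two_presents_def)

lemma res_two_presents:
  "two_presents R (P (Suc (Suc n))) (d (Suc n)) (P (Suc n)) (d n) (res_syzygy P d n)"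
  using res_syzygy_presents res_projective res_hom res_exact[of n]
  by (simp add: two_presents_def res_syzygy_def)

end

context fd_algebra
begin

lemma presentation_exists:
  assumes "fg_module R M"
  obtains P :: "('r, 'r univ) module" and p where "presents R P p M"
  using fg_free_cover[OF assms] unfolding presents_def by metis

lemma syzygy_of_fg:
  assumes "syzygy_of R M Y" "right_module R M"
  shows "fg_module R Y"
proof -
  obtain P p where "presents R P p M" "Y = kernel_module P p M"
    using assms(1) unfolding syzygy_of_def by (elim exE conjE)
  then show ?thesis using fg_kernel[OF presentsD(2) assms(2) presentsD(4)] by simp
qed

lemma resolution_exists:
  assumes "fg_module R M"
  obtains P :: "nat \<Rightarrow> ('r, 'r univ) module" and d e where "proj_resolution R M P d e"
proof -
  obtain P0 :: "('r, 'r univ) module" and e where P0: "presents R P0 e M"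
    using presentation_exists[OF assms] by blast
  define pc :: "('r, 'r univ) module \<Rightarrow> ('r, 'r univ) module \<times> ('r univ \<Rightarrow> 'r univ)"
    where "pc N = (SOME Pp. presents R (fst Pp) (snd Pp) N)" for N
  have pc: "presents R (fst (pc N)) (snd (pc N)) N" if "fg_module R N" for N
  proof -
    from presentation_exists[OF that]
    obtain P :: "('r, 'r univ) module" and p where "presents R P p N" by blast
    then have "\<exists>Pp :: ('r, 'r univ) module \<times> ('r univ \<Rightarrow> 'r univ). presents R (fst Pp) (snd Pp) N"
      by (intro exI[of _ "(P, p)"]) simp
    then show ?thesis unfolding pc_def by (rule someI_ex)
  qed
  define K where "K = rec_nat (kernel_module P0 e M)
    (\<lambda>_ N. kernel_module (fst (pc N)) (snd (pc N)) N)"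
  have K0: "K 0 = kernel_module P0 e M"
    and KS: "K (Suc n) = kernel_module (fst (pc (K n))) (snd (pc (K n))) (K n)" for n
    by (simp_all add: K_def)
  have fgK: "fg_module R (K n)" for n
  proof (induction n)
    case 0
    show ?case unfolding K0
      using presentsD[OF P0] assms by (intro fg_kernel) (auto intro: fg_right_module)
  next
    case (Suc n)
    show ?case unfolding KS
      using presentsD[OF pc[OF Suc]] Suc by (intro fg_kernel) (auto intro: fg_right_module)
  qed
  define P where "P n = (case n of 0 \<Rightarrow> P0 | Suc m \<Rightarrow> fst (pc (K m)))" for n
  define d where "d n = snd (pc (K n))" for n
  have KP: "K n = (P n)\<lparr>carrier := carrier (K n)\<rparr>" "carrier (K n) \<subseteq> carrier (P n)" for n
    by (cases n; simp add: K0 KS P_def kernel_module_def)+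
  have pres: "presents R (P (Suc n)) (d n) (K n)" for n
    using pc[OF fgK] by (simp add: P_def d_def)
  have zero: "\<zero>\<^bsub>K n\<^esub> = \<zero>\<^bsub>P n\<^esub>" for n by (subst KP(1)) simp
  have "proj_resolution R M P d e"
    unfolding proj_resolution_def
  proof (intro conjI allI)
    show "projective R (P i)" for i
      using P0 pres by (cases i) (auto simp: presents_def P_def)
    show "d i \<in> mod_hom R (P (Suc i)) (P i)" for i
      using presentsD(4)[OF pres[of i]] KP by (metis hom_codomainD)
    show "e \<in> mod_hom R (P 0) M" "e ` carrier (P 0) = carrier M"
      using P0 by (simp_all add: presents_def P_def)
    show "d 0 ` carrier (P 1) = {x \<in> carrier (P 0). e x = \<zero>\<^bsub>M\<^esub>}"
      using presentsD(5)[OF pres[of 0]] by (simp add: K0 carrier_kernel_module P_def)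
    show "d (Suc i) ` carrier (P (Suc (Suc i))) = {x \<in> carrier (P (Suc i)). d i x = \<zero>\<^bsub>P i\<^esub>}" for i
      using presentsD(5)[OF pres[of "Suc i"]]
      by (simp add: KS carrier_kernel_module zero) (simp add: P_def d_def)
  qed
  then show thesis by (rule that)
qed

end

section \<open>Stable equivalence\<close>

text \<open>
  A homomorphism is null if it lifts along every epimorphism onto its target; equivalently, it
  factors through a projective module. Two modules are stably equivalent if they are connected by
  homomorphisms that are mutually inverse up to null maps.
\<close>

definition null_map :: "('k, 'r) module \<Rightarrow> ('r, 'm) module \<Rightarrow> ('r, 'n) module \<Rightarrow> ('m \<Rightarrow> 'n) \<Rightarrow> bool" where
  "null_map R Z W h \<longleftrightarrow> h \<in> mod_hom R Z W \<and>
     (\<forall>(E :: ('r, 'r univ) module) g. fg_module R E \<and> g \<in> mod_hom R E W \<and> g ` carrier E = carrier W \<longrightarrow>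
        (\<exists>k\<in>mod_hom R Z E. \<forall>x\<in>carrier Z. g (k x) = h x))"

definition stably_inverse ::
  "('k, 'r) module \<Rightarrow> ('r, 'm) module \<Rightarrow> ('r, 'n) module \<Rightarrow> ('m \<Rightarrow> 'n) \<Rightarrow> ('n \<Rightarrow> 'm) \<Rightarrow> bool" where
  "stably_inverse R Z W a b \<longleftrightarrow> a \<in> mod_hom R Z W \<and> b \<in> mod_hom R W Z \<and>
     (\<exists>h. null_map R Z Z h \<and> (\<forall>x\<in>carrier Z. b (a x) = x \<oplus>\<^bsub>Z\<^esub> h x))"

definition stably_equivalent :: "('k, 'r) module \<Rightarrow> ('r, 'm) module \<Rightarrow> ('r, 'n) module \<Rightarrow> bool" where
  "stably_equivalent R Z W \<longleftrightarrow> (\<exists>a b. stably_inverse R Z W a b \<and> stably_inverse R W Z b a)"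

lemma null_map_hom: "null_map R Z W h \<Longrightarrow> h \<in> mod_hom R Z W"
  by (simp add: null_map_def)

lemma stably_inverseE:
  assumes "stably_inverse R Z W a b"
  obtains h where "a \<in> mod_hom R Z W" "b \<in> mod_hom R W Z" "null_map R Z Z h"
    "\<And>x. x \<in> carrier Z \<Longrightarrow> b (a x) = x \<oplus>\<^bsub>Z\<^esub> h x"
  using assms unfolding stably_inverse_def by (elim conjE exE) simp

lemma stably_equivalent_sym: "stably_equivalent R Z W \<Longrightarrow> stably_equivalent R W Z"
  unfolding stably_equivalent_def by (elim exE conjE) (intro exI conjI)

context fd_algebra
begin

lemma null_map_through_projective:
  assumes "projective R P" "fg_module R W" "right_module R Z"
    and k: "k \<in> mod_hom R Z P" and p: "p \<in> mod_hom R P W"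
  shows "null_map R Z W (compose (carrier Z) p k)"
  unfolding null_map_def
proof (intro conjI allI impI hom_comp[OF assms(3) k p])
  fix E :: "('r, 'r univ) module" and g
  assume E: "fg_module R E \<and> g \<in> mod_hom R E W \<and> g ` carrier E = carrier W"
  then obtain q where q: "q \<in> mod_hom R P E" "\<And>x. x \<in> carrier P \<Longrightarrow> g (q x) = p x"
    using projective_lift[OF assms(1) _ assms(2) _ _ p] by metis
  show "\<exists>k'\<in>mod_hom R Z E. \<forall>x\<in>carrier Z. g (k' x) = compose (carrier Z) p k x"
    by (rule bexI[OF _ hom_comp[OF assms(3) k q(1)]]) (simp add: compose_eq q(2) hom_closed[OF k])
qed

lemma null_map_factor:
  assumes "null_map R Z W h" "fg_module R W"
  obtains P :: "('r, 'r univ) module" and p k where "presents R P p W" "k \<in> mod_hom R Z P"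
    "\<And>x. x \<in> carrier Z \<Longrightarrow> p (k x) = h x"
proof -
  obtain P :: "('r, 'r univ) module" and p where P: "presents R P p W"
    using presentation_exists[OF assms(2)] by blast
  have "\<exists>k\<in>mod_hom R Z P. \<forall>x\<in>carrier Z. p (k x) = h x"
    using assms(1) presentsD(2,4,5)[OF P] unfolding null_map_def by (elim conjE allE[of _ P] allE[of _ p]) simp
  then show thesis using that[OF P] by auto
qed

lemma null_map_lift:
  assumes "null_map R Z W h" "right_module R Z" "fg_module R W" "fg_module R E"
    and g: "g \<in> mod_hom R E W" "g ` carrier E = carrier W"
  obtains k where "k \<in> mod_hom R Z E" "\<And>x. x \<in> carrier Z \<Longrightarrow> g (k x) = h x"
proof -
  obtain P :: "('r, 'r univ) module" and p k where P: "presents R P p W" "k \<in> mod_hom R Z P"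
    "\<And>x. x \<in> carrier Z \<Longrightarrow> p (k x) = h x"
    using null_map_factor[OF assms(1,3)] by metis
  obtain q where q: "q \<in> mod_hom R P E" "\<And>x. x \<in> carrier P \<Longrightarrow> g (q x) = p x"
    using projective_lift[OF presentsD(1)[OF P(1)] assms(4,3) g presentsD(4)[OF P(1)]] by metis
  show thesis
    by (rule that[OF hom_comp[OF assms(2) P(2) q(1)]])
      (simp add: compose_eq q(2) hom_closed[OF P(2)] P(3))
qed

lemma null_map_cong:
  assumes "null_map R Z W h" "h' \<in> mod_hom R Z W" "\<And>x. x \<in> carrier Z \<Longrightarrow> h' x = h x"
  shows "null_map R Z W h'"
  using assms(1) mod_hom_eqI[OF null_map_hom[OF assms(1)] assms(2)] assms(3) by simp

lemma null_map_comp: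
  assumes "null_map R Z W h" "right_module R Y" "right_module R Z" "fg_module R W" "fg_module R V"
    and f: "f \<in> mod_hom R Y Z" and g: "g \<in> mod_hom R W V"
  shows "null_map R Y V (compose (carrier Y) g (compose (carrier Y) h f))"
proof -
  obtain P :: "('r, 'r univ) module" and p k where P: "presents R P p W" "k \<in> mod_hom R Z P"
    "\<And>x. x \<in> carrier Z \<Longrightarrow> p (k x) = h x"
    using null_map_factor[OF assms(1,4)] by metis
  have "null_map R Y V (compose (carrier Y) (compose (carrier P) g p) (compose (carrier Y) k f))"
    by (rule null_map_through_projective[OF presentsD(1)[OF P(1)] assms(5,2)
          hom_comp[OF assms(2) f P(2)] hom_comp[OF presentsD(3)[OF P(1)] presentsD(4)[OF P(1)] g]])
  then show ?thesis
    by (rule null_map_cong[OF _ hom_comp[OF assms(2) hom_comp[OF assms(2) f null_map_hom[OF assms(1)]] g]])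
      (simp add: compose_eq hom_closed[OF P(2)] hom_closed[OF f] P(3))
qed

lemma null_map_sum:
  assumes "null_map R Z W h" "null_map R Z W h'" "right_module R Z" "right_module R W"
  shows "null_map R Z W (\<lambda>x\<in>carrier Z. h x \<oplus>\<^bsub>W\<^esub> h' x)"
  unfolding null_map_def
proof (intro conjI allI impI hom_sum assms null_map_hom[OF assms(1)] null_map_hom[OF assms(2)])
  fix E :: "('r, 'r univ) module" and g
  assume E: "fg_module R E \<and> g \<in> mod_hom R E W \<and> g ` carrier E = carrier W"
  have "\<exists>k\<in>mod_hom R Z E. \<forall>x\<in>carrier Z. g (k x) = h x"
    using assms(1) E unfolding null_map_def by (elim conjE allE[of _ E] allE[of _ g]) simp
  then obtain k where k: "k \<in> mod_hom R Z E" "\<forall>x\<in>carrier Z. g (k x) = h x" by blast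
  have "\<exists>k\<in>mod_hom R Z E. \<forall>x\<in>carrier Z. g (k x) = h' x"
    using assms(2) E unfolding null_map_def by (elim conjE allE[of _ E] allE[of _ g]) simp
  then obtain k' where k': "k' \<in> mod_hom R Z E" "\<forall>x\<in>carrier Z. g (k' x) = h' x" by blast
  have "(\<lambda>x\<in>carrier Z. k x \<oplus>\<^bsub>E\<^esub> k' x) \<in> mod_hom R Z E"
    by (rule hom_sum[OF assms(3) _ k(1) k'(1)]) (use E fg_right_module in blast)
  moreover have "\<forall>x\<in>carrier Z. g ((\<lambda>x\<in>carrier Z. k x \<oplus>\<^bsub>E\<^esub> k' x) x) = (\<lambda>x\<in>carrier Z. h x \<oplus>\<^bsub>W\<^esub> h' x) x"
  proof -
    have "g \<in> mod_hom R E W" using E by simp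
    then show ?thesis
      using k k' hom_closed[OF k(1)] hom_closed[OF k'(1)] by (simp add: hom_add[where f = g and R = R])
  qed
  ultimately show "\<exists>k\<in>mod_hom R Z E. \<forall>x\<in>carrier Z. g (k x) = (\<lambda>x\<in>carrier Z. h x \<oplus>\<^bsub>W\<^esub> h' x) x"
    by (intro bexI)
qed

lemma null_map_zero:
  assumes "right_module R Z" "fg_module R W"
  shows "null_map R Z W (\<lambda>x\<in>carrier Z. \<zero>\<^bsub>W\<^esub>)"
  unfolding null_map_def
proof (intro conjI allI impI hom_zero_map assms fg_right_module[OF assms(2)])
  fix E :: "('r, 'r univ) module" and g
  assume E: "fg_module R E \<and> g \<in> mod_hom R E W \<and> g ` carrier E = carrier W"
  then have E': "right_module R E" by (simp add: fg_right_module)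
  show "\<exists>k\<in>mod_hom R Z E. \<forall>x\<in>carrier Z. g (k x) = (\<lambda>x\<in>carrier Z. \<zero>\<^bsub>W\<^esub>) x"
    by (rule bexI[OF _ hom_zero_map[OF assms(1) E']])
      (use E hom_zero[OF E' fg_right_module[OF assms(2)]] in simp)
qed

lemma stably_inverse_iso:
  assumes "fg_module R Z" "a \<in> mod_hom R Z W" "b \<in> mod_hom R W Z" "\<And>x. x \<in> carrier Z \<Longrightarrow> b (a x) = x"
  shows "stably_inverse R Z W a b"
proof -
  have Z: "right_module R Z" using assms(1) by (rule fg_right_module)
  interpret Z: right_module R Z by fact
  show ?thesis
    unfolding stably_inverse_def
    by (intro conjI assms exI[of _ "\<lambda>x\<in>carrier Z. \<zero>\<^bsub>Z\<^esub>"] null_map_zero Z) (simp add: assms(4))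
qed

lemma stably_equivalent_iso:
  assumes "fg_module R Z" "right_module R W" "mod_isomorphic R Z W"
  shows "stably_equivalent R Z W"
proof -
  have W: "fg_module R W" by (rule fg_iso[OF assms])
  obtain a where a: "a \<in> mod_hom R Z W" "bij_betw a (carrier Z) (carrier W)"
    using assms(3) unfolding mod_isomorphic_def by blast
  obtain b where "b \<in> mod_hom R W Z" "\<And>x. x \<in> carrier Z \<Longrightarrow> b (a x) = x"
    "\<And>y. y \<in> carrier W \<Longrightarrow> a (b y) = y"
    using iso_inverse[OF fg_right_module[OF assms(1)] assms(2) a] by metis
  then show ?thesis
    unfolding stably_equivalent_def
    using stably_inverse_iso[OF assms(1) a(1)] stably_inverse_iso[OF W _ a(1)] by blast
qed

lemma stably_equivalent_refl: "fg_module R Z \<Longrightarrow> stably_equivalent R Z Z"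
  by (rule stably_equivalent_iso) (auto intro: mod_isomorphic_refl fg_right_module)

lemma stably_inverse_trans:
  assumes "fg_module R Z" "fg_module R W" "fg_module R V"
    and "stably_inverse R Z W a b" "stably_inverse R W V a' b'"
  shows "stably_inverse R Z V (compose (carrier Z) a' a) (compose (carrier V) b b')"
proof -
  have rm: "right_module R Z" "right_module R W" "right_module R V"
    using assms(1-3) by (auto intro: fg_right_module)
  interpret Z: right_module R Z by fact
  obtain h where h: "a \<in> mod_hom R Z W" "b \<in> mod_hom R W Z" "null_map R Z Z h"
    "\<And>x. x \<in> carrier Z \<Longrightarrow> b (a x) = x \<oplus>\<^bsub>Z\<^esub> h x"
    using stably_inverseE[OF assms(4)] by metis
  obtain h' where h': "a' \<in> mod_hom R W V" "b' \<in> mod_hom R V W" "null_map R W W h'"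
    "\<And>x. x \<in> carrier W \<Longrightarrow> b' (a' x) = x \<oplus>\<^bsub>W\<^esub> h' x"
    using stably_inverseE[OF assms(5)] by metis
  let ?l = "compose (carrier Z) b (compose (carrier Z) h' a)"
  have l: "null_map R Z Z ?l" by (rule null_map_comp[OF h'(3) rm(1,2) assms(2,1) h(1,2)])
  show ?thesis
    unfolding stably_inverse_def
  proof (intro conjI exI ballI)
    show "null_map R Z Z (\<lambda>x\<in>carrier Z. h x \<oplus>\<^bsub>Z\<^esub> ?l x)" by (rule null_map_sum[OF h(3) l rm(1,1)])
    fix x assume x: "x \<in> carrier Z"
    have ax: "a x \<in> carrier W" "h' (a x) \<in> carrier W"
      using hom_closed[OF h(1) x] hom_closed[OF null_map_hom[OF h'(3)]] by auto
    have "compose (carrier V) b b' (compose (carrier Z) a' a x) = b (b' (a' (a x)))"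
      using x ax hom_closed[OF h'(1)] by (simp add: compose_eq)
    also have "\<dots> = x \<oplus>\<^bsub>Z\<^esub> h x \<oplus>\<^bsub>Z\<^esub> b (h' (a x))"
      using ax x by (simp add: h'(4) hom_add[OF h(2)] h(4))
    also have "\<dots> = x \<oplus>\<^bsub>Z\<^esub> (\<lambda>x\<in>carrier Z. h x \<oplus>\<^bsub>Z\<^esub> ?l x) x"
      using x ax hom_closed[OF h(2)] hom_closed[OF null_map_hom[OF h(3)] x]
      by (simp add: compose_eq Z.M.a_assoc)
    finally show "compose (carrier V) b b' (compose (carrier Z) a' a x) =
      x \<oplus>\<^bsub>Z\<^esub> (\<lambda>x\<in>carrier Z. h x \<oplus>\<^bsub>Z\<^esub> ?l x) x" .
  qed (rule hom_comp[OF rm(1) h(1) h'(1)], rule hom_comp[OF rm(3) h'(2) h(2)])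
qed

lemma stably_equivalent_trans:
  assumes "fg_module R Z" "fg_module R W" "fg_module R V"
    and "stably_equivalent R Z W" "stably_equivalent R W V"
  shows "stably_equivalent R Z V"
proof -
  obtain a b where ab: "stably_inverse R Z W a b" "stably_inverse R W Z b a"
    using assms(4) unfolding stably_equivalent_def by blast
  obtain a' b' where ab': "stably_inverse R W V a' b'" "stably_inverse R V W b' a'"
    using assms(5) unfolding stably_equivalent_def by blast
  show ?thesis
    unfolding stably_equivalent_def
    using stably_inverse_trans[OF assms(1,2,3) ab(1) ab'(1)]
      stably_inverse_trans[OF assms(3,2,1) ab'(2) ab(2)] by blast
qed

text \<open>
  Every endomorphism of a projective module is null, so zero maps are stably inverse to each
  other.
\<close>

lemma stably_equivalent_projective:
  assumes "projective R P" "projective R P'"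
  shows "stably_equivalent R P P'"
proof -
  have inv: "stably_inverse R P P' (\<lambda>x\<in>carrier P. \<zero>\<^bsub>P'\<^esub>) (\<lambda>x\<in>carrier P'. \<zero>\<^bsub>P\<^esub>)"
    if "projective R P" "projective R P'" for P :: "('r, 'p) module" and P' :: "('r, 'q) module"
  proof -
    have rm: "right_module R P" "right_module R P'" and fg: "fg_module R P"
      using that by (auto intro: fg_right_module projective_fg)
    interpret P: right_module R P by fact
    interpret P': right_module R P' by fact
    let ?h = "\<lambda>x\<in>carrier P. \<ominus>\<^bsub>P\<^esub> (\<lambda>x\<in>carrier P. x) x"
    have h: "?h \<in> mod_hom R P P" by (rule hom_neg[OF rm(1,1) hom_id[OF rm(1)]])
    have "null_map R P P (compose (carrier P) ?h (\<lambda>x\<in>carrier P. x))"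
      by (rule null_map_through_projective[OF that(1) fg rm(1) hom_id[OF rm(1)] h])
    then have "null_map R P P ?h" by (rule null_map_cong[OF _ h]) (simp add: compose_eq)
    then show ?thesis
      unfolding stably_inverse_def
      by (intro conjI hom_zero_map rm exI[of _ ?h]) (simp_all add: P.M.r_neg)
  qed
  show ?thesis
    unfolding stably_equivalent_def using inv[OF assms] inv[OF assms(2,1)] by blast
qed

lemma lift_to_presentations:
  assumes "presents R P p Z" "presents R P' p' Z'" "fg_module R Z'" "a \<in> mod_hom R Z Z'"
  obtains a0 where "a0 \<in> mod_hom R P P'" "\<And>x. x \<in> carrier P \<Longrightarrow> p' (a0 x) = a (p x)"
proof -
  note P = presentsD[OF assms(1)] and P' = presentsD[OF assms(2)]
  obtain a0 where "a0 \<in> mod_hom R P P'" "\<And>x. x \<in> carrier P \<Longrightarrow> p' (a0 x) = compose (carrier P) a p x"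
    using projective_lift[OF P(1) P'(2) assms(3) P'(4,5) hom_comp[OF P(3,4) assms(4)]] by metis
  then show thesis using that by (simp add: compose_eq)
qed

text \<open>
  Since \<open>ba = 1 + h\<close> with \<open>h = pk\<close>, the map \<open>u = b\<^sub>0a\<^sub>0 - 1 - kp\<close> has its image in the kernel of
  \<open>p\<close>. Both error terms are harmless: \<open>kp\<close> vanishes on the kernel of \<open>p\<close>, and \<open>u\<close>, which is
  defined on all of \<open>P\<close>, restricts to a null map on that kernel and changes cocycles only by
  coboundaries.
\<close>

lemma lifted_stable_inverse:
  assumes pres: "presents R P p Z" "presents R P' p' Z'" and fg: "fg_module R Z" "fg_module R Z'"
    and inv: "stably_inverse R Z Z' a b"
    and a0: "a0 \<in> mod_hom R P P'" "\<And>x. x \<in> carrier P \<Longrightarrow> p' (a0 x) = a (p x)"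
    and b0: "b0 \<in> mod_hom R P' P" "\<And>x. x \<in> carrier P' \<Longrightarrow> p (b0 x) = b (p' x)"
  obtains k u where "k \<in> mod_hom R Z P" "u \<in> mod_hom R P (kernel_module P p Z)"
    "\<And>x. x \<in> carrier P \<Longrightarrow> b0 (a0 x) = x \<oplus>\<^bsub>P\<^esub> (k (p x) \<oplus>\<^bsub>P\<^esub> u x)"
proof -
  note P = presentsD[OF pres(1)] and P' = presentsD[OF pres(2)]
  have Z: "right_module R Z" using fg(1) by (rule fg_right_module)
  interpret P: right_module R P by (rule P)
  interpret Z: right_module R Z by (rule Z)
  obtain h where h: "a \<in> mod_hom R Z Z'" "b \<in> mod_hom R Z' Z" "null_map R Z Z h"
    "\<And>x. x \<in> carrier Z \<Longrightarrow> b (a x) = x \<oplus>\<^bsub>Z\<^esub> h x"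
    using stably_inverseE[OF inv] by metis
  obtain k where k: "k \<in> mod_hom R Z P" "\<And>x. x \<in> carrier Z \<Longrightarrow> p (k x) = h x"
    using null_map_lift[OF h(3) Z fg(1) P(2,4,5)] by metis
  let ?v = "\<lambda>x\<in>carrier P. x \<oplus>\<^bsub>P\<^esub> k (p x)"
  let ?u = "\<lambda>x\<in>carrier P. compose (carrier P) b0 a0 x \<ominus>\<^bsub>P\<^esub> ?v x"
  have v: "?v \<in> mod_hom R P P"
    using hom_sum[OF P(3,3) hom_id[OF P(3)] hom_comp[OF P(3,4) k(1)]]
    by (rule back_subst[of "\<lambda>f. f \<in> mod_hom R P P"]) (auto simp: compose_eq fun_eq_iff)
  have u: "?u \<in> mod_hom R P P"
    by (rule hom_diff[OF P(3,3) hom_comp[OF P(3) a0(1) b0(1)] v])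
  note cl = hom_closed[OF a0(1)] hom_closed[OF b0(1)] hom_closed[OF k(1)] hom_closed[OF P(4)]
    hom_closed[OF null_map_hom[OF h(3)]]
  have "p (?u x) = \<zero>\<^bsub>Z\<^esub>" if x: "x \<in> carrier P" for x
  proof -
    have "p (?u x) = p (b0 (a0 x)) \<oplus>\<^bsub>Z\<^esub> \<ominus>\<^bsub>Z\<^esub> p (x \<oplus>\<^bsub>P\<^esub> k (p x))"
      using x cl by (simp add: a_minus_def compose_eq hom_add[OF P(4)] hom_minus[OF P(3) Z P(4)])
    also have "p (b0 (a0 x)) = p x \<oplus>\<^bsub>Z\<^esub> h (p x)" using x cl by (simp add: b0(2) a0(2) h(4))
    also have "p (x \<oplus>\<^bsub>P\<^esub> k (p x)) = p x \<oplus>\<^bsub>Z\<^esub> h (p x)"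
      using x cl by (simp add: hom_add[OF P(4)] k(2))
    also have "(p x \<oplus>\<^bsub>Z\<^esub> h (p x)) \<oplus>\<^bsub>Z\<^esub> \<ominus>\<^bsub>Z\<^esub> (p x \<oplus>\<^bsub>Z\<^esub> h (p x)) = \<zero>\<^bsub>Z\<^esub>"
      by (rule Z.M.r_neg) (use x cl in simp)
    finally show ?thesis .
  qed
  then have "?u \<in> mod_hom R P (kernel_module P p Z)"
    unfolding kernel_module_def using hom_closed[OF u] by (intro hom_codomain[OF u]) blast
  moreover have "b0 (a0 x) = x \<oplus>\<^bsub>P\<^esub> (k (p x) \<oplus>\<^bsub>P\<^esub> ?u x)" if x: "x \<in> carrier P" for x
  proof -
    define y where "y = x \<oplus>\<^bsub>P\<^esub> k (p x)"
    have y: "y \<in> carrier P" unfolding y_def using x cl by simp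
    have z: "b0 (a0 x) \<in> carrier P" using x cl by simp
    have ux: "?u x = b0 (a0 x) \<oplus>\<^bsub>P\<^esub> \<ominus>\<^bsub>P\<^esub> y" using x by (simp add: y_def a_minus_def compose_eq)
    have "x \<oplus>\<^bsub>P\<^esub> (k (p x) \<oplus>\<^bsub>P\<^esub> ?u x) = y \<oplus>\<^bsub>P\<^esub> (b0 (a0 x) \<oplus>\<^bsub>P\<^esub> \<ominus>\<^bsub>P\<^esub> y)"
      unfolding ux using x cl y z by (simp add: y_def[symmetric] P.M.a_assoc[symmetric])
    also have "\<dots> = b0 (a0 x)"
      using y z by (metis P.M.a_comm P.M.a_inv_closed P.M.a_lcomm P.M.r_neg P.M.r_zero)
    finally show ?thesis by (rule sym)
  qed
  ultimately show thesis by (rule that[OF k(1)])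
qed

lemma restrict_to_kernel:
  assumes "right_module R P" "right_module R Z" "right_module R Z'" "right_module R P'"
    and p: "p \<in> mod_hom R P Z" and p': "p' \<in> mod_hom R P' Z'"
    and a: "a \<in> mod_hom R Z Z'"
    and a0: "a0 \<in> mod_hom R P P'" "\<And>x. x \<in> carrier P \<Longrightarrow> p' (a0 x) = a (p x)"
  shows "restrict a0 (carrier (kernel_module P p Z)) \<in> mod_hom R (kernel_module P p Z) (kernel_module P' p' Z')"
proof -
  note sub = kernel_submodule[OF assms(1,2) p]
  have "restrict a0 {x \<in> carrier P. p x = \<zero>\<^bsub>Z\<^esub>} \<in> mod_hom R (kernel_module P p Z) P'"
    unfolding kernel_module_def by (rule hom_restrict_domain[OF sub a0(1)])
  then show ?thesis
    unfolding kernel_module_def[of P'] carrier_kernel_module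
    by (rule hom_codomain)
      (simp add: carrier_kernel_module a0(2) hom_closed[OF a0(1)] hom_zero[OF assms(2,3) a])
qed

text \<open>
  Schanuel's lemma in stable form. Lifts of mutually inverse stable maps restrict to the syzygies,
  where only the error term \<open>u\<close> is left, and it factors through the projective module \<open>P\<close>.
\<close>

theorem stably_equivalent_syzygy:
  assumes "syzygy_of R Z Y" "syzygy_of R Z' Y'" "fg_module R Z" "fg_module R Z'"
    and "stably_equivalent R Z Z'"
  shows "stably_equivalent R Y Y'"
proof -
  obtain P p where P: "presents R P p Z" and Y: "Y = kernel_module P p Z"
    using assms(1) unfolding syzygy_of_def by blast
  obtain P' p' where P': "presents R P' p' Z'" and Y': "Y' = kernel_module P' p' Z'"
    using assms(2) unfolding syzygy_of_def by blast
  obtain a b where inv: "stably_inverse R Z Z' a b" "stably_inverse R Z' Z b a"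
    using assms(5) unfolding stably_equivalent_def by blast
  have ab: "a \<in> mod_hom R Z Z'" "b \<in> mod_hom R Z' Z" using inv by (auto simp: stably_inverse_def)
  obtain a0 where a0: "a0 \<in> mod_hom R P P'" "\<And>x. x \<in> carrier P \<Longrightarrow> p' (a0 x) = a (p x)"
    using lift_to_presentations[OF P P' assms(4) ab(1)] by metis
  obtain b0 where b0: "b0 \<in> mod_hom R P' P" "\<And>x. x \<in> carrier P' \<Longrightarrow> p (b0 x) = b (p' x)"
    using lift_to_presentations[OF P' P assms(3) ab(2)] by metis
  have half: "stably_inverse R (kernel_module P p Z) (kernel_module P' p' Z')
      (restrict a0 (carrier (kernel_module P p Z))) (restrict b0 (carrier (kernel_module P' p' Z')))"
    if P: "presents R P p Z" and P': "presents R P' p' Z'" and fg: "fg_module R Z" "fg_module R Z'"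
      and inv: "stably_inverse R Z Z' a b" and ab: "a \<in> mod_hom R Z Z'" "b \<in> mod_hom R Z' Z"
      and a0: "a0 \<in> mod_hom R P P'" "\<And>x. x \<in> carrier P \<Longrightarrow> p' (a0 x) = a (p x)"
      and b0: "b0 \<in> mod_hom R P' P" "\<And>x. x \<in> carrier P' \<Longrightarrow> p (b0 x) = b (p' x)"
    for P :: "('r, 'p) module" and p and Z :: "('r, 'z) module" and P' :: "('r, 'p2) module" and p'
      and Z' :: "('r, 'z2) module" and a b a0 b0
  proof -
    let ?K = "kernel_module P p Z" and ?K' = "kernel_module P' p' Z'"
    note P1 = presentsD[OF P] and P1' = presentsD[OF P']
    have rm: "right_module R Z" "right_module R Z'" using fg by (auto intro: fg_right_module)
    interpret P: right_module R P by (rule P1)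
    have fgK: "fg_module R ?K" by (rule fg_kernel[OF P1(2) rm(1) P1(4)])
    have K: "right_module R ?K" by (rule fg_right_module[OF fgK])
    obtain k u where ku: "k \<in> mod_hom R Z P" "u \<in> mod_hom R P ?K"
      "\<And>x. x \<in> carrier P \<Longrightarrow> b0 (a0 x) = x \<oplus>\<^bsub>P\<^esub> (k (p x) \<oplus>\<^bsub>P\<^esub> u x)"
      using lifted_stable_inverse[OF P P' fg inv a0 b0] by metis
    have i: "(\<lambda>x\<in>carrier ?K. x) \<in> mod_hom R ?K P"
      using hom_incl[OF P1(3) kernel_submodule[OF P1(3) rm(1) P1(4)]]
      by (simp add: kernel_module_def)
    have aK: "restrict a0 (carrier ?K) \<in> mod_hom R ?K ?K'"
      by (rule restrict_to_kernel[OF P1(3) rm P1'(3) P1(4) P1'(4) ab(1) a0])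
    show ?thesis
      unfolding stably_inverse_def
    proof (intro conjI exI ballI)
      show "null_map R ?K ?K (compose (carrier ?K) u (\<lambda>x\<in>carrier ?K. x))"
        by (rule null_map_through_projective[OF P1(1) fgK K i ku(2)])
      show "restrict b0 (carrier ?K') \<in> mod_hom R ?K' ?K"
        by (rule restrict_to_kernel[OF P1'(3) rm(2,1) P1(3) P1'(4) P1(4) ab(2) b0])
      fix x assume x: "x \<in> carrier ?K"
      then have xP: "x \<in> carrier P" "p x = \<zero>\<^bsub>Z\<^esub>" by (auto simp: carrier_kernel_module)
      have "u x \<in> carrier P" using hom_closed[OF ku(2) xP(1)] by (simp add: carrier_kernel_module)
      then have "b0 (a0 x) = x \<oplus>\<^bsub>P\<^esub> u x"
        using xP by (simp add: ku(3) hom_zero[OF rm(1) P1(3) ku(1)])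
      then show "restrict b0 (carrier ?K') (restrict a0 (carrier ?K) x) =
          x \<oplus>\<^bsub>?K\<^esub> compose (carrier ?K) u (\<lambda>x\<in>carrier ?K. x) x"
        using x hom_closed[OF aK x] by (simp add: compose_eq) (simp add: kernel_module_def)
    qed (rule aK)
  qed
  show ?thesis
    unfolding stably_equivalent_def Y Y'
    using half[OF P P' assms(3,4) inv(1) ab a0 b0] half[OF P' P assms(4,3) inv(2) ab(2,1) b0 a0]
    by blast
qed

end

section \<open>Ext from two steps of a resolution\<close>

text \<open>
  The first Ext group of a module that is presented by two steps \<open>d : Q \<rightarrow> P\<close>: homomorphisms on \<open>Q\<close>
  that vanish on the kernel of \<open>d\<close>, modulo those that extend along \<open>d\<close>. Describing the cocycles by
  the kernel of \<open>d\<close> avoids a third projective module.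
\<close>

definition ext_cocycles ::
  "('k, 'r) module \<Rightarrow> ('r, 'q) module \<Rightarrow> ('q \<Rightarrow> 'p) \<Rightarrow> ('r, 'p) module \<Rightarrow> ('r, 'n) module \<Rightarrow> ('q \<Rightarrow> 'n) set" where
  "ext_cocycles R Q d P N = {f \<in> mod_hom R Q N. \<forall>x\<in>carrier Q. d x = \<zero>\<^bsub>P\<^esub> \<longrightarrow> f x = \<zero>\<^bsub>N\<^esub>}"

definition ext_coboundaries ::
  "('k, 'r) module \<Rightarrow> ('r, 'q) module \<Rightarrow> ('q \<Rightarrow> 'p) \<Rightarrow> ('r, 'p) module \<Rightarrow> ('r, 'n) module \<Rightarrow> ('q \<Rightarrow> 'n) set" where
  "ext_coboundaries R Q d P N = (\<lambda>g. compose (carrier Q) g d) ` mod_hom R P N"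

definition ext_space ::
  "('k, 'r) module \<Rightarrow> ('r, 'q) module \<Rightarrow> ('q \<Rightarrow> 'p) \<Rightarrow> ('r, 'p) module \<Rightarrow> ('r, 'n) module \<Rightarrow>
    ('k, 'q \<Rightarrow> 'n) module" where
  "ext_space R Q d P N = (hom_space R Q N)\<lparr>carrier := ext_cocycles R Q d P N\<rparr>"

definition ext_quot ::
  "('k, 'r) module \<Rightarrow> ('r, 'q) module \<Rightarrow> ('q \<Rightarrow> 'p) \<Rightarrow> ('r, 'p) module \<Rightarrow> ('r, 'n) module \<Rightarrow>
    ('k, ('q \<Rightarrow> 'n) set) module" where
  "ext_quot R Q d P N = quot_alg (ext_space R Q d P N) (ext_coboundaries R Q d P N)"

lemma ext_space_simps:
  shows "carrier (ext_space R Q d P N) = ext_cocycles R Q d P N"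
    and "\<zero>\<^bsub>ext_space R Q d P N\<^esub> = (\<lambda>x\<in>carrier Q. \<zero>\<^bsub>N\<^esub>)"
    and "f \<oplus>\<^bsub>ext_space R Q d P N\<^esub> g = (\<lambda>x\<in>carrier Q. f x \<oplus>\<^bsub>N\<^esub> g x)"
    and "c \<odot>\<^bsub>ext_space R Q d P N\<^esub> f = (\<lambda>x\<in>carrier Q. (c \<odot>\<^bsub>R\<^esub> \<one>\<^bsub>R\<^esub>) \<odot>\<^bsub>N\<^esub> f x)"
  by (simp_all add: ext_space_def hom_space_def)

lemma Ext_as_quotient:
  assumes "\<exists>(P :: nat \<Rightarrow> ('r, 'r univ) module) d e. proj_resolution R M P d e"
  obtains P :: "nat \<Rightarrow> ('r, 'r univ) module" and d e where "proj_resolution R M P d e"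
    "\<And>n. Ext R (Suc n) M N = ext_quot R (P (Suc n)) (d n) (P n) N"
proof -
  define Pd where "Pd = (SOME Pd :: (nat \<Rightarrow> ('r, 'r univ) module) \<times> (nat \<Rightarrow> 'r univ \<Rightarrow> 'r univ).
    case Pd of (P, d) \<Rightarrow> \<exists>e. proj_resolution R M P d e)"
  have "\<exists>Pd :: (nat \<Rightarrow> ('r, 'r univ) module) \<times> (nat \<Rightarrow> 'r univ \<Rightarrow> 'r univ).
    case Pd of (P, d) \<Rightarrow> \<exists>e. proj_resolution R M P d e" using assms by simp
  from someI_ex[OF this] have "case Pd of (P, d) \<Rightarrow> \<exists>e. proj_resolution R M P d e"
    unfolding Pd_def .
  then obtain P d e where Pd: "Pd = (P, d)" and res: "proj_resolution R M P d e"
    by (cases Pd) auto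
  have "Ext R (Suc n) M N = ext_quot R (P (Suc n)) (d n) (P n) N" for n
  proof -
    have im: "(\<forall>x\<in>carrier (P (Suc (Suc n))). f (d (Suc n) x) = \<zero>\<^bsub>N\<^esub>) \<longleftrightarrow>
      (\<forall>y\<in>carrier (P (Suc n)). d n y = \<zero>\<^bsub>P n\<^esub> \<longrightarrow> f y = \<zero>\<^bsub>N\<^esub>)" for f
    proof -
      have "(\<forall>x\<in>carrier (P (Suc (Suc n))). f (d (Suc n) x) = \<zero>\<^bsub>N\<^esub>) \<longleftrightarrow>
        (\<forall>y\<in>d (Suc n) ` carrier (P (Suc (Suc n))). f y = \<zero>\<^bsub>N\<^esub>)" by simp
      then show ?thesis unfolding res_exact[OF res] by blast
    qed
    have "Ext R (Suc n) M N = (let (P, d) = Pd in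
      quot_alg ((hom_space R (P (Suc n)) N)\<lparr>carrier :=
        {f \<in> mod_hom R (P (Suc n)) N. \<forall>x\<in>carrier (P (Suc (Suc n))). f (d (Suc n) x) = \<zero>\<^bsub>N\<^esub>}\<rparr>)
        ((\<lambda>g. compose (carrier (P (Suc n))) g (d n)) ` mod_hom R (P n) N))"
      by (simp only: Ext_def Pd_def Let_def nat.case)
    then show ?thesis
      by (simp add: Pd ext_quot_def ext_space_def ext_cocycles_def ext_coboundaries_def im)
  qed
  with res show thesis by (rule that)
qed

lemma two_presentsD:
  assumes "two_presents R Q d P p Z"
  shows "presents R P p Z" "projective R Q" "fg_module R Q" "right_module R Q" "d \<in> mod_hom R Q P"
    and "d ` carrier Q = {x \<in> carrier P. p x = \<zero>\<^bsub>Z\<^esub>}"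
  using assms by (auto simp: two_presents_def projective_fg fg_right_module)

context fd_algebra
begin

lemma right_module_hom_space:
  assumes Q: "right_module R Q" and N: "right_module R N"
  shows "right_module base_field (hom_space R Q N)"
proof -
  interpret Q: right_module R Q by fact
  interpret N: right_module R N by fact
  let ?V = "hom_space R Q N"
  have c: "carrier ?V = mod_hom R Q N" by (simp add: hom_space_def)
  note s = hom_space_def
  show ?thesis
  proof (rule right_moduleI)
    show "ring (base_field :: 'k ring)" by (rule ring_from_type_algebra)
    show "\<zero>\<^bsub>?V\<^esub> \<in> carrier ?V" using hom_zero_map[OF Q N] by (simp add: s)
    fix f g h and a b :: 'k
    assume "f \<in> carrier ?V"
    then have f: "f \<in> mod_hom R Q N" by (simp add: c)
    note [simp] = hom_closed[OF f]
    have fr: "(\<lambda>x\<in>carrier Q. f x) = f"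
      using hom_funcset[OF f] by (intro extensionalityI[of _ "carrier Q"]) (auto simp: PiE_def)
    show "\<zero>\<^bsub>?V\<^esub> \<oplus>\<^bsub>?V\<^esub> f = f"
      by (subst (2) fr[symmetric]) (simp add: s cong: restrict_cong)
    show "\<exists>g\<in>carrier ?V. g \<oplus>\<^bsub>?V\<^esub> f = \<zero>\<^bsub>?V\<^esub>"
      using hom_neg[OF Q N f]
      by (intro bexI[of _ "\<lambda>x\<in>carrier Q. \<ominus>\<^bsub>N\<^esub> f x"]) (auto simp: s N.M.l_neg cong: restrict_cong)
    show "a \<odot>\<^bsub>?V\<^esub> f \<in> carrier ?V"
    proof -
      have "(\<lambda>x\<in>carrier Q. scal a \<odot>\<^bsub>N\<^esub> f x) \<in> mod_hom R Q N"
        by (rule mod_homI)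
          (auto simp: hom_add[OF f] hom_act[OF f] N.act_add scal_act_comm[OF N])
      then show ?thesis by (simp add: s)
    qed
    show "(a \<oplus>\<^bsub>base_field\<^esub> b) \<odot>\<^bsub>?V\<^esub> f = a \<odot>\<^bsub>?V\<^esub> f \<oplus>\<^bsub>?V\<^esub> b \<odot>\<^bsub>?V\<^esub> f"
      by (simp add: s scal_add N.act_add_scalar cong: restrict_cong)
    show "(a \<otimes>\<^bsub>base_field\<^esub> b) \<odot>\<^bsub>?V\<^esub> f = b \<odot>\<^bsub>?V\<^esub> (a \<odot>\<^bsub>?V\<^esub> f)"
      by (simp add: s scal_prod N.act_mult cong: restrict_cong)
    show "\<one>\<^bsub>base_field\<^esub> \<odot>\<^bsub>?V\<^esub> f = f"
      by (subst (2) fr[symmetric]) (simp add: s N.act_one cong: restrict_cong)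
    assume "g \<in> carrier ?V"
    then have g: "g \<in> mod_hom R Q N" by (simp add: c)
    note [simp] = hom_closed[OF g]
    show "f \<oplus>\<^bsub>?V\<^esub> g \<in> carrier ?V" using hom_sum[OF Q N f g] by (simp add: s)
    show "f \<oplus>\<^bsub>?V\<^esub> g = g \<oplus>\<^bsub>?V\<^esub> f" by (simp add: s N.M.a_comm cong: restrict_cong)
    show "a \<odot>\<^bsub>?V\<^esub> (f \<oplus>\<^bsub>?V\<^esub> g) = a \<odot>\<^bsub>?V\<^esub> f \<oplus>\<^bsub>?V\<^esub> a \<odot>\<^bsub>?V\<^esub> g"
      by (simp add: s N.act_add cong: restrict_cong)
    assume "h \<in> carrier ?V"
    then have h: "h \<in> mod_hom R Q N" by (simp add: c)
    note [simp] = hom_closed[OF h]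
    show "f \<oplus>\<^bsub>?V\<^esub> g \<oplus>\<^bsub>?V\<^esub> h = f \<oplus>\<^bsub>?V\<^esub> (g \<oplus>\<^bsub>?V\<^esub> h)"
      by (simp add: s N.M.a_assoc cong: restrict_cong)
  qed
qed

lemma ext_space_module:
  assumes Q: "right_module R Q" and P: "right_module R P" and N: "right_module R N" and d: "d \<in> mod_hom R Q P"
  shows "module_quotient base_field (ext_space R Q d P N) (ext_coboundaries R Q d P N)"
proof -
  let ?V = "ext_space R Q d P N"
  let ?Z = "ext_cocycles R Q d P N"
  let ?B = "ext_coboundaries R Q d P N"
  interpret Q: right_module R Q by fact
  interpret P: right_module R P by fact
  interpret N: right_module R N by fact
  interpret H: right_module base_field "hom_space R Q N" by (rule right_module_hom_space[OF Q N])
  have "submodule (?Z) base_field (hom_space R Q N)"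
  proof (rule H.is_submoduleI)
    show "?Z \<subseteq> carrier (hom_space R Q N)"
      by (auto simp: ext_cocycles_def hom_space_def)
    show "\<zero>\<^bsub>hom_space R Q N\<^esub> \<in> ?Z"
      using hom_zero_map[OF Q N] by (simp add: ext_cocycles_def hom_space_def)
  next
    fix f g assume "f \<in> ?Z" "g \<in> ?Z"
    then show "f \<oplus>\<^bsub>hom_space R Q N\<^esub> g \<in> ?Z"
      using hom_sum[OF Q N, of f g] by (simp add: ext_cocycles_def hom_space_def)
  next
    fix c f assume f: "f \<in> ?Z"
    then have "c \<odot>\<^bsub>hom_space R Q N\<^esub> f \<in> carrier (hom_space R Q N)"
      by (intro H.act_closed) (simp_all add: ext_cocycles_def hom_space_def)
    with f show "c \<odot>\<^bsub>hom_space R Q N\<^esub> f \<in> ?Z"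
      by (simp add: ext_cocycles_def hom_space_def)
  qed
  then have V: "right_module base_field (?V)"
    unfolding ext_space_def by (rule right_module_submodule[OF H.right_module_axioms])
  interpret V: right_module base_field "?V" by fact
  interpret HP: right_module base_field "hom_space R P N" by (rule right_module_hom_space[OF P N])
  note dc = hom_closed[OF d]
  have "submodule (?B) base_field (?V)"
  proof (rule V.is_submoduleI)
    show "?B \<subseteq> carrier (?V)"
    proof
      fix f assume "f \<in> ?B"
      then obtain g where g: "g \<in> mod_hom R P N" "f = compose (carrier Q) g d"
        by (auto simp: ext_coboundaries_def)
      then show "f \<in> carrier (?V)"
        using hom_comp[OF Q d g(1)] hom_zero[OF P N g(1)]
        by (simp add: ext_space_simps ext_cocycles_def compose_eq)
    qed
    show "\<zero>\<^bsub>?V\<^esub> \<in> ?B"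
      unfolding ext_coboundaries_def
      by (rule image_eqI[OF _ hom_zero_map[OF P N]]) (simp add: ext_space_simps compose_def dc cong: restrict_cong)
  next
    fix f g assume "f \<in> ?B" "g \<in> ?B"
    then obtain f' g' where fg: "f' \<in> mod_hom R P N" "f = compose (carrier Q) f' d"
      "g' \<in> mod_hom R P N" "g = compose (carrier Q) g' d" by (auto simp: ext_coboundaries_def)
    show "f \<oplus>\<^bsub>?V\<^esub> g \<in> ?B"
      unfolding ext_coboundaries_def
      by (rule image_eqI[OF _ hom_sum[OF P N fg(1,3)]])
        (simp add: ext_space_simps compose_def dc fg(2,4) cong: restrict_cong)
  next
    fix c f assume "f \<in> ?B"
    then obtain f' where f: "f' \<in> mod_hom R P N" "f = compose (carrier Q) f' d"
      by (auto simp: ext_coboundaries_def)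
    have "c \<odot>\<^bsub>hom_space R P N\<^esub> f' \<in> carrier (hom_space R P N)"
      by (rule HP.act_closed) (simp_all add: f hom_space_def)
    then have "(\<lambda>x\<in>carrier P. scal c \<odot>\<^bsub>N\<^esub> f' x) \<in> mod_hom R P N" by (simp add: hom_space_def)
    then show "c \<odot>\<^bsub>?V\<^esub> f \<in> ?B"
      unfolding ext_coboundaries_def
      by (rule image_eqI[rotated]) (simp add: ext_space_simps compose_def dc f(2) cong: restrict_cong)
  qed
  with V show ?thesis by (simp add: module_quotient_def module_quotient_axioms_def)
qed

lemma ext_pullback:
  assumes Q: "right_module R Q" and N: "right_module R N" and P: "right_module R P"
    and Q': "right_module R Q'" and P': "right_module R P'"
    and d: "d \<in> mod_hom R Q P" and d': "d' \<in> mod_hom R Q' P'"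
    and a1: "a1 \<in> mod_hom R Q Q'" and a0: "a0 \<in> mod_hom R P P'"
    and comm: "\<And>x. x \<in> carrier Q \<Longrightarrow> d' (a1 x) = a0 (d x)"
  shows "(\<lambda>f\<in>ext_cocycles R Q' d' P' N. compose (carrier Q) f a1)
    \<in> mod_hom base_field (ext_space R Q' d' P' N) (ext_space R Q d P N)"
proof -
  let ?V = "ext_space R Q' d' P' N"
  let ?F = "\<lambda>f\<in>ext_cocycles R Q' d' P' N. compose (carrier Q) f a1"
  interpret E: module_quotient base_field "?V" "ext_coboundaries R Q' d' P' N"
    by (rule ext_space_module[OF Q' P' N d'])
  note closed = E.V.M.a_closed[unfolded ext_space_simps(1)] E.V.act_closed[unfolded ext_space_simps(1)]
  have c: "compose (carrier Q) f a1 \<in> ext_cocycles R Q d P N" if f: "f \<in> ext_cocycles R Q' d' P' N" for f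
  proof -
    have "compose (carrier Q) f a1 \<in> mod_hom R Q N"
      using f by (intro hom_comp[OF Q a1]) (simp add: ext_cocycles_def)
    moreover have "f (a1 x) = \<zero>\<^bsub>N\<^esub>" if "x \<in> carrier Q" "d x = \<zero>\<^bsub>P\<^esub>" for x
      using f that hom_closed[OF a1] comm hom_zero[OF P P' a0] by (simp add: ext_cocycles_def)
    ultimately show ?thesis by (simp add: ext_cocycles_def compose_eq)
  qed
  show ?thesis
  proof (rule mod_homI)
    show "(?F)
      \<in> carrier (?V) \<rightarrow>\<^sub>E carrier (ext_space R Q d P N)"
      using c by (auto simp: ext_space_simps)
  next
    fix f g assume fg: "f \<in> carrier (?V)" "g \<in> carrier (?V)"
    then show "(?F) (f \<oplus>\<^bsub>?V\<^esub> g) =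
      (?F) f \<oplus>\<^bsub>ext_space R Q d P N\<^esub>
      (?F) g"
      using E.V.M.a_closed[OF fg] hom_closed[OF a1]
      by (simp add: ext_space_simps compose_def cong: restrict_cong)
  next
    fix c f assume f: "f \<in> carrier (?V)"
    have "c \<odot>\<^bsub>?V\<^esub> f \<in> carrier (?V)"
      by (rule E.V.act_closed) (simp_all add: f)
    with f show "(?F) (c \<odot>\<^bsub>?V\<^esub> f) =
      c \<odot>\<^bsub>ext_space R Q d P N\<^esub> (?F) f"
      using hom_closed[OF a1]
      by (simp add: ext_space_simps compose_def cong: restrict_cong)
  qed
qed

lemma lift_second_step:
  assumes "two_presents R Q' d' P' p' Z'" "fg_module R Z'" "projective R Y"
    and f: "f \<in> mod_hom R Y P'" "\<And>y. y \<in> carrier Y \<Longrightarrow> p' (f y) = \<zero>\<^bsub>Z'\<^esub>"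
  obtains h where "h \<in> mod_hom R Y Q'" "\<And>y. y \<in> carrier Y \<Longrightarrow> d' (h y) = f y"
proof -
  note T = two_presentsD[OF assms(1)]
  note P' = presentsD[OF T(1)]
  have fgK: "fg_module R (kernel_module P' p' Z')"
    by (rule fg_kernel[OF P'(2) fg_right_module[OF assms(2)] P'(4)])
  have d': "d' \<in> mod_hom R Q' (kernel_module P' p' Z')"
    unfolding kernel_module_def
    using T(6) by (intro hom_codomain[OF T(5)]) auto
  have f': "f \<in> mod_hom R Y (kernel_module P' p' Z')"
    unfolding kernel_module_def
    using hom_closed[OF f(1)] f(2) by (intro hom_codomain[OF f(1)]) simp
  have "d' ` carrier Q' = carrier (kernel_module P' p' Z')" using T(6) by (simp add: carrier_kernel_module)
  from projective_lift[OF assms(3) T(3) fgK d' this f'] that show thesis by metis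
qed

text \<open>
  By the formula for \<open>b\<^sub>0a\<^sub>0\<close>, there is a map \<open>t\<close> such that \<open>b\<^sub>1a\<^sub>1\<close> and \<open>1 + td\<close> have the same
  composite with \<open>d\<close>. A cocycle \<open>f\<close> does not see the difference, and \<open>ft\<close> provides the coboundary.
\<close>

lemma ext_homotopy:
  assumes T: "two_presents R Q d P p Z" and P': "presents R P' p' Z'" and fg: "fg_module R Z" "fg_module R Z'"
    and Q': "right_module R Q'" and d': "d' \<in> mod_hom R Q' P'"
    and inv: "stably_inverse R Z Z' a b"
    and a0: "a0 \<in> mod_hom R P P'" "\<And>x. x \<in> carrier P \<Longrightarrow> p' (a0 x) = a (p x)"
    and b0: "b0 \<in> mod_hom R P' P" "\<And>x. x \<in> carrier P' \<Longrightarrow> p (b0 x) = b (p' x)"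
    and a1: "a1 \<in> mod_hom R Q Q'" "\<And>x. x \<in> carrier Q \<Longrightarrow> d' (a1 x) = a0 (d x)"
    and b1: "b1 \<in> mod_hom R Q' Q" "\<And>x. x \<in> carrier Q' \<Longrightarrow> d (b1 x) = b0 (d' x)"
    and N: "right_module R N" and f: "f \<in> ext_cocycles R Q d P N"
  obtains g where "g \<in> mod_hom R P N"
    "\<And>x. x \<in> carrier Q \<Longrightarrow> f (b1 (a1 x)) = f x \<oplus>\<^bsub>N\<^esub> g (d x)"
proof -
  note T1 = two_presentsD[OF T]
  note P1 = presentsD[OF T1(1)]
  have Z: "right_module R Z" using fg(1) by (rule fg_right_module)
  interpret P: right_module R P by (rule P1)
  interpret Q: right_module R Q by (rule T1)
  interpret N: right_module R N by (rule N)
  obtain k u where ku: "k \<in> mod_hom R Z P" "u \<in> mod_hom R P (kernel_module P p Z)"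
    "\<And>x. x \<in> carrier P \<Longrightarrow> b0 (a0 x) = x \<oplus>\<^bsub>P\<^esub> (k (p x) \<oplus>\<^bsub>P\<^esub> u x)"
    using lifted_stable_inverse[OF T1(1) P' fg inv a0 b0] by metis
  have u: "u \<in> mod_hom R P P" "\<And>x. x \<in> carrier P \<Longrightarrow> p (u x) = \<zero>\<^bsub>Z\<^esub>"
    using hom_codomainD[OF ku(2)[unfolded kernel_module_def]] hom_closed[OF ku(2)]
    by (auto simp: carrier_kernel_module)
  obtain t where t: "t \<in> mod_hom R P Q" "\<And>x. x \<in> carrier P \<Longrightarrow> d (t x) = u x"
    using lift_second_step[OF T fg(1) P1(1) u] by metis
  have f': "f \<in> mod_hom R Q N" "\<And>x. x \<in> carrier Q \<Longrightarrow> d x = \<zero>\<^bsub>P\<^esub> \<Longrightarrow> f x = \<zero>\<^bsub>N\<^esub>"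
    using f by (auto simp: ext_cocycles_def)
  note cl = hom_closed[OF a1(1)] hom_closed[OF b1(1)] hom_closed[OF t(1)] hom_closed[OF T1(5)]
    hom_closed[OF f'(1)] hom_closed[OF u(1)]
  have eq: "f (b1 (a1 x)) = f x \<oplus>\<^bsub>N\<^esub> f (t (d x))" if x: "x \<in> carrier Q" for x
  proof -
    have dx: "p (d x) = \<zero>\<^bsub>Z\<^esub>" using T1(6) x by auto
    have w: "b1 (a1 x) \<in> carrier Q" "x \<oplus>\<^bsub>Q\<^esub> t (d x) \<in> carrier Q" using x cl by auto
    have "d (b1 (a1 x)) = b0 (a0 (d x))" using x cl by (simp add: b1(2) a1(2))
    also have "\<dots> = d x \<oplus>\<^bsub>P\<^esub> u (d x)"
      using x cl by (simp add: ku(3) dx hom_zero[OF Z P1(3) ku(1)])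
    also have "\<dots> = d (x \<oplus>\<^bsub>Q\<^esub> t (d x))" using x cl by (simp add: hom_add[OF T1(5)] t(2))
    finally have "d (b1 (a1 x) \<oplus>\<^bsub>Q\<^esub> \<ominus>\<^bsub>Q\<^esub> (x \<oplus>\<^bsub>Q\<^esub> t (d x))) = \<zero>\<^bsub>P\<^esub>"
      using w cl(4)[OF w(2)]
      by (simp add: hom_add[OF T1(5)] hom_minus[OF T1(4) P1(3) T1(5)] P.M.r_neg del: Q.M.minus_add)
    then have "f (b1 (a1 x) \<oplus>\<^bsub>Q\<^esub> \<ominus>\<^bsub>Q\<^esub> (x \<oplus>\<^bsub>Q\<^esub> t (d x))) = \<zero>\<^bsub>N\<^esub>" by (rule f'(2)[rotated]) (use w in simp)
    then have "f (b1 (a1 x)) \<oplus>\<^bsub>N\<^esub> \<ominus>\<^bsub>N\<^esub> f (x \<oplus>\<^bsub>Q\<^esub> t (d x)) = \<zero>\<^bsub>N\<^esub>"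
      using w by (simp add: hom_add[OF f'(1)] hom_minus[OF T1(4) N f'(1)])
    then have "f (b1 (a1 x)) = f (x \<oplus>\<^bsub>Q\<^esub> t (d x))"
      using cl(5)[OF w(1)] cl(5)[OF w(2)]
      by (metis N.M.minus_equality N.M.minus_minus N.M.add.inv_closed)
    then show ?thesis using x cl by (simp add: hom_add[OF f'(1)])
  qed
  show thesis
    by (rule that[OF hom_comp[OF P1(3) t(1) f'(1)]]) (simp add: eq compose_eq cl)
qed

lemma coboundary_diff:
  assumes "module_quotient base_field (ext_space R Q d P N) (ext_coboundaries R Q d P N)"
    and "f \<in> ext_cocycles R Q d P N" "h \<in> ext_cocycles R Q d P N" and d: "d \<in> mod_hom R Q P"
    and g: "g \<in> mod_hom R P N" "\<And>x. x \<in> carrier Q \<Longrightarrow> f x = h x \<oplus>\<^bsub>N\<^esub> g (d x)"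
  shows "f \<ominus>\<^bsub>ext_space R Q d P N\<^esub> h \<in> ext_coboundaries R Q d P N"
proof -
  let ?V = "ext_space R Q d P N"
  interpret E: module_quotient base_field "?V" "ext_coboundaries R Q d P N" by fact
  have c: "compose (carrier Q) g d \<in> ext_coboundaries R Q d P N"
    using g(1) by (auto simp: ext_coboundaries_def)
  then have cV: "compose (carrier Q) g d \<in> carrier (?V)"
    using submodule_subset[OF E.B] by auto
  have fV: "f \<in> carrier (?V)" and hV: "h \<in> carrier (?V)"
    using assms(2,3) by (simp_all add: ext_space_simps)
  have "f = h \<oplus>\<^bsub>?V\<^esub> compose (carrier Q) g d"
  proof (rule mod_hom_eqI[where R = R and M = Q and N = N])
    show "f \<in> mod_hom R Q N" using assms(2) by (simp add: ext_cocycles_def)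
    show "h \<oplus>\<^bsub>?V\<^esub> compose (carrier Q) g d \<in> mod_hom R Q N"
      using E.V.M.a_closed[OF hV cV] by (simp add: ext_space_simps(1) ext_cocycles_def)
  qed (simp add: ext_space_simps compose_eq g(2))
  then have "f \<ominus>\<^bsub>?V\<^esub> h = compose (carrier Q) g d"
    using hV cV by (metis E.V.M.a_comm E.V.M.add.inv_closed E.V.M.add.m_closed E.V.M.r_neg1 a_minus_def)
  with c show ?thesis by simp
qed

text \<open>
  Lifts of stably inverse maps to the two steps induce maps between the Ext groups, which are
  inverse to each other by the homotopy above.
\<close>

theorem ext_quot_stable:
  assumes T: "two_presents R Q d P p Z" and T': "two_presents R Q' d' P' p' Z'"
    and fg: "fg_module R Z" "fg_module R Z'" and N: "right_module R N" and "stably_equivalent R Z Z'"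
  shows "vs_isomorphic (ext_quot R Q' d' P' N) (ext_quot R Q d P N)"
proof -
  note T1 = two_presentsD[OF T] and T1' = two_presentsD[OF T']
  note P = presentsD[OF T1(1)] and P' = presentsD[OF T1'(1)]
  have rm: "right_module R Z" "right_module R Z'" using fg by (auto intro: fg_right_module)
  interpret N: right_module R N by (rule N)
  obtain a b where inv: "stably_inverse R Z Z' a b" "stably_inverse R Z' Z b a"
    using assms(6) unfolding stably_equivalent_def by blast
  have ab: "a \<in> mod_hom R Z Z'" "b \<in> mod_hom R Z' Z" using inv by (auto simp: stably_inverse_def)
  obtain a0 where a0: "a0 \<in> mod_hom R P P'" "\<And>x. x \<in> carrier P \<Longrightarrow> p' (a0 x) = a (p x)"
    using lift_to_presentations[OF T1(1) T1'(1) fg(2) ab(1)] by metis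
  obtain b0 where b0: "b0 \<in> mod_hom R P' P" "\<And>x. x \<in> carrier P' \<Longrightarrow> p (b0 x) = b (p' x)"
    using lift_to_presentations[OF T1'(1) T1(1) fg(1) ab(2)] by metis
  have pd: "p (d x) = \<zero>\<^bsub>Z\<^esub>" if "x \<in> carrier Q" for x using T1(6) that by auto
  have pd': "p' (d' x) = \<zero>\<^bsub>Z'\<^esub>" if "x \<in> carrier Q'" for x using T1'(6) that by auto
  have "p' (compose (carrier Q) a0 d x) = \<zero>\<^bsub>Z'\<^esub>" if "x \<in> carrier Q" for x
    using that pd hom_closed[OF T1(5)] hom_zero[OF rm ab(1)] by (simp add: compose_eq a0(2))
  from lift_second_step[OF T' fg(2) T1(2) hom_comp[OF T1(4,5) a0(1)] this]
  obtain a1 where a1: "a1 \<in> mod_hom R Q Q'" "\<And>x. x \<in> carrier Q \<Longrightarrow> d' (a1 x) = a0 (d x)"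
    by (auto simp: compose_eq)
  have "p (compose (carrier Q') b0 d' x) = \<zero>\<^bsub>Z\<^esub>" if "x \<in> carrier Q'" for x
    using that pd' hom_closed[OF T1'(5)] hom_zero[OF rm(2,1) ab(2)] by (simp add: compose_eq b0(2))
  from lift_second_step[OF T fg(1) T1'(2) hom_comp[OF T1'(4,5) b0(1)] this]
  obtain b1 where b1: "b1 \<in> mod_hom R Q' Q" "\<And>x. x \<in> carrier Q' \<Longrightarrow> d (b1 x) = b0 (d' x)"
    by (auto simp: compose_eq)
  let ?V = "ext_space R Q d P N" and ?B = "ext_coboundaries R Q d P N"
  let ?V' = "ext_space R Q' d' P' N" and ?B' = "ext_coboundaries R Q' d' P' N"
  interpret E: module_quotient base_field ?V ?B by (rule ext_space_module[OF T1(4) P(3) N T1(5)])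
  interpret E': module_quotient base_field ?V' ?B' by (rule ext_space_module[OF T1'(4) P'(3) N T1'(5)])
  let ?F = "\<lambda>f\<in>ext_cocycles R Q' d' P' N. compose (carrier Q) f a1"
  let ?G = "\<lambda>f\<in>ext_cocycles R Q d P N. compose (carrier Q') f b1"
  have F: "?F \<in> mod_hom base_field ?V' ?V"
    by (rule ext_pullback[OF T1(4) N P(3) T1'(4) P'(3) T1(5) T1'(5) a1(1) a0(1) a1(2)])
  have G: "?G \<in> mod_hom base_field ?V ?V'"
    by (rule ext_pullback[OF T1'(4) N P'(3) T1(4) P(3) T1'(5) T1(5) b1(1) b0(1) b1(2)])
  have Fc: "compose (carrier Q) f a1 \<in> ext_cocycles R Q d P N" if "f \<in> ext_cocycles R Q' d' P' N" for f
    using hom_closed[OF F, of f] that by (simp add: ext_space_simps)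
  have Gc: "compose (carrier Q') f b1 \<in> ext_cocycles R Q' d' P' N" if "f \<in> ext_cocycles R Q d P N" for f
    using hom_closed[OF G, of f] that by (simp add: ext_space_simps)
  note cl = hom_closed[OF a1(1)] hom_closed[OF b1(1)] hom_closed[OF T1(5)] hom_closed[OF T1'(5)]
    hom_closed[OF a0(1)] hom_closed[OF b0(1)]
  show ?thesis
    unfolding vs_isomorphic_def ext_quot_def
  proof (rule E'.first_isomorphism[OF E.right_module_quot])
    let ?q = "\<lambda>x\<in>carrier ?V. ?B +>\<^bsub>?V\<^esub> x"
    show "compose (carrier ?V') ?q ?F \<in> mod_hom base_field ?V' (quot_alg ?V ?B)"
      by (rule hom_comp[OF E'.V.right_module_axioms F E.hom_quot])
    have qF: "compose (carrier ?V') ?q ?F f = ?B +>\<^bsub>?V\<^esub> compose (carrier Q) f a1"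
      if "f \<in> ext_cocycles R Q' d' P' N" for f
      using that Fc[OF that] by (simp add: compose_eq ext_space_simps(1))
    show "compose (carrier ?V') ?q ?F ` carrier ?V' = carrier (quot_alg ?V ?B)"
    proof
      show "compose (carrier ?V') ?q ?F ` carrier ?V' \<subseteq> carrier (quot_alg ?V ?B)"
        using hom_closed[OF hom_comp[OF E'.V.right_module_axioms F E.hom_quot]] by blast
      show "carrier (quot_alg ?V ?B) \<subseteq> compose (carrier ?V') ?q ?F ` carrier ?V'"
      proof
        fix C assume "C \<in> carrier (quot_alg ?V ?B)"
        then obtain f where f: "f \<in> ext_cocycles R Q d P N" "C = ?B +>\<^bsub>?V\<^esub> f"
          by (auto simp: E.carrier_quot ext_space_simps(1))
        obtain g where g: "g \<in> mod_hom R P N"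
          "\<And>x. x \<in> carrier Q \<Longrightarrow> f (b1 (a1 x)) = f x \<oplus>\<^bsub>N\<^esub> g (d x)"
          using ext_homotopy[OF T T1'(1) fg T1'(4,5) inv(1) a0 b0 a1 b1 N f(1)] by metis
        have c: "compose (carrier Q) (compose (carrier Q') f b1) a1 \<in> ext_cocycles R Q d P N"
          by (rule Fc[OF Gc[OF f(1)]])
        have "compose (carrier Q) (compose (carrier Q') f b1) a1 \<ominus>\<^bsub>?V\<^esub> f \<in> ?B"
          by (rule coboundary_diff[OF E.module_quotient_axioms c f(1) T1(5) g(1)]) (simp_all add: compose_eq cl g(2))
        then have "?B +>\<^bsub>?V\<^esub> compose (carrier Q) (compose (carrier Q') f b1) a1 = C"
          using c f E.coset_eq_iff by (simp add: ext_space_simps(1))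
        then have "C = compose (carrier ?V') ?q ?F (compose (carrier Q') f b1)"
          using qF[OF Gc[OF f(1)]] by simp
        then show "C \<in> compose (carrier ?V') ?q ?F ` carrier ?V'"
          using Gc[OF f(1)] by (auto simp: ext_space_simps(1))
      qed
    qed
    fix f assume "f \<in> carrier ?V'"
    then have f: "f \<in> ext_cocycles R Q' d' P' N" by (simp add: ext_space_simps)
    then have fh: "f \<in> mod_hom R Q' N" by (simp add: ext_cocycles_def)
    have "compose (carrier ?V') ?q ?F f = \<zero>\<^bsub>quot_alg ?V ?B\<^esub> \<longleftrightarrow> compose (carrier Q) f a1 \<in> ?B"
      using qF[OF f] E.coset_zero_iff[of "compose (carrier Q) f a1"] Fc[OF f]
      by (simp add: E.zero_quot ext_space_simps(1))
    also have "\<dots> \<longleftrightarrow> f \<in> ?B'"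
    proof
      assume "f \<in> ?B'"
      then obtain g where g: "g \<in> mod_hom R P' N" "f = compose (carrier Q') g d'"
        by (auto simp: ext_coboundaries_def)
      have "compose (carrier Q) f a1 = compose (carrier Q) (compose (carrier P) g a0) d"
        by (auto simp: g(2) compose_def cl a1(2) fun_eq_iff)
      then show "compose (carrier Q) f a1 \<in> ?B"
        using hom_comp[OF P(3) a0(1) g(1)] by (auto simp: ext_coboundaries_def)
    next
      assume "compose (carrier Q) f a1 \<in> ?B"
      then obtain g where g: "g \<in> mod_hom R P N" "compose (carrier Q) f a1 = compose (carrier Q) g d"
        by (auto simp: ext_coboundaries_def)
      obtain g' where g': "g' \<in> mod_hom R P' N"
        "\<And>x. x \<in> carrier Q' \<Longrightarrow> f (a1 (b1 x)) = f x \<oplus>\<^bsub>N\<^esub> g' (d' x)"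
        using ext_homotopy[OF T' T1(1) fg(2,1) T1(4,5) inv(2) b0 a0 b1 a1 N f] by metis
      let ?g = "\<lambda>x\<in>carrier P'. compose (carrier P') g b0 x \<ominus>\<^bsub>N\<^esub> g' x"
      have h: "?g \<in> mod_hom R P' N"
        by (rule hom_diff[OF P'(3) N hom_comp[OF P'(3) b0(1) g(1)] g'(1)])
      have "f x = ?g (d' x)" if x: "x \<in> carrier Q'" for x
      proof -
        have "f (a1 (b1 x)) = g (d (b1 x))"
          using fun_cong[OF g(2), of "b1 x"] x by (simp add: compose_eq cl)
        also have "\<dots> = g (b0 (d' x))" using x by (simp add: b1(2))
        finally have "f x \<oplus>\<^bsub>N\<^esub> g' (d' x) = g (b0 (d' x))" using g'(2)[OF x] by simp
        moreover have "f x \<in> carrier N" "g' (d' x) \<in> carrier N"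
          using x hom_closed[OF fh] hom_closed[OF g'(1)] cl by auto
        ultimately have "f x = g (b0 (d' x)) \<ominus>\<^bsub>N\<^esub> g' (d' x)"
          by (metis N.M.a_assoc N.M.add.inv_closed N.M.r_neg N.M.r_zero a_minus_def)
        then show ?thesis using x by (simp add: cl compose_eq)
      qed
      then have "f = compose (carrier Q') ?g d'"
        by (intro mod_hom_eqI[OF fh hom_comp[OF T1'(4,5) h]]) (simp add: compose_eq)
      then show "f \<in> ?B'" using h by (auto simp: ext_coboundaries_def)
    qed
    finally show "compose (carrier ?V') ?q ?F f = \<zero>\<^bsub>quot_alg ?V ?B\<^esub> \<longleftrightarrow> f \<in> ?B'" .
  qed
qed

end

section \<open>Direct sums of presentations\<close>

definition family_map ::
  "nat set \<Rightarrow> (nat \<Rightarrow> ('r, 'm) module) \<Rightarrow> (nat \<Rightarrow> 'm \<Rightarrow> 'n) \<Rightarrow> (nat \<Rightarrow> 'm) \<Rightarrow> nat \<Rightarrow> 'n" where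
  "family_map J L f = (\<lambda>x\<in>carrier (mod_family_sum J L). \<lambda>i\<in>J. f i (x i))"

lemma family_memI: "(\<And>i. i \<in> J \<Longrightarrow> x i \<in> carrier (L i)) \<Longrightarrow> (\<lambda>i\<in>J. x i) \<in> carrier (mod_family_sum J L)"
  by (simp add: carrier_family)

lemma restrict_in_PiE: "(\<And>x. x \<in> A \<Longrightarrow> g x \<in> B) \<Longrightarrow> (\<lambda>x\<in>A. g x) \<in> A \<rightarrow>\<^sub>E B"
  by simp

lemma hom_family_map:
  assumes "ring R" "\<And>i. i \<in> J \<Longrightarrow> right_module R (L i)" "\<And>i. i \<in> J \<Longrightarrow> right_module R (L' i)"
    and f: "\<And>i. i \<in> J \<Longrightarrow> f i \<in> mod_hom R (L i) (L' i)"
  shows "family_map J L f \<in> mod_hom R (mod_family_sum J L) (mod_family_sum J L')"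
proof -
  interpret S: right_module R "mod_family_sum J L" by (rule right_module_family[OF assms(1,2)])
  let ?f = "\<lambda>x\<in>carrier (mod_family_sum J L). \<lambda>i\<in>J. f i (x i)"
  show ?thesis
    unfolding family_map_def
  proof (rule mod_homI)
    fix x y assume xy: "x \<in> carrier (mod_family_sum J L)" "y \<in> carrier (mod_family_sum J L)"
    then show "(?f) (x \<oplus>\<^bsub>mod_family_sum J L\<^esub> y) =
      (?f) x \<oplus>\<^bsub>mod_family_sum J L'\<^esub>
      (?f) y"
      using S.M.a_closed[OF xy]
      by (simp add: add_family hom_add[OF f] family_memD cong: restrict_cong)
  next
    fix r x assume rx: "r \<in> carrier R" "x \<in> carrier (mod_family_sum J L)"
    then show "(?f) (r \<odot>\<^bsub>mod_family_sum J L\<^esub> x) =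
      r \<odot>\<^bsub>mod_family_sum J L'\<^esub> (?f) x"
      using S.act_closed[OF rx]
      by (simp add: act_family hom_act[OF f] family_memD cong: restrict_cong)
  next
    show "(?f)
      \<in> carrier (mod_family_sum J L) \<rightarrow>\<^sub>E carrier (mod_family_sum J L')"
      by (intro restrict_in_PiE family_memI hom_closed[OF f] family_memD)
  qed
qed

lemma family_map_apply:
  "x \<in> carrier (mod_family_sum J L) \<Longrightarrow> i \<in> J \<Longrightarrow> family_map J L f x i = f i (x i)"
  by (simp add: family_map_def)

lemma family_map_eq_zero_iff:
  assumes "x \<in> carrier (mod_family_sum J L)"
  shows "family_map J L f x = \<zero>\<^bsub>mod_family_sum J L'\<^esub> \<longleftrightarrow> (\<forall>i\<in>J. f i (x i) = \<zero>\<^bsub>L' i\<^esub>)"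
  using assms by (auto simp: family_map_def zero_family fun_eq_iff restrict_def)

lemma family_map_image:
  assumes f: "\<And>i. i \<in> J \<Longrightarrow> f i ` carrier (L i) = C i"
  shows "family_map J L f ` carrier (mod_family_sum J L) = (\<Pi>\<^sub>E i\<in>J. C i)"
proof
  show "family_map J L f ` carrier (mod_family_sum J L) \<subseteq> (\<Pi>\<^sub>E i\<in>J. C i)"
  proof
    fix y assume "y \<in> family_map J L f ` carrier (mod_family_sum J L)"
    then obtain x where x: "x \<in> carrier (mod_family_sum J L)" "y = family_map J L f x" by blast
    have "f i (x i) \<in> C i" if "i \<in> J" for i
      using f[OF that] family_memD[OF x(1) that] by auto
    then show "y \<in> (\<Pi>\<^sub>E i\<in>J. C i)" using x by (simp add: family_map_def)
  qed
  show "(\<Pi>\<^sub>E i\<in>J. C i) \<subseteq> family_map J L f ` carrier (mod_family_sum J L)"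
  proof
    fix y assume y: "y \<in> (\<Pi>\<^sub>E i\<in>J. C i)"
    have "\<forall>i\<in>J. \<exists>x. x \<in> carrier (L i) \<and> f i x = y i"
    proof
      fix i assume i: "i \<in> J"
      then have "y i \<in> f i ` carrier (L i)" using y f by auto
      then show "\<exists>x. x \<in> carrier (L i) \<and> f i x = y i" by auto
    qed
    from bchoice[OF this] obtain x where x: "\<forall>i\<in>J. x i \<in> carrier (L i) \<and> f i (x i) = y i" by blast
    then have xc: "restrict x J \<in> carrier (mod_family_sum J L)" by (simp add: carrier_family)
    have "family_map J L f (restrict x J) = y"
      using xc x y by (intro PiE_ext[of _ J C]) (auto simp: family_map_def)
    then show "y \<in> family_map J L f ` carrier (mod_family_sum J L)" using xc by (metis imageI)
  qed
qed

lemma presents_family: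
  assumes "ring R" "finite J" "\<And>i. i \<in> J \<Longrightarrow> right_module R (Z i)"
    and pres: "\<And>i. i \<in> J \<Longrightarrow> presents R (P i) (p i) (Z i)"
  shows "presents R (mod_family_sum J P) (family_map J P p) (mod_family_sum J Z)"
proof -
  note P = presentsD[OF pres]
  have "family_map J P p ` carrier (mod_family_sum J P) = carrier (mod_family_sum J Z)"
    unfolding carrier_family[of J Z] by (rule family_map_image[OF P(5)])
  then show ?thesis
    unfolding presents_def
    by (intro conjI projective_family[OF assms(1,2) P(1)] hom_family_map[OF assms(1) P(3) assms(3) P(4)])
qed

lemma kernel_family_map:
  "{x \<in> carrier (mod_family_sum J P). family_map J P p x = \<zero>\<^bsub>mod_family_sum J Z\<^esub>} =
    (\<Pi>\<^sub>E i\<in>J. {x \<in> carrier (P i). p i x = \<zero>\<^bsub>Z i\<^esub>})" (is "?A = ?B")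
proof (rule Set.set_eqI)
  fix x
  have "x \<in> ?A \<longleftrightarrow> x \<in> carrier (mod_family_sum J P) \<and> (\<forall>i\<in>J. p i (x i) = \<zero>\<^bsub>Z i\<^esub>)"
    using family_map_eq_zero_iff[of x J P p Z] by blast
  also have "\<dots> \<longleftrightarrow> x \<in> ?B" by (auto simp: carrier_family PiE_iff)
  finally show "x \<in> ?A \<longleftrightarrow> x \<in> ?B" .
qed

lemma kernel_family:
  "kernel_module (mod_family_sum J P) (family_map J P p) (mod_family_sum J Z) =
    mod_family_sum J (\<lambda>i. kernel_module (P i) (p i) (Z i))"
proof -
  have "{x \<in> carrier (mod_family_sum J P). family_map J P p x = \<zero>\<^bsub>mod_family_sum J Z\<^esub>} =
    (\<Pi>\<^sub>E i\<in>J. carrier (kernel_module (P i) (p i) (Z i)))"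
    by (simp only: kernel_family_map carrier_kernel_module)
  then show ?thesis by (simp add: kernel_module_def mod_family_sum_def)
qed

lemma syzygy_of_family:
  assumes "ring R" "finite J" "\<And>i. i \<in> J \<Longrightarrow> right_module R (Z i)"
    and "\<And>i. i \<in> J \<Longrightarrow> syzygy_of R (Z i) (Y i)"
  shows "syzygy_of R (mod_family_sum J Z) (mod_family_sum J Y)"
proof -
  have "\<forall>i\<in>J. \<exists>P p. presents R P p (Z i) \<and> Y i = kernel_module P p (Z i)"
    using assms(4) by (simp add: syzygy_of_def)
  from this[unfolded bchoice_iff] obtain P p
    where Pp: "\<forall>i\<in>J. presents R (P i) (p i) (Z i) \<and> Y i = kernel_module (P i) (p i) (Z i)" by blast
  have pres: "presents R (mod_family_sum J P) (family_map J P p) (mod_family_sum J Z)"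
    by (rule presents_family[OF assms(1-3)]) (use Pp in auto)
  have "mod_family_sum J Y = mod_family_sum J (\<lambda>i. kernel_module (P i) (p i) (Z i))"
    by (rule family_cong) (use Pp in blast)
  then show ?thesis unfolding syzygy_of_def kernel_family[symmetric] using pres by blast
qed

lemma two_presents_family:
  assumes "ring R" "finite J" "\<And>i. i \<in> J \<Longrightarrow> right_module R (Z i)"
    and T: "\<And>i. i \<in> J \<Longrightarrow> two_presents R (Q i) (d i) (P i) (p i) (Z i)"
  shows "two_presents R (mod_family_sum J Q) (family_map J Q d) (mod_family_sum J P) (family_map J P p)
    (mod_family_sum J Z)"
proof -
  note T1 = two_presentsD[OF T]
  have "family_map J Q d ` carrier (mod_family_sum J Q) = (\<Pi>\<^sub>E i\<in>J. {x \<in> carrier (P i). p i x = \<zero>\<^bsub>Z i\<^esub>})"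
    by (rule family_map_image[OF T1(6)])
  also have "\<dots> = {x \<in> carrier (mod_family_sum J P). family_map J P p x = \<zero>\<^bsub>mod_family_sum J Z\<^esub>}"
    by (rule kernel_family_map[symmetric])
  finally show ?thesis
    unfolding two_presents_def
    by (intro conjI presents_family[OF assms(1-3) T1(1)] projective_family[OF assms(1,2) T1(2)]
        hom_family_map[OF assms(1) T1(4) presentsD(3)[OF T1(1)] T1(5)])
qed

lemma right_module_mod_sum:
  assumes "right_module R V" "right_module R W"
  shows "right_module R (mod_sum V W)"
proof -
  interpret V: right_module R V by fact
  interpret W: right_module R W by fact
  show ?thesis
  proof (rule right_moduleI[OF V.R.ring_axioms])
    show "\<exists>y\<in>carrier (mod_sum V W). y \<oplus>\<^bsub>mod_sum V W\<^esub> x = \<zero>\<^bsub>mod_sum V W\<^esub>"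
      if "x \<in> carrier (mod_sum V W)" for x
      using that
      by (intro bexI[of _ "(\<ominus>\<^bsub>V\<^esub> fst x, \<ominus>\<^bsub>W\<^esub> snd x)"]) (auto simp: mod_sum_def V.M.l_neg W.M.l_neg)
  qed (auto simp: mod_sum_def V.M.a_ac W.M.a_ac V.act_add_scalar W.act_add_scalar V.act_add W.act_add
      V.act_mult W.act_mult V.act_one W.act_one)
qed

context fd_algebra
begin

text \<open>A sum of null maps factors through the sum of the projective modules involved.\<close>

lemma stably_equivalent_family:
  assumes "finite J" "\<And>i. i \<in> J \<Longrightarrow> fg_module R (Z i)" "\<And>i. i \<in> J \<Longrightarrow> fg_module R (W i)"
    and "\<And>i. i \<in> J \<Longrightarrow> stably_equivalent R (Z i) (W i)"
  shows "stably_equivalent R (mod_family_sum J Z) (mod_family_sum J W)"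
proof -
  have "\<forall>i\<in>J. \<exists>a b. stably_inverse R (Z i) (W i) a b \<and> stably_inverse R (W i) (Z i) b a"
    using assms(4) by (simp add: stably_equivalent_def)
  from this[unfolded bchoice_iff] obtain a b where
    ab: "\<forall>i\<in>J. stably_inverse R (Z i) (W i) (a i) (b i) \<and> stably_inverse R (W i) (Z i) (b i) (a i)" by blast
  have half: "stably_inverse R (mod_family_sum J Z) (mod_family_sum J W) (family_map J Z a) (family_map J W b)"
    if fg: "\<And>i. i \<in> J \<Longrightarrow> fg_module R (Z i)" "\<And>i. i \<in> J \<Longrightarrow> fg_module R (W i)"
      and inv: "\<And>i. i \<in> J \<Longrightarrow> stably_inverse R (Z i) (W i) (a i) (b i)"
    for a b and Z :: "nat \<Rightarrow> ('r, 'x) module" and W :: "nat \<Rightarrow> ('r, 'y) module"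
  proof -
    let ?Z = "mod_family_sum J Z" and ?W = "mod_family_sum J W"
    note rm = fg_right_module[OF fg(1)] fg_right_module[OF fg(2)]
    have Z: "right_module R ?Z" by (rule right_module_family[OF ring rm(1)])
    have fgZ: "fg_module R ?Z" by (rule fg_family[OF ring assms(1) fg(1)])
    have "\<forall>i\<in>J. \<exists>(P :: ('r, 'r univ) module) p k. presents R P p (Z i) \<and> k \<in> mod_hom R (Z i) P \<and>
        (\<forall>x\<in>carrier (Z i). b i (a i x) = x \<oplus>\<^bsub>Z i\<^esub> p (k x))"
    proof
      fix i assume i: "i \<in> J"
      obtain h where h: "null_map R (Z i) (Z i) h" "\<And>x. x \<in> carrier (Z i) \<Longrightarrow> b i (a i x) = x \<oplus>\<^bsub>Z i\<^esub> h x"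
        using stably_inverseE[OF inv[OF i]] by metis
      obtain P :: "('r, 'r univ) module" and p k where "presents R P p (Z i)" "k \<in> mod_hom R (Z i) P"
        "\<And>x. x \<in> carrier (Z i) \<Longrightarrow> p (k x) = h x"
        using null_map_factor[OF h(1) fg(1)[OF i]] by metis
      then show "\<exists>(P :: ('r, 'r univ) module) p k. presents R P p (Z i) \<and> k \<in> mod_hom R (Z i) P \<and>
          (\<forall>x\<in>carrier (Z i). b i (a i x) = x \<oplus>\<^bsub>Z i\<^esub> p (k x))"
        using h(2) by (intro exI[of _ P] exI[of _ p] exI[of _ k]) simp
    qed
    from this[unfolded bchoice_iff] obtain P :: "nat \<Rightarrow> ('r, 'r univ) module" and p k
      where Q: "\<forall>i\<in>J. presents R (P i) (p i) (Z i) \<and> k i \<in> mod_hom R (Z i) (P i) \<and>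
        (\<forall>x\<in>carrier (Z i). b i (a i x) = x \<oplus>\<^bsub>Z i\<^esub> p i (k i x))" by blast
    have P: "presents R (P i) (p i) (Z i)" and k: "k i \<in> mod_hom R (Z i) (P i)"
      and pk: "\<And>x. x \<in> carrier (Z i) \<Longrightarrow> b i (a i x) = x \<oplus>\<^bsub>Z i\<^esub> p i (k i x)" if "i \<in> J" for i
      using Q that by simp_all
    note PD = presentsD[OF presents_family[OF ring assms(1) rm(1) P]]
    have kk: "family_map J Z k \<in> mod_hom R ?Z (mod_family_sum J P)"
      by (rule hom_family_map[OF ring rm(1) presentsD(3)[OF P] k])
    have ai: "a i \<in> mod_hom R (Z i) (W i)" and bi: "b i \<in> mod_hom R (W i) (Z i)" if "i \<in> J" for i
      using inv[OF that] by (simp_all add: stably_inverse_def)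
    have aa: "family_map J Z a \<in> mod_hom R ?Z ?W" by (rule hom_family_map[OF ring rm ai])
    have bb: "family_map J W b \<in> mod_hom R ?W ?Z" by (rule hom_family_map[OF ring rm(2,1) bi])
    let ?n = "compose (carrier ?Z) (family_map J P p) (family_map J Z k)"
    have n: "null_map R ?Z ?Z ?n"
      by (rule null_map_through_projective[OF PD(1) fgZ Z kk PD(4)])
    show ?thesis
      unfolding stably_inverse_def
    proof (intro conjI aa bb exI[of _ ?n] n ballI)
      fix x assume x: "x \<in> carrier ?Z"
      interpret Z: right_module R ?Z by fact
      have nx: "?n x \<in> carrier ?Z" using hom_closed[OF null_map_hom[OF n] x] .
      show "family_map J W b (family_map J Z a x) = x \<oplus>\<^bsub>?Z\<^esub> ?n x"
      proof (rule family_eqI[OF hom_closed[OF bb hom_closed[OF aa x]] Z.M.a_closed[OF x nx]])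
        fix i assume i: "i \<in> J"
        have "family_map J W b (family_map J Z a x) i = b i (a i (x i))"
          using i x hom_closed[OF aa x] by (simp add: family_map_apply)
        also have "\<dots> = x i \<oplus>\<^bsub>Z i\<^esub> p i (k i (x i))"
          by (rule pk[OF i family_memD[OF x i]])
        also have "\<dots> = (x \<oplus>\<^bsub>?Z\<^esub> ?n x) i"
          using i x hom_closed[OF kk x] by (simp add: add_family compose_eq family_map_apply)
        finally show "family_map J W b (family_map J Z a x) i = (x \<oplus>\<^bsub>?Z\<^esub> ?n x) i" .
      qed
    qed
  qed
  show ?thesis
    unfolding stably_equivalent_def
  proof (intro exI conjI)
    show "stably_inverse R (mod_family_sum J Z) (mod_family_sum J W) (family_map J Z a) (family_map J W b)"
      by (rule half[OF assms(2,3)]) (use ab in auto)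
    show "stably_inverse R (mod_family_sum J W) (mod_family_sum J Z) (family_map J W b) (family_map J Z a)"
      by (rule half[OF assms(3,2)]) (use ab in auto)
  qed
qed

text \<open>
  The projection to the remaining summands, followed by the inclusion, differs from the identity
  by a map that factors through the sum of the dropped summands.
\<close>

lemma stably_equivalent_drop_projectives:
  assumes "finite J'" "J \<subseteq> J'" "\<And>i. i \<in> J' \<Longrightarrow> fg_module R (L i)" "\<And>i. i \<in> J' - J \<Longrightarrow> projective R (L i)"
  shows "stably_equivalent R (mod_family_sum J' L) (mod_family_sum J L)"
proof -
  let ?S' = "mod_family_sum J' L" and ?S = "mod_family_sum J L" and ?D = "mod_family_sum (J' - J) L"
  have J: "finite J" using assms(1,2) finite_subset by blast
  have L: "right_module R (L i)" if "i \<in> J'" for i using assms(3)[OF that] by (rule fg_right_module)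
  have L2: "right_module R (L i)" if "i \<in> J" for i using L that assms(2) by auto
  have fgS': "fg_module R ?S'" by (rule fg_family[OF ring assms(1,3)])
  have fgS: "fg_module R ?S" using assms(2,3) by (intro fg_family[OF ring J]) auto
  have S': "right_module R ?S'" and S: "right_module R ?S"
    using fgS' fgS by (auto intro: fg_right_module)
  have D: "projective R ?D" by (rule projective_family) (use ring assms in auto)
  have Drm: "right_module R ?D" by (rule fg_right_module[OF projective_fg[OF D]])
  interpret S': right_module R ?S' by fact
  let ?a = "\<lambda>x\<in>carrier ?S'. restrict x J"
  let ?b = "\<lambda>x\<in>carrier ?S. \<lambda>i\<in>J'. if i \<in> J then x i else \<zero>\<^bsub>L i\<^esub>"
  let ?k = "\<lambda>x\<in>carrier ?S'. restrict x (J' - J)"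
  \<comment> \<open>The minus sign turns \<open>?b (?a x)\<close> into \<open>x + ?p (?k x)\<close>.\<close>
  let ?p = "\<lambda>x\<in>carrier ?D. \<lambda>i\<in>J'. if i \<in> J then \<zero>\<^bsub>L i\<^esub> else \<ominus>\<^bsub>L i\<^esub> x i"
  note z = right_module.module_facts[OF L]
  have inJ: "i \<in> J'" if "i \<in> J" for i using that assms(2) by auto
  interpret S: right_module R ?S by (rule S)
  interpret D: right_module R ?D by (rule Drm)
  note closed = S'.M.a_closed S'.act_closed S.M.a_closed S.act_closed D.M.a_closed D.act_closed
  have a: "?a \<in> mod_hom R ?S' ?S"
  proof (rule mod_homI)
    show "?a \<in> carrier ?S' \<rightarrow>\<^sub>E carrier ?S" using inJ by (auto simp: carrier_family)
  qed (use closed inJ in \<open>auto simp: add_family act_family intro!: restrict_ext\<close>)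
  have b: "?b \<in> mod_hom R ?S ?S'"
  proof (rule mod_homI)
    show "?b \<in> carrier ?S \<rightarrow>\<^sub>E carrier ?S'" using z(1) by (auto simp: carrier_family)
  qed (use closed z(1,5,9) in \<open>auto simp: add_family act_family intro!: restrict_ext\<close>)
  have k: "?k \<in> mod_hom R ?S' ?D"
  proof (rule mod_homI)
    show "?k \<in> carrier ?S' \<rightarrow>\<^sub>E carrier ?D" by (auto simp: carrier_family)
  qed (use closed in \<open>auto simp: add_family act_family intro!: restrict_ext\<close>)
  have p: "?p \<in> mod_hom R ?D ?S'"
  proof (rule mod_homI)
    show "?p \<in> carrier ?D \<rightarrow>\<^sub>E carrier ?S'" 
    proof (intro restrict_in_PiE family_memI)
      fix x i assume "x \<in> carrier ?D" "i \<in> J'"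
      then show "(if i \<in> J then \<zero>\<^bsub>L i\<^esub> else \<ominus>\<^bsub>L i\<^esub> x i) \<in> carrier (L i)"
        using z(1,4) family_memD[of x "J' - J" L i] by simp
    qed
  qed (use closed z(1,4,5,9,10,11) in \<open>auto simp: add_family act_family family_memD intro!: restrict_ext\<close>)
  have ab: "?a (?b x) = x" if "x \<in> carrier ?S" for x
    using hom_closed[OF b that] that inJ
    by (intro family_eqI[OF hom_closed[OF a hom_closed[OF b that]] that]) auto
  have "stably_inverse R ?S ?S' ?b ?a" by (rule stably_inverse_iso[OF fgS b a]) (rule ab)
  moreover have "stably_inverse R ?S' ?S ?a ?b"
    unfolding stably_inverse_def
  proof (intro conjI a b exI ballI)
    show n: "null_map R ?S' ?S' (compose (carrier ?S') ?p ?k)"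
      by (rule null_map_through_projective[OF D fgS' S' k p])
    fix x assume x: "x \<in> carrier ?S'"
    have nx: "compose (carrier ?S') ?p ?k x \<in> carrier ?S'" using hom_closed[OF null_map_hom[OF n] x] .
    show "?b (?a x) = x \<oplus>\<^bsub>?S'\<^esub> compose (carrier ?S') ?p ?k x"
      by (rule family_eqI[OF hom_closed[OF b hom_closed[OF a x]] S'.M.a_closed[OF x nx]])
        (use x hom_closed[OF a x] hom_closed[OF k x] z(6,8) family_memD[OF x] in
          \<open>auto simp: add_family compose_eq\<close>)
  qed
  ultimately show ?thesis unfolding stably_equivalent_def by blast
qed

lemma hom_pair:
  assumes "right_module S V" "f \<in> mod_hom S V A" "g \<in> mod_hom S V B"
  shows "(\<lambda>x\<in>carrier V. (f x, g x)) \<in> mod_hom S V (mod_sum A B)"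
proof -
  interpret V: right_module S V by fact
  show ?thesis
    by (rule mod_homI)
      (auto simp: mod_sum_def hom_closed[OF assms(2)] hom_closed[OF assms(3)] hom_add[OF assms(2)]
        hom_add[OF assms(3)] hom_act[OF assms(2)] hom_act[OF assms(3)])
qed

text \<open>
  The isomorphism restricts a cocycle to the two summands. Cocycles, and the homomorphisms that
  exhibit them as coboundaries, are glued by the universal property of the direct sum.
\<close>

lemma ext_quot_pair:
  assumes ij: "i \<noteq> j" and N: "right_module R N"
    and Q: "\<And>k. k \<in> {i, j} \<Longrightarrow> right_module R (Q k)" and P: "\<And>k. k \<in> {i, j} \<Longrightarrow> right_module R (P k)"
    and d: "\<And>k. k \<in> {i, j} \<Longrightarrow> d k \<in> mod_hom R (Q k) (P k)"
  shows "vs_isomorphic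
    (ext_quot R (mod_family_sum {i, j} Q) (family_map {i, j} Q d) (mod_family_sum {i, j} P) N)
    (mod_sum (ext_quot R (Q i) (d i) (P i) N) (ext_quot R (Q j) (d j) (P j) N))"
proof -
  let ?J = "{i, j}"
  let ?Q = "mod_family_sum ?J Q" and ?P = "mod_family_sum ?J P" and ?d = "family_map ?J Q d"
  let ?V = "ext_space R ?Q ?d ?P N" and ?B = "ext_coboundaries R ?Q ?d ?P N"
  let ?Vk = "\<lambda>k. ext_space R (Q k) (d k) (P k) N" and ?Bk = "\<lambda>k. ext_coboundaries R (Q k) (d k) (P k) N"
  have QQ: "right_module R ?Q" by (rule right_module_family[OF ring Q])
  have PP: "right_module R ?P" by (rule right_module_family[OF ring P])
  have dd: "?d \<in> mod_hom R ?Q ?P" by (rule hom_family_map[OF ring Q P d])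
  have J: "finite ?J" by simp
  interpret N: right_module R N by (rule N)
  interpret E: module_quotient base_field ?V ?B by (rule ext_space_module[OF QQ PP N dd])
  have Ek: "module_quotient base_field (?Vk k) (?Bk k)" if "k \<in> ?J" for k
    by (rule ext_space_module[OF Q[OF that] P[OF that] N d[OF that]])
  interpret Ei: module_quotient base_field "?Vk i" "?Bk i" by (rule Ek) simp
  interpret Ej: module_quotient base_field "?Vk j" "?Bk j" by (rule Ek) simp
  have inQ: "family_in ?J Q k \<in> mod_hom R (Q k) ?Q" and inP: "family_in ?J P k \<in> mod_hom R (P k) ?P"
    if "k \<in> ?J" for k
    using that hom_family_in[of R ?J Q k] hom_family_in[of R ?J P k] ring Q P by blast+
  have comm: "?d (family_in ?J Q k x) = family_in ?J P k (d k x)" if k: "k \<in> ?J" and x: "x \<in> carrier (Q k)" for k x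
  proof (rule family_eqI[where J = ?J and L = P])
    show "?d (family_in ?J Q k x) \<in> carrier ?P" by (rule hom_closed[OF dd hom_closed[OF inQ[OF k] x]])
    show "family_in ?J P k (d k x) \<in> carrier ?P" by (rule hom_closed[OF inP[OF k] hom_closed[OF d[OF k] x]])
    fix l assume l: "l \<in> ?J"
    have "?d (family_in ?J Q k x) l = d l (family_in ?J Q k x l)"
      by (rule family_map_apply[OF hom_closed[OF inQ[OF k] x] l])
    also have "\<dots> = family_in ?J P k (d k x) l"
      using l x hom_closed[OF d[OF k] x] hom_zero[OF Q[OF l] P[OF l] d[OF l]] by (simp add: family_in_def)
    finally show "?d (family_in ?J Q k x) l = family_in ?J P k (d k x) l" .
  qed
  define F where "F k = (\<lambda>f\<in>ext_cocycles R ?Q ?d ?P N. compose (carrier (Q k)) f (family_in ?J Q k))" for k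
  have F: "F k \<in> mod_hom base_field ?V (?Vk k)" if k: "k \<in> ?J" for k
    unfolding F_def
    by (rule ext_pullback[OF Q[OF k] N P[OF k] QQ PP d[OF k] dd inQ[OF k] inP[OF k]], rule comm[OF k])
  have Fc: "F k f \<in> ext_cocycles R (Q k) (d k) (P k) N" if "k \<in> ?J" "f \<in> ext_cocycles R ?Q ?d ?P N" for k f
    using hom_closed[OF F[OF that(1)], of f] that(2) by (simp add: ext_space_simps(1))
  let ?q = "\<lambda>k. \<lambda>x\<in>carrier (?Vk k). ?Bk k +>\<^bsub>?Vk k\<^esub> x"
  let ?G = "\<lambda>f\<in>carrier ?V. (compose (carrier ?V) (?q i) (F i) f, compose (carrier ?V) (?q j) (F j) f)"
  have G: "?G \<in> mod_hom base_field ?V (mod_sum (quot_alg (?Vk i) (?Bk i)) (quot_alg (?Vk j) (?Bk j)))"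
    by (intro hom_pair hom_comp[OF E.V.right_module_axioms F] Ei.hom_quot Ej.hom_quot E.V.right_module_axioms)
      simp_all
  have Gf: "?G f = (?Bk i +>\<^bsub>?Vk i\<^esub> F i f, ?Bk j +>\<^bsub>?Vk j\<^esub> F j f)" if "f \<in> ext_cocycles R ?Q ?d ?P N" for f
    using that Fc[OF _ that] by (simp add: compose_eq ext_space_simps(1))
  have cot: "family_cotuple ?J Q N g \<in> ext_cocycles R ?Q ?d ?P N"
    "F k (family_cotuple ?J Q N g) = g k"
    if g: "\<And>k. k \<in> ?J \<Longrightarrow> g k \<in> ext_cocycles R (Q k) (d k) (P k) N" and k: "k \<in> ?J" for g k
  proof -
    have gh: "g k \<in> mod_hom R (Q k) N" if "k \<in> ?J" for k using g[OF that] by (simp add: ext_cocycles_def)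
    have c: "family_cotuple ?J Q N g \<in> mod_hom R ?Q N" by (rule hom_family_cotuple[OF ring N Q gh J])
    have "family_cotuple ?J Q N g x = \<zero>\<^bsub>N\<^esub>" if x: "x \<in> carrier ?Q" "?d x = \<zero>\<^bsub>?P\<^esub>" for x
    proof -
      have "g k (x k) = \<zero>\<^bsub>N\<^esub>" if k: "k \<in> ?J" for k
      proof -
        have "d k (x k) = \<zero>\<^bsub>P k\<^esub>"
          by (rule family_map_eq_zero_iff[OF x(1), THEN iffD1, OF x(2), rule_format, OF k])
        then show ?thesis using g[OF k] family_memD[OF x(1) k] by (simp add: ext_cocycles_def)
      qed
      then have "finsum N (\<lambda>k. g k (x k)) ?J = finsum N (\<lambda>k. \<zero>\<^bsub>N\<^esub>) ?J" by (intro N.M.finsum_cong') auto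
      then show ?thesis using x by (simp add: family_cotuple_def)
    qed
    with c show cc: "family_cotuple ?J Q N g \<in> ext_cocycles R ?Q ?d ?P N" by (simp add: ext_cocycles_def)
    have "F k (family_cotuple ?J Q N g) = compose (carrier (Q k)) (family_cotuple ?J Q N g) (family_in ?J Q k)"
      using cc by (simp add: F_def)
    also have "\<dots> = g k"
    proof (rule mod_hom_eqI[OF hom_comp[OF Q[OF k] inQ[OF k] c] gh[OF k]])
      fix x assume x: "x \<in> carrier (Q k)"
      then show "compose (carrier (Q k)) (family_cotuple ?J Q N g) (family_in ?J Q k) x = g k x"
        by (simp add: compose_eq) (rule family_cotuple_in[where J = ?J and L = Q and f = g and Y = N],
          use ring N Q J gh k in auto)
    qed
    finally show "F k (family_cotuple ?J Q N g) = g k" .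
  qed
  show ?thesis
    unfolding vs_isomorphic_def ext_quot_def
  proof (rule E.first_isomorphism[OF right_module_mod_sum[OF Ei.right_module_quot Ej.right_module_quot] G])
    show "?G ` carrier ?V = carrier (mod_sum (quot_alg (?Vk i) (?Bk i)) (quot_alg (?Vk j) (?Bk j)))"
    proof
      show "?G ` carrier ?V \<subseteq> carrier (mod_sum (quot_alg (?Vk i) (?Bk i)) (quot_alg (?Vk j) (?Bk j)))"
        using hom_closed[OF G] by blast
      show "carrier (mod_sum (quot_alg (?Vk i) (?Bk i)) (quot_alg (?Vk j) (?Bk j))) \<subseteq> ?G ` carrier ?V"
      proof
        fix C assume "C \<in> carrier (mod_sum (quot_alg (?Vk i) (?Bk i)) (quot_alg (?Vk j) (?Bk j)))"
        then obtain f1 f2 where f: "f1 \<in> ext_cocycles R (Q i) (d i) (P i) N"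
          "f2 \<in> ext_cocycles R (Q j) (d j) (P j) N"
          "C = (?Bk i +>\<^bsub>?Vk i\<^esub> f1, ?Bk j +>\<^bsub>?Vk j\<^esub> f2)"
          by (auto simp: mod_sum_def Ei.carrier_quot Ej.carrier_quot ext_space_simps(1))
        define g where "g k = (if k = i then f1 else f2)" for k
        have g: "g k \<in> ext_cocycles R (Q k) (d k) (P k) N" if "k \<in> ?J" for k
          using f(1,2) that by (auto simp: g_def)
        let ?f = "family_cotuple ?J Q N g"
        have ij_mem: "i \<in> ?J" "j \<in> ?J" and gij: "g i = f1" "g j = f2" using ij by (simp_all add: g_def)
        have c: "?f \<in> ext_cocycles R ?Q ?d ?P N" "F i ?f = f1" "F j ?f = f2"
          using cot(1)[OF g ij_mem(1)] cot(2)[OF g ij_mem(1)] cot(2)[OF g ij_mem(2)] by (simp_all only: gij)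
        have "?G ?f = C" unfolding Gf[OF c(1)] c(2,3) f(3) by (rule refl)
        moreover have "?f \<in> carrier ?V" using c(1) by (simp add: ext_space_simps(1))
        ultimately show "C \<in> ?G ` carrier ?V" by (rule image_eqI[OF sym])
      qed
    qed
    fix f assume "f \<in> carrier ?V"
    then have f: "f \<in> ext_cocycles R ?Q ?d ?P N" by (simp add: ext_space_simps)
    then have fh: "f \<in> mod_hom R ?Q N" by (simp add: ext_cocycles_def)
    have "?G f = \<zero>\<^bsub>mod_sum (quot_alg (?Vk i) (?Bk i)) (quot_alg (?Vk j) (?Bk j))\<^esub> \<longleftrightarrow>
        F i f \<in> ?Bk i \<and> F j f \<in> ?Bk j"
      unfolding Gf[OF f] using Fc[OF _ f] Ei.coset_zero_iff[of "F i f"] Ej.coset_zero_iff[of "F j f"]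
      by (simp add: mod_sum_def Ei.zero_quot Ej.zero_quot ext_space_simps(1))
    also have "\<dots> \<longleftrightarrow> (\<forall>k\<in>?J. F k f \<in> ?Bk k)" by simp
    also have "\<dots> \<longleftrightarrow> f \<in> ?B"
    proof
      assume "f \<in> ?B"
      then obtain g where g: "g \<in> mod_hom R ?P N" "f = compose (carrier ?Q) g ?d"
        by (auto simp: ext_coboundaries_def)
      show "\<forall>k\<in>?J. F k f \<in> ?Bk k"
      proof
        fix k assume k: "k \<in> ?J"
        have gin: "compose (carrier (P k)) g (family_in ?J P k) \<in> mod_hom R (P k) N"
          by (rule hom_comp[OF P[OF k] inP[OF k] g(1)])
        have Ff: "F k f = compose (carrier (Q k)) f (family_in ?J Q k)" using f by (simp add: F_def)
        have "F k f = compose (carrier (Q k)) (compose (carrier (P k)) g (family_in ?J P k)) (d k)"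
          unfolding Ff
        proof (rule mod_hom_eqI[OF hom_comp[OF Q[OF k] inQ[OF k] fh] hom_comp[OF Q[OF k] d[OF k] gin]])
          fix x assume x: "x \<in> carrier (Q k)"
          then show "compose (carrier (Q k)) f (family_in ?J Q k) x =
            compose (carrier (Q k)) (compose (carrier (P k)) g (family_in ?J P k)) (d k) x"
            using comm[OF k x] hom_closed[OF inQ[OF k] x] hom_closed[OF d[OF k] x] by (simp add: compose_eq g(2))
        qed
        then show "F k f \<in> ?Bk k" using gin by (auto simp: ext_coboundaries_def)
      qed
    next
      assume "\<forall>k\<in>?J. F k f \<in> ?Bk k"
      then have "\<forall>k\<in>?J. \<exists>g. g \<in> mod_hom R (P k) N \<and> F k f = compose (carrier (Q k)) g (d k)"
        unfolding ext_coboundaries_def by blast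
      from bchoice[OF this] obtain g where
        g: "\<forall>k\<in>?J. g k \<in> mod_hom R (P k) N \<and> F k f = compose (carrier (Q k)) (g k) (d k)" by blast
      have gh: "g k \<in> mod_hom R (P k) N" if "k \<in> ?J" for k using g that by blast
      have c: "family_cotuple ?J P N g \<in> mod_hom R ?P N" by (rule hom_family_cotuple[OF ring N P gh J])
      have "f = compose (carrier ?Q) (family_cotuple ?J P N g) ?d"
      proof (rule hom_family_eqI[OF ring N Q J fh hom_comp[OF QQ dd c]])
        fix k x assume k: "k \<in> ?J" and x: "x \<in> carrier (Q k)"
        have "f (family_in ?J Q k x) = F k f x" using f x by (simp add: F_def compose_eq)
        also have "\<dots> = g k (d k x)"
          using fun_cong[OF conjunct2[OF bspec[OF g k]], of x] x by (simp add: compose_eq)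
        also have "\<dots> = family_cotuple ?J P N g (family_in ?J P k (d k x))"
          by (rule family_cotuple_in[where L = P and f = g, OF ring N P J gh k hom_closed[OF d[OF k] x], symmetric])
        also have "\<dots> = compose (carrier ?Q) (family_cotuple ?J P N g) ?d (family_in ?J Q k x)"
          using hom_closed[OF inQ[OF k] x] by (simp add: compose_eq comm[OF k x])
        finally show "f (family_in ?J Q k x) =
          compose (carrier ?Q) (family_cotuple ?J P N g) ?d (family_in ?J Q k x)" .
      qed
      then show "f \<in> ?B" using c by (auto simp: ext_coboundaries_def)
    qed
    finally show "?G f = \<zero>\<^bsub>mod_sum (quot_alg (?Vk i) (?Bk i)) (quot_alg (?Vk j) (?Bk j))\<^esub> \<longleftrightarrow> f \<in> ?B" .
  qed
qed

section \<open>Dimension shifting\<close>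

lemma Ext_resolution:
  fixes M :: "('r, 'm) module" and N :: "('r, 'n) module"
  assumes "fg_module R M"
  obtains P :: "nat \<Rightarrow> ('r, 'r univ) module" and d e where "proj_resolution R M P d e"
    "\<And>n. Ext R (Suc n) M N = ext_quot R (P (Suc n)) (d n) (P n) N"
proof -
  have "\<exists>(P :: nat \<Rightarrow> ('r, 'r univ) module) d e. proj_resolution R M P d e"
    using resolution_exists[OF assms] by metis
  from Ext_as_quotient[OF this] that show thesis by metis
qed

lemma res_syzygy_fg:
  assumes "fg_module R M" "proj_resolution R M P d e"
  shows "fg_module R (res_syzygy P d n)"
proof (induction n)
  case 0 show ?case by (rule syzygy_of_fg[OF res_syzygy_0[OF assms(2)] fg_right_module[OF assms(1)]])
next
  case (Suc n) show ?case by (rule syzygy_of_fg[OF res_syzygy_Suc[OF assms(2)] fg_right_module[OF Suc]])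
qed

lemma vs_isomorphic_trans:
  assumes "right_module base_field V" "vs_isomorphic V V'" "vs_isomorphic V' V''"
  shows "vs_isomorphic V V''"
  using assms mod_isomorphic_trans unfolding vs_isomorphic_def by blast

lemma ext_quot_module:
  assumes "two_presents R Q d P p Z" "right_module R N"
  shows "right_module base_field (ext_quot R Q d P N)"
proof -
  note T = two_presentsD[OF assms(1)]
  interpret module_quotient base_field "ext_space R Q d P N" "ext_coboundaries R Q d P N"
    by (rule ext_space_module[OF T(4) presentsD(3)[OF T(1)] assms(2) T(5)])
  show ?thesis unfolding ext_quot_def by (rule right_module_quot)
qed

text \<open>
  By induction and Schanuel's lemma, the syzygies in a resolution of \<open>M\<close> are stably equivalent to
  the sums of \<open>W n i\<close> and \<open>W n j\<close>. So the higher Ext groups of \<open>M\<close> are first Ext groups of these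
  sums.
\<close>

theorem Ext_split:
  fixes M :: "('r, 'm) module" and N :: "('r, 'n) module" and W :: "nat \<Rightarrow> nat \<Rightarrow> ('r, 'w) module"
  assumes M: "fg_module R M" and N: "right_module R N" and ij: "i \<noteq> j"
    and Y: "syzygy_of R M Y" "stably_equivalent R Y (mod_family_sum {i, j} (W 0))"
    and W0: "\<And>k. k \<in> {i, j} \<Longrightarrow> fg_module R (W 0 k)"
    and W: "\<And>n k. k \<in> {i, j} \<Longrightarrow> syzygy_of R (W n k) (W (Suc n) k)"
  shows "vs_isomorphic (Ext R (Suc (Suc n)) M N) (mod_sum (Ext R (Suc 0) (W n i) N) (Ext R (Suc 0) (W n j) N))"
proof -
  have fgW: "fg_module R (W n k)" if "k \<in> {i, j}" for n k
  proof (induction n)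
    case 0 show ?case by (rule W0[OF that])
  next
    case (Suc n) show ?case by (rule syzygy_of_fg[OF W[OF that] fg_right_module[OF Suc]])
  qed
  have rmW: "right_module R (W n k)" if "k \<in> {i, j}" for n k by (rule fg_right_module[OF fgW[OF that]])
  have fgS: "fg_module R (mod_family_sum {i, j} (W n))" for n by (rule fg_family[OF ring _ fgW]) simp
  obtain P :: "nat \<Rightarrow> ('r, 'r univ) module" and d e where res: "proj_resolution R M P d e"
    and ExtM: "\<And>n. Ext R (Suc n) M N = ext_quot R (P (Suc n)) (d n) (P n) N"
    using Ext_resolution[OF M] by metis
  note fgK = res_syzygy_fg[OF M res]
  have fgY: "fg_module R Y" by (rule syzygy_of_fg[OF Y(1) fg_right_module[OF M]])
  have st: "stably_equivalent R (res_syzygy P d n) (mod_family_sum {i, j} (W n))" for n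
  proof (induction n)
    case 0
    have "stably_equivalent R (res_syzygy P d 0) Y"
      by (rule stably_equivalent_syzygy[OF res_syzygy_0[OF res] Y(1) M M stably_equivalent_refl[OF M]])
    then show ?case by (rule stably_equivalent_trans[OF fgK fgY fgS _ Y(2)])
  next
    case (Suc n)
    show ?case
      by (rule stably_equivalent_syzygy[OF res_syzygy_Suc[OF res] syzygy_of_family[OF ring _ rmW W] fgK fgS Suc])
        simp_all
  qed
  have "\<forall>k\<in>{i, j}. \<exists>(P :: nat \<Rightarrow> ('r, 'r univ) module) d e. proj_resolution R (W n k) P d e \<and>
      Ext R (Suc 0) (W n k) N = ext_quot R (P (Suc 0)) (d 0) (P 0) N"
    using Ext_resolution[OF fgW, where N = N] by metis
  from this[unfolded bchoice_iff] obtain P' :: "nat \<Rightarrow> nat \<Rightarrow> ('r, 'r univ) module" and d' e'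
    where T: "\<forall>k\<in>{i, j}. proj_resolution R (W n k) (P' k) (d' k) (e' k) \<and>
      Ext R (Suc 0) (W n k) N = ext_quot R (P' k (Suc 0)) (d' k 0) (P' k 0) N" by blast
  let ?Q1 = "\<lambda>k. P' k (Suc 0)" and ?Q0 = "\<lambda>k. P' k 0" and ?\<delta> = "\<lambda>k. d' k 0"
  have TW: "two_presents R (?Q1 k) (?\<delta> k) (?Q0 k) (e' k) (W n k)"
    and ExtW: "Ext R (Suc 0) (W n k) N = ext_quot R (?Q1 k) (?\<delta> k) (?Q0 k) N" if "k \<in> {i, j}" for k
    using T that res_two_presents_0 by blast+
  note D = two_presentsD[OF TW]
  have TT: "two_presents R (mod_family_sum {i, j} ?Q1) (family_map {i, j} ?Q1 ?\<delta>) (mod_family_sum {i, j} ?Q0)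
      (family_map {i, j} ?Q0 e') (mod_family_sum {i, j} (W n))"
    by (rule two_presents_family[OF ring _ rmW TW]) simp_all
  note TM = res_two_presents[OF res, of n]
  have "vs_isomorphic (Ext R (Suc (Suc n)) M N)
    (ext_quot R (mod_family_sum {i, j} ?Q1) (family_map {i, j} ?Q1 ?\<delta>) (mod_family_sum {i, j} ?Q0) N)"
    unfolding ExtM by (rule ext_quot_stable[OF TT TM fgS fgK N stably_equivalent_sym[OF st]])
  moreover have "vs_isomorphic
    (ext_quot R (mod_family_sum {i, j} ?Q1) (family_map {i, j} ?Q1 ?\<delta>) (mod_family_sum {i, j} ?Q0) N)
    (mod_sum (Ext R (Suc 0) (W n i) N) (Ext R (Suc 0) (W n j) N))"
    using ext_quot_pair[OF ij N D(4) presentsD(3)[OF D(1)] D(5)] by (simp add: ExtW)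
  ultimately show ?thesis
    by (rule vs_isomorphic_trans[rotated]) (unfold ExtM, rule ext_quot_module[OF TM N])
qed

text \<open>
  The stable class of a syzygy determines the Ext groups above it and all later syzygies, so it
  suffices that it recurs once.
\<close>

theorem Ext_periodic:
  fixes M :: "('r, 'm) module" and N :: "('r, 'n) module" and V :: "nat \<Rightarrow> ('r, 'w) module"
  assumes M: "fg_module R M" and N: "right_module R N"
    and Y: "syzygy_of R M Y" "stably_equivalent R Y (V 0)"
    and V: "fg_module R (V 0)" "\<And>n. n < t \<Longrightarrow> syzygy_of R (V n) (V (Suc n))" "stably_equivalent R (V t) (V 0)"
  shows "vs_isomorphic (Ext R (Suc (Suc n)) M N) (Ext R (Suc (Suc (n + t))) M N)"
proof -
  have fgV: "fg_module R (V n)" if "n \<le> t" for n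
    using that
  proof (induction n)
    case 0 show ?case by (rule V)
  next
    case (Suc n) then show ?case by (intro syzygy_of_fg[OF V(2)] fg_right_module) auto
  qed
  obtain P :: "nat \<Rightarrow> ('r, 'r univ) module" and d e where res: "proj_resolution R M P d e"
    and ExtM: "\<And>n. Ext R (Suc n) M N = ext_quot R (P (Suc n)) (d n) (P n) N"
    using Ext_resolution[OF M] by metis
  note fgK = res_syzygy_fg[OF M res]
  have fgY: "fg_module R Y" by (rule syzygy_of_fg[OF Y(1) fg_right_module[OF M]])
  have "stably_equivalent R (res_syzygy P d 0) Y"
    by (rule stably_equivalent_syzygy[OF res_syzygy_0[OF res] Y(1) M M stably_equivalent_refl[OF M]])
  then have st0: "stably_equivalent R (res_syzygy P d 0) (V 0)"
    by (rule stably_equivalent_trans[OF fgK fgY V(1) _ Y(2)])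
  have st: "stably_equivalent R (res_syzygy P d n) (V n)" if "n \<le> t" for n
    using that
  proof (induction n)
    case 0 show ?case by (rule st0)
  next
    case (Suc n)
    show ?case
      by (rule stably_equivalent_syzygy[OF res_syzygy_Suc[OF res] V(2) fgK fgV Suc.IH]) (use Suc.prems in auto)
  qed
  have per: "stably_equivalent R (res_syzygy P d n) (res_syzygy P d (n + t))" for n
  proof (induction n)
    case 0
    have "stably_equivalent R (res_syzygy P d 0) (V t)"
      by (rule stably_equivalent_trans[OF fgK V(1) fgV[OF order_refl] st0 stably_equivalent_sym[OF V(3)]])
    then have "stably_equivalent R (res_syzygy P d 0) (res_syzygy P d t)"
      by (rule stably_equivalent_trans[OF fgK fgV[OF order_refl] fgK _ stably_equivalent_sym[OF st[OF order_refl]]])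
    then show ?case by simp
  next
    case (Suc n)
    show ?case
      using stably_equivalent_syzygy[OF res_syzygy_Suc[OF res] res_syzygy_Suc[OF res] fgK fgK Suc] by simp
  qed
  show ?thesis
    unfolding ExtM
    by (rule ext_quot_stable[OF res_two_presents[OF res] res_two_presents[OF res] fgK fgK N
          stably_equivalent_sym[OF per]])
qed

end

section \<open>Path algebras modulo quadratic monomial relations\<close>

definition path_end :: "('v, 'a) pre_digraph \<Rightarrow> 'v \<Rightarrow> 'a list \<Rightarrow> 'v" where
  "path_end Q v p = (if p = [] then v else head Q (last p))"

lemma path_end_Nil [simp]: "path_end Q v [] = v"
  by (simp add: path_end_def)

lemma path_end_append: "path_end Q v (p @ q) = path_end Q (path_end Q v p) q"
  by (simp add: path_end_def)

lemma path_end_snoc [simp]: "path_end Q v (p @ [a]) = head Q a"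
  by (simp add: path_end_def)

lemma awlast_path_end: "last (pre_digraph.awalk_verts Q v p) = path_end Q v p"
proof (induction p arbitrary: v)
  case (Cons a p)
  have "pre_digraph.awalk_verts Q w q \<noteq> []" for w q by (cases q) (simp_all add: pre_digraph.awalk_verts.simps)
  with Cons show ?case by (simp add: pre_digraph.awalk_verts.simps path_end_def)
qed (simp add: pre_digraph.awalk_verts.simps)

lemma path_algebra_simps:
  shows "carrier (path_algebra Q) = {x. finite {p. x p \<noteq> (0 :: 'k :: field)} \<and> {p. x p \<noteq> 0} \<subseteq> qpaths Q}"
    and "\<zero>\<^bsub>path_algebra Q\<^esub> = (\<lambda>p. 0 :: 'k)"
    and "x \<oplus>\<^bsub>path_algebra Q\<^esub> y = (\<lambda>p. x p + y p :: 'k)"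
    and "c \<odot>\<^bsub>path_algebra Q\<^esub> x = (\<lambda>p. c * x p :: 'k)"
    and "\<one>\<^bsub>path_algebra Q\<^esub> (v, p) = (if v \<in> verts Q \<and> p = [] then 1 else 0 :: 'k)"
    and "(x \<otimes>\<^bsub>path_algebra Q\<^esub> y) (v, p) =
      (\<Sum>i\<le>length p. x (v, take i p) * y (path_end Q v (take i p), drop i p) :: 'k)"
  by (simp_all add: path_algebra_def awlast_path_end)

lemma sum_atMost_single:
  fixes f :: "nat \<Rightarrow> 'k :: comm_monoid_add"
  assumes "\<And>i. i \<le> n \<Longrightarrow> i \<noteq> m \<Longrightarrow> f i = 0" "m \<le> n"
  shows "(\<Sum>i\<le>n. f i) = f m"
proof -
  have "(\<Sum>i\<le>n. f i) = (\<Sum>i\<in>{m}. f i)"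
    by (rule sum.mono_neutral_right) (use assms in auto)
  then show ?thesis by simp
qed

lemma mult_path_elt_right:
  "(x \<otimes>\<^bsub>path_algebra Q\<^esub> path_elt (w, q)) (v, r) =
    (if \<exists>r'. r = r' @ q \<and> path_end Q v r' = w then x (v, take (length r - length q) r) else (0 :: 'k :: field))"
proof (cases "\<exists>r'. r = r' @ q \<and> path_end Q v r' = w")
  case True
  then obtain r' where r: "r = r' @ q" "path_end Q v r' = w" by blast
  have "(x \<otimes>\<^bsub>path_algebra Q\<^esub> path_elt (w, q)) (v, r) =
    x (v, take (length r') r) * path_elt (w, q) (path_end Q v (take (length r') r), drop (length r') r)"
    unfolding path_algebra_simps
  proof (rule sum_atMost_single)
    fix i assume i: "i \<le> length r" "i \<noteq> length r'"
    have ne: "drop i r \<noteq> q"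
    proof
      assume "drop i r = q"
      then have "length r - i = length q" by (metis length_drop)
      then show False using i r by simp
    qed
    show "x (v, take i r) * path_elt (w, q) (path_end Q v (take i r), drop i r) = 0"
      unfolding path_elt_def using ne by auto
  qed (simp add: r)
  then show ?thesis using r by (simp add: path_elt_def)
next
  case False
  have "x (v, take i r) * path_elt (w, q) (path_end Q v (take i r), drop i r) = 0" for i
  proof -
    have "r = take i r @ drop i r" by simp
    then have ne: "(path_end Q v (take i r), drop i r) \<noteq> (w, q)" using False by (metis prod.inject)
    have "path_elt (w, q) (path_end Q v (take i r), drop i r) = (0 :: 'k)"
      unfolding path_elt_def using ne by (rule if_not_P)
    then show ?thesis by simp
  qed
  then have "(\<Sum>i\<le>length r. x (v, take i r) * path_elt (w, q) (path_end Q v (take i r), drop i r)) = 0"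
    by (intro sum.neutral) blast
  then show ?thesis unfolding path_algebra_simps using False by (simp only: if_False)
qed

locale monomial_quiver = wf_digraph Q for Q :: "('v, 'a) pre_digraph" +
  fixes S :: "('v \<times> 'a list) set"
  assumes finite_verts: "finite (verts Q)"
    and quadratic: "S \<subseteq> {p \<in> qpaths Q. length (snd p) = 2}"
begin

lemma qpaths_append: "(v, p @ q) \<in> qpaths Q \<longleftrightarrow> (v, p) \<in> qpaths Q \<and> (path_end Q v p, q) \<in> qpaths Q"
proof -
  have "(v, p @ q) \<in> qpaths Q \<longleftrightarrow> (\<exists>u. awalk v p (awlast v p) \<and> awalk (awlast v p) q u)"
    by (auto simp: qpaths_def awalk_append_iff)
  also have "\<dots> \<longleftrightarrow> (v, p) \<in> qpaths Q \<and> (path_end Q v p, q) \<in> qpaths Q"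
  proof -
    have "awalk v p (awlast v p) \<longleftrightarrow> (\<exists>u. awalk v p u)" 
    proof
      assume "\<exists>u. awalk v p u"
      then obtain u where "awalk v p u" by blast
      moreover from this have "awlast v p = u" by simp
      ultimately show "awalk v p (awlast v p)" by simp
    qed blast
    then show ?thesis by (simp add: qpaths_def awlast_path_end)
  qed
  finally show ?thesis .
qed

lemma qpaths_Nil: "(v, []) \<in> qpaths Q \<longleftrightarrow> v \<in> verts Q"
  by (auto simp: qpaths_def awalk_Nil_iff)

lemma qpaths_Cons: "(v, a # p) \<in> qpaths Q \<longleftrightarrow> a \<in> arcs Q \<and> tail Q a = v \<and> (head Q a, p) \<in> qpaths Q"
  by (auto simp: qpaths_def awalk_Cons_iff)

lemma qpaths_arrow: "a \<in> arcs Q \<Longrightarrow> (tail Q a, [a]) \<in> qpaths Q"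
  by (simp add: qpaths_Cons qpaths_Nil)

lemma qpaths_end: "(v, p) \<in> qpaths Q \<Longrightarrow> path_end Q v p \<in> verts Q"
  using qpaths_append[of v p "[]"] by (simp add: qpaths_Nil)

lemma qpaths_start: "(v, p) \<in> qpaths Q \<Longrightarrow> v \<in> verts Q"
  by (auto simp: qpaths_def awalk_def)

lemma ring_path_algebra: "ring (path_algebra Q :: ('k :: field, 'v \<times> 'a list \<Rightarrow> 'k) module)"
proof (rule ringI)
  let ?A = "path_algebra Q :: ('k, 'v \<times> 'a list \<Rightarrow> 'k) module"
  note s = path_algebra_simps
  have closed: "x \<otimes>\<^bsub>?A\<^esub> y \<in> carrier ?A" if x: "x \<in> carrier ?A" and y: "y \<in> carrier ?A" for x y
  proof -
    let ?sx = "{p. x p \<noteq> 0}" and ?sy = "{p. y p \<noteq> 0}"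
    have sub: "\<exists>i. x (v, take i p) \<noteq> 0 \<and> y (path_end Q v (take i p), drop i p) \<noteq> 0"
      if "(x \<otimes>\<^bsub>?A\<^esub> y) (v, p) \<noteq> 0" for v p
    proof -
      from that obtain i where "x (v, take i p) * y (path_end Q v (take i p), drop i p) \<noteq> 0"
        unfolding s by (meson sum.not_neutral_contains_not_neutral)
      then show ?thesis by auto
    qed
    have "{p. (x \<otimes>\<^bsub>?A\<^esub> y) p \<noteq> 0} \<subseteq> (\<lambda>((v, p), (w, q)). (v, p @ q)) ` (?sx \<times> ?sy)"
    proof
      fix vp assume "vp \<in> {p. (x \<otimes>\<^bsub>?A\<^esub> y) p \<noteq> 0}"
      then obtain v p where vp: "vp = (v, p)" "(x \<otimes>\<^bsub>?A\<^esub> y) (v, p) \<noteq> 0" by (cases vp) auto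
      from sub[OF vp(2)] obtain i where
        "x (v, take i p) \<noteq> 0" "y (path_end Q v (take i p), drop i p) \<noteq> 0" by blast
      then show "vp \<in> (\<lambda>((v, p), (w, q)). (v, p @ q)) ` (?sx \<times> ?sy)"
        by (intro image_eqI[of _ _ "((v, take i p), (path_end Q v (take i p), drop i p))"]) (simp_all add: vp)
    qed
    moreover have "finite (?sx \<times> ?sy)" using x y by (simp add: s)
    ultimately have fin: "finite {p. (x \<otimes>\<^bsub>?A\<^esub> y) p \<noteq> 0}" using finite_surj by blast
    have "(v, p) \<in> qpaths Q" if nz: "(x \<otimes>\<^bsub>?A\<^esub> y) (v, p) \<noteq> 0" for v p
    proof -
      from sub[OF nz] obtain i where
        "x (v, take i p) \<noteq> 0" "y (path_end Q v (take i p), drop i p) \<noteq> 0" by blast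
      then have "(v, take i p) \<in> qpaths Q" "(path_end Q v (take i p), drop i p) \<in> qpaths Q"
        using x y by (auto simp: s)
      then show ?thesis using qpaths_append[of v "take i p" "drop i p"] by simp
    qed
    with fin show ?thesis by (auto simp: s(1))
  qed
  have sum_closed: "x \<oplus>\<^bsub>?A\<^esub> y \<in> carrier ?A" if "x \<in> carrier ?A" "y \<in> carrier ?A" for x y
  proof -
    have "{p. x p + y p \<noteq> 0} \<subseteq> {p. x p \<noteq> 0} \<union> {p. y p \<noteq> 0}" by auto
    moreover have "finite ({p. x p \<noteq> 0} \<union> {p. y p \<noteq> 0})" using that by (simp add: s)
    ultimately have "finite {p. x p + y p \<noteq> 0}" by (rule finite_subset)
    moreover have "{p. x p + y p \<noteq> 0} \<subseteq> qpaths Q"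
      using \<open>{p. x p + y p \<noteq> 0} \<subseteq> _\<close> that by (auto simp: s(1))
    ultimately show ?thesis by (simp add: s(1,3))
  qed
  have one: "\<one>\<^bsub>?A\<^esub> \<in> carrier ?A"
  proof -
    have "{p. \<one>\<^bsub>?A\<^esub> p \<noteq> 0} \<subseteq> (\<lambda>v. (v, [])) ` verts Q"
    proof
      fix q assume "q \<in> {p. \<one>\<^bsub>?A\<^esub> p \<noteq> 0}"
      then show "q \<in> (\<lambda>v. (v, [])) ` verts Q" by (cases q) (auto simp: s split: if_splits)
    qed
    then show ?thesis
      using finite_verts finite_subset[of "{p. \<one>\<^bsub>?A\<^esub> p \<noteq> 0}" "(\<lambda>v. (v, [])) ` verts Q"]
      by (auto simp: s(1) qpaths_Nil)
  qed
  show "abelian_group ?A"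
  proof (rule abelian_groupI)
    show "\<exists>y\<in>carrier ?A. y \<oplus>\<^bsub>?A\<^esub> x = \<zero>\<^bsub>?A\<^esub>" if "x \<in> carrier ?A" for x
      using that by (intro bexI[of _ "\<lambda>p. - x p"]) (auto simp: s)
  qed (use sum_closed in \<open>auto simp: s\<close>)
  show "Group.monoid ?A"
  proof (rule Group.monoidI)
    fix x y z assume xyz: "x \<in> carrier ?A" "y \<in> carrier ?A" "z \<in> carrier ?A"
    show "x \<otimes>\<^bsub>?A\<^esub> y \<in> carrier ?A" using xyz closed by blast
    show "x \<otimes>\<^bsub>?A\<^esub> y \<otimes>\<^bsub>?A\<^esub> z = x \<otimes>\<^bsub>?A\<^esub> (y \<otimes>\<^bsub>?A\<^esub> z)"
    proof (rule ext, safe)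
      fix v :: 'v and p :: "'a list"
      let ?n = "length p"
      let ?g = "\<lambda>j k. x (v, take j p) * (y (path_end Q v (take j p), take k (drop j p)) *
        z (path_end Q v (take (j + k) p), drop (j + k) p))"
      \<comment> \<open>Both sides sum over all ways to cut the path into three pieces.\<close>
      have "(x \<otimes>\<^bsub>?A\<^esub> y \<otimes>\<^bsub>?A\<^esub> z) (v, p) = (\<Sum>i\<le>?n. \<Sum>j\<le>i. ?g j (i - j))"
        unfolding s
        by (intro sum.cong refl)
          (auto simp: sum_distrib_right mult.assoc min_def drop_take intro!: sum.cong)
      also have "\<dots> = (\<Sum>(j, k)\<in>{(j, k). j + k \<le> ?n}. ?g j k)" by (rule sum.triangle_reindex_eq[symmetric])
      also have "{(j, k). j + k \<le> ?n} = Sigma {..?n} (\<lambda>j. {..?n - j})" by auto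
      also have "(\<Sum>(j, k)\<in>Sigma {..?n} (\<lambda>j. {..?n - j}). ?g j k) = (\<Sum>j\<le>?n. \<Sum>k\<le>?n - j. ?g j k)"
        by (rule sum.Sigma[symmetric]) auto
      also have "\<dots> = (x \<otimes>\<^bsub>?A\<^esub> (y \<otimes>\<^bsub>?A\<^esub> z)) (v, p)"
        unfolding s
        by (intro sum.cong refl)
          (auto simp: sum_distrib_left take_add path_end_append add.commute intro!: sum.cong)
      finally show "(x \<otimes>\<^bsub>?A\<^esub> y \<otimes>\<^bsub>?A\<^esub> z) (v, p) = (x \<otimes>\<^bsub>?A\<^esub> (y \<otimes>\<^bsub>?A\<^esub> z)) (v, p)" .
    qed
    show "\<one>\<^bsub>?A\<^esub> \<otimes>\<^bsub>?A\<^esub> x = x"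
    proof (rule ext, safe)
      fix v :: 'v and p :: "'a list"
      have "(\<one>\<^bsub>?A\<^esub> \<otimes>\<^bsub>?A\<^esub> x) (v, p) = \<one>\<^bsub>?A\<^esub> (v, take 0 p) * x (path_end Q v (take 0 p), drop 0 p)"
        unfolding s(6) by (rule sum_atMost_single) (auto simp: s(5))
      also have "\<dots> = x (v, p)"
        using xyz(1) qpaths_start by (auto simp: s(1,5))
      finally show "(\<one>\<^bsub>?A\<^esub> \<otimes>\<^bsub>?A\<^esub> x) (v, p) = x (v, p)" .
    qed
    show "x \<otimes>\<^bsub>?A\<^esub> \<one>\<^bsub>?A\<^esub> = x"
    proof (rule ext, safe)
      fix v :: 'v and p :: "'a list"
      have "(x \<otimes>\<^bsub>?A\<^esub> \<one>\<^bsub>?A\<^esub>) (v, p) =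
        x (v, take (length p) p) * \<one>\<^bsub>?A\<^esub> (path_end Q v (take (length p) p), drop (length p) p)"
        unfolding s(6) by (rule sum_atMost_single) (auto simp: s(5))
      also have "\<dots> = x (v, p)"
        using xyz(1) qpaths_end by (auto simp: s(1,5))
      finally show "(x \<otimes>\<^bsub>?A\<^esub> \<one>\<^bsub>?A\<^esub>) (v, p) = x (v, p)" .
    qed
  qed (rule one)
  fix x y z :: "'v \<times> 'a list \<Rightarrow> 'k"
  show "(x \<oplus>\<^bsub>?A\<^esub> y) \<otimes>\<^bsub>?A\<^esub> z = x \<otimes>\<^bsub>?A\<^esub> z \<oplus>\<^bsub>?A\<^esub> y \<otimes>\<^bsub>?A\<^esub> z"
    by (rule ext, safe) (simp add: s distrib_right sum.distrib)
  show "z \<otimes>\<^bsub>?A\<^esub> (x \<oplus>\<^bsub>?A\<^esub> y) = z \<otimes>\<^bsub>?A\<^esub> x \<oplus>\<^bsub>?A\<^esub> z \<otimes>\<^bsub>?A\<^esub> y"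
    by (rule ext, safe) (simp add: s distrib_left sum.distrib)
qed

text \<open>The residue classes of these paths form a basis of the path algebra modulo \<open>S\<close>.\<close>

definition nonzero_path :: "'v \<times> 'a list \<Rightarrow> bool" where
  "nonzero_path q \<longleftrightarrow> q \<in> qpaths Q \<and> successively (\<lambda>\<alpha> \<beta>. (tail Q \<alpha>, [\<alpha>, \<beta>]) \<notin> S) (snd q)"

lemma nonzero_path_append:
  "nonzero_path (v, p @ q) \<longleftrightarrow> nonzero_path (v, p) \<and> nonzero_path (path_end Q v p, q) \<and>
    (p = [] \<or> q = [] \<or> (tail Q (last p), [last p, hd q]) \<notin> S)"
  by (auto simp: nonzero_path_def qpaths_append successively_append_iff)

lemma nonzero_path_take_drop:
  assumes "nonzero_path (v, p)"
  shows "nonzero_path (v, take i p)" "nonzero_path (path_end Q v (take i p), drop i p)"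
  using assms nonzero_path_append[of v "take i p" "drop i p"] by simp_all

lemma nonzero_path_qpath: "nonzero_path q \<Longrightarrow> q \<in> qpaths Q"
  by (simp add: nonzero_path_def)

lemma nonzero_path_Nil: "nonzero_path (v, []) \<longleftrightarrow> v \<in> verts Q"
  by (simp add: nonzero_path_def qpaths_Nil)

lemma nonzero_path_arrow: "a \<in> arcs Q \<Longrightarrow> nonzero_path (tail Q a, [a])"
  by (simp add: nonzero_path_def qpaths_arrow)

lemma path_elt_carrier: "q \<in> qpaths Q \<Longrightarrow> (path_elt q :: _ \<Rightarrow> 'k :: field) \<in> carrier (path_algebra Q)"
proof -
  assume q: "q \<in> qpaths Q"
  have "{p. path_elt q p \<noteq> (0 :: 'k)} = {q}" by (auto simp: path_elt_def)
  then show ?thesis using q by (simp add: path_algebra_simps(1))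
qed

lemma path_elt_mult:
  "path_elt (v, p) \<otimes>\<^bsub>path_algebra Q\<^esub> path_elt (path_end Q v p, q) = (path_elt (v, p @ q) :: _ \<Rightarrow> 'k :: field)"
proof (rule ext, safe)
  fix w r
  show "(path_elt (v, p) \<otimes>\<^bsub>path_algebra Q\<^esub> path_elt (path_end Q v p, q)) (w, r) =
    (path_elt (v, p @ q) (w, r) :: 'k)"
    unfolding mult_path_elt_right by (auto simp: path_elt_def)
qed

abbreviation relation_ideal :: "('v \<times> 'a list \<Rightarrow> 'k :: field) set" where
  "relation_ideal \<equiv> Idl\<^bsub>path_algebra Q\<^esub> (path_elt ` S)"

text \<open>
  The set on the right is an ideal, since subpaths of a path without subpath in \<open>S\<close> have no
  subpath in \<open>S\<close> either. Conversely, every other path is a multiple of a generator.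
\<close>

lemma relation_ideal_eq:
  "relation_ideal = {x \<in> carrier (path_algebra Q). \<forall>q. nonzero_path q \<longrightarrow> x q = (0 :: 'k :: field)}"
  (is "_ = ?J")
proof
  let ?A = "path_algebra Q :: ('k, 'v \<times> 'a list \<Rightarrow> 'k) module"
  interpret A: ring ?A by (rule ring_path_algebra)
  note s = path_algebra_simps
  have SA: "(path_elt ` S :: ('v \<times> 'a list \<Rightarrow> 'k) set) \<subseteq> carrier ?A"
    using quadratic path_elt_carrier by auto
  interpret I: ideal "relation_ideal :: ('v \<times> 'a list \<Rightarrow> 'k) set" ?A by (rule A.genideal_ideal[OF SA])
  have J: "ideal ?J ?A"
  proof (rule idealI[OF ring_path_algebra])
    show "subgroup ?J (add_monoid ?A)"
    proof (rule A.add.subgroupI)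
      show "?J \<subseteq> carrier ?A" by auto
      show "?J \<noteq> {}" using A.zero_closed by (auto simp: s(2) intro!: exI[of _ "\<lambda>p. 0"])
      fix x y assume x: "x \<in> ?J" and y: "y \<in> ?J"
      have "(\<lambda>p. - x p) \<in> carrier ?A" "(\<lambda>p. - x p) \<oplus>\<^bsub>?A\<^esub> x = \<zero>\<^bsub>?A\<^esub>" using x by (auto simp: s)
      then have "\<ominus>\<^bsub>?A\<^esub> x = (\<lambda>p. - x p)" using x A.minus_equality by blast
      then show "\<ominus>\<^bsub>?A\<^esub> x \<in> ?J" using x by (auto simp: s(1))
      show "x \<oplus>\<^bsub>?A\<^esub> y \<in> ?J" using A.a_closed[of x y] x y by (auto simp: s(3))
    qed
    fix x y assume x: "x \<in> ?J" and y: "y \<in> carrier ?A"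
    have "(y \<otimes>\<^bsub>?A\<^esub> x) (v, p) = 0" "(x \<otimes>\<^bsub>?A\<^esub> y) (v, p) = 0" if "nonzero_path (v, p)" for v p
      using x nonzero_path_take_drop[OF that] by (auto simp: s(6) intro!: sum.neutral)
    then show "y \<otimes>\<^bsub>?A\<^esub> x \<in> ?J" "x \<otimes>\<^bsub>?A\<^esub> y \<in> ?J"
      using x y A.m_closed[of x y] A.m_closed[of y x] by auto
  qed
  have "(path_elt ` S :: ('v \<times> 'a list \<Rightarrow> 'k) set) \<subseteq> ?J"
  proof
    fix x :: "'v \<times> 'a list \<Rightarrow> 'k" assume "x \<in> path_elt ` S"
    then obtain v p where q: "(v, p) \<in> S" "x = path_elt (v, p)" by auto
    then have "(v, p) \<in> qpaths Q" "length p = 2" using quadratic by auto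
    then obtain a b where p: "p = [a, b]" by (auto simp: length_Suc_conv numeral_2_eq_2)
    have "tail Q a = v" using \<open>(v, p) \<in> qpaths Q\<close> by (simp add: p qpaths_Cons)
    then have "\<not> nonzero_path (v, p)" using q by (simp add: nonzero_path_def p)
    then show "x \<in> ?J" using q SA by (auto simp: path_elt_def)
  qed
  then show "relation_ideal \<subseteq> ?J" by (rule A.genideal_minimal[OF J])
  have elt: "c \<odot>\<^bsub>?A\<^esub> path_elt q \<in> relation_ideal" if q: "q \<in> qpaths Q" "\<not> nonzero_path q" for q and c :: 'k
  proof -
    obtain v p where vp: "q = (v, p)" by (cases q)
    from q obtain i where i: "Suc i < length p" "(tail Q (p ! i), [p ! i, p ! Suc i]) \<in> S"
      unfolding nonzero_path_def vp by (auto simp: successively_conv_nth)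
    let ?p1 = "take i p" and ?p2 = "drop (Suc (Suc i)) p" and ?r = "[p ! i, p ! Suc i]"
    have p: "p = ?p1 @ ?r @ ?p2" using i(1) by (metis Cons_nth_drop_Suc Suc_lessD append_Cons append_Nil append_take_drop_id)
    let ?w = "path_end Q v ?p1"
    have wr: "(v, ?p1) \<in> qpaths Q" "(?w, ?r) \<in> qpaths Q" "(path_end Q ?w ?r, ?p2) \<in> qpaths Q"
      using q(1) unfolding vp by (subst (asm) p, simp only: qpaths_append)+
    then have "tail Q (p ! i) = ?w" by (simp add: qpaths_Cons)
    then have r: "(?w, ?r) \<in> S" using i(2) by simp
    have "(path_elt (?w, ?r) :: _ \<Rightarrow> 'k) \<in> relation_ideal" using A.genideal_self[OF SA] r by auto
    then have "(c \<odot>\<^bsub>?A\<^esub> path_elt (v, ?p1)) \<otimes>\<^bsub>?A\<^esub> (path_elt (?w, ?r) \<otimes>\<^bsub>?A\<^esub> path_elt (path_end Q ?w ?r, ?p2))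
      \<in> relation_ideal"
      using path_elt_carrier[OF wr(1), where 'k = 'k] path_elt_carrier[OF wr(3), where 'k = 'k]
      by (intro I.I_l_closed I.I_r_closed) (auto simp: s(1,4))
    also have "path_elt (?w, ?r) \<otimes>\<^bsub>?A\<^esub> path_elt (path_end Q ?w ?r, ?p2) = path_elt (?w, ?r @ ?p2)"
      by (rule path_elt_mult)
    also have "(c \<odot>\<^bsub>?A\<^esub> path_elt (v, ?p1)) \<otimes>\<^bsub>?A\<^esub> path_elt (?w, ?r @ ?p2) =
      c \<odot>\<^bsub>?A\<^esub> (path_elt (v, ?p1) \<otimes>\<^bsub>?A\<^esub> path_elt (?w, ?r @ ?p2))"
      by (rule ext, safe) (simp add: s sum_distrib_left mult.assoc)
    also have "path_elt (v, ?p1) \<otimes>\<^bsub>?A\<^esub> path_elt (?w, ?r @ ?p2) = path_elt (v, ?p1 @ ?r @ ?p2)"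
      by (rule path_elt_mult)
    finally show ?thesis unfolding vp p[symmetric] .
  qed
  have "x \<in> relation_ideal" if "finite F" "x \<in> ?J" "{q. x q \<noteq> 0} \<subseteq> F" for F x
    using that
  proof (induction F arbitrary: x)
    case empty
    then have "x = \<zero>\<^bsub>?A\<^esub>" by (auto simp: s(2))
    then show ?case by (simp add: I.a_subgroup additive_subgroup.zero_closed I.is_additive_subgroup)
  next
    case (insert q F)
    let ?y = "\<lambda>p. if p = q then 0 else x p"
    have fin: "finite {p. x p \<noteq> 0}" using insert.hyps insert.prems(2) by (meson finite.insertI finite_subset)
    have "{p. ?y p \<noteq> 0} \<subseteq> {p. x p \<noteq> 0}" by auto
    then have y: "?y \<in> ?J" using insert.prems(1) finite_subset[OF _ fin] by (auto simp: s(1))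
    have "?y \<in> relation_ideal" by (rule insert.IH[OF y]) (use insert.prems(2) in auto)
    moreover have "x q \<odot>\<^bsub>?A\<^esub> path_elt q \<in> relation_ideal"
    proof (cases "x q = 0")
      case True
      then have "x q \<odot>\<^bsub>?A\<^esub> path_elt q = \<zero>\<^bsub>?A\<^esub>" by (simp add: s)
      then show ?thesis by (simp add: additive_subgroup.zero_closed I.is_additive_subgroup)
    next
      case False
      then have "q \<in> qpaths Q" using insert.prems(1) by (auto simp: s(1))
      moreover have "\<not> nonzero_path q" using False insert.prems(1) by blast
      ultimately show ?thesis by (rule elt)
    qed
    ultimately have "?y \<oplus>\<^bsub>?A\<^esub> x q \<odot>\<^bsub>?A\<^esub> path_elt q \<in> relation_ideal"
      by (rule additive_subgroup.a_closed[OF I.is_additive_subgroup])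
    moreover have "?y \<oplus>\<^bsub>?A\<^esub> x q \<odot>\<^bsub>?A\<^esub> path_elt q = x" by (auto simp: s path_elt_def)
    ultimately show ?case by simp
  qed
  then show "?J \<subseteq> relation_ideal" by (auto simp: s(1))
qed

lemma arrow_prod_in_ideal_iff:
  assumes "a \<in> arcs Q" "b \<in> arcs Q" "head Q a = tail Q b"
  shows "(arrow_prod Q a b :: _ \<Rightarrow> 'k :: field) \<in> relation_ideal \<longleftrightarrow> (tail Q a, [a, b]) \<in> S"
proof -
  have "(tail Q a, [a, b]) \<in> qpaths Q" using assms by (simp add: qpaths_Cons qpaths_Nil)
  then show ?thesis
    unfolding relation_ideal_eq using path_elt_carrier[where 'k = 'k]
    by (auto simp: path_elt_def nonzero_path_def)
qed

end

lemma ring_quot_alg: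
  assumes "ideal I A"
  shows "ring (quot_alg A I)"
proof -
  interpret Q: ring "A Quot I" by (rule ideal.quotient_is_ring[OF assms])
  have eqs: "carrier (quot_alg A I) = carrier (A Quot I)" "\<zero>\<^bsub>quot_alg A I\<^esub> = \<zero>\<^bsub>A Quot I\<^esub>"
    "\<one>\<^bsub>quot_alg A I\<^esub> = \<one>\<^bsub>A Quot I\<^esub>" "x \<oplus>\<^bsub>quot_alg A I\<^esub> y = x \<oplus>\<^bsub>A Quot I\<^esub> y"
    "x \<otimes>\<^bsub>quot_alg A I\<^esub> y = x \<otimes>\<^bsub>A Quot I\<^esub> y" for x y
    by (simp_all add: quot_alg_def)
  show ?thesis
  proof (rule ringI)
    show "abelian_group (quot_alg A I)"
    proof (rule abelian_groupI)
      show "\<exists>y\<in>carrier (quot_alg A I). y \<oplus>\<^bsub>quot_alg A I\<^esub> x = \<zero>\<^bsub>quot_alg A I\<^esub>"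
        if "x \<in> carrier (quot_alg A I)" for x
        using that Q.l_neg Q.a_inv_closed unfolding eqs by blast
    qed (simp_all add: eqs Q.a_ac)
    show "Group.monoid (quot_alg A I)"
      by (rule Group.monoidI) (simp_all add: eqs Q.m_assoc)
  qed (simp_all add: eqs Q.l_distr Q.r_distr)
qed

locale monomial_algebra = monomial_quiver Q S for Q :: "('v, 'a) pre_digraph" and S +
  fixes I :: "('v \<times> 'a list \<Rightarrow> 'k :: field) set"
  assumes I_def: "I = relation_ideal"
    and finite_arcs: "finite (arcs Q)"
    and bounded: "\<exists>m. \<forall>q. nonzero_path q \<longrightarrow> length (snd q) < m"
begin

abbreviation A :: "('k, 'v \<times> 'a list \<Rightarrow> 'k) module" where "A \<equiv> path_algebra Q"

abbreviation R :: "('k, ('v \<times> 'a list \<Rightarrow> 'k) set) module" where "R \<equiv> bound_algebra Q I"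

lemma I_eq: "I = {x \<in> carrier A. \<forall>q. nonzero_path q \<longrightarrow> x q = 0}"
  unfolding I_def by (rule relation_ideal_eq)

lemma ideal_I: "ideal I A"
proof -
  interpret A: ring A by (rule ring_path_algebra)
  show ?thesis
    unfolding I_def by (rule A.genideal_ideal) (use quadratic path_elt_carrier in auto)
qed

sublocale A: ring A by (rule ring_path_algebra)

sublocale I: ideal I A by (rule ideal_I)

lemma vector_space_A: "right_module base_field A"
proof (rule right_moduleI)
  show "ring (base_field :: 'k ring)" by (rule ring_from_type_algebra)
  show "\<exists>y\<in>carrier A. y \<oplus>\<^bsub>A\<^esub> x = \<zero>\<^bsub>A\<^esub>" if "x \<in> carrier A" for x
    using A.l_neg[OF that] A.a_inv_closed[OF that] by blast
  show "c \<odot>\<^bsub>A\<^esub> x \<in> carrier A" if "x \<in> carrier A" for c x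
  proof -
    have "{p. c * x p \<noteq> 0} \<subseteq> {p. x p \<noteq> 0}" by auto
    then show ?thesis using that finite_subset by (auto simp: path_algebra_simps)
  qed
  show "x \<oplus>\<^bsub>A\<^esub> y \<in> carrier A" if "x \<in> carrier A" "y \<in> carrier A" for x y
    using that by (rule A.a_closed)
  show "x \<oplus>\<^bsub>A\<^esub> y = y \<oplus>\<^bsub>A\<^esub> x" if "x \<in> carrier A" "y \<in> carrier A" for x y
    using that by (rule A.a_comm)
qed (auto simp: path_algebra_simps(2-4) algebra_simps intro: A.zero_closed[unfolded path_algebra_simps(2)])

sublocale quot: module_quotient base_field A I
proof -
  interpret V: right_module base_field A by (rule vector_space_A)
  show "module_quotient base_field A I"
    unfolding module_quotient_def module_quotient_axioms_def
  proof (intro conjI vector_space_A V.is_submoduleI)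
    show "c \<odot>\<^bsub>A\<^esub> x \<in> I" if "x \<in> I" for c x
      using that V.act_closed[of c x] by (auto simp: I_eq path_algebra_simps)
  qed (use I.a_subset I.zero_closed I.a_closed in auto)
qed

lemma carrier_R: "carrier R = (\<lambda>x. I +>\<^bsub>A\<^esub> x) ` carrier A"
  unfolding bound_algebra_def by (rule quot.carrier_quot)

lemma add_R: "x \<in> carrier A \<Longrightarrow> y \<in> carrier A \<Longrightarrow> (I +>\<^bsub>A\<^esub> x) \<oplus>\<^bsub>R\<^esub> (I +>\<^bsub>A\<^esub> y) = I +>\<^bsub>A\<^esub> (x \<oplus>\<^bsub>A\<^esub> y)"
  unfolding bound_algebra_def by (rule quot.add_quot)

lemma mult_R: "x \<in> carrier A \<Longrightarrow> y \<in> carrier A \<Longrightarrow> (I +>\<^bsub>A\<^esub> x) \<otimes>\<^bsub>R\<^esub> (I +>\<^bsub>A\<^esub> y) = I +>\<^bsub>A\<^esub> (x \<otimes>\<^bsub>A\<^esub> y)"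
  unfolding bound_algebra_def quot_alg_def by (simp add: FactRing_def I.rcoset_mult_add)

lemma smult_R: "x \<in> carrier A \<Longrightarrow> c \<odot>\<^bsub>R\<^esub> (I +>\<^bsub>A\<^esub> x) = I +>\<^bsub>A\<^esub> (c \<odot>\<^bsub>A\<^esub> x)"
  unfolding bound_algebra_def by (rule quot.act_quot) simp_all

lemma one_R: "\<one>\<^bsub>R\<^esub> = I +>\<^bsub>A\<^esub> \<one>\<^bsub>A\<^esub>"
  by (simp add: bound_algebra_def quot_alg_def FactRing_def)

lemma zero_R: "\<zero>\<^bsub>R\<^esub> = I +>\<^bsub>A\<^esub> \<zero>\<^bsub>A\<^esub>"
  using quot.coset_zero_iff[of "\<zero>\<^bsub>A\<^esub>"] by (simp add: bound_algebra_def quot.zero_quot)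

lemma ring_R: "ring R"
  unfolding bound_algebra_def by (rule ring_quot_alg[OF ideal_I])

sublocale R: ring R by (rule ring_R)

lemma R_cases:
  assumes "r \<in> carrier R"
  obtains x where "x \<in> carrier A" "r = I +>\<^bsub>A\<^esub> x"
  using assms by (auto simp: carrier_R)

text \<open>
  The coefficients of an element of \<open>KQ/I\<close> with respect to the basis of nonzero paths. Any
  representative may be used, because the elements of \<open>I\<close> vanish on these paths.
\<close>

definition cf :: "('v \<times> 'a list \<Rightarrow> 'k) set \<Rightarrow> 'v \<times> 'a list \<Rightarrow> 'k" where
  "cf r q = (if nonzero_path q then (SOME x. x \<in> r) q else 0)"

lemma coset_coefficient:
  assumes "x \<in> carrier A" "y \<in> I +>\<^bsub>A\<^esub> x" "nonzero_path q"
  shows "y q = x q"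
proof -
  obtain i where "i \<in> I" "y = i \<oplus>\<^bsub>A\<^esub> x" using assms(2) by (auto simp: a_r_coset_def r_coset_def)
  then show ?thesis using assms(3) unfolding I_eq path_algebra_simps by (cases q) auto
qed

lemma cf_coset:
  assumes "x \<in> carrier A"
  shows "cf (I +>\<^bsub>A\<^esub> x) q = (if nonzero_path q then x q else 0)"
proof -
  have "(SOME y. y \<in> I +>\<^bsub>A\<^esub> x) \<in> I +>\<^bsub>A\<^esub> x"
    by (rule someI[of _ x]) (rule I.a_rcos_self[OF assms])
  then show ?thesis using coset_coefficient[OF assms] by (simp add: cf_def)
qed

lemma cf_eqI:
  assumes "r \<in> carrier R" "s \<in> carrier R" "\<And>q. nonzero_path q \<Longrightarrow> cf r q = cf s q"
  shows "r = s"
proof -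
  obtain x where x: "x \<in> carrier A" "r = I +>\<^bsub>A\<^esub> x" using assms(1) by (rule R_cases)
  obtain y where y: "y \<in> carrier A" "s = I +>\<^bsub>A\<^esub> y" using assms(2) by (rule R_cases)
  have c: "x \<ominus>\<^bsub>A\<^esub> y \<in> carrier A" using x y by simp
  have "(x \<ominus>\<^bsub>A\<^esub> y) \<oplus>\<^bsub>A\<^esub> y = x" using x y by (simp add: a_minus_def A.a_assoc A.l_neg)
  then have sum: "(x \<ominus>\<^bsub>A\<^esub> y) q + y q = x q" for q
    unfolding path_algebra_simps(3) by (rule fun_cong)
  have "(x \<ominus>\<^bsub>A\<^esub> y) q = 0" if "nonzero_path q" for q
  proof -
    have "x q = y q" using assms(3)[OF that] that x y by (simp add: cf_coset)
    then show ?thesis using sum[of q] by simp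
  qed
  then have "x \<ominus>\<^bsub>A\<^esub> y \<in> I" using c unfolding I_eq by blast
  then show ?thesis using x y quot.coset_eq_iff by simp
qed

lemma cf_bad [simp]: "\<not> nonzero_path q \<Longrightarrow> cf r q = 0"
  by (simp add: cf_def)

lemma cf_zero [simp]: "cf \<zero>\<^bsub>R\<^esub> q = 0"
  by (simp add: zero_R cf_coset) (simp add: path_algebra_simps)

lemma cf_add [simp]: "r \<in> carrier R \<Longrightarrow> s \<in> carrier R \<Longrightarrow> cf (r \<oplus>\<^bsub>R\<^esub> s) q = cf r q + cf s q"
  by (elim R_cases) (simp add: add_R cf_coset, simp add: path_algebra_simps)

lemma cf_smult [simp]:
  assumes "r \<in> carrier R"
  shows "cf (c \<odot>\<^bsub>R\<^esub> r) q = c * cf r q"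
proof -
  obtain x where x: "x \<in> carrier A" "r = I +>\<^bsub>A\<^esub> x" using assms by (rule R_cases)
  have "c \<odot>\<^bsub>A\<^esub> x \<in> carrier A" using x by (intro quot.V.act_closed) simp_all
  then show ?thesis using x by (simp add: smult_R cf_coset) (simp add: path_algebra_simps)
qed

lemma cf_one: "cf \<one>\<^bsub>R\<^esub> (v, p) = (if v \<in> verts Q \<and> p = [] then 1 else 0)"
  by (auto simp: one_R cf_coset path_algebra_simps(5) nonzero_path_Nil)

lemma cf_mult:
  assumes "r \<in> carrier R" "s \<in> carrier R" "nonzero_path (v, p)"
  shows "cf (r \<otimes>\<^bsub>R\<^esub> s) (v, p) = (\<Sum>i\<le>length p. cf r (v, take i p) * cf s (path_end Q v (take i p), drop i p))"
proof -
  obtain x where x: "x \<in> carrier A" "r = I +>\<^bsub>A\<^esub> x" using assms(1) by (rule R_cases)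
  obtain y where y: "y \<in> carrier A" "s = I +>\<^bsub>A\<^esub> y" using assms(2) by (rule R_cases)
  have "cf (r \<otimes>\<^bsub>R\<^esub> s) (v, p) = (x \<otimes>\<^bsub>A\<^esub> y) (v, p)"
    using x y assms(3) by (simp add: mult_R cf_coset)
  also have "\<dots> = (\<Sum>i\<le>length p. cf r (v, take i p) * cf s (path_end Q v (take i p), drop i p))"
    unfolding path_algebra_simps using x y nonzero_path_take_drop[OF assms(3)]
    by (intro sum.cong) (simp_all add: cf_coset)
  finally show ?thesis .
qed

lemma finite_nonzero_paths: "finite {q. nonzero_path q}"
proof -
  obtain m where m: "\<And>q. nonzero_path q \<Longrightarrow> length (snd q) < m" using bounded by blast
  have "{q. nonzero_path q} \<subseteq> verts Q \<times> {p. set p \<subseteq> arcs Q \<and> length p \<le> m}"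
  proof
    fix q assume "q \<in> {q. nonzero_path q}"
    moreover obtain v p where vp: "q = (v, p)" by (cases q)
    ultimately have q: "nonzero_path (v, p)" by simp
    then obtain u where "awalk v p u" using nonzero_path_qpath by (auto simp: qpaths_def)
    then have "v \<in> verts Q" "set p \<subseteq> arcs Q" by (auto simp: awalk_def)
    then show "q \<in> verts Q \<times> {p. set p \<subseteq> arcs Q \<and> length p \<le> m}" using m[OF q] by (simp add: vp)
  qed
  moreover have "finite (verts Q \<times> {p. set p \<subseteq> arcs Q \<and> length p \<le> m})"
    using finite_verts finite_lists_length_le[OF finite_arcs] by blast
  ultimately show ?thesis by (rule finite_subset)
qed

definition elt :: "('v \<times> 'a list \<Rightarrow> 'k) \<Rightarrow> ('v \<times> 'a list \<Rightarrow> 'k) set" where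
  "elt f = I +>\<^bsub>A\<^esub> (\<lambda>q. if nonzero_path q then f q else 0)"

lemma elt_aux: "(\<lambda>q. if nonzero_path q then f q else 0) \<in> carrier A"
proof -
  have "{q. (if nonzero_path q then f q else 0) \<noteq> 0} \<subseteq> {q. nonzero_path q}" by (auto split: if_splits)
  then show ?thesis
    using finite_subset[OF _ finite_nonzero_paths] nonzero_path_qpath
    by (auto simp: path_algebra_simps(1))
qed

lemma elt_closed [simp]: "elt f \<in> carrier R"
  unfolding elt_def carrier_R using elt_aux by (rule imageI)

lemma cf_elt: "cf (elt f) q = (if nonzero_path q then f q else 0)"
  unfolding elt_def using cf_coset[OF elt_aux] by simp

abbreviation bpath :: "'v \<times> 'a list \<Rightarrow> ('v \<times> 'a list \<Rightarrow> 'k) set" where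
  "bpath q \<equiv> I +>\<^bsub>A\<^esub> path_elt q"

lemma bpath_closed [simp]: "q \<in> qpaths Q \<Longrightarrow> bpath q \<in> carrier R"
  unfolding carrier_R using path_elt_carrier by (rule imageI)

lemma cf_bpath: "nonzero_path q \<Longrightarrow> cf (bpath q) p = (if p = q then 1 else 0)"
  using cf_coset[OF path_elt_carrier[OF nonzero_path_qpath]] by (auto simp: path_elt_def)

lemma bpath_span:
  assumes U: "submodule U base_field R" and "\<And>q. nonzero_path q \<Longrightarrow> bpath q \<in> U"
  shows "carrier R \<subseteq> U"
proof -
  have V: "right_module base_field R" unfolding bound_algebra_def by (rule quot.right_module_quot)
  interpret V: right_module base_field R by (rule V)
  have "r \<in> U" if "finite F" "F \<subseteq> {q. nonzero_path q}" "r \<in> carrier R" "{q. cf r q \<noteq> 0} \<subseteq> F" for F r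
    using that
  proof (induction F arbitrary: r)
    case empty
    then have "r = \<zero>\<^bsub>R\<^esub>" by (intro cf_eqI) auto
    then show ?case using submodule_zero[OF U] by simp
  next
    case (insert q F)
    have q: "nonzero_path q" using insert.prems by simp
    let ?b = "cf r q \<odot>\<^bsub>R\<^esub> bpath q"
    have b: "bpath q \<in> carrier R" "?b \<in> carrier R" "?b \<in> U"
      using bpath_closed[OF nonzero_path_qpath[OF q]] submodule_act[OF U _ assms(2)[OF q], of "cf r q"]
      by (auto intro!: V.act_closed)
    let ?s = "elt (\<lambda>p. if p = q then 0 else cf r p)"
    have "?s \<in> U"
      by (rule insert.IH) (use insert.prems in \<open>auto simp: cf_elt\<close>)
    then have "?s \<oplus>\<^bsub>R\<^esub> ?b \<in> U" using submodule_add[OF U] b by blast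
    moreover have "?s \<oplus>\<^bsub>R\<^esub> ?b = r"
      by (rule cf_eqI) (use b insert.prems q in \<open>auto simp: cf_elt cf_bpath\<close>)
    ultimately show ?case by simp
  qed
  then show ?thesis using finite_nonzero_paths cf_bad by blast
qed

sublocale R: fd_algebra R
proof
  have V: "right_module base_field R" unfolding bound_algebra_def by (rule quot.right_module_quot)
  interpret V: right_module base_field R by (rule V)
  show "fg_module base_field R"
  proof (rule fg_moduleI[OF V, of "bpath ` {q. nonzero_path q}"])
    show "finite (bpath ` {q. nonzero_path q})" using finite_nonzero_paths by simp
    show "bpath ` {q. nonzero_path q} \<subseteq> carrier R" using nonzero_path_qpath by auto
    show "carrier R \<subseteq> U" if "submodule U base_field R" "bpath ` {q. nonzero_path q} \<subseteq> U" for U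
      by (rule bpath_span[OF that(1)]) (use that(2) in auto)
  qed
  have sc: "c \<odot>\<^bsub>R\<^esub> r \<in> carrier R" if "r \<in> carrier R" for c r
    by (rule V.act_closed) (simp_all add: that)
  fix r s c assume rs: "r \<in> carrier R" "s \<in> carrier R"
  show "c \<odot>\<^bsub>R\<^esub> (r \<otimes>\<^bsub>R\<^esub> s) = (c \<odot>\<^bsub>R\<^esub> r) \<otimes>\<^bsub>R\<^esub> s"
    by (rule cf_eqI) (use rs sc in \<open>auto simp: cf_mult sum_distrib_left mult.assoc\<close>)
  show "c \<odot>\<^bsub>R\<^esub> (r \<otimes>\<^bsub>R\<^esub> s) = r \<otimes>\<^bsub>R\<^esub> (c \<odot>\<^bsub>R\<^esub> s)"
    by (rule cf_eqI) (use rs sc in \<open>auto simp: cf_mult sum_distrib_left mult_ac\<close>)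
qed

end

section \<open>Projective covers\<close>

lemma proj_coverD:
  assumes "proj_cover R M P p"
  shows proj_cover_presents: "presents R P p M"
    and proj_cover_essential: "\<And>U. submodule U R P \<Longrightarrow> p ` U = carrier M \<Longrightarrow> U = carrier P"
  using assms unfolding proj_cover_def presents_def by simp_all

context fd_algebra
begin

text \<open>
  A lift between two covers is onto because its image covers the module; it splits because the
  target is projective; the splitting is onto for the same reason.
\<close>

lemma proj_cover_unique:
  assumes c: "proj_cover R M P p" and c': "proj_cover R M P' p'" and M: "fg_module R M"
  obtains a where "a \<in> mod_hom R P P'" "bij_betw a (carrier P) (carrier P')"
    "\<And>x. x \<in> carrier P \<Longrightarrow> p' (a x) = p x"
proof -
  note P = presentsD[OF proj_cover_presents[OF c]] and P' = presentsD[OF proj_cover_presents[OF c']]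
  have Mr: "right_module R M" using M by (rule fg_right_module)
  interpret P: right_module R P by (rule P)
  interpret P': right_module R P' by (rule P')
  have onto: "f ` carrier Q = carrier Q'"
    if "proj_cover R M Q q" "proj_cover R M Q' q'" "f \<in> mod_hom R Q Q'" "\<And>x. x \<in> carrier Q \<Longrightarrow> q' (f x) = q x"
    for Q :: "('r, 'x) module" and q and Q' :: "('r, 'y) module" and q' f
  proof -
    note Q = presentsD[OF proj_cover_presents[OF that(1)]]
    note Q' = presentsD[OF proj_cover_presents[OF that(2)]]
    have "q' ` f ` carrier Q = carrier M" using that(4) Q(5) by (simp add: image_image)
    moreover have "submodule (f ` carrier Q) R Q'"
      by (rule image_submodule[OF Q(3) Q'(3) that(3) right_module.carrier_submodule[OF Q(3)]])
    ultimately show ?thesis using proj_cover_essential[OF that(2)] by blast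
  qed
  obtain a where a: "a \<in> mod_hom R P P'" "\<And>x. x \<in> carrier P \<Longrightarrow> p' (a x) = p x"
    using projective_lift[OF P(1) P'(2) M P'(4,5) P(4)] by metis
  have as: "a ` carrier P = carrier P'" by (rule onto[OF c c' a])
  obtain b where b: "b \<in> mod_hom R P' P" "\<And>x. x \<in> carrier P' \<Longrightarrow> a (b x) = (\<lambda>x\<in>carrier P'. x) x"
    using projective_lift[OF P'(1) P(2) P'(2) a(1) as hom_id[OF P'(3)]] by metis
  have ab: "a (b x) = x" if "x \<in> carrier P'" for x using b(2)[OF that] that by simp
  have "p (b x) = p' x" if "x \<in> carrier P'" for x
    using a(2)[OF hom_closed[OF b(1) that]] ab[OF that] by simp
  then have bs: "b ` carrier P' = carrier P" by (rule onto[OF c' c b(1)])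
  have "inj_on a (carrier P)"
  proof (rule inj_onI)
    fix x y assume xy: "x \<in> carrier P" "y \<in> carrier P" "a x = a y"
    then obtain x' y' where "x = b x'" "x' \<in> carrier P'" "y = b y'" "y' \<in> carrier P'"
      using bs by blast
    then show "x = y" using xy(3) ab by simp
  qed
  with as have "bij_betw a (carrier P) (carrier P')" by (simp add: bij_betw_def)
  with a show thesis using that by blast
qed

lemma kernel_iso:
  assumes "fg_module R P" "fg_module R P'" "right_module R M" "p \<in> mod_hom R P M" "p' \<in> mod_hom R P' M"
    and a: "a \<in> mod_hom R P P'" "bij_betw a (carrier P) (carrier P')" "\<And>x. x \<in> carrier P \<Longrightarrow> p' (a x) = p x"
  shows "mod_isomorphic R (kernel_module P p M) (kernel_module P' p' M)"
proof -
  have rm: "right_module R P" "right_module R P'" using assms(1,2) by (auto intro: fg_right_module)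
  let ?K = "kernel_module P p M" and ?K' = "kernel_module P' p' M"
  have "restrict a (carrier ?K) \<in> mod_hom R ?K P'"
    using hom_restrict_domain[OF kernel_submodule[OF rm(1) assms(3,4)] a(1)]
    by (simp add: kernel_module_def)
  then have h: "restrict a (carrier ?K) \<in> mod_hom R ?K ?K'"
    unfolding kernel_module_def[of P']
    by (rule hom_codomain) (auto simp: carrier_kernel_module a(3) hom_closed[OF a(1)])
  have "bij_betw a (carrier ?K) (carrier ?K')"
    unfolding bij_betw_def
  proof
    show "inj_on a (carrier ?K)"
      using a(2) by (auto simp: bij_betw_def carrier_kernel_module intro: inj_on_subset)
    have "y \<in> a ` carrier ?K" if y: "y \<in> carrier ?K'" for y
    proof -
      have "y \<in> a ` carrier P" using y a(2) by (simp add: bij_betw_def carrier_kernel_module)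
      then obtain x where "x \<in> carrier P" "y = a x" by blast
      then show ?thesis using y a(3) by (auto simp: carrier_kernel_module)
    qed
    moreover have "a ` carrier ?K \<subseteq> carrier ?K'"
      by (auto simp: carrier_kernel_module a(3) hom_closed[OF a(1)])
    ultimately show "a ` carrier ?K = carrier ?K'" by blast
  qed
  then have "bij_betw (restrict a (carrier ?K)) (carrier ?K) (carrier ?K')"
    by (rule bij_betw_cong[THEN iffD1, rotated]) simp
  with h show ?thesis unfolding mod_isomorphic_def by blast
qed

lemma proj_cover_kernel_iso:
  assumes "proj_cover R M P p" "proj_cover R M P' p'" "fg_module R M"
  shows "mod_isomorphic R (kernel_module P p M) (kernel_module P' p' M)"
proof -
  note P = presentsD[OF proj_cover_presents[OF assms(1)]] and P' = presentsD[OF proj_cover_presents[OF assms(2)]]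
  obtain a where "a \<in> mod_hom R P P'" "bij_betw a (carrier P) (carrier P')"
    "\<And>x. x \<in> carrier P \<Longrightarrow> p' (a x) = p x"
    using proj_cover_unique[OF assms] by metis
  then show ?thesis by (rule kernel_iso[OF P(2) P'(2) fg_right_module[OF assms(3)] P(4) P'(4)])
qed

text \<open>
  The chosen pair in the definition of \<open>syzygy\<close> is a projective cover as soon as there is one
  within the type.
\<close>

lemma syzygy_kernel:
  assumes "proj_cover R M (P' :: ('r, 'r univ) module) p'"
  obtains P :: "('r, 'r univ) module" and p where "proj_cover R M P p" "syzygy R M = kernel_module P p M"
proof -
  have "\<exists>Pp :: ('r, 'r univ) module \<times> ('r univ \<Rightarrow> _). case Pp of (P, p) \<Rightarrow> proj_cover R M P p"
    using assms by (intro exI[of _ "(P', p')"]) simp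
  from someI_ex[OF this]
  obtain P :: "('r, 'r univ) module" and p where
    Pp: "(SOME (P :: ('r, 'r univ) module, p). proj_cover R M P p) = (P, p)" "proj_cover R M P p"
    by (metis (mono_tags, lifting) case_prodE)
  then have "syzygy R M = kernel_module P p M" by (simp add: syzygy_def kernel_module_def)
  with Pp(2) show thesis using that by blast
qed

end

context monomial_algebra
begin

definition idem :: "'v \<Rightarrow> ('v \<times> 'a list \<Rightarrow> 'k) set" where
  "idem u = bpath (u, [])"

abbreviation PV :: "'v \<Rightarrow> (('v \<times> 'a list \<Rightarrow> 'k) set, ('v \<times> 'a list \<Rightarrow> 'k) set) module" where
  "PV u \<equiv> right_ideal_gen R (idem u)"

lemma idem_closed [simp]: "u \<in> verts Q \<Longrightarrow> idem u \<in> carrier R"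
  by (simp add: idem_def qpaths_Nil)

lemma cf_idem: "u \<in> verts Q \<Longrightarrow> cf (idem u) q = (if q = (u, []) then 1 else 0)"
  by (simp add: idem_def cf_bpath nonzero_path_Nil)

lemma cf_mult_idem:
  assumes "r \<in> carrier R" "u \<in> verts Q" "nonzero_path (v, p)"
  shows "cf (r \<otimes>\<^bsub>R\<^esub> idem u) (v, p) = (if path_end Q v p = u then cf r (v, p) else 0)"
proof -
  have "cf (r \<otimes>\<^bsub>R\<^esub> idem u) (v, p) =
      cf r (v, take (length p) p) * cf (idem u) (path_end Q v (take (length p) p), drop (length p) p)"
    unfolding cf_mult[OF assms(1) idem_closed[OF assms(2)] assms(3)]
    by (rule sum_atMost_single) (auto simp: cf_idem[OF assms(2)])
  then show ?thesis by (simp add: cf_idem[OF assms(2)])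
qed

lemma cf_bpath_mult:
  assumes "r \<in> carrier R" "nonzero_path (w, q)" "nonzero_path (v, p)"
  shows "cf (bpath (w, q) \<otimes>\<^bsub>R\<^esub> r) (v, p) =
    (if v = w \<and> take (length q) p = q then cf r (path_end Q w q, drop (length q) p) else 0)"
proof -
  have eq: "cf (bpath (w, q) \<otimes>\<^bsub>R\<^esub> r) (v, p) = (\<Sum>i\<le>length p.
      cf (bpath (w, q)) (v, take i p) * cf r (path_end Q v (take i p), drop i p))"
    by (rule cf_mult) (use assms nonzero_path_qpath in auto)
  show ?thesis
  proof (cases "v = w \<and> take (length q) p = q")
    case True
    then have l: "length q \<le> length p" by (metis length_take min.cobounded1)
    have "cf (bpath (w, q) \<otimes>\<^bsub>R\<^esub> r) (v, p) =
      cf (bpath (w, q)) (v, take (length q) p) * cf r (path_end Q v (take (length q) p), drop (length q) p)"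
      unfolding eq
    proof (rule sum_atMost_single[OF _ l])
      fix i assume i: "i \<le> length p" "i \<noteq> length q"
      then have "take i p \<noteq> q" by (metis length_take min.absorb2)
      then show "cf (bpath (w, q)) (v, take i p) * cf r (path_end Q v (take i p), drop i p) = 0"
        using assms(2) by (simp add: cf_bpath)
    qed
    then show ?thesis using True assms(2) by (simp add: cf_bpath)
  next
    case False
    have "cf (bpath (w, q)) (v, take i p) = 0" if "i \<le> length p" for i
    proof -
      have "(v, take i p) \<noteq> (w, q)" using False that by (metis length_take min.absorb2 prod.inject)
      then show ?thesis using assms(2) by (simp add: cf_bpath)
    qed
    then show ?thesis unfolding eq if_not_P[OF False] by (intro sum.neutral) simp
  qed
qed

lemma cf_idem_mult:
  assumes "r \<in> carrier R" "u \<in> verts Q" "nonzero_path (v, p)"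
  shows "cf (idem u \<otimes>\<^bsub>R\<^esub> r) (v, p) = (if v = u then cf r (v, p) else 0)"
  using cf_bpath_mult[OF assms(1) _ assms(3), of u "[]"] assms(2)
  by (simp add: idem_def nonzero_path_Nil)

lemma mult_closed: "r \<in> carrier R \<Longrightarrow> s \<in> carrier R \<Longrightarrow> r \<otimes>\<^bsub>R\<^esub> s \<in> carrier R"
  by simp

lemma idem_idem: "u \<in> verts Q \<Longrightarrow> idem u \<otimes>\<^bsub>R\<^esub> idem u = idem u"
proof (rule cf_eqI)
  fix q assume "u \<in> verts Q" "nonzero_path q"
  then show "cf (idem u \<otimes>\<^bsub>R\<^esub> idem u) q = cf (idem u) q"
    by (cases q) (simp add: cf_idem_mult cf_idem)
qed simp_all

lemma PV_iff:
  assumes "u \<in> verts Q"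
  shows "r \<in> carrier (PV u) \<longleftrightarrow> r \<in> carrier R \<and> (\<forall>v p. cf r (v, p) \<noteq> 0 \<longrightarrow> v = u)"
proof
  assume "r \<in> carrier (PV u)"
  then obtain s where s: "s \<in> carrier R" "r = idem u \<otimes>\<^bsub>R\<^esub> s" by (auto simp: carrier_right_ideal)
  have "v = u" if "cf r (v, p) \<noteq> 0" for v p
  proof -
    have "nonzero_path (v, p)" using that cf_bad by blast
    then show ?thesis using that s assms by (simp add: cf_idem_mult split: if_splits)
  qed
  then show "r \<in> carrier R \<and> (\<forall>v p. cf r (v, p) \<noteq> 0 \<longrightarrow> v = u)" using s assms by simp
next
  assume r: "r \<in> carrier R \<and> (\<forall>v p. cf r (v, p) \<noteq> 0 \<longrightarrow> v = u)"
  have "idem u \<otimes>\<^bsub>R\<^esub> r = r"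
  proof (rule cf_eqI)
    fix q assume "nonzero_path q"
    then show "cf (idem u \<otimes>\<^bsub>R\<^esub> r) q = cf r q" using r assms by (cases q) (auto simp: cf_idem_mult)
  qed (use r assms in auto)
  then show "r \<in> carrier (PV u)" using right_ideal_mem[of r R "idem u"] r by simp
qed

lemma PV_start: "u \<in> verts Q \<Longrightarrow> r \<in> carrier (PV u) \<Longrightarrow> cf r (v, p) \<noteq> 0 \<Longrightarrow> v = u"
  by (auto simp: PV_iff)

lemma PV_I:
  assumes "u \<in> verts Q" "r \<in> carrier R" "\<And>v p. cf r (v, p) \<noteq> 0 \<Longrightarrow> v = u"
  shows "r \<in> carrier (PV u)"
  using assms by (simp add: PV_iff)

lemma idem_PV: "u \<in> verts Q \<Longrightarrow> idem u \<in> carrier (PV u)"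
  by (rule PV_I) (simp_all add: cf_idem split: if_splits)

lemma PV_closed: "u \<in> verts Q \<Longrightarrow> r \<in> carrier (PV u) \<Longrightarrow> r \<in> carrier R"
  by (simp add: PV_iff)

lemma idem_mult_PV: "u \<in> verts Q \<Longrightarrow> r \<in> carrier (PV u) \<Longrightarrow> idem u \<otimes>\<^bsub>R\<^esub> r = r"
  by (rule right_ideal_idem[OF ring_R idem_closed idem_idem])

lemma projective_PV: "u \<in> verts Q \<Longrightarrow> projective R (PV u)"
  by (rule projective_right_ideal_idem[OF ring_R idem_closed idem_idem])

text \<open>The powers of the radical: elements supported on paths of length at least \<open>k\<close>.\<close>

definition deep :: "nat \<Rightarrow> ('v \<times> 'a list \<Rightarrow> 'k) set \<Rightarrow> bool" where
  "deep k r \<longleftrightarrow> r \<in> carrier R \<and> (\<forall>v p. cf r (v, p) \<noteq> 0 \<longrightarrow> k \<le> length p)"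

lemma deep_mult:
  assumes "deep k r" "deep l s"
  shows "deep (k + l) (r \<otimes>\<^bsub>R\<^esub> s)"
  unfolding deep_def
proof (intro conjI allI impI)
  show "r \<otimes>\<^bsub>R\<^esub> s \<in> carrier R" using assms by (simp add: deep_def)
  fix v p assume nz: "cf (r \<otimes>\<^bsub>R\<^esub> s) (v, p) \<noteq> 0"
  then have "nonzero_path (v, p)" using cf_bad by blast
  then have "(\<Sum>i\<le>length p. cf r (v, take i p) * cf s (path_end Q v (take i p), drop i p)) \<noteq> 0"
    using nz assms by (simp add: deep_def cf_mult)
  then obtain i where i: "i \<le> length p" "cf r (v, take i p) * cf s (path_end Q v (take i p), drop i p) \<noteq> 0"
    by (rule sum.not_neutral_contains_not_neutral) simp
  then have "cf r (v, take i p) \<noteq> 0" "cf s (path_end Q v (take i p), drop i p) \<noteq> 0" by auto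
  then have "k \<le> length (take i p)" "l \<le> length (drop i p)" using assms unfolding deep_def by blast+
  then show "k + l \<le> length p" using i(1) by simp
qed

lemma deep_add: "deep k r \<Longrightarrow> deep k s \<Longrightarrow> deep k (r \<oplus>\<^bsub>R\<^esub> s)"
proof -
  assume rs: "deep k r" "deep k s"
  have "cf r q = 0 \<Longrightarrow> cf s q = 0 \<Longrightarrow> cf (r \<oplus>\<^bsub>R\<^esub> s) q = 0" for q
    using rs by (simp add: deep_def)
  then show ?thesis using rs unfolding deep_def by (metis R.a_closed)
qed

lemma deep_zero: "deep k \<zero>\<^bsub>R\<^esub>"
  by (simp add: deep_def)

lemma deep_vanishes:
  obtains m where "\<And>r k. m \<le> k \<Longrightarrow> deep k r \<Longrightarrow> r = \<zero>\<^bsub>R\<^esub>"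
proof -
  obtain m where m: "\<And>q. nonzero_path q \<Longrightarrow> length (snd q) < m" using bounded by blast
  have "r = \<zero>\<^bsub>R\<^esub>" if mk: "m \<le> k" and d: "deep k r" for r k
  proof (rule cf_eqI)
    fix q assume q: "nonzero_path q"
    obtain v p where vp: "q = (v, p)" by (cases q)
    have "length p < k" using m[OF q] mk by (simp add: vp)
    then have "cf r (v, p) = 0" using d unfolding deep_def by (meson not_le)
    then show "cf r q = cf \<zero>\<^bsub>R\<^esub> q" by (simp add: vp)
  qed (use d in \<open>simp_all add: deep_def\<close>)
  then show thesis using that by blast
qed

text \<open>
  Dividing \<open>s\<close> by its constant term \<open>c\<close> gives \<open>e\<^sub>w = s c\<^sup>-\<^sup>1 + \<rho>\<close> with \<open>\<rho>\<close> in the radical. So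
  modulo \<open>sR\<close> every element of \<open>e\<^sub>wR\<close> can be pushed into higher and higher powers of the radical.
\<close>

lemma right_inverse_local:
  assumes w: "w \<in> verts Q" and s: "s \<in> carrier (PV w)" and c: "cf s (w, []) \<noteq> 0"
  obtains t where "t \<in> carrier R" "s \<otimes>\<^bsub>R\<^esub> t = idem w"
proof -
  let ?c = "cf s (w, [])"
  have sR: "s \<in> carrier R" using s w by (simp add: PV_iff)
  \<comment> \<open>The equation \<open>e\<^sub>w = s t\<^sub>0 + \<rho>\<close> holds by the choice of \<open>t\<^sub>0\<close> and \<open>\<rho>\<close>.\<close>
  define t0 where "t0 = R.scal (inverse ?c)"
  have t0: "t0 \<in> carrier R" by (simp add: t0_def)
  define \<rho> where "\<rho> = elt (\<lambda>q. if q = (w, []) then 0 else - inverse ?c * cf s q)"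
  have \<rho>R: "\<rho> \<in> carrier R" by (simp add: \<rho>_def)
  have \<rho>: "deep 1 \<rho>"
    unfolding deep_def
  proof (intro conjI allI impI)
    fix v p assume "cf \<rho> (v, p) \<noteq> 0"
    then have "(v, p) \<noteq> (w, [])" "cf s (v, p) \<noteq> 0" by (auto simp: \<rho>_def cf_elt split: if_splits)
    moreover from this(2) have "v = w" by (rule PV_start[OF w s])
    ultimately show "1 \<le> length p" by (cases p) auto
  qed (rule \<rho>R)
  have \<rho>P: "\<rho> \<in> carrier (PV w)"
  proof (rule PV_I[OF w \<rho>R])
    fix v p assume "cf \<rho> (v, p) \<noteq> 0"
    then have "cf s (v, p) \<noteq> 0" by (auto simp: \<rho>_def cf_elt split: if_splits)
    then show "v = w" by (rule PV_start[OF w s])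
  qed
  have split: "idem w = s \<otimes>\<^bsub>R\<^esub> t0 \<oplus>\<^bsub>R\<^esub> \<rho>"
  proof (rule cf_eqI)
    fix q assume q: "nonzero_path q"
    have "cf (s \<otimes>\<^bsub>R\<^esub> t0) q = inverse ?c * cf s q" using sR by (simp add: t0_def R.mult_scal)
    then show "cf (idem w) q = cf (s \<otimes>\<^bsub>R\<^esub> t0 \<oplus>\<^bsub>R\<^esub> \<rho>) q"
      using w sR t0 \<rho>R q c by (simp add: cf_idem \<rho>_def cf_elt)
  qed (use w sR t0 \<rho>R in auto)
  obtain m where m: "\<And>r k. m \<le> k \<Longrightarrow> deep k r \<Longrightarrow> r = \<zero>\<^bsub>R\<^esub>" using deep_vanishes by blast
  have push: "\<exists>t\<in>carrier R. x = s \<otimes>\<^bsub>R\<^esub> t" if "deep k x" "x \<in> carrier (PV w)" for k x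
    using that
  proof (induction "m - k" arbitrary: k x)
    case 0
    then have "x = \<zero>\<^bsub>R\<^esub>" using m by simp
    then show ?case using sR by (intro bexI[of _ "\<zero>\<^bsub>R\<^esub>"]) simp_all
  next
    case (Suc n)
    have xR: "x \<in> carrier R" using Suc.prems w by (simp add: PV_iff)
    have "\<exists>t\<in>carrier R. \<rho> \<otimes>\<^bsub>R\<^esub> x = s \<otimes>\<^bsub>R\<^esub> t"
    proof (rule Suc.hyps(1))
      show "n = m - Suc k" using Suc.hyps(2) by simp
      show "deep (Suc k) (\<rho> \<otimes>\<^bsub>R\<^esub> x)" using deep_mult[OF \<rho> Suc.prems(1)] by simp
      have "\<rho> \<otimes>\<^bsub>R\<^esub> x = idem w \<otimes>\<^bsub>R\<^esub> (\<rho> \<otimes>\<^bsub>R\<^esub> x)"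
        using idem_mult_PV[OF w \<rho>P] w xR \<rho>R by (simp add: R.m_assoc[symmetric])
      then show "\<rho> \<otimes>\<^bsub>R\<^esub> x \<in> carrier (PV w)" using right_ideal_mem[of "\<rho> \<otimes>\<^bsub>R\<^esub> x" R "idem w"] xR \<rho>R by simp
    qed
    then obtain t where t: "t \<in> carrier R" "\<rho> \<otimes>\<^bsub>R\<^esub> x = s \<otimes>\<^bsub>R\<^esub> t" by blast
    have "x = idem w \<otimes>\<^bsub>R\<^esub> x" using idem_mult_PV[OF w Suc.prems(2)] by simp
    also have "\<dots> = s \<otimes>\<^bsub>R\<^esub> (t0 \<otimes>\<^bsub>R\<^esub> x \<oplus>\<^bsub>R\<^esub> t)"
      unfolding split using sR t0 \<rho>R xR t by (simp add: R.l_distr R.r_distr R.m_assoc)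
    finally show ?case using t0 xR t(1) by (intro bexI[of _ "t0 \<otimes>\<^bsub>R\<^esub> x \<oplus>\<^bsub>R\<^esub> t"]) simp_all
  qed
  have "deep 0 (idem w)" using w by (simp add: deep_def)
  from push[OF this idem_PV[OF w]] obtain t where "t \<in> carrier R" "idem w = s \<otimes>\<^bsub>R\<^esub> t" by blast
  then show thesis using that[of t] by simp
qed

text \<open>Some multiple \<open>st\<close> equals \<open>e\<^sub>w\<close>, so \<open>x = (xs)t\<close>.\<close>

lemma exchange:
  assumes M: "right_module R M" and W: "submodule W R M" and w: "w \<in> verts Q"
    and x: "x \<in> carrier M" "idem w \<odot>\<^bsub>M\<^esub> x = x"
    and s: "s \<in> carrier (PV w)" "cf s (w, []) \<noteq> 0" "s \<odot>\<^bsub>M\<^esub> x \<in> W"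
  shows "x \<in> W"
proof -
  interpret M: right_module R M by (rule M)
  obtain t where t: "t \<in> carrier R" "s \<otimes>\<^bsub>R\<^esub> t = idem w" by (rule right_inverse_local[OF w s(1,2)])
  have "t \<odot>\<^bsub>M\<^esub> (s \<odot>\<^bsub>M\<^esub> x) = x"
    using M.act_mult[of s t x] PV_closed[OF w s(1)] t x by simp
  then show ?thesis using submodule_act[OF W t(1) s(3)] by simp
qed

text \<open>Generators with this property amount to an epimorphism from a sum of modules \<open>e\<^sub>vR\<close>.\<close>

definition vertex_generators ::
  "(('v \<times> 'a list \<Rightarrow> 'k) set, 'm) module \<Rightarrow> nat set \<Rightarrow> (nat \<Rightarrow> 'v) \<Rightarrow> (nat \<Rightarrow> 'm) \<Rightarrow> bool" where
  "vertex_generators M J u x \<longleftrightarrow> finite J \<and>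
     (\<forall>j\<in>J. u j \<in> verts Q \<and> x j \<in> carrier M \<and> idem (u j) \<odot>\<^bsub>M\<^esub> x j = x j) \<and>
     (\<forall>W. submodule W R M \<and> x ` J \<subseteq> W \<longrightarrow> carrier M \<subseteq> W)"

text \<open>
  Replace every generator \<open>s\<close> by the products \<open>se\<^sub>v\<close>. They generate \<open>s\<close>, because every path starts
  at a vertex.
\<close>

lemma vertex_generators_exist:
  assumes "fg_module R M"
  shows "\<exists>J u x. vertex_generators M J u x"
proof -
  obtain T where T: "right_module R M" "finite T" "T \<subseteq> carrier M"
    "\<And>U. submodule U R M \<Longrightarrow> T \<subseteq> U \<Longrightarrow> U = carrier M"
    using fg_moduleE[OF assms] by metis
  interpret M: right_module R M by (rule T(1))
  have "finite (T \<times> verts Q)" using T(2) finite_verts by blast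
  then obtain g and n :: nat where g: "T \<times> verts Q = g ` {i. i < n}"
    using finite_imp_nat_seg_image_inj_on by metis
  have gi: "fst (g i) \<in> carrier M" "snd (g i) \<in> verts Q" if "i < n" for i
  proof -
    have "g i \<in> T \<times> verts Q" using g that by blast
    then show "fst (g i) \<in> carrier M" "snd (g i) \<in> verts Q" using T(3) by auto
  qed
  let ?x = "\<lambda>i. idem (snd (g i)) \<odot>\<^bsub>M\<^esub> fst (g i)"
  have "vertex_generators M {i. i < n} (\<lambda>i. snd (g i)) ?x"
    unfolding vertex_generators_def
  proof (intro conjI ballI allI impI)
    fix j assume "j \<in> {i. i < n}"
    then have j: "j < n" by simp
    show "snd (g j) \<in> verts Q" by (rule gi[OF j])
    show "?x j \<in> carrier M" using gi[OF j] by simp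
    have "idem (snd (g j)) \<odot>\<^bsub>M\<^esub> ?x j = (idem (snd (g j)) \<otimes>\<^bsub>R\<^esub> idem (snd (g j))) \<odot>\<^bsub>M\<^esub> fst (g j)"
      using gi[OF j] by (simp only: M.act_mult idem_closed)
    then show "idem (snd (g j)) \<odot>\<^bsub>M\<^esub> ?x j = ?x j" using gi[OF j] by (simp only: idem_idem)
  next
    fix W assume W: "submodule W R M \<and> ?x ` {i. i < n} \<subseteq> W"
    have idW: "idem v \<odot>\<^bsub>M\<^esub> s \<in> W" if "s \<in> T" "v \<in> verts Q" for s v
    proof -
      have "(s, v) \<in> g ` {i. i < n}" using that g by blast
      then obtain i where "i < n" "g i = (s, v)" by auto
      then have "?x i = idem v \<odot>\<^bsub>M\<^esub> s" by simp
      moreover have "?x i \<in> W" using W \<open>i < n\<close> by blast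
      ultimately show ?thesis by simp
    qed
    have "s \<in> W" if s: "s \<in> T" for s
    proof -
      have sM: "s \<in> carrier M" using s T(3) by blast
      let ?Y = "{r \<in> carrier R. r \<odot>\<^bsub>M\<^esub> s \<in> W}"
      have "carrier R \<subseteq> ?Y"
      proof (rule bpath_span)
        show "submodule ?Y base_field R"
        proof (rule R.VR.is_submoduleI)
          show "\<zero>\<^bsub>R\<^esub> \<in> ?Y"
            using sM submodule_zero[of W R M] W by simp
          show "r \<oplus>\<^bsub>R\<^esub> t \<in> ?Y"
            if "r \<in> ?Y" "t \<in> ?Y" for r t
            using that sM submodule_add[of W R M] W by (simp add: M.act_add_scalar)
          show "c \<odot>\<^bsub>R\<^esub> r \<in> ?Y"
            if "r \<in> ?Y" for c r
          proof -
            have r: "r \<in> carrier R" "r \<odot>\<^bsub>M\<^esub> s \<in> W" using that by auto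
            have "(c \<odot>\<^bsub>R\<^esub> r) \<odot>\<^bsub>M\<^esub> s = (r \<otimes>\<^bsub>R\<^esub> R.scal c) \<odot>\<^bsub>M\<^esub> s" by (simp only: R.mult_scal[OF r(1)])
            also have "\<dots> = R.scal c \<odot>\<^bsub>M\<^esub> (r \<odot>\<^bsub>M\<^esub> s)" by (rule M.act_mult) (use r sM in simp_all)
            finally show ?thesis using submodule_act[of W R M "R.scal c" "r \<odot>\<^bsub>M\<^esub> s"] W r by simp
          qed
        qed auto
        fix q assume q: "nonzero_path q"
        obtain v p where vp: "q = (v, p)" by (cases q)
        have qR: "bpath q \<in> carrier R" using q nonzero_path_qpath by simp
        have v: "v \<in> verts Q" using q vp nonzero_path_qpath qpaths_start by blast
        have "bpath q \<in> carrier (PV v)"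
          by (rule PV_I[OF v qR]) (use q in \<open>auto simp: cf_bpath vp split: if_splits\<close>)
        then have "bpath q \<odot>\<^bsub>M\<^esub> s = (idem v \<otimes>\<^bsub>R\<^esub> bpath q) \<odot>\<^bsub>M\<^esub> s" by (simp only: idem_mult_PV[OF v])
        also have "\<dots> = bpath q \<odot>\<^bsub>M\<^esub> (idem v \<odot>\<^bsub>M\<^esub> s)" by (rule M.act_mult) (use v qR sM in simp_all)
        finally show "bpath q \<in> ?Y"
          using submodule_act[of W R M "bpath q" "idem v \<odot>\<^bsub>M\<^esub> s"] W idW[OF s v] qR by simp
      qed
      then have "\<one>\<^bsub>R\<^esub> \<odot>\<^bsub>M\<^esub> s \<in> W" using R.one_closed by blast
      then show ?thesis using M.act_one[OF sM] by simp
    qed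
    then show "carrier M \<subseteq> W" using T(4)[of W] W by blast
  qed simp
  then show ?thesis by blast
qed

abbreviation FV :: "nat set \<Rightarrow> (nat \<Rightarrow> 'v) \<Rightarrow>
    (('v \<times> 'a list \<Rightarrow> 'k) set, nat \<Rightarrow> ('v \<times> 'a list \<Rightarrow> 'k) set) module" where
  "FV J u \<equiv> mod_family_sum J (\<lambda>j. PV (u j))"

definition radical_part :: "nat set \<Rightarrow> (nat \<Rightarrow> 'v) \<Rightarrow> (nat \<Rightarrow> ('v \<times> 'a list \<Rightarrow> 'k) set) set" where
  "radical_part J u = {x \<in> carrier (FV J u). \<forall>j\<in>J. cf (x j) (u j, []) = 0}"

lemma FV_modules:
  assumes "finite J" "\<And>j. j \<in> J \<Longrightarrow> u j \<in> verts Q"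
  shows "\<And>j. j \<in> J \<Longrightarrow> right_module R (PV (u j))" "right_module R (FV J u)" "projective R (FV J u)"
    "fg_module R (FV J u)"
proof -
  show PV: "right_module R (PV (u j))" if "j \<in> J" for j
    by (rule right_module_right_ideal[OF ring_R idem_closed[OF assms(2)[OF that]]])
  show "right_module R (FV J u)" by (rule right_module_family[OF ring_R PV])
  show "projective R (FV J u)" by (rule projective_family[OF ring_R assms(1) projective_PV[OF assms(2)]])
  then show "fg_module R (FV J u)" by (rule projective_fg)
qed

text \<open>
  Nakayama's lemma. The submodule \<open>U\<close> and the radical together are everything, so each \<open>e\<^sub>j\<close> is
  congruent to an element \<open>y\<^sub>j\<close> of \<open>U\<close>. Iterating this pushes any element into arbitrarily high
  powers of the radical, modulo \<open>U\<close>.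
\<close>

lemma essential_of_radical_kernel:
  assumes J: "finite J" "\<And>j. j \<in> J \<Longrightarrow> u j \<in> verts Q" and M: "right_module R M"
    and p: "p \<in> mod_hom R (FV J u) M"
    and ker: "\<And>x. x \<in> carrier (FV J u) \<Longrightarrow> p x = \<zero>\<^bsub>M\<^esub> \<Longrightarrow> x \<in> radical_part J u"
    and U: "submodule U R (FV J u)" "p ` U = carrier M"
  shows "U = carrier (FV J u)"
proof
  let ?F = "FV J u"
  have F: "\<And>j. j \<in> J \<Longrightarrow> right_module R (PV (u j))" "right_module R ?F"
    using FV_modules(1,2)[of J u] J by auto
  interpret F: right_module R ?F by (rule F)
  interpret M: right_module R M by (rule M)
  show "U \<subseteq> carrier ?F" by (rule submodule_subset[OF U(1)])
  let ?e = "\<lambda>j. family_in J (\<lambda>j. PV (u j)) j (idem (u j))"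
  have idP: "idem (u j) \<in> carrier (PV (u j))" if "j \<in> J" for j
    by (rule idem_PV[OF J(2)[OF that]])
  have inF: "family_in J (\<lambda>j. PV (u j)) j r \<in> carrier ?F" if "j \<in> J" "r \<in> carrier (PV (u j))" for j r
    by (rule hom_closed[OF hom_family_in]) (use that ring_R F(1) in auto)
  \<comment> \<open>As \<open>U\<close> maps onto the image of \<open>p\<close>, it contains an element with the same image as \<open>e\<^sub>j\<close>.\<close>
  have "\<forall>j\<in>J. \<exists>y. y \<in> U \<and> ?e j \<ominus>\<^bsub>?F\<^esub> y \<in> radical_part J u"
  proof
    fix j assume j: "j \<in> J"
    have e: "?e j \<in> carrier ?F" by (rule inF[OF j idP[OF j]])
    then have "p (?e j) \<in> p ` U" using U(2) hom_closed[OF p] by blast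
    then obtain y where y: "y \<in> U" "p (?e j) = p y" by blast
    then have yF: "y \<in> carrier ?F" using submodule_subset[OF U(1)] by blast
    have "p (?e j \<ominus>\<^bsub>?F\<^esub> y) = \<zero>\<^bsub>M\<^esub>"
      using e yF y(2) hom_closed[OF p yF]
      by (simp add: a_minus_def hom_add[OF p] hom_minus[OF F(2) M p] M.M.r_neg)
    then show "\<exists>y. y \<in> U \<and> ?e j \<ominus>\<^bsub>?F\<^esub> y \<in> radical_part J u"
      using y(1) ker[of "?e j \<ominus>\<^bsub>?F\<^esub> y"] e yF by blast
  qed
  from bchoice[OF this] obtain y where y: "\<forall>j\<in>J. y j \<in> U \<and> ?e j \<ominus>\<^bsub>?F\<^esub> y j \<in> radical_part J u" by blast
  define \<rho> where "\<rho> j = ?e j \<ominus>\<^bsub>?F\<^esub> y j" for j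
  have \<rho>: "\<rho> j \<in> carrier ?F" "\<And>i. i \<in> J \<Longrightarrow> deep 1 (\<rho> j i)" if j: "j \<in> J" for j
  proof -
    have r: "\<rho> j \<in> radical_part J u" using y j by (simp add: \<rho>_def)
    then show "\<rho> j \<in> carrier ?F" by (simp add: radical_part_def)
    fix i assume i: "i \<in> J"
    have P: "\<rho> j i \<in> carrier (PV (u i))" by (rule family_memD[OF \<open>\<rho> j \<in> carrier ?F\<close> i])
    show "deep 1 (\<rho> j i)"
      unfolding deep_def
    proof (intro conjI allI impI)
      show "\<rho> j i \<in> carrier R" by (rule PV_closed[OF J(2)[OF i] P])
      fix v q assume nz: "cf (\<rho> j i) (v, q) \<noteq> 0"
      then have "v = u i" by (rule PV_start[OF J(2)[OF i] P])
      then have "q \<noteq> []" using nz r i by (auto simp: radical_part_def)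
      then show "1 \<le> length q" by (cases q) auto
    qed
  qed
  have yU: "y j \<in> U" "y j \<in> carrier ?F" if "j \<in> J" for j
    using y that submodule_subset[OF U(1)] by auto
  have ey: "?e j = y j \<oplus>\<^bsub>?F\<^esub> \<rho> j" if j: "j \<in> J" for j
    using inF[OF j idP[OF j]] yU(2)[OF j]
    by (simp add: \<rho>_def a_minus_def F.M.a_lcomm[of "y j"] F.M.r_neg)
  obtain m where m: "\<And>r k. m \<le> k \<Longrightarrow> deep k r \<Longrightarrow> r = \<zero>\<^bsub>R\<^esub>" using deep_vanishes by blast
  have push: "x \<in> U" if "x \<in> carrier ?F" "\<And>i. i \<in> J \<Longrightarrow> deep k (x i)" for k x
    using that
  proof (induction "m - k" arbitrary: k x)
    case 0
    then have "x i = \<zero>\<^bsub>R\<^esub>" if "i \<in> J" for i using m that by simp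
    then have "x = \<zero>\<^bsub>?F\<^esub>"
      by (intro family_eqI[OF 0(2) F.M.zero_closed]) (simp add: zero_family)
    then show ?case using submodule_zero[OF U(1)] by simp
  next
    case (Suc n)
    note x = Suc.prems
    have xi: "x i \<in> carrier (PV (u i))" "x i \<in> carrier R" if "i \<in> J" for i
      using family_memD[OF x(1) that] PV_closed[OF J(2)[OF that]] by auto
    \<comment> \<open>Replacing each \<open>e\<^sub>i\<close> by \<open>y\<^sub>i + \<rho>\<^sub>i\<close> in \<open>x = \<Sum> e\<^sub>ix\<^sub>i\<close> gives an element of \<open>U\<close> plus \<open>?z\<close>.\<close>
    let ?z = "finsum ?F (\<lambda>i. x i \<odot>\<^bsub>?F\<^esub> \<rho> i) J"
    have z: "?z \<in> carrier ?F" using xi \<rho> by (intro F.M.finsum_closed) auto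
    have zd: "deep (Suc k) (?z j)" if j: "j \<in> J" for j
    proof -
      interpret P: right_module R "PV (u j)" by (rule F(1)[OF j])
      have "?z j = finsum (PV (u j)) (\<lambda>i. (x i \<odot>\<^bsub>?F\<^esub> \<rho> i) j) J"
        by (rule family_finsum_apply) (use ring_R F(1) J(1) xi \<rho> j in auto)
      also have "\<dots> = finsum (PV (u j)) (\<lambda>i. \<rho> i j \<otimes>\<^bsub>R\<^esub> x i) J"
        using j by (simp add: act_family)
      finally have eq: "?z j = finsum (PV (u j)) (\<lambda>i. \<rho> i j \<otimes>\<^bsub>R\<^esub> x i) J" .
      have d: "deep (Suc k) (\<rho> i j \<otimes>\<^bsub>R\<^esub> x i)" if "i \<in> J" for i
        using deep_mult[OF \<rho>(2)[OF that j] x(2)[OF that]] by simp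
      have "deep (Suc k) (finsum (PV (u j)) (\<lambda>i. \<rho> i j \<otimes>\<^bsub>R\<^esub> x i) J')" if "J' \<subseteq> J" for J'
      proof -
        have fin: "finite J'" using that J(1) finite_subset by blast
        from fin that show ?thesis
        proof (induction J')
          case (insert l J')
          have c: "\<rho> i j \<otimes>\<^bsub>R\<^esub> x i \<in> carrier (PV (u j))" if "i \<in> J" for i
            using P.act_closed[OF xi(2)[OF that] family_memD[OF \<rho>(1)[OF that] j]] by simp
          show ?case using insert c d
            by (subst P.M.finsum_insert) (auto intro!: deep_add)
        qed (simp add: deep_zero)
      qed
      then show ?thesis using eq by simp
    qed
    have "n = m - Suc k" using Suc.hyps(2) by simp
    then have zU: "?z \<in> U" by (rule Suc.hyps(1)[OF _ z zd])
    have "x = finsum ?F (\<lambda>i. family_in J (\<lambda>j. PV (u j)) i (x i)) J"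
      by (rule family_decomp) (use ring_R F(1) J(1) x(1) in auto)
    also have "\<dots> = finsum ?F (\<lambda>i. x i \<odot>\<^bsub>?F\<^esub> y i \<oplus>\<^bsub>?F\<^esub> x i \<odot>\<^bsub>?F\<^esub> \<rho> i) J"
    proof (rule F.M.finsum_cong')
      fix i assume i: "i \<in> J"
      have h: "family_in J (\<lambda>j. PV (u j)) i \<in> mod_hom R (PV (u i)) ?F"
        by (rule hom_family_in) (use ring_R F(1) i in auto)
      have "x i \<odot>\<^bsub>PV (u i)\<^esub> idem (u i) = x i" using idem_mult_PV[OF J(2)[OF i] xi(1)[OF i]] by simp
      then have "family_in J (\<lambda>j. PV (u j)) i (x i) = x i \<odot>\<^bsub>?F\<^esub> ?e i"
        using hom_act[OF h xi(2)[OF i] idP[OF i]] by simp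
      also have "\<dots> = x i \<odot>\<^bsub>?F\<^esub> y i \<oplus>\<^bsub>?F\<^esub> x i \<odot>\<^bsub>?F\<^esub> \<rho> i"
        unfolding ey[OF i] by (rule F.act_add) (use i xi yU \<rho> in auto)
      finally show "family_in J (\<lambda>j. PV (u j)) i (x i) = x i \<odot>\<^bsub>?F\<^esub> y i \<oplus>\<^bsub>?F\<^esub> x i \<odot>\<^bsub>?F\<^esub> \<rho> i" .
    qed (use xi yU \<rho> in auto)
    also have "\<dots> = finsum ?F (\<lambda>i. x i \<odot>\<^bsub>?F\<^esub> y i) J \<oplus>\<^bsub>?F\<^esub> ?z"
      by (rule F.M.finsum_addf) (use xi yU \<rho> in auto)
    finally have x_eq: "x = finsum ?F (\<lambda>i. x i \<odot>\<^bsub>?F\<^esub> y i) J \<oplus>\<^bsub>?F\<^esub> ?z" .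
    have "finsum ?F (\<lambda>i. x i \<odot>\<^bsub>?F\<^esub> y i) J \<in> U"
      by (rule submodule_finsum[OF F(2) U(1)]) (intro submodule_act[OF U(1)] xi yU)
    from submodule_add[OF U(1) this zU] show ?case by (simp only: x_eq[symmetric])
  qed
  show "carrier ?F \<subseteq> U"
  proof
    fix x assume x: "x \<in> carrier ?F"
    show "x \<in> U"
      by (rule push[of x 0, OF x]) (use family_memD[OF x] PV_closed[OF J(2)] in \<open>auto simp: deep_def\<close>)
  qed
qed

text \<open>
  Take as few generators at vertices as possible. If the kernel of the resulting epimorphism
  contained an element with a nonzero constant coefficient, the corresponding generator could be
  expressed by the others.
\<close>

theorem radical_cover_exists:
  assumes M: "fg_module R M"
  obtains J u p where "finite J" "\<And>j. j \<in> J \<Longrightarrow> u j \<in> verts Q" "proj_cover R M (FV J u) p"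
    "\<And>x. x \<in> carrier (FV J u) \<Longrightarrow> p x = \<zero>\<^bsub>M\<^esub> \<Longrightarrow> x \<in> radical_part J u"
proof -
  define n where "n = (LEAST n. \<exists>J u x. vertex_generators M J u x \<and> card J = n)"
  have "\<exists>n J u x. vertex_generators M J u x \<and> card J = n"
    using vertex_generators_exist[OF M] by blast
  from LeastI_ex[OF this] obtain J u x where g: "vertex_generators M J u x" and n: "card J = n"
    unfolding n_def by blast
  have least: "n \<le> card J'" if "vertex_generators M J' u' x'" for J' u' x'
    unfolding n_def by (rule Least_le) (use that in blast)
  have J: "finite J" "\<And>j. j \<in> J \<Longrightarrow> u j \<in> verts Q" "\<And>j. j \<in> J \<Longrightarrow> x j \<in> carrier M"
    "\<And>j. j \<in> J \<Longrightarrow> idem (u j) \<odot>\<^bsub>M\<^esub> x j = x j"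
    and gen: "\<And>W. submodule W R M \<Longrightarrow> x ` J \<subseteq> W \<Longrightarrow> carrier M \<subseteq> W"
    using g by (auto simp: vertex_generators_def)
  have Mr: "right_module R M" using M by (rule fg_right_module)
  interpret M: right_module R M by (rule Mr)
  have F: "projective R (FV J u)" using FV_modules(3)[of J u] J(1,2) by simp
  let ?p = "generator_map R M J (\<lambda>j. idem (u j)) x"
  have eR: "idem (u j) \<in> carrier R" if "j \<in> J" for j using J(2)[OF that] by simp
  have p: "?p \<in> mod_hom R (FV J u) M" by (rule hom_generator_map[OF Mr J(1) eR J(3)])
  have ps: "?p ` carrier (FV J u) = carrier M"
    by (rule generator_map_surj[OF Mr J(1) eR J(3,4) gen])
  have ker: "f \<in> radical_part J u" if f: "f \<in> carrier (FV J u)" "?p f = \<zero>\<^bsub>M\<^esub>" for f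
  proof (rule ccontr)
    assume "f \<notin> radical_part J u"
    then obtain j where j: "j \<in> J" "cf (f j) (u j, []) \<noteq> 0" using f(1) by (auto simp: radical_part_def)
    have fR: "f i \<in> carrier R" if "i \<in> J" for i using PV_closed[OF J(2)[OF that] family_memD[OF f(1) that]] .
    have fx: "(\<lambda>i. f i \<odot>\<^bsub>M\<^esub> x i) \<in> J \<rightarrow> carrier M" using fR J(3) by blast
    have "finsum M (\<lambda>i. f i \<odot>\<^bsub>M\<^esub> x i) J = \<zero>\<^bsub>M\<^esub>"
      using f(2) generator_map_apply[OF Mr eR J(3) f(1)] by simp
    moreover have "finsum M (\<lambda>i. f i \<odot>\<^bsub>M\<^esub> x i) J =
      f j \<odot>\<^bsub>M\<^esub> x j \<oplus>\<^bsub>M\<^esub> finsum M (\<lambda>i. f i \<odot>\<^bsub>M\<^esub> x i) (J - {j})"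
      using M.M.finsum_insert[of "J - {j}" j "\<lambda>i. f i \<odot>\<^bsub>M\<^esub> x i"] J(1) j(1) fx
      by (auto simp: insert_absorb Pi_iff)
    ultimately have eq: "f j \<odot>\<^bsub>M\<^esub> x j = \<ominus>\<^bsub>M\<^esub> finsum M (\<lambda>i. f i \<odot>\<^bsub>M\<^esub> x i) (J - {j})"
      using fx j(1) by (intro M.M.minus_equality[symmetric]) (auto intro!: M.M.finsum_closed)
    have "vertex_generators M (J - {j}) u x"
      unfolding vertex_generators_def
    proof (intro conjI allI impI ballI)
      fix W assume W: "submodule W R M \<and> x ` (J - {j}) \<subseteq> W"
      then have Ws: "submodule W R M" by simp
      have "finsum M (\<lambda>i. f i \<odot>\<^bsub>M\<^esub> x i) (J - {j}) \<in> W"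
        by (rule submodule_finsum[OF Mr Ws]) (use submodule_act[OF Ws] W fR in blast)
      then have "f j \<odot>\<^bsub>M\<^esub> x j \<in> W" unfolding eq by (rule submodule_minus[OF Ws])
      then have "x j \<in> W"
        by (rule exchange[OF Mr Ws J(2)[OF j(1)] J(3,4)[OF j(1)] family_memD[OF f(1) j(1)] j(2)])
      then have "x ` J \<subseteq> W" using W by blast
      then show "carrier M \<subseteq> W" by (rule gen[OF Ws])
    qed (use J in auto)
    from least[OF this] show False using n j(1) J(1) by (metis card_Diff1_less not_less)
  qed
  have "proj_cover R M (FV J u) ?p"
    unfolding proj_cover_def
  proof (intro conjI F p ps allI impI)
    fix U assume U: "submodule U R (FV J u) \<and> ?p ` U = carrier M"
    show "U = carrier (FV J u)"
      by (rule essential_of_radical_kernel[where p = ?p and u = u and J = J and M = M])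
        (use J(1,2) Mr p ker U in auto)
  qed
  then show thesis using that J(1,2) ker by blast
qed

lemma syzygy_cover:
  fixes M :: "(('v \<times> 'a list \<Rightarrow> 'k) set, 'm) module"
  assumes "fg_module R M"
  obtains P :: "(('v \<times> 'a list \<Rightarrow> 'k) set, ('v \<times> 'a list \<Rightarrow> 'k) set univ) module" and p
  where "proj_cover R M P p" "syzygy R M = kernel_module P p M"
  using radical_cover_exists[OF assms] R.syzygy_kernel by metis

lemma syzygy_of_syzygy: "fg_module R M \<Longrightarrow> syzygy_of R M (syzygy R M)"
  using syzygy_cover[of M] proj_cover_presents unfolding syzygy_of_def by metis

end

section \<open>Submodules of the radical of a projective module\<close>

lemma uniserial_iso:
  assumes "right_module R M" "right_module R N" "mod_isomorphic R M N" "uniserial R M"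
  shows "uniserial R N"
proof -
  obtain f where f: "f \<in> mod_hom R M N" "bij_betw f (carrier M) (carrier N)"
    using assms(3) by (auto simp: mod_isomorphic_def)
  obtain g where g: "g \<in> mod_hom R N M" "\<And>x. x \<in> carrier M \<Longrightarrow> g (f x) = x" "\<And>y. y \<in> carrier N \<Longrightarrow> f (g y) = y"
    using iso_inverse[OF assms(1,2) f] by metis
  have nz: "\<not> zero_module N"
  proof
    assume "zero_module N"
    then have "zero_module M"
      by (rule zero_module_iso[OF assms(2,1) mod_isomorphic_sym[OF assms(1,2,3)]])
    then show False using assms(4) by (simp add: uniserial_def)
  qed
  have "U \<subseteq> V \<or> V \<subseteq> U" if UV: "submodule U R N" "submodule V R N" for U V
  proof -
    have "g ` U \<subseteq> g ` V \<or> g ` V \<subseteq> g ` U"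
      using assms(4) image_submodule[OF assms(2,1) g(1)] UV by (simp add: uniserial_def)
    moreover have "f ` g ` U = U" if "submodule U R N" for U
      using g(3) submodule_subset[OF that] by (auto simp: image_image image_iff subset_iff)
    ultimately show ?thesis using UV by (metis image_mono)
  qed
  then show ?thesis using nz by (simp add: uniserial_def)
qed

text \<open>
  A generator of a submodule of \<open>\<Oplus> e\<^sub>jR\<close> is either a combination of paths that all end with the
  same arrow, or just a combination of paths that end at the same vertex.
\<close>

datatype ('v, 'a) end_kind = At_vertex 'v | At_arrow 'a

fun kind_end :: "('v, 'a) pre_digraph \<Rightarrow> ('v, 'a) end_kind \<Rightarrow> 'v" where
  "kind_end Q (At_vertex w) = w"
| "kind_end Q (At_arrow a) = head Q a"

fun kind_weight :: "('v, 'a) end_kind \<Rightarrow> nat" where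
  "kind_weight (At_vertex w) = 2"
| "kind_weight (At_arrow a) = 1"

fun valid_kind :: "('v, 'a) pre_digraph \<Rightarrow> ('v, 'a) end_kind \<Rightarrow> bool" where
  "valid_kind Q (At_vertex w) \<longleftrightarrow> w \<in> verts Q"
| "valid_kind Q (At_arrow a) \<longleftrightarrow> a \<in> arcs Q"

fun last_fits :: "('v, 'a) pre_digraph \<Rightarrow> ('v, 'a) end_kind \<Rightarrow> 'a \<Rightarrow> bool" where
  "last_fits Q (At_vertex w) b \<longleftrightarrow> head Q b = w"
| "last_fits Q (At_arrow a) b \<longleftrightarrow> b = a"

locale gentle_algebra = monomial_algebra Q S I
  for Q :: "('v, 'a) pre_digraph" and S and I :: "('v \<times> 'a list \<Rightarrow> 'k :: field) set" +
  assumes out_rel: "(tail Q a, [a, b]) \<in> S \<Longrightarrow> (tail Q a, [a, b']) \<in> S \<Longrightarrow> b = b'"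
    and in_rel: "(tail Q a, [a, b]) \<in> S \<Longrightarrow> (tail Q a', [a', b]) \<in> S \<Longrightarrow> a = a'"
begin

lemma relation_arrows:
  assumes "(tail Q a, [a, b]) \<in> S"
  shows "a \<in> arcs Q" "b \<in> arcs Q" "head Q a = tail Q b"
  using assms quadratic by (auto simp: qpaths_Cons)

abbreviation arrow :: "'a \<Rightarrow> ('v \<times> 'a list \<Rightarrow> 'k) set" where
  "arrow a \<equiv> bpath (tail Q a, [a])"

abbreviation RA :: "'a \<Rightarrow> (('v \<times> 'a list \<Rightarrow> 'k) set, ('v \<times> 'a list \<Rightarrow> 'k) set) module" where
  "RA a \<equiv> right_ideal_gen R (arrow a)"

lemma arrow_module_RA: "arrow_module Q I a = RA a"
  by (simp add: arrow_module_def)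

lemma arrow_closed [simp]: "a \<in> arcs Q \<Longrightarrow> arrow a \<in> carrier R"
  by (simp add: qpaths_arrow)

lemma cf_arrow_mult:
  assumes "a \<in> arcs Q" "r \<in> carrier R" "nonzero_path (v, p)"
  shows "cf (arrow a \<otimes>\<^bsub>R\<^esub> r) (v, p) = (if v = tail Q a \<and> p \<noteq> [] \<and> hd p = a then cf r (head Q a, tl p) else 0)"
  using cf_bpath_mult[OF assms(2) nonzero_path_arrow[OF assms(1)] assms(3)]
  by (cases p) (auto simp: path_end_def)

lemma arrow_idem: "a \<in> arcs Q \<Longrightarrow> arrow a \<otimes>\<^bsub>R\<^esub> idem (head Q a) = arrow a"
proof (rule cf_eqI)
  fix q assume a: "a \<in> arcs Q" and q: "nonzero_path q"
  obtain v p where vp: "q = (v, p)" by (cases q)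
  show "cf (arrow a \<otimes>\<^bsub>R\<^esub> idem (head Q a)) q = cf (arrow a) q"
    using a q nonzero_path_arrow[OF a] unfolding vp
    by (subst cf_mult_idem) (auto simp: cf_bpath path_end_def)
qed simp_all

fun kind_elt :: "('v, 'a) end_kind \<Rightarrow> ('v \<times> 'a list \<Rightarrow> 'k) set" where
  "kind_elt (At_vertex w) = idem w"
| "kind_elt (At_arrow a) = arrow a"

lemma kind_facts:
  assumes "valid_kind Q t"
  shows "kind_end Q t \<in> verts Q" "kind_elt t \<in> carrier R" "kind_elt t \<otimes>\<^bsub>R\<^esub> idem (kind_end Q t) = kind_elt t"
  using assms by (cases t; simp add: arrow_idem idem_idem)+

text \<open>
  For a nonzero path \<open>q\<close> from the end of \<open>t\<close>: the product of \<open>kind_elt t\<close> and \<open>q\<close> is not zero.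
\<close>

definition continues :: "('v, 'a) end_kind \<Rightarrow> 'a list \<Rightarrow> bool" where
  "continues t q \<longleftrightarrow> (case t of At_vertex w \<Rightarrow> True | At_arrow a \<Rightarrow> q = [] \<or> (tail Q a, [a, hd q]) \<notin> S)"

lemma kind_elt_mult_zero_iff:
  assumes t: "valid_kind Q t" and r: "r \<in> carrier (PV (kind_end Q t))"
  shows "kind_elt t \<otimes>\<^bsub>R\<^esub> r = \<zero>\<^bsub>R\<^esub> \<longleftrightarrow>
    (\<forall>q. nonzero_path (kind_end Q t, q) \<and> continues t q \<longrightarrow> cf r (kind_end Q t, q) = 0)"
proof (cases t)
  case (At_vertex w)
  have w: "w \<in> verts Q" using t At_vertex by simp
  have rw: "r \<in> carrier (PV w)" using r At_vertex by simp
  have "r = \<zero>\<^bsub>R\<^esub> \<longleftrightarrow> (\<forall>q. nonzero_path (w, q) \<longrightarrow> cf r (w, q) = 0)"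
  proof
    assume *: "\<forall>q. nonzero_path (w, q) \<longrightarrow> cf r (w, q) = 0"
    show "r = \<zero>\<^bsub>R\<^esub>"
    proof (rule cf_eqI)
      fix q assume q: "nonzero_path q"
      obtain v p where vp: "q = (v, p)" by (cases q)
      show "cf r q = cf \<zero>\<^bsub>R\<^esub> q"
      proof (rule ccontr)
        assume "cf r q \<noteq> cf \<zero>\<^bsub>R\<^esub> q"
        then have nz: "cf r (v, p) \<noteq> 0" by (simp add: vp)
        then have "v = w" by (rule PV_start[OF w rw])
        then show False using * q nz by (simp add: vp)
      qed
    qed (use PV_closed[OF w rw] in simp_all)
  qed simp
  then show ?thesis using idem_mult_PV[OF w rw] by (simp add: At_vertex continues_def)
next
  case (At_arrow a)
  have a: "a \<in> arcs Q" using t At_arrow by simp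
  have h: "head Q a \<in> verts Q" using a by simp
  have rh: "r \<in> carrier (PV (head Q a))" using r At_arrow by simp
  have rR: "r \<in> carrier R" by (rule PV_closed[OF h rh])
  have ext: "nonzero_path (tail Q a, a # q) \<longleftrightarrow> nonzero_path (head Q a, q) \<and> continues t q" for q
    using nonzero_path_append[of "tail Q a" "[a]" q] nonzero_path_arrow[OF a]
    by (auto simp: continues_def At_arrow path_end_def)
  have "arrow a \<otimes>\<^bsub>R\<^esub> r = \<zero>\<^bsub>R\<^esub> \<longleftrightarrow> (\<forall>q. nonzero_path (tail Q a, a # q) \<longrightarrow> cf r (head Q a, q) = 0)"
  proof
    assume z: "arrow a \<otimes>\<^bsub>R\<^esub> r = \<zero>\<^bsub>R\<^esub>"
    show "\<forall>q. nonzero_path (tail Q a, a # q) \<longrightarrow> cf r (head Q a, q) = 0"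
    proof (intro allI impI)
      fix q assume "nonzero_path (tail Q a, a # q)"
      from cf_arrow_mult[OF a rR this] show "cf r (head Q a, q) = 0" by (simp add: z)
    qed
  next
    assume *: "\<forall>q. nonzero_path (tail Q a, a # q) \<longrightarrow> cf r (head Q a, q) = 0"
    show "arrow a \<otimes>\<^bsub>R\<^esub> r = \<zero>\<^bsub>R\<^esub>"
    proof (rule cf_eqI)
      fix q assume q: "nonzero_path q"
      obtain v p where vp: "q = (v, p)" by (cases q)
      have "cf (arrow a \<otimes>\<^bsub>R\<^esub> r) (v, p) = 0"
        using cf_arrow_mult[OF a rR q[unfolded vp]] * q by (cases p) (auto simp: vp)
      then show "cf (arrow a \<otimes>\<^bsub>R\<^esub> r) q = cf \<zero>\<^bsub>R\<^esub> q" by (simp add: vp)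
    qed (use a rR in simp_all)
  qed
  then show ?thesis by (auto simp: At_arrow ext)
qed

definition left_mult :: "('v \<times> 'a list \<Rightarrow> 'k) set \<Rightarrow> 'v \<Rightarrow> ('v \<times> 'a list \<Rightarrow> 'k) set \<Rightarrow> ('v \<times> 'a list \<Rightarrow> 'k) set" where
  "left_mult a w = (\<lambda>r\<in>carrier (PV w). a \<otimes>\<^bsub>R\<^esub> r)"

lemma left_mult_presents:
  assumes a: "a \<in> carrier R" and w: "w \<in> verts Q" and aw: "a \<otimes>\<^bsub>R\<^esub> idem w = a"
  shows "presents R (PV w) (left_mult a w) (right_ideal_gen R a)"
proof -
  interpret P: right_module R "PV w" by (rule right_module_right_ideal[OF ring_R idem_closed[OF w]])
  have c: "r \<in> carrier R" if "r \<in> carrier (PV w)" for r by (rule PV_closed[OF w that])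
  have sm: "r \<oplus>\<^bsub>R\<^esub> s \<in> carrier (PV w)" if "r \<in> carrier (PV w)" "s \<in> carrier (PV w)" for r s
    using P.M.a_closed[OF that] by simp
  have ac: "r \<otimes>\<^bsub>R\<^esub> s \<in> carrier (PV w)" if "r \<in> carrier (PV w)" "s \<in> carrier R" for r s
    using P.act_closed[OF that(2,1)] by simp
  have hom: "left_mult a w \<in> mod_hom R (PV w) (right_ideal_gen R a)"
    unfolding left_mult_def
    by (rule mod_homI) (auto simp: right_ideal_mem c sm ac a R.r_distr R.m_assoc)
  have "carrier (right_ideal_gen R a) \<subseteq> left_mult a w ` carrier (PV w)"
  proof
    fix y assume "y \<in> carrier (right_ideal_gen R a)"
    then obtain r where r: "r \<in> carrier R" "y = a \<otimes>\<^bsub>R\<^esub> r" by (auto simp: carrier_right_ideal)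
    have m: "idem w \<otimes>\<^bsub>R\<^esub> r \<in> carrier (PV w)" by (rule right_ideal_mem[OF r(1)])
    have "y = left_mult a w (idem w \<otimes>\<^bsub>R\<^esub> r)"
      using m a w r aw by (simp add: left_mult_def R.m_assoc[symmetric])
    then show "y \<in> left_mult a w ` carrier (PV w)" using m by blast
  qed
  moreover have "left_mult a w ` carrier (PV w) \<subseteq> carrier (right_ideal_gen R a)"
    using hom_closed[OF hom] by blast
  ultimately show ?thesis using hom projective_PV[OF w] by (auto simp: presents_def)
qed

end

text \<open>The setting of the structure theorem: a submodule \<open>U\<close> of the radical of \<open>\<Oplus> e\<^sub>jR\<close>.\<close>

locale radical_submodule = gentle_algebra Q S I
  for Q :: "('v, 'a) pre_digraph" and S and I :: "('v \<times> 'a list \<Rightarrow> 'k :: field) set" +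
  fixes J :: "nat set" and u :: "nat \<Rightarrow> 'v" and U
  assumes finite_J: "finite J" and verts_u: "\<And>j. j \<in> J \<Longrightarrow> u j \<in> verts Q"
    and submodule_U: "submodule U R (FV J u)" and radical_U: "U \<subseteq> radical_part J u"
begin

abbreviation F where "F \<equiv> FV J u"

sublocale F: right_module R F
  using FV_modules(2)[of J u] finite_J verts_u by simp

lemma U_carrier: "U \<subseteq> carrier F"
  by (rule submodule_subset[OF submodule_U])

lemma coord_PV: "x \<in> carrier F \<Longrightarrow> j \<in> J \<Longrightarrow> x j \<in> carrier (PV (u j))"
  by (rule family_memD)

lemma coord_closed: "x \<in> carrier F \<Longrightarrow> j \<in> J \<Longrightarrow> x j \<in> carrier R"
  by (rule PV_closed[OF verts_u coord_PV])

lemma F_eqI: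
  assumes "x \<in> carrier F" "y \<in> carrier F"
    and "\<And>j p. j \<in> J \<Longrightarrow> nonzero_path (u j, p) \<Longrightarrow> cf (x j) (u j, p) = cf (y j) (u j, p)"
  shows "x = y"
proof (rule family_eqI[OF assms(1,2)])
  fix j assume j: "j \<in> J"
  show "x j = y j"
  proof (rule cf_eqI[OF coord_closed[OF assms(1) j] coord_closed[OF assms(2) j]])
    fix q assume q: "nonzero_path q"
    obtain v p where vp: "q = (v, p)" by (cases q)
    show "cf (x j) q = cf (y j) q"
    proof (cases "v = u j")
      case True then show ?thesis using assms(3)[OF j] q by (simp add: vp)
    next
      case False
      then have "cf (x j) (v, p) = 0" "cf (y j) (v, p) = 0"
        using PV_start[OF verts_u[OF j] coord_PV[OF assms(1) j]] PV_start[OF verts_u[OF j] coord_PV[OF assms(2) j]]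
        by blast+
      then show ?thesis by (simp add: vp)
    qed
  qed
qed

lemma cf_U_nontrivial:
  assumes "x \<in> U" "j \<in> J" "cf (x j) (u j, p) \<noteq> 0"
  shows "p \<noteq> []"
  using assms radical_U by (auto simp: radical_part_def)

text \<open>
  Meant for elements of \<open>U\<close>, whose paths are not trivial, so that \<open>last p\<close> is meaningful.
\<close>

definition ends_at :: "('v, 'a) end_kind \<Rightarrow> (nat \<Rightarrow> ('v \<times> 'a list \<Rightarrow> 'k) set) \<Rightarrow> bool" where
  "ends_at t x \<longleftrightarrow> valid_kind Q t \<and> (\<forall>j\<in>J. \<forall>p. cf (x j) (u j, p) \<noteq> 0 \<longrightarrow> last_fits Q t (last p))"

lemma ends_at_path_end:
  assumes "ends_at t x" "x \<in> U" "j \<in> J" "cf (x j) (u j, p) \<noteq> 0"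
  shows "path_end Q (u j) p = kind_end Q t"
proof -
  have "p \<noteq> []" by (rule cf_U_nontrivial[OF assms(2-4)])
  moreover have "last_fits Q t (last p)" using assms(1,3,4) by (auto simp: ends_at_def)
  ultimately show ?thesis by (cases t) (auto simp: path_end_def)
qed

lemma ends_at_idem:
  assumes "ends_at t x" "x \<in> U"
  shows "idem (kind_end Q t) \<odot>\<^bsub>F\<^esub> x = x"
proof -
  have t: "kind_end Q t \<in> verts Q" using assms(1) kind_facts(1) by (simp add: ends_at_def)
  have x: "x \<in> carrier F" using assms(2) U_carrier by blast
  show ?thesis
  proof (rule F_eqI)
    show "idem (kind_end Q t) \<odot>\<^bsub>F\<^esub> x \<in> carrier F" by (rule F.act_closed) (use t x in simp_all)
    fix j p assume j: "j \<in> J" and p: "nonzero_path (u j, p)"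
    have "cf ((idem (kind_end Q t) \<odot>\<^bsub>F\<^esub> x) j) (u j, p) = cf (x j \<otimes>\<^bsub>R\<^esub> idem (kind_end Q t)) (u j, p)"
      using j by (simp add: act_family)
    also have "\<dots> = (if path_end Q (u j) p = kind_end Q t then cf (x j) (u j, p) else 0)"
      by (rule cf_mult_idem[OF coord_closed[OF x j] t p])
    also have "\<dots> = cf (x j) (u j, p)" using ends_at_path_end[OF assms j] by auto
    finally show "cf ((idem (kind_end Q t) \<odot>\<^bsub>F\<^esub> x) j) (u j, p) = cf (x j) (u j, p)" .
  qed (rule x)
qed

lemma cf_combination:
  assumes "finite G" "\<And>i. i \<in> G \<Longrightarrow> x i \<in> carrier F" "\<And>i. i \<in> G \<Longrightarrow> r i \<in> carrier R"
    and j: "j \<in> J" and p: "nonzero_path (u j, p)"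
  shows "cf (finsum F (\<lambda>i. r i \<odot>\<^bsub>F\<^esub> x i) G j) (u j, p) =
    (\<Sum>i\<in>G. \<Sum>k\<le>length p. cf (x i j) (u j, take k p) * cf (r i) (path_end Q (u j) (take k p), drop k p))"
  using assms(1-3)
proof (induction G)
  case empty
  show ?case using j by (simp add: zero_family)
next
  case (insert i G)
  have xr: "r l \<odot>\<^bsub>F\<^esub> x l \<in> carrier F" if "l \<in> insert i G" for l
    using insert.prems that by (intro F.act_closed) auto
  have S: "finsum F (\<lambda>i. r i \<odot>\<^bsub>F\<^esub> x i) G \<in> carrier F" using xr by (intro F.M.finsum_closed) auto
  have "finsum F (\<lambda>i. r i \<odot>\<^bsub>F\<^esub> x i) (insert i G) = r i \<odot>\<^bsub>F\<^esub> x i \<oplus>\<^bsub>F\<^esub> finsum F (\<lambda>i. r i \<odot>\<^bsub>F\<^esub> x i) G"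
    using insert.hyps xr by (intro F.M.finsum_insert) auto
  then have "finsum F (\<lambda>i. r i \<odot>\<^bsub>F\<^esub> x i) (insert i G) j =
      (x i j \<otimes>\<^bsub>R\<^esub> r i) \<oplus>\<^bsub>R\<^esub> finsum F (\<lambda>i. r i \<odot>\<^bsub>F\<^esub> x i) G j"
    using j by (simp add: add_family act_family)
  then have "cf (finsum F (\<lambda>i. r i \<odot>\<^bsub>F\<^esub> x i) (insert i G) j) (u j, p) =
      cf (x i j \<otimes>\<^bsub>R\<^esub> r i) (u j, p) + cf (finsum F (\<lambda>i. r i \<odot>\<^bsub>F\<^esub> x i) G j) (u j, p)"
    using coord_closed[OF insert.prems(1)[OF insertI1] j] insert.prems(2)[OF insertI1] coord_closed[OF S j] by simp
  moreover have "cf (x i j \<otimes>\<^bsub>R\<^esub> r i) (u j, p) =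
      (\<Sum>k\<le>length p. cf (x i j) (u j, take k p) * cf (r i) (path_end Q (u j) (take k p), drop k p))"
    by (rule cf_mult[OF coord_closed[OF insert.prems(1)[OF insertI1] j] insert.prems(2)[OF insertI1] p])
  ultimately show ?case using insert by simp
qed

lemma ends_at_continues:
  assumes "ends_at t x" "x \<in> U" "j \<in> J" "nonzero_path (u j, p)" "cf (x j) (u j, take k p) \<noteq> 0"
  shows "continues t (drop k p)" "path_end Q (u j) (take k p) = kind_end Q t"
proof -
  have ne: "take k p \<noteq> []" by (rule cf_U_nontrivial[OF assms(2,3,5)])
  have lf: "last_fits Q t (last (take k p))" using assms(1,3,5) by (auto simp: ends_at_def)
  show "path_end Q (u j) (take k p) = kind_end Q t" by (rule ends_at_path_end[OF assms(1-3,5)])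
  have "drop k p = [] \<or> (tail Q (last (take k p)), [last (take k p), hd (drop k p)]) \<notin> S"
    using assms(4) nonzero_path_append[of "u j" "take k p" "drop k p"] ne by simp
  then show "continues t (drop k p)" using lf by (cases t) (auto simp: continues_def)
qed

text \<open>
  A path that is killed by \<open>kind_elt t\<close> also gives zero when it is appended to a path that ends as
  prescribed by \<open>t\<close>.
\<close>

lemma annihilated_by_kind:
  assumes "ends_at t x" "x \<in> U" "r \<in> carrier (PV (kind_end Q t))" "kind_elt t \<otimes>\<^bsub>R\<^esub> r = \<zero>\<^bsub>R\<^esub>"
  shows "r \<odot>\<^bsub>F\<^esub> x = \<zero>\<^bsub>F\<^esub>"
proof -
  have t: "valid_kind Q t" using assms(1) by (simp add: ends_at_def)
  have x: "x \<in> carrier F" using assms(2) U_carrier by blast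
  have r: "r \<in> carrier R" by (rule PV_closed[OF kind_facts(1)[OF t] assms(3)])
  have z: "cf r (kind_end Q t, q) = 0" if "continues t q" for q
    using kind_elt_mult_zero_iff[OF t assms(3)] assms(4) that by (cases "nonzero_path (kind_end Q t, q)") auto
  show ?thesis
  proof (rule F_eqI)
    show "r \<odot>\<^bsub>F\<^esub> x \<in> carrier F" by (rule F.act_closed[OF r x])
    fix j p assume j: "j \<in> J" and p: "nonzero_path (u j, p)"
    have "cf ((r \<odot>\<^bsub>F\<^esub> x) j) (u j, p) =
        (\<Sum>k\<le>length p. cf (x j) (u j, take k p) * cf r (path_end Q (u j) (take k p), drop k p))"
      using j cf_mult[OF coord_closed[OF x j] r p] by (simp add: act_family)
    also have "\<dots> = 0"
    proof (rule sum.neutral, rule ballI)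
      fix k
      show "cf (x j) (u j, take k p) * cf r (path_end Q (u j) (take k p), drop k p) = 0"
      proof (cases "cf (x j) (u j, take k p) = 0")
        case False
        from ends_at_continues[OF assms(1,2) j p False] z show ?thesis by simp
      qed simp
    qed
    finally show "cf ((r \<odot>\<^bsub>F\<^esub> x) j) (u j, p) = cf (\<zero>\<^bsub>F\<^esub> j) (u j, p)" using j by (simp add: zero_family)
  qed simp
qed

text \<open>
  An arrow end says more than a vertex end and has the smaller weight. Systems of minimal total
  weight will turn out to have no relations other than the obvious ones.
\<close>

definition generating :: "nat set \<Rightarrow> (nat \<Rightarrow> ('v, 'a) end_kind) \<Rightarrow> (nat \<Rightarrow> nat \<Rightarrow> ('v \<times> 'a list \<Rightarrow> 'k) set) \<Rightarrow> bool" where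
  "generating G t x \<longleftrightarrow> finite G \<and> (\<forall>i\<in>G. x i \<in> U \<and> ends_at (t i) (x i)) \<and>
     (\<forall>W. submodule W R F \<and> x ` G \<subseteq> W \<longrightarrow> U \<subseteq> W)"

definition weight :: "nat set \<Rightarrow> (nat \<Rightarrow> ('v, 'a) end_kind) \<Rightarrow> nat" where
  "weight G t = (\<Sum>i\<in>G. kind_weight (t i))"

lemma generating_exists: "\<exists>G t x. generating G t x"
proof -
  have "fg_module R F" using FV_modules(4)[of J u] finite_J verts_u by simp
  then have "fg_module R (F\<lparr>carrier := U\<rparr>)" by (rule R.fg_submodule[OF _ submodule_U])
  from vertex_generators_exist[OF this] obtain G w x where g: "vertex_generators (F\<lparr>carrier := U\<rparr>) G w x" by blast
  have "generating G (\<lambda>i. At_vertex (w i)) x"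
    unfolding generating_def
  proof (intro conjI ballI allI impI)
    show "finite G" using g by (simp add: vertex_generators_def)
    fix i assume i: "i \<in> G"
    have x: "x i \<in> U" "w i \<in> verts Q" "idem (w i) \<odot>\<^bsub>F\<^esub> x i = x i"
      using g i by (auto simp: vertex_generators_def)
    then show "x i \<in> U" by simp
    have xF: "x i \<in> carrier F" using x U_carrier by blast
    show "ends_at (At_vertex (w i)) (x i)"
      unfolding ends_at_def
    proof (intro conjI ballI allI impI)
      fix j p assume j: "j \<in> J" and nz: "cf (x i j) (u j, p) \<noteq> 0"
      have p: "nonzero_path (u j, p)" using nz cf_bad by blast
      have "x i j = x i j \<otimes>\<^bsub>R\<^esub> idem (w i)"
        using fun_cong[OF x(3), of j] j by (simp add: act_family)
      then have "cf (x i j) (u j, p) = (if path_end Q (u j) p = w i then cf (x i j) (u j, p) else 0)"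
        using cf_mult_idem[OF coord_closed[OF xF j] x(2) p] by simp
      then have "path_end Q (u j) p = w i" using nz by (simp split: if_splits)
      then show "last_fits Q (At_vertex (w i)) (last p)"
        using cf_U_nontrivial[OF x(1) j nz] by (simp add: path_end_def)
    qed (simp add: x)
  next
    fix W assume W: "submodule W R F \<and> x ` G \<subseteq> W"
    have xU: "x ` G \<subseteq> U" using g by (auto simp: vertex_generators_def)
    have "submodule (W \<inter> U) R (F\<lparr>carrier := U\<rparr>)"
      by (rule submodule_within[OF submodule_inter[OF F.right_module_axioms _ submodule_U] _
            right_module_submodule[OF F.right_module_axioms submodule_U]]) (use W in auto)
    moreover have "\<forall>W. submodule W R (F\<lparr>carrier := U\<rparr>) \<and> x ` G \<subseteq> W \<longrightarrow> U \<subseteq> W"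
      using g by (simp add: vertex_generators_def)
    ultimately have "U \<subseteq> W \<inter> U" using W xU by blast
    then show "U \<subseteq> W" by blast
  qed
  then show ?thesis by blast
qed

end

context radical_submodule
begin

lemma kind_weight_pos: "0 < kind_weight t"
  by (cases t) simp_all

text \<open>
  The constant term makes the coefficient invertible from the right, so the combination can be
  solved for \<open>x\<^sub>i\<close>.
\<close>

lemma solve_for_generator:
  assumes G: "finite G" "\<And>i. i \<in> G \<Longrightarrow> x i \<in> U" "\<And>i. i \<in> G \<Longrightarrow> ends_at (t i) (x i)"
    and r: "\<And>i. i \<in> G \<Longrightarrow> r i \<in> carrier (PV (kind_end Q (t i)))"
    and i: "i \<in> G" "cf (r i) (kind_end Q (t i), []) \<noteq> 0"
    and W: "submodule W R F" "x ` (G - {i}) \<subseteq> W" "finsum F (\<lambda>i. r i \<odot>\<^bsub>F\<^esub> x i) G \<in> W"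
  shows "x i \<in> W"
proof -
  have w: "kind_end Q (t i) \<in> verts Q" if "i \<in> G" for i
    using kind_facts(1) G(3)[OF that] by (simp add: ends_at_def)
  have rR: "r i \<in> carrier R" if "i \<in> G" for i by (rule PV_closed[OF w[OF that] r[OF that]])
  have xF: "x i \<in> carrier F" if "i \<in> G" for i using G(2)[OF that] U_carrier by blast
  let ?f = "\<lambda>i. r i \<odot>\<^bsub>F\<^esub> x i"
  have f: "?f l \<in> carrier F" if "l \<in> G" for l by (rule F.act_closed[OF rR[OF that] xF[OF that]])
  have rest: "finsum F ?f (G - {i}) \<in> W"
    by (rule submodule_finsum[OF F.right_module_axioms W(1)])
      (use submodule_act[OF W(1) rR] W(2) in blast)
  have "finsum F ?f (insert i (G - {i})) = ?f i \<oplus>\<^bsub>F\<^esub> finsum F ?f (G - {i})"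
    using G(1) f i(1) by (intro F.M.finsum_insert) auto
  then have "finsum F ?f G = ?f i \<oplus>\<^bsub>F\<^esub> finsum F ?f (G - {i})" using i(1) by (simp only: insert_Diff)
  then have "finsum F ?f G \<oplus>\<^bsub>F\<^esub> \<ominus>\<^bsub>F\<^esub> finsum F ?f (G - {i}) = ?f i"
    using f[OF i(1)] submodule_subset[OF W(1)] rest by (auto simp: F.M.a_assoc F.M.r_neg)
  moreover have "finsum F ?f G \<oplus>\<^bsub>F\<^esub> \<ominus>\<^bsub>F\<^esub> finsum F ?f (G - {i}) \<in> W"
    by (rule submodule_add[OF W(1) W(3) submodule_minus[OF W(1) rest]])
  ultimately have "?f i \<in> W" by simp
  then show ?thesis
    by (rule exchange[OF F.right_module_axioms W(1) w[OF i(1)] xF[OF i(1)]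
          ends_at_idem[OF G(3)[OF i(1)] G(2)[OF i(1)]] r[OF i(1)] i(2)])
qed

lemma minimal_generating_exists:
  obtains G t x where "generating G t x" "\<And>G' t' x'. generating G' t' x' \<Longrightarrow> weight G t \<le> weight G' t'"
proof -
  define n where "n = (LEAST n. \<exists>G t x. generating G t x \<and> weight G t = n)"
  have "\<exists>n G t x. generating G t x \<and> weight G t = n" using generating_exists by blast
  from LeastI_ex[OF this] obtain G t x where g: "generating G t x" and n: "weight G t = n"
    unfolding n_def by blast
  have "n \<le> weight G' t'" if "generating G' t' x'" for G' t' x'
    unfolding n_def by (rule Least_le) (use that in blast)
  then show thesis using that g n by blast
qed

end

locale minimal_generators = radical_submodule Q S I J u U
  for Q :: "('v, 'a) pre_digraph" and S and I :: "('v \<times> 'a list \<Rightarrow> 'k :: field) set" and J u U +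
  fixes G t x
  assumes generating: "generating G t x"
    and minimal: "generating G' t' x' \<Longrightarrow> weight G t \<le> weight G' t'"
begin

abbreviation w where "w i \<equiv> kind_end Q (t i)"

lemma finite_G: "finite G"
  and x_U: "i \<in> G \<Longrightarrow> x i \<in> U"
  and x_ends: "i \<in> G \<Longrightarrow> ends_at (t i) (x i)"
  and x_generate: "submodule W R F \<Longrightarrow> x ` G \<subseteq> W \<Longrightarrow> U \<subseteq> W"
  using generating by (auto simp: generating_def)

lemma kind_valid: "i \<in> G \<Longrightarrow> valid_kind Q (t i)"
  using x_ends by (simp add: ends_at_def)

lemma w_verts: "i \<in> G \<Longrightarrow> w i \<in> verts Q"
  by (rule kind_facts(1)[OF kind_valid])

lemma x_F: "i \<in> G \<Longrightarrow> x i \<in> carrier F"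
  using x_U U_carrier by blast

lemma no_redundant_generator:
  assumes i: "i \<in> G" and r: "\<And>W. submodule W R F \<Longrightarrow> x ` (G - {i}) \<subseteq> W \<Longrightarrow> x i \<in> W"
  shows False
proof -
  have "generating (G - {i}) t x"
    unfolding generating_def
  proof (intro conjI ballI allI impI)
    fix W assume W: "submodule W R F \<and> x ` (G - {i}) \<subseteq> W"
    then have "x i \<in> W" using r by blast
    then show "U \<subseteq> W" using x_generate[of W] W by blast
  qed (use finite_G x_U x_ends in auto)
  then have "weight G t \<le> weight (G - {i}) t" by (rule minimal)
  moreover have "weight G t = kind_weight (t i) + weight (G - {i}) t"
    unfolding weight_def by (rule sum.remove[OF finite_G i])
  ultimately show False using kind_weight_pos[of "t i"] by simp
qed

lemma no_better_generator:
  assumes i: "i \<in> G" "t i = At_vertex v" and z: "z \<in> U" "ends_at (At_arrow a) z"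
    and r: "\<And>W. submodule W R F \<Longrightarrow> x ` (G - {i}) \<subseteq> W \<Longrightarrow> z \<in> W \<Longrightarrow> x i \<in> W"
  shows False
proof -
  let ?t = "t(i := At_arrow a)" and ?x = "x(i := z)"
  have "generating G ?t ?x"
    unfolding generating_def
  proof (intro conjI ballI allI impI)
    fix W assume W: "submodule W R F \<and> ?x ` G \<subseteq> W"
    have zW: "z \<in> W" and xW: "x ` (G - {i}) \<subseteq> W" using W i(1) by (auto simp: image_subset_iff)
    then have "x i \<in> W" using r W by blast
    then show "U \<subseteq> W" using x_generate[of W] W xW by blast
  qed (use finite_G x_U x_ends z in auto)
  then have "weight G t \<le> weight G ?t" by (rule minimal)
  moreover have "weight G t = kind_weight (t i) + weight (G - {i}) t"
    and "weight G ?t = kind_weight (?t i) + weight (G - {i}) ?t"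
    unfolding weight_def by (rule sum.remove[OF finite_G i(1)])+
  moreover have "weight (G - {i}) ?t = weight (G - {i}) t"
    unfolding weight_def by (rule sum.cong) auto
  ultimately show False using i(2) by simp
qed

text \<open>
  A relation with a constant term in some coefficient makes a generator redundant. For a longer
  path \<open>q\<close>, let \<open>\<beta>\<close> be its last arrow, and strip \<open>\<beta>\<close> from the part of the relation that ends with
  \<open>\<beta>\<close>. This leaves an element \<open>z\<close> of \<open>U\<close> with \<open>z\<beta> = 0\<close>, so every path in \<open>z\<close> ends with the unique
  arrow \<open>\<alpha>\<close> such that \<open>\<alpha>\<beta>\<close> is a relation. If \<open>z\<close> is not zero, then a generator with a vertex end
  occurs in \<open>z\<close> with a constant coefficient and can be replaced by \<open>z\<close>, which contradicts
  minimality. Hence \<open>z = 0\<close> is a shorter relation.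
\<close>

lemma relation_coefficients:
  assumes r: "\<And>i. i \<in> G \<Longrightarrow> r i \<in> carrier (PV (w i))"
    and rel: "finsum F (\<lambda>i. r i \<odot>\<^bsub>F\<^esub> x i) G = \<zero>\<^bsub>F\<^esub>"
    and i: "i \<in> G" and q: "nonzero_path (w i, q)" "continues (t i) q"
  shows "cf (r i) (w i, q) = 0"
  using assms
proof (induction "length q" arbitrary: r i q)
  case 0
  then have q: "q = []" by simp
  show ?case
  proof (rule ccontr)
    assume nz: "cf (r i) (w i, q) \<noteq> 0"
    show False
    proof (rule no_redundant_generator[OF \<open>i \<in> G\<close>])
      fix W assume W: "submodule W R F" "x ` (G - {i}) \<subseteq> W"
      show "x i \<in> W"
      proof (rule solve_for_generator[OF finite_G x_U x_ends 0(2) \<open>i \<in> G\<close> _ W])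
        show "cf (r i) (w i, []) \<noteq> 0" using nz q by simp
        show "finsum F (\<lambda>i. r i \<odot>\<^bsub>F\<^esub> x i) G \<in> W" using 0(3) submodule_zero[OF W(1)] by simp
      qed
    qed
  qed
next
  case (Suc n)
  note r = Suc.prems(1) and rel = Suc.prems(2)
  have const: "cf (r l) (w l, []) = 0" if l: "l \<in> G" for l
  proof (rule ccontr)
    assume nz: "cf (r l) (w l, []) \<noteq> 0"
    show False
    proof (rule no_redundant_generator[OF l])
      fix W assume W: "submodule W R F" "x ` (G - {l}) \<subseteq> W"
      show "x l \<in> W"
        by (rule solve_for_generator[OF finite_G x_U x_ends r l nz W])
          (use rel submodule_zero[OF W(1)] in simp_all)
    qed
  qed
  have rR: "r l \<in> carrier R" if "l \<in> G" for l by (rule PV_closed[OF w_verts[OF that] r[OF that]])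
  from Suc.hyps(2) obtain q' \<beta> where q': "q = q' @ [\<beta>]" "length q' = n"
    by (metis length_Suc_conv_rev)
  \<comment> \<open>The coefficient at \<open>p\<close> of \<open>r' l\<close> is that of \<open>r l\<close> at \<open>p\<close> followed by \<open>\<beta>\<close>.\<close>
  define r' where "r' l = elt (\<lambda>(v, p). if v = w l \<and> continues (t l) (p @ [\<beta>]) then cf (r l) (v, p @ [\<beta>]) else 0)" for l
  have r'R: "r' l \<in> carrier R" for l by (simp add: r'_def)
  have cf_r': "cf (r' l) (v, p) =
      (if nonzero_path (v, p) \<and> v = w l \<and> continues (t l) (p @ [\<beta>]) then cf (r l) (v, p @ [\<beta>]) else 0)" for l v p
    by (simp only: r'_def cf_elt prod.case) auto
  have r'P: "r' l \<in> carrier (PV (w l))" if "l \<in> G" for l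
    by (rule PV_I[OF w_verts[OF that] r'R]) (simp add: cf_r' split: if_splits)
  define z where "z = finsum F (\<lambda>i. r' i \<odot>\<^bsub>F\<^esub> x i) G"
  have zU: "z \<in> U"
    unfolding z_def
    by (rule submodule_finsum[OF F.right_module_axioms submodule_U])
      (rule submodule_act[OF submodule_U r'R x_U])
  have zF: "z \<in> carrier F" using zU U_carrier by blast
  have cf_z: "cf (z j) (u j, p) =
      (\<Sum>i\<in>G. \<Sum>k\<le>length p. cf (x i j) (u j, take k p) * cf (r' i) (path_end Q (u j) (take k p), drop k p))"
    if "j \<in> J" "nonzero_path (u j, p)" for j p
    unfolding z_def by (rule cf_combination[OF finite_G x_F r'R that])
  have strip: "cf (z j) (u j, p) = 0" if j: "j \<in> J" and p: "nonzero_path (u j, p @ [\<beta>])" for j p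
  proof -
    have p': "nonzero_path (u j, p)" using p nonzero_path_append by blast
    have inner: "(\<Sum>k\<le>length (p @ [\<beta>]). cf (x i j) (u j, take k (p @ [\<beta>])) *
          cf (r i) (path_end Q (u j) (take k (p @ [\<beta>])), drop k (p @ [\<beta>]))) =
        (\<Sum>k\<le>length p. cf (x i j) (u j, take k p) * cf (r' i) (path_end Q (u j) (take k p), drop k p))"
      if i: "i \<in> G" for i
    proof -
      let ?c = "\<lambda>k. cf (x i j) (u j, take k (p @ [\<beta>])) *
          cf (r i) (path_end Q (u j) (take k (p @ [\<beta>])), drop k (p @ [\<beta>]))"
      have last: "?c (Suc (length p)) = 0"
      proof (cases "cf (x i j) (u j, take (Suc (length p)) (p @ [\<beta>])) = 0")
        case False
        from ends_at_continues(2)[OF x_ends[OF i] x_U[OF i] j p False] const[OF i] show ?thesis by simp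
      qed simp
      have "(\<Sum>k\<le>length (p @ [\<beta>]). ?c k) = (\<Sum>k\<le>length p. ?c k)" using last by simp
      also have "\<dots> = (\<Sum>k\<le>length p. cf (x i j) (u j, take k p) * cf (r' i) (path_end Q (u j) (take k p), drop k p))"
      proof (rule sum.cong[OF refl])
        fix k assume "k \<in> {..length p}"
        then have k: "take k (p @ [\<beta>]) = take k p" "drop k (p @ [\<beta>]) = drop k p @ [\<beta>]" by simp_all
        show "?c k = cf (x i j) (u j, take k p) * cf (r' i) (path_end Q (u j) (take k p), drop k p)"
        proof (cases "cf (x i j) (u j, take k p) = 0")
          case False
          then have "cf (x i j) (u j, take k (p @ [\<beta>])) \<noteq> 0" by (simp only: k not_False_eq_True)
          from ends_at_continues[OF x_ends[OF i] x_U[OF i] j p this]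
          have c: "continues (t i) (drop k p @ [\<beta>])" "path_end Q (u j) (take k p) = w i" by (simp_all only: k)
          have "nonzero_path (w i, drop k p)"
            using nonzero_path_take_drop(2)[OF p', of k] by (simp only: c(2))
          then show ?thesis by (simp only: k c cf_r' simp_thms if_True)
        next
          case True
          then show ?thesis by (simp only: k mult_zero_left)
        qed
      qed
      finally show ?thesis .
    qed
    have "0 = cf (finsum F (\<lambda>i. r i \<odot>\<^bsub>F\<^esub> x i) G j) (u j, p @ [\<beta>])" using j by (simp add: rel zero_family)
    also have "\<dots> = (\<Sum>i\<in>G. \<Sum>k\<le>length (p @ [\<beta>]). cf (x i j) (u j, take k (p @ [\<beta>])) *
          cf (r i) (path_end Q (u j) (take k (p @ [\<beta>])), drop k (p @ [\<beta>])))"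
      by (rule cf_combination[OF finite_G x_F rR j p])
    also have "\<dots> = cf (z j) (u j, p)"
      unfolding cf_z[OF j p'] by (rule sum.cong[OF refl inner])
    finally show ?thesis by simp
  qed
  \<comment> \<open>Every path in \<open>z\<close> arises from a generator \<open>x\<^sub>i\<close> and a coefficient of \<open>r\<^sub>i\<close>, and is killed by \<open>\<beta>\<close>.\<close>
  have support: "\<exists>i\<in>G. \<exists>k. cf (x i j) (u j, take k p) \<noteq> 0 \<and> cf (r' i) (w i, drop k p) \<noteq> 0 \<and>
      nonzero_path (w i, drop k p @ [\<beta>]) \<and> continues (t i) (drop k p @ [\<beta>]) \<and>
      p \<noteq> [] \<and> (tail Q (last p), [last p, \<beta>]) \<in> S"
    if j: "j \<in> J" and nz: "cf (z j) (u j, p) \<noteq> 0" for j p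
  proof -
    have p: "nonzero_path (u j, p)" using nz cf_bad by blast
    have ne: "p \<noteq> []" by (rule cf_U_nontrivial[OF zU j nz])
    from nz obtain i where i: "i \<in> G"
      "(\<Sum>k\<le>length p. cf (x i j) (u j, take k p) * cf (r' i) (path_end Q (u j) (take k p), drop k p)) \<noteq> 0"
      unfolding cf_z[OF j p] by (rule sum.not_neutral_contains_not_neutral)
    from i(2) obtain k where k: "cf (x i j) (u j, take k p) * cf (r' i) (path_end Q (u j) (take k p), drop k p) \<noteq> 0"
      by (rule sum.not_neutral_contains_not_neutral)
    then have cx: "cf (x i j) (u j, take k p) \<noteq> 0"
      and cr: "cf (r' i) (path_end Q (u j) (take k p), drop k p) \<noteq> 0" by auto
    have pe: "path_end Q (u j) (take k p) = w i" by (rule ends_at_continues(2)[OF x_ends[OF i(1)] x_U[OF i(1)] j p cx])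
    have "cf (r i) (w i, drop k p @ [\<beta>]) \<noteq> 0" and c: "continues (t i) (drop k p @ [\<beta>])"
      using cr by (auto simp: pe cf_r' split: if_splits)
    then have nzp: "nonzero_path (w i, drop k p @ [\<beta>])" using cf_bad by blast
    have "path_end Q (w i) (drop k p) = path_end Q (u j) p"
      using path_end_append[of Q "u j" "take k p" "drop k p"] by (simp add: pe)
    then have b: "nonzero_path (path_end Q (u j) p, [\<beta>])" using nzp nonzero_path_append[of "w i" "drop k p" "[\<beta>]"] by simp
    have "\<not> nonzero_path (u j, p @ [\<beta>])" using strip[OF j] nz by blast
    then have "(tail Q (last p), [last p, \<beta>]) \<in> S" using p b ne by (simp add: nonzero_path_append)
    then show ?thesis using i(1) cx cr nzp c ne by (auto simp: pe)
  qed
  have "z = \<zero>\<^bsub>F\<^esub>"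
  proof (rule ccontr)
    assume "z \<noteq> \<zero>\<^bsub>F\<^esub>"
    then obtain j p where jp: "j \<in> J" "cf (z j) (u j, p) \<noteq> 0"
      using F_eqI[OF zF F.M.zero_closed] by (auto simp: zero_family)
    obtain i k where ik: "i \<in> G" "cf (x i j) (u j, take k p) \<noteq> 0" "cf (r' i) (w i, drop k p) \<noteq> 0"
      "nonzero_path (w i, drop k p @ [\<beta>])" "continues (t i) (drop k p @ [\<beta>])" "p \<noteq> []"
      and rel_p: "(tail Q (last p), [last p, \<beta>]) \<in> S"
      using support[OF jp] by blast
    have z_ends: "ends_at (At_arrow (last p)) z"
      unfolding ends_at_def
    proof (intro conjI ballI allI impI)
      show "valid_kind Q (At_arrow (last p))" using relation_arrows(1)[OF rel_p] by simp
      fix j' p' assume "j' \<in> J" "cf (z j') (u j', p') \<noteq> 0"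
      from support[OF this] have "(tail Q (last p'), [last p', \<beta>]) \<in> S" by blast
      then have "last p' = last p" using rel_p by (rule in_rel)
      then show "last_fits Q (At_arrow (last p)) (last p')" by simp
    qed
    have drop_nil: "drop k p = []"
    proof (rule ccontr)
      assume ne: "drop k p \<noteq> []"
      then have "last (drop k p) = last p" by (simp add: last_drop)
      then show False using ik(4) ne rel_p nonzero_path_append[of "w i" "drop k p" "[\<beta>]"] by simp
    qed
    then have tk: "take k p = p" by simp
    have c0: "cf (r' i) (w i, []) \<noteq> 0" by (rule ik(3)[unfolded drop_nil])
    show False
    proof (cases "t i")
      case (At_arrow a)
      then have "last p = a" using x_ends[OF ik(1)] ik(2) jp(1) tk by (auto simp: ends_at_def)
      then show False using ik(5) rel_p by (simp add: drop_nil At_arrow continues_def)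
    next
      case (At_vertex v)
      show False
      proof (rule no_better_generator[OF ik(1) At_vertex zU z_ends])
        fix W assume W: "submodule W R F" "x ` (G - {i}) \<subseteq> W" "z \<in> W"
        show "x i \<in> W"
          by (rule solve_for_generator[OF finite_G x_U x_ends r'P ik(1) c0 W(1,2)])
            (use W(3) in \<open>simp_all add: z_def\<close>)
      qed
    qed
  qed
  then have rel': "finsum F (\<lambda>i. r' i \<odot>\<^bsub>F\<^esub> x i) G = \<zero>\<^bsub>F\<^esub>" by (simp add: z_def)
  have c: "continues (t i) (q' @ [\<beta>])" "continues (t i) q'"
    using Suc.prems(5) by (cases "t i"; cases q'; simp add: q'(1) continues_def)+
  have nq: "nonzero_path (w i, q')" using Suc.prems(4) q'(1) nonzero_path_append by blast
  have "cf (r' i) (w i, q') = 0"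
    by (rule Suc.hyps(1)[OF q'(2)[symmetric] r'P rel' Suc.prems(3) nq c(2)])
  then show ?case using nq c(1) by (simp add: cf_r' q'(1))
qed

lemma relation_trivial:
  assumes r: "\<And>i. i \<in> G \<Longrightarrow> r i \<in> carrier (PV (w i))"
    and rel: "finsum F (\<lambda>i. r i \<odot>\<^bsub>F\<^esub> x i) G = \<zero>\<^bsub>F\<^esub>" and i: "i \<in> G"
  shows "kind_elt (t i) \<otimes>\<^bsub>R\<^esub> r i = \<zero>\<^bsub>R\<^esub>"
  unfolding kind_elt_mult_zero_iff[OF kind_valid[OF i] r[OF i]]
  using relation_coefficients[OF r rel i] by blast

text \<open>
  If all paths in a generator ended with the same arrow, the generator would have an arrow end,
  which has the smaller weight.
\<close>

lemma vertex_kind_arrows: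
  assumes i: "i \<in> G" "t i = At_vertex v"
  shows "\<exists>a\<in>arcs Q. \<exists>b\<in>arcs Q. a \<noteq> b \<and> head Q a = v \<and> head Q b = v"
proof -
  have arr: "last p \<in> arcs Q" "head Q (last p) = v" if "j \<in> J" "cf (x i j) (u j, p) \<noteq> 0" for j p
  proof -
    have ne: "p \<noteq> []" by (rule cf_U_nontrivial[OF x_U[OF i(1)] that])
    have "nonzero_path (u j, p)" using that cf_bad by blast
    then have "nonzero_path (u j, butlast p @ [last p])" using ne by simp
    then have "nonzero_path (path_end Q (u j) (butlast p), [last p])" unfolding nonzero_path_append by blast
    then show "last p \<in> arcs Q" by (auto dest!: nonzero_path_qpath simp: qpaths_Cons)
    show "head Q (last p) = v" using x_ends[OF i(1)] that i(2) by (auto simp: ends_at_def)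
  qed
  have "x i \<noteq> \<zero>\<^bsub>F\<^esub>"
  proof
    assume "x i = \<zero>\<^bsub>F\<^esub>"
    then show False
      by (intro no_redundant_generator[OF i(1)]) (simp add: submodule_zero)
  qed
  then obtain j p where jp: "j \<in> J" "cf (x i j) (u j, p) \<noteq> 0"
    using F_eqI[OF x_F[OF i(1)] F.M.zero_closed] by (auto simp: zero_family)
  have "\<exists>j'\<in>J. \<exists>p'. cf (x i j') (u j', p') \<noteq> 0 \<and> last p' \<noteq> last p"
  proof (rule ccontr)
    assume "\<not> (\<exists>j'\<in>J. \<exists>p'. cf (x i j') (u j', p') \<noteq> 0 \<and> last p' \<noteq> last p)"
    then have "ends_at (At_arrow (last p)) (x i)" using arr(1)[OF jp] by (auto simp: ends_at_def)
    then show False by (rule no_better_generator[OF i x_U[OF i(1)]])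
  qed
  then show ?thesis using arr jp by metis
qed

text \<open>
  The generators define an epimorphism from a sum of modules \<open>e\<^sub>wR\<close> onto \<open>U\<close>. By the description
  of the relations, it has the same kernel as the epimorphism onto the sum of the right ideals.
\<close>

lemma decomposition:
  "mod_isomorphic R (F\<lparr>carrier := U\<rparr>) (mod_family_sum G (\<lambda>i. right_ideal_gen R (kind_elt (t i))))"
proof -
  let ?M = "F\<lparr>carrier := U\<rparr>" and ?D = "mod_family_sum G (\<lambda>i. right_ideal_gen R (kind_elt (t i)))"
  let ?P = "mod_family_sum G (\<lambda>i. PV (w i))"
  have M: "right_module R ?M" by (rule right_module_submodule[OF F.right_module_axioms submodule_U])
  have eR: "idem (w i) \<in> carrier R" if "i \<in> G" for i using w_verts[OF that] by simp
  have xM: "x i \<in> carrier ?M" "idem (w i) \<odot>\<^bsub>?M\<^esub> x i = x i" if "i \<in> G" for i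
    using x_U[OF that] ends_at_idem[OF x_ends[OF that] x_U[OF that]] by simp_all
  let ?\<Phi> = "generator_map R ?M G (\<lambda>i. idem (w i)) x"
  have \<Phi>: "?\<Phi> \<in> mod_hom R ?P ?M" by (rule hom_generator_map[OF M finite_G eR xM(1)])
  have \<Phi>s: "?\<Phi> ` carrier ?P = carrier ?M"
  proof (rule generator_map_surj[OF M finite_G eR xM])
    fix W assume W: "submodule W R ?M" "x ` G \<subseteq> W"
    show "carrier ?M \<subseteq> W"
      using x_generate[OF submodule_of_submodule[OF F.right_module_axioms submodule_U W(1)] W(2)] by simp
  qed
  have \<Phi>_eq: "?\<Phi> r = finsum F (\<lambda>i. r i \<odot>\<^bsub>F\<^esub> x i) G" if r: "r \<in> carrier ?P" for r
  proof -
    have rR: "r i \<in> carrier R" if "i \<in> G" for i by (rule PV_closed[OF w_verts[OF that] family_memD[OF r that]])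
    have c: "r i \<odot>\<^bsub>F\<^esub> x i \<in> U" if "i \<in> G" for i by (rule submodule_act[OF submodule_U rR[OF that] x_U[OF that]])
    interpret M: right_module R ?M by (rule M)
    have "?\<Phi> r = finsum ?M (\<lambda>i. r i \<odot>\<^bsub>F\<^esub> x i) G"
      using generator_map_apply[OF M eR xM(1) r] by simp
    moreover have "finsum ?M (\<lambda>i. r i \<odot>\<^bsub>F\<^esub> x i) G \<in> U" using c M.M.finsum_closed[of "\<lambda>i. r i \<odot>\<^bsub>F\<^esub> x i" G] by auto
    ultimately have "?\<Phi> r = (\<lambda>y\<in>U. y) (finsum ?M (\<lambda>i. r i \<odot>\<^bsub>F\<^esub> x i) G)" by simp
    also have "\<dots> = finsum F (\<lambda>i. (\<lambda>y\<in>U. y) (r i \<odot>\<^bsub>F\<^esub> x i)) G"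
      by (rule hom_finsum[OF M F.right_module_axioms hom_incl[OF F.right_module_axioms submodule_U] finite_G])
        (simp add: c)
    also have "\<dots> = finsum F (\<lambda>i. r i \<odot>\<^bsub>F\<^esub> x i) G"
      using c U_carrier by (intro F.M.finsum_cong') auto
    finally show ?thesis .
  qed
  have pres: "presents R (PV (w i)) (left_mult (kind_elt (t i)) (w i)) (right_ideal_gen R (kind_elt (t i)))"
    if "i \<in> G" for i
    by (rule left_mult_presents[OF kind_facts(2)[OF kind_valid[OF that]] w_verts[OF that] kind_facts(3)[OF kind_valid[OF that]]])
  have Drm: "right_module R (right_ideal_gen R (kind_elt (t i)))" if "i \<in> G" for i
    by (rule right_module_right_ideal[OF ring_R kind_facts(2)[OF kind_valid[OF that]]])
  have D: "right_module R ?D" by (rule right_module_family[OF ring_R Drm])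
  let ?\<Psi> = "family_map G (\<lambda>i. PV (w i)) (\<lambda>i. left_mult (kind_elt (t i)) (w i))"
  have \<Psi>: "presents R ?P ?\<Psi> ?D" by (rule presents_family[OF ring_R finite_G Drm pres])
  note \<Psi>D = presentsD[OF \<Psi>]
  have \<Psi>_zero: "?\<Psi> r = \<zero>\<^bsub>?D\<^esub> \<longleftrightarrow> (\<forall>i\<in>G. kind_elt (t i) \<otimes>\<^bsub>R\<^esub> r i = \<zero>\<^bsub>R\<^esub>)" if r: "r \<in> carrier ?P" for r
    using family_map_eq_zero_iff[OF r, of "\<lambda>i. left_mult (kind_elt (t i)) (w i)" "\<lambda>i. right_ideal_gen R (kind_elt (t i))"]
      family_memD[OF r] by (simp add: left_mult_def)
  have zero_M: "\<zero>\<^bsub>?M\<^esub> = \<zero>\<^bsub>F\<^esub>" by simp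
  obtain g where g: "g \<in> mod_hom R ?M ?D" "\<And>r. r \<in> carrier ?P \<Longrightarrow> g (?\<Phi> r) = ?\<Psi> r"
  proof (rule hom_factor[OF \<Psi>D(3) M D \<Phi> \<Phi>s \<Psi>D(4)])
    fix r assume r: "r \<in> carrier ?P" "?\<Phi> r = \<zero>\<^bsub>?M\<^esub>"
    then have "finsum F (\<lambda>i. r i \<odot>\<^bsub>F\<^esub> x i) G = \<zero>\<^bsub>F\<^esub>" by (simp only: \<Phi>_eq zero_M)
    from relation_trivial[OF family_memD[OF r(1)] this] show "?\<Psi> r = \<zero>\<^bsub>?D\<^esub>" unfolding \<Psi>_zero[OF r(1)] by blast
  qed (use that in blast)
  show ?thesis
  proof (rule mod_isomorphicI[OF M D g(1)])
    have "g ` carrier ?M = g ` ?\<Phi> ` carrier ?P" by (simp only: \<Phi>s)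
    also have "\<dots> = ?\<Psi> ` carrier ?P" unfolding image_image by (rule image_cong[OF refl g(2)])
    finally show "g ` carrier ?M = carrier ?D" by (simp only: \<Psi>D(5))
    fix y assume y: "y \<in> carrier ?M" "g y = \<zero>\<^bsub>?D\<^esub>"
    obtain r where r: "r \<in> carrier ?P" "y = ?\<Phi> r" using y(1) \<Phi>s by blast
    have "\<forall>i\<in>G. kind_elt (t i) \<otimes>\<^bsub>R\<^esub> r i = \<zero>\<^bsub>R\<^esub>"
      using y(2) g(2)[OF r(1)] \<Psi>_zero[OF r(1)] by (simp only: r(2))
    then have "r i \<odot>\<^bsub>F\<^esub> x i = \<zero>\<^bsub>F\<^esub>" if "i \<in> G" for i
      using annihilated_by_kind[OF x_ends[OF that] x_U[OF that] family_memD[OF r(1) that]] that by blast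
    then have "finsum F (\<lambda>i. r i \<odot>\<^bsub>F\<^esub> x i) G = finsum F (\<lambda>i. \<zero>\<^bsub>F\<^esub>) G" by (intro F.M.finsum_cong') auto
    then show "y = \<zero>\<^bsub>?M\<^esub>" using \<Phi>_eq[OF r(1)] by (simp only: r(2) zero_M F.M.finsum_zero)
  qed
qed

end

text \<open>
  The arrows that end at \<open>v\<close> serve to recognise the uniserial modules among the summands \<open>e\<^sub>vR\<close>.
\<close>

theorem (in radical_submodule) radical_submodule_decomposition:
  obtains G t where "finite G" "\<forall>i\<in>G. valid_kind Q (t i)"
    "\<forall>i\<in>G. \<forall>v. t i = At_vertex v \<longrightarrow> (\<exists>a\<in>arcs Q. \<exists>b\<in>arcs Q. a \<noteq> b \<and> head Q a = v \<and> head Q b = v)"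
    "mod_isomorphic R (F\<lparr>carrier := U\<rparr>) (mod_family_sum G (\<lambda>i. right_ideal_gen R (kind_elt (t i))))"
proof -
  obtain G t x where "generating G t x" "\<And>G' t' x'. generating G' t' x' \<Longrightarrow> weight G t \<le> weight G' t'"
    using minimal_generating_exists by metis
  then interpret minimal_generators Q S I J u U G t x by unfold_locales
  show thesis by (rule that[OF finite_G _ _ decomposition]) (use kind_valid vertex_kind_arrows in blast)+
qed

section \<open>Syzygies of the modules generated by an arrow\<close>

lemma proj_cover_iso:
  assumes c: "proj_cover R M P p" and M: "right_module R M" "right_module R M'"
    and f: "f \<in> mod_hom R M M'" "bij_betw f (carrier M) (carrier M')"
  shows "proj_cover R M' P (compose (carrier P) f p)"
    and "kernel_module P (compose (carrier P) f p) M' = kernel_module P p M"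
proof -
  note pres = presentsD[OF proj_cover_presents[OF c]]
  have inj: "inj_on f (carrier M)" and sur: "f ` carrier M = carrier M'" using f(2) by (auto simp: bij_betw_def)
  have img: "compose (carrier P) f p ` U = f ` p ` U" if "U \<subseteq> carrier P" for U
    unfolding image_image by (rule image_cong[OF refl]) (use that in \<open>auto simp: compose_eq\<close>)
  show "proj_cover R M' P (compose (carrier P) f p)"
    unfolding proj_cover_def
  proof (intro conjI allI impI)
    show "compose (carrier P) f p \<in> mod_hom R P M'" by (rule hom_comp[OF pres(3,4) f(1)])
    show "compose (carrier P) f p ` carrier P = carrier M'" by (simp add: img pres(5) sur)
    fix U assume U: "submodule U R P \<and> compose (carrier P) f p ` U = carrier M'"
    have UP: "U \<subseteq> carrier P" using submodule_subset U by blast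
    have "f ` p ` U = f ` carrier M" using U img[OF UP] sur by simp
    moreover have "p ` U \<subseteq> carrier M" using UP hom_closed[OF pres(4)] by blast
    ultimately have "p ` U = carrier M" using inj_on_image_eq_iff[OF inj] by blast
    then show "U = carrier P" using proj_cover_essential[OF c] U by blast
  qed (rule pres(1))
  have "compose (carrier P) f p x = \<zero>\<^bsub>M'\<^esub> \<longleftrightarrow> p x = \<zero>\<^bsub>M\<^esub>" if x: "x \<in> carrier P" for x
  proof -
    interpret M: right_module R M by (rule M(1))
    have "f (p x) = f \<zero>\<^bsub>M\<^esub> \<longleftrightarrow> p x = \<zero>\<^bsub>M\<^esub>"
      using inj_on_eq_iff[OF inj hom_closed[OF pres(4) x] M.M.zero_closed] .
    then show ?thesis using x by (simp add: compose_eq hom_zero[OF M f(1)])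
  qed
  then have "{x \<in> carrier P. compose (carrier P) f p x = \<zero>\<^bsub>M'\<^esub>} = {x \<in> carrier P. p x = \<zero>\<^bsub>M\<^esub>}" by blast
  then show "kernel_module P (compose (carrier P) f p) M' = kernel_module P p M" by (simp only: kernel_module_def)
qed

lemma projective_zero_module:
  assumes "fg_module R M" "zero_module M"
  shows "projective R M"
  unfolding projective_def
proof (intro conjI allI ballI impI)
  fix E :: "('a, 'a univ) module" and F :: "('a, 'a univ) module" and g f
  assume g: "g \<in> mod_hom R E F" and f: "f \<in> mod_hom R M F"
    and EF: "fg_module R E \<and> fg_module R F \<and> g ` carrier E = carrier F"
  have E: "right_module R E" and F: "right_module R F" using EF fg_right_module by blast+
  have M: "right_module R M" by (rule fg_right_module[OF assms(1)])
  show "\<exists>h\<in>mod_hom R M E. \<forall>x\<in>carrier M. g (h x) = f x"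
  proof (intro bexI ballI)
    show "(\<lambda>x\<in>carrier M. \<zero>\<^bsub>E\<^esub>) \<in> mod_hom R M E" by (rule hom_zero_map[OF M E])
    fix x assume "x \<in> carrier M"
    then show "g ((\<lambda>x\<in>carrier M. \<zero>\<^bsub>E\<^esub>) x) = f x"
      using assms(2) hom_zero[OF E F g] hom_zero[OF M F f] by (simp add: zero_module_def)
  qed
qed (rule assms(1))

context gentle_algebra
begin

lemma carrier_RA:
  assumes b: "b \<in> arcs Q"
  shows "x \<in> carrier (RA b) \<longleftrightarrow>
    x \<in> carrier R \<and> (\<forall>v p. cf x (v, p) \<noteq> 0 \<longrightarrow> v = tail Q b \<and> p \<noteq> [] \<and> hd p = b)"
proof
  assume "x \<in> carrier (RA b)"
  then obtain r where r: "r \<in> carrier R" and x: "x = arrow b \<otimes>\<^bsub>R\<^esub> r" by (auto simp: carrier_right_ideal)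
  show "x \<in> carrier R \<and> (\<forall>v p. cf x (v, p) \<noteq> 0 \<longrightarrow> v = tail Q b \<and> p \<noteq> [] \<and> hd p = b)"
  proof (intro conjI allI impI)
    show "x \<in> carrier R" unfolding x by (rule mult_closed[OF arrow_closed[OF b] r])
    fix v p assume nz: "cf x (v, p) \<noteq> 0"
    have p: "nonzero_path (v, p)" using nz cf_bad by blast
    from nz[unfolded x cf_arrow_mult[OF b r p]] have "v = tail Q b \<and> p \<noteq> [] \<and> hd p = b"
      by (rule contrapos_np) (simp only: if_False)
    then show "v = tail Q b" "p \<noteq> []" "hd p = b" by blast+
  qed
next
  assume x: "x \<in> carrier R \<and> (\<forall>v p. cf x (v, p) \<noteq> 0 \<longrightarrow> v = tail Q b \<and> p \<noteq> [] \<and> hd p = b)"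
  define r where "r = elt (\<lambda>(v, p). if v = head Q b then cf x (tail Q b, b # p) else 0)"
  have r: "r \<in> carrier R" by (simp add: r_def)
  have "arrow b \<otimes>\<^bsub>R\<^esub> r = x"
  proof (rule cf_eqI)
    fix q assume q: "nonzero_path q"
    obtain v p where vp: "q = (v, p)" by (cases q)
    show "cf (arrow b \<otimes>\<^bsub>R\<^esub> r) q = cf x q"
    proof (cases "v = tail Q b \<and> p \<noteq> [] \<and> hd p = b")
      case True
      then obtain p' where p': "p = b # p'" by (cases p) auto
      have "nonzero_path (head Q b, p')"
        using q True nonzero_path_append[of v "[b]" p'] by (simp add: vp p' path_end_def)
      then show ?thesis using True cf_arrow_mult[OF b r q[unfolded vp]] by (simp add: vp p' r_def cf_elt)
    next
      case False
      have "cf x (v, p) = 0" using x False by blast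
      moreover have "cf (arrow b \<otimes>\<^bsub>R\<^esub> r) (v, p) = 0"
        unfolding cf_arrow_mult[OF b r q[unfolded vp]] using False by (simp only: if_False)
      ultimately show ?thesis by (simp add: vp)
    qed
  qed (use x mult_closed[OF arrow_closed[OF b] r] in auto)
  then show "x \<in> carrier (RA b)" using right_ideal_mem[OF r] by metis
qed

abbreviation arrow_cover :: "'a \<Rightarrow> ('v \<times> 'a list \<Rightarrow> 'k) set \<Rightarrow> ('v \<times> 'a list \<Rightarrow> 'k) set" where
  "arrow_cover a \<equiv> left_mult (arrow a) (head Q a)"

lemma arrow_cover_presents: "a \<in> arcs Q \<Longrightarrow> presents R (PV (head Q a)) (arrow_cover a) (RA a)"
  by (rule left_mult_presents) (simp_all add: arrow_idem)

lemma arrow_cover_zero_iff: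
  assumes a: "a \<in> arcs Q" and r: "r \<in> carrier (PV (head Q a))"
  shows "arrow_cover a r = \<zero>\<^bsub>RA a\<^esub> \<longleftrightarrow>
    (\<forall>q. cf r (head Q a, q) \<noteq> 0 \<longrightarrow> q \<noteq> [] \<and> (tail Q a, [a, hd q]) \<in> S)"
proof -
  have "arrow_cover a r = arrow a \<otimes>\<^bsub>R\<^esub> r" using r by (simp add: left_mult_def)
  moreover have "arrow a \<otimes>\<^bsub>R\<^esub> r = \<zero>\<^bsub>R\<^esub> \<longleftrightarrow>
      (\<forall>q. nonzero_path (head Q a, q) \<and> continues (At_arrow a) q \<longrightarrow> cf r (head Q a, q) = 0)"
    using kind_elt_mult_zero_iff[of "At_arrow a" r] a r by simp
  moreover have "\<dots> \<longleftrightarrow> (\<forall>q. cf r (head Q a, q) \<noteq> 0 \<longrightarrow> q \<noteq> [] \<and> (tail Q a, [a, hd q]) \<in> S)"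
    unfolding continues_def end_kind.case using cf_bad[of _ r] by blast
  ultimately show ?thesis by simp
qed

text \<open>
  Left multiplication by \<open>a\<close> kills a nonzero path iff the path starts with the unique arrow \<open>b\<close>
  such that \<open>ab\<close> is a relation.
\<close>

lemma arrow_cover_kernel_relation:
  assumes ab: "(tail Q a, [a, b]) \<in> S"
  shows "kernel_module (PV (head Q a)) (arrow_cover a) (RA a) = RA b"
proof -
  note arr = relation_arrows[OF ab]
  have h: "head Q a \<in> verts Q" using arr by simp
  have "{r \<in> carrier (PV (head Q a)). arrow_cover a r = \<zero>\<^bsub>RA a\<^esub>} = carrier (RA b)"
  proof (intro Set.set_eqI iffI)
    fix r assume "r \<in> {r \<in> carrier (PV (head Q a)). arrow_cover a r = \<zero>\<^bsub>RA a\<^esub>}"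
    then have r: "r \<in> carrier (PV (head Q a))" and z: "arrow_cover a r = \<zero>\<^bsub>RA a\<^esub>" by blast+
    note z' = z[unfolded arrow_cover_zero_iff[OF arr(1) r]]
    show "r \<in> carrier (RA b)"
      unfolding carrier_RA[OF arr(2)]
    proof (intro conjI allI impI)
      show "r \<in> carrier R" by (rule PV_closed[OF h r])
      fix v p assume nz: "cf r (v, p) \<noteq> 0"
      have v: "v = head Q a" by (rule PV_start[OF h r nz])
      then show "v = tail Q b" using arr(3) by simp
      from z' nz v have "p \<noteq> [] \<and> (tail Q a, [a, hd p]) \<in> S" by blast
      then show "p \<noteq> []" "hd p = b" using out_rel[OF _ ab] by blast+
    qed
  next
    fix r assume "r \<in> carrier (RA b)"
    then have rR: "r \<in> carrier R" and r: "\<And>v p. cf r (v, p) \<noteq> 0 \<Longrightarrow> v = tail Q b \<and> p \<noteq> [] \<and> hd p = b"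
      unfolding carrier_RA[OF arr(2)] by blast+
    have rP: "r \<in> carrier (PV (head Q a))" by (rule PV_I[OF h rR]) (use r arr(3) in auto)
    have "arrow_cover a r = \<zero>\<^bsub>RA a\<^esub>"
      unfolding arrow_cover_zero_iff[OF arr(1) rP] using r ab by blast
    then show "r \<in> {r \<in> carrier (PV (head Q a)). arrow_cover a r = \<zero>\<^bsub>RA a\<^esub>}" using rP by blast
  qed
  then show ?thesis by (simp add: kernel_module_def right_ideal_gen_def)
qed

lemma arrow_cover_kernel_zero:
  assumes a: "a \<in> arcs Q" and no: "\<And>b. (tail Q a, [a, b]) \<notin> S"
    and r: "r \<in> carrier (PV (head Q a))" "arrow_cover a r = \<zero>\<^bsub>RA a\<^esub>"
  shows "r = \<zero>\<^bsub>R\<^esub>"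
proof (rule cf_eqI)
  have h: "head Q a \<in> verts Q" using a by simp
  show "r \<in> carrier R" by (rule PV_closed[OF h r(1)])
  fix q :: "'v \<times> 'a list"
  obtain v p where vp: "q = (v, p)" by (cases q)
  have "cf r (v, p) = 0"
    using r(2)[unfolded arrow_cover_zero_iff[OF a r(1)]] no PV_start[OF h r(1)] by blast
  then show "cf r q = cf \<zero>\<^bsub>R\<^esub> q" by (simp add: vp)
qed simp

lemma right_module_RA: "a \<in> arcs Q \<Longrightarrow> right_module R (RA a)"
  by (rule right_module_right_ideal[OF ring_R arrow_closed])

lemma fg_RA: "a \<in> arcs Q \<Longrightarrow> fg_module R (RA a)"
  by (rule fg_right_ideal[OF ring_R arrow_closed])

lemma arrow_module_free:
  assumes a: "a \<in> arcs Q" and no: "\<And>b. (tail Q a, [a, b]) \<notin> S"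
  shows "mod_isomorphic R (PV (head Q a)) (RA a)" "projective R (RA a)"
proof -
  note pres = presentsD[OF arrow_cover_presents[OF a]]
  show iso: "mod_isomorphic R (PV (head Q a)) (RA a)"
  proof (rule mod_isomorphicI[OF pres(3) right_module_RA[OF a] pres(4,5)])
    fix r assume "r \<in> carrier (PV (head Q a))" "arrow_cover a r = \<zero>\<^bsub>RA a\<^esub>"
    from arrow_cover_kernel_zero[OF a no this] show "r = \<zero>\<^bsub>PV (head Q a)\<^esub>" by simp
  qed
  show "projective R (RA a)" by (rule projective_iso[OF pres(1) right_module_RA[OF a] iso])
qed

text \<open>
  A submodule that maps onto \<open>aR\<close> contains a preimage of \<open>a\<close>. Its constant term is \<open>1\<close>, so it
  generates \<open>e\<^sub>vR\<close>.
\<close>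

lemma arrow_cover_proj_cover:
  assumes a: "a \<in> arcs Q"
  shows "proj_cover R (RA a) (PV (head Q a)) (arrow_cover a)"
proof -
  note pres = presentsD[OF arrow_cover_presents[OF a]]
  have h: "head Q a \<in> verts Q" using a by simp
  show ?thesis
    unfolding proj_cover_def
  proof (intro conjI allI impI)
    fix U assume U: "submodule U R (PV (head Q a)) \<and> arrow_cover a ` U = carrier (RA a)"
    then have U1: "submodule U R (PV (head Q a))" by blast
    have "arrow a \<in> carrier (RA a)" using right_ideal_mem[OF R.one_closed, of "arrow a"] a by simp
    then have "arrow a \<in> arrow_cover a ` U" using U by simp
    then obtain s where s: "s \<in> U" "arrow_cover a s = arrow a" by (elim imageE) simp
    have sP: "s \<in> carrier (PV (head Q a))" using submodule_subset[OF U1] s(1) by blast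
    have sR: "s \<in> carrier R" by (rule PV_closed[OF h sP])
    have as: "arrow a \<otimes>\<^bsub>R\<^esub> s = arrow a" using s(2) sP by (simp add: left_mult_def)
    have "cf (arrow a \<otimes>\<^bsub>R\<^esub> s) (tail Q a, [a]) = cf s (head Q a, [])"
      using cf_arrow_mult[OF a sR nonzero_path_arrow[OF a]] by simp
    then have "cf s (head Q a, []) \<noteq> 0" by (simp add: as cf_bpath nonzero_path_arrow[OF a])
    from right_inverse_local[OF h sP this] obtain t where t: "t \<in> carrier R" "s \<otimes>\<^bsub>R\<^esub> t = idem (head Q a)" .
    have e: "idem (head Q a) \<in> U" using submodule_act[OF U1 t(1) s(1)] t(2) by simp
    show "U = carrier (PV (head Q a))"
    proof
      show "carrier (PV (head Q a)) \<subseteq> U"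
      proof
        fix r assume r: "r \<in> carrier (PV (head Q a))"
        from submodule_act[OF U1 PV_closed[OF h r] e] idem_mult_PV[OF h r] show "r \<in> U" by simp
      qed
    qed (rule submodule_subset[OF U1])
  qed (rule pres(1,4,5))+
qed

text \<open>
  This class contains the uniserial submodules of the radical of a projective module and is closed
  under syzygies.
\<close>

definition arrow_or_zero :: "(('v \<times> 'a list \<Rightarrow> 'k) set, 'm) module \<Rightarrow> bool" where
  "arrow_or_zero Y \<longleftrightarrow> fg_module R Y \<and> (zero_module Y \<or> (\<exists>a\<in>arcs Q. mod_isomorphic R Y (RA a)))"

lemma syzygy_fg: "fg_module R M \<Longrightarrow> fg_module R (syzygy R M)"
  using R.syzygy_of_fg[OF syzygy_of_syzygy fg_right_module] by blast

text \<open>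
  By uniqueness of projective covers, the syzygy is the kernel of left multiplication by an arrow.
\<close>

lemma arrow_or_zero_syzygy:
  fixes Y :: "(('v \<times> 'a list \<Rightarrow> 'k) set, 'm) module"
  assumes Y: "arrow_or_zero Y"
  shows "arrow_or_zero (syzygy R Y)"
proof -
  have fg: "fg_module R Y" using Y by (simp add: arrow_or_zero_def)
  note rY = fg_right_module[OF fg]
  obtain P :: "(('v \<times> 'a list \<Rightarrow> 'k) set, ('v \<times> 'a list \<Rightarrow> 'k) set univ) module" and p
    where P: "proj_cover R Y P p" and syz: "syzygy R Y = kernel_module P p Y"
    using syzygy_cover[OF fg] .
  note pres = presentsD[OF proj_cover_presents[OF P]]
  have fgS: "fg_module R (syzygy R Y)" by (rule syzygy_fg[OF fg])
  have "zero_module (syzygy R Y) \<or> (\<exists>b\<in>arcs Q. mod_isomorphic R (syzygy R Y) (RA b))"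
  proof (cases "zero_module Y")
    case True
    interpret P: right_module R P by (rule pres(3))
    have "p ` {\<zero>\<^bsub>P\<^esub>} = carrier Y" using True hom_zero[OF pres(3) rY pres(4)] by (simp add: zero_module_def)
    from proj_cover_essential[OF P P.zero_submodule this]
    have "carrier P = {\<zero>\<^bsub>P\<^esub>}" by (rule sym)
    then have "zero_module (syzygy R Y)"
      using hom_zero[OF pres(3) rY pres(4)] by (auto simp: zero_module_def syz kernel_module_def)
    then show ?thesis ..
  next
    case False
    then obtain a where a: "a \<in> arcs Q" and iso: "mod_isomorphic R Y (RA a)" using Y by (auto simp: arrow_or_zero_def)
    have "mod_isomorphic R (RA a) Y" by (rule mod_isomorphic_sym[OF rY right_module_RA[OF a] iso])
    then obtain f where f: "f \<in> mod_hom R (RA a) Y" "bij_betw f (carrier (RA a)) (carrier Y)"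
      by (auto simp: mod_isomorphic_def)
    note c = proj_cover_iso[OF arrow_cover_proj_cover[OF a] right_module_RA[OF a] rY f]
    have k: "mod_isomorphic R (syzygy R Y) (kernel_module (PV (head Q a)) (arrow_cover a) (RA a))"
      using R.proj_cover_kernel_iso[OF P c(1) fg] by (simp only: syz c(2))
    show ?thesis
    proof (cases "\<exists>b. (tail Q a, [a, b]) \<in> S")
      case True
      then obtain b where b: "(tail Q a, [a, b]) \<in> S" ..
      then show ?thesis using k relation_arrows(2)[OF b] by (auto simp: arrow_cover_kernel_relation)
    next
      case no: False
      let ?K = "kernel_module (PV (head Q a)) (arrow_cover a) (RA a)"
      note presa = presentsD[OF arrow_cover_presents[OF a]]
      have sK: "submodule {x \<in> carrier (PV (head Q a)). arrow_cover a x = \<zero>\<^bsub>RA a\<^esub>} R (PV (head Q a))"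
        by (rule kernel_submodule[OF presa(3) right_module_RA[OF a] presa(4)])
      have rK: "right_module R ?K"
        unfolding kernel_module_def by (rule right_module_submodule[OF presa(3) sK])
      have zK: "zero_module ?K"
        using arrow_cover_kernel_zero[OF a] no submodule_zero[OF sK]
        by (auto simp: zero_module_def kernel_module_def)
      have "zero_module (syzygy R Y)"
        by (rule zero_module_iso[OF rK fg_right_module[OF fgS] mod_isomorphic_sym[OF fg_right_module[OF fgS] rK k] zK])
      then show ?thesis ..
    qed
  qed
  then show ?thesis using fgS by (simp add: arrow_or_zero_def)
qed

lemma arrow_or_zero_syzygy_pow: "arrow_or_zero Y \<Longrightarrow> arrow_or_zero (syzygy_pow R n Y)"
  by (induction n) (simp_all add: syzygy_pow_def arrow_or_zero_syzygy)

end

text \<open>Different summands of a direct sum are incomparable submodules.\<close>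

lemma uniserial_family_index:
  assumes R: "ring R" and L: "\<And>i. i \<in> G \<Longrightarrow> right_module R (L i)" "\<And>i. i \<in> G \<Longrightarrow> \<not> zero_module (L i)"
    and uni: "uniserial R (mod_family_sum G L)"
  obtains i where "G = {i}"
proof -
  let ?D = "mod_family_sum G L"
  have D: "right_module R ?D" by (rule right_module_family[OF R L(1)])
  have "G \<noteq> {}"
  proof
    assume "G = {}"
    then have "zero_module ?D" by (auto simp: zero_module_def carrier_family zero_family)
    then show False using uni by (simp add: uniserial_def)
  qed
  then obtain i where i: "i \<in> G" by blast
  have sub: "submodule (family_in G L l ` carrier (L l)) R ?D" if "l \<in> G" for l
    by (rule image_submodule[OF L(1)[OF that] D hom_family_in[OF R L(1) that]
          right_module.carrier_submodule[OF L(1)[OF that]]])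
  have incl: "i = l" if il: "i \<in> G" "l \<in> G" and le: "family_in G L i ` carrier (L i) \<subseteq> family_in G L l ` carrier (L l)" for i l
  proof (rule ccontr)
    assume ne: "i \<noteq> l"
    interpret Li: right_module R "L i" by (rule L(1)[OF il(1)])
    have "x = \<zero>\<^bsub>L i\<^esub>" if x: "x \<in> carrier (L i)" for x
    proof -
      obtain y where y: "y \<in> carrier (L l)" "family_in G L i x = family_in G L l y" using le x by blast
      from fun_cong[OF y(2), of i] show ?thesis using x y(1) il ne by (simp add: family_in_def)
    qed
    then have "zero_module (L i)" by (auto simp: zero_module_def)
    then show False using L(2)[OF il(1)] by contradiction
  qed
  have "l = i" if l: "l \<in> G" for l
  proof -
    have "family_in G L i ` carrier (L i) \<subseteq> family_in G L l ` carrier (L l) \<or>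
        family_in G L l ` carrier (L l) \<subseteq> family_in G L i ` carrier (L i)"
      using uni sub[OF i] sub[OF l] by (simp add: uniserial_def)
    then show ?thesis using incl[OF i l] incl[OF l i] by blast
  qed
  then show thesis using that[of i] i by blast
qed

lemma family_singleton_iso:
  assumes R: "ring R" and L: "right_module R (L i)"
  shows "mod_isomorphic R (L i) (mod_family_sum {i} L)"
proof -
  have D: "right_module R (mod_family_sum {i} L)" by (rule right_module_family[OF R]) (simp add: L)
  have e: "family_in {i} L i \<in> mod_hom R (L i) (mod_family_sum {i} L)" by (rule hom_family_in[OF R]) (simp_all add: L)
  show ?thesis
  proof (rule mod_isomorphicI[OF L D e])
    show "family_in {i} L i ` carrier (L i) = carrier (mod_family_sum {i} L)"
    proof
      show "family_in {i} L i ` carrier (L i) \<subseteq> carrier (mod_family_sum {i} L)"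
        using hom_closed[OF e] by blast
      show "carrier (mod_family_sum {i} L) \<subseteq> family_in {i} L i ` carrier (L i)"
      proof
        fix x assume x: "x \<in> carrier (mod_family_sum {i} L)"
        have xi: "x i \<in> carrier (L i)" by (rule family_memD[OF x]) simp
        have "x = family_in {i} L i (x i)"
          using x xi by (auto simp: family_in_def carrier_family fun_eq_iff PiE_iff extensional_def)
        then show "x \<in> family_in {i} L i ` carrier (L i)" using xi by blast
      qed
    qed
    fix x assume x: "x \<in> carrier (L i)" "family_in {i} L i x = \<zero>\<^bsub>mod_family_sum {i} L\<^esub>"
    from fun_cong[OF x(2), of i] show "x = \<zero>\<^bsub>L i\<^esub>" using x(1) by (simp add: family_in_def zero_family)
  qed
qed

context gentle_algebra
begin

lemma kind_module: "valid_kind Q t \<Longrightarrow> right_module R (right_ideal_gen R (kind_elt t))"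
  by (rule right_module_right_ideal[OF ring_R kind_facts(2)])

lemma kind_module_nonzero:
  assumes t: "valid_kind Q t"
  shows "\<not> zero_module (right_ideal_gen R (kind_elt t))"
proof
  assume "zero_module (right_ideal_gen R (kind_elt t))"
  moreover have "kind_elt t \<in> carrier (right_ideal_gen R (kind_elt t))"
    using right_ideal_mem[OF R.one_closed, of "kind_elt t"] kind_facts(2)[OF t] by simp
  ultimately have z: "kind_elt t = \<zero>\<^bsub>R\<^esub>" by (simp add: zero_module_def)
  show False
  proof (cases t)
    case (At_vertex w)
    then show False using t arg_cong[OF z, of "\<lambda>r. cf r (w, [])"] by (simp add: cf_idem)
  next
    case (At_arrow a)
    then show False
      using t arg_cong[OF z, of "\<lambda>r. cf r (tail Q a, [a])"] nonzero_path_arrow[of a] by (simp add: cf_bpath)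
  qed
qed

text \<open>
  If two different arrows \<open>a\<close>, \<open>b\<close> end at \<open>w\<close> and none of them generates a module isomorphic to
  \<open>e\<^sub>wR\<close>, then there are relations \<open>ac\<close> and \<open>bd\<close>. By gentleness \<open>c \<noteq> d\<close>, and so \<open>cR\<close> and \<open>dR\<close> are
  incomparable submodules of \<open>e\<^sub>wR\<close>.
\<close>

lemma uniserial_kind_module:
  assumes t: "valid_kind Q t"
    and two: "\<And>w. t = At_vertex w \<Longrightarrow> \<exists>a\<in>arcs Q. \<exists>b\<in>arcs Q. a \<noteq> b \<and> head Q a = w \<and> head Q b = w"
    and uni: "uniserial R (right_ideal_gen R (kind_elt t))"
  shows "\<exists>a\<in>arcs Q. mod_isomorphic R (right_ideal_gen R (kind_elt t)) (RA a)"
proof (cases t)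
  case (At_arrow a)
  then have "a \<in> arcs Q" using t by simp
  then show ?thesis using mod_isomorphic_refl[OF right_module_RA] At_arrow by auto
next
  case (At_vertex w)
  have uw: "uniserial R (PV w)" using uni At_vertex by simp
  obtain a b where ab: "a \<in> arcs Q" "b \<in> arcs Q" "a \<noteq> b" "head Q a = w" "head Q b = w"
    using two[OF At_vertex] by blast
  have "(\<forall>c. (tail Q a, [a, c]) \<notin> S) \<or> (\<forall>c. (tail Q b, [b, c]) \<notin> S)"
  proof (rule ccontr)
    assume "\<not> ((\<forall>c. (tail Q a, [a, c]) \<notin> S) \<or> (\<forall>c. (tail Q b, [b, c]) \<notin> S))"
    then obtain c d where cd: "(tail Q a, [a, c]) \<in> S" "(tail Q b, [b, d]) \<in> S" by blast
    have ne: "c \<noteq> d" using in_rel[OF cd(1)] cd(2) ab(3) by blast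
    have sub: "submodule (carrier (RA c')) R (PV w)"
      if a': "a' \<in> arcs Q" "head Q a' = w" "(tail Q a', [a', c']) \<in> S" for a' c'
    proof -
      note pres = presentsD[OF arrow_cover_presents[OF a'(1)]]
      have "submodule {x \<in> carrier (PV (head Q a')). arrow_cover a' x = \<zero>\<^bsub>RA a'\<^esub>} R (PV (head Q a'))"
        by (rule kernel_submodule[OF pres(3) right_module_RA[OF a'(1)] pres(4)])
      then show ?thesis
        using arg_cong[OF arrow_cover_kernel_relation[OF a'(3)], of carrier]
        by (simp only: carrier_kernel_module a'(2))
    qed
    have not_le: "\<not> carrier (RA c') \<subseteq> carrier (RA d')" if c': "c' \<in> arcs Q" "d' \<in> arcs Q" "c' \<noteq> d'" for c' d'
    proof
      assume le: "carrier (RA c') \<subseteq> carrier (RA d')"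
      have "arrow c' \<in> carrier (RA c')" using right_ideal_mem[OF R.one_closed, of "arrow c'"] c'(1) by simp
      then have "arrow c' \<in> carrier (RA d')" using le by blast
      then have m: "\<And>v p. cf (arrow c') (v, p) \<noteq> 0 \<Longrightarrow> hd p = d'" unfolding carrier_RA[OF c'(2)] by blast
      have "cf (arrow c') (tail Q c', [c']) \<noteq> 0" by (simp add: cf_bpath nonzero_path_arrow[OF c'(1)])
      from m[OF this] show False using c'(3) by simp
    qed
    have "carrier (RA c) \<subseteq> carrier (RA d) \<or> carrier (RA d) \<subseteq> carrier (RA c)"
      using uw sub[OF ab(1,4) cd(1)] sub[OF ab(2,5) cd(2)] by (simp add: uniserial_def)
    then show False
      using not_le relation_arrows(2)[OF cd(1)] relation_arrows(2)[OF cd(2)] ne by blast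
  qed
  then have "mod_isomorphic R (PV w) (RA a) \<or> mod_isomorphic R (PV w) (RA b)"
    using arrow_module_free(1)[OF ab(1), unfolded ab(4)] arrow_module_free(1)[OF ab(2), unfolded ab(5)] by blast
  then show ?thesis using ab(1,2) by (auto simp: At_vertex)
qed

end

lemma (in radical_submodule) uniserial_radical_submodule:
  assumes uni: "uniserial R (F\<lparr>carrier := U\<rparr>)"
  shows "\<exists>a\<in>arcs Q. mod_isomorphic R (F\<lparr>carrier := U\<rparr>) (RA a)"
proof -
  obtain G t where fG: "finite G" and tG: "\<forall>i\<in>G. valid_kind Q (t i)"
    "\<forall>i\<in>G. \<forall>v. t i = At_vertex v \<longrightarrow> (\<exists>a\<in>arcs Q. \<exists>b\<in>arcs Q. a \<noteq> b \<and> head Q a = v \<and> head Q b = v)"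
    and iso: "mod_isomorphic R (F\<lparr>carrier := U\<rparr>) (mod_family_sum G (\<lambda>i. right_ideal_gen R (kind_elt (t i))))"
    using radical_submodule_decomposition .
  have G: "valid_kind Q (t i)"
    "t i = At_vertex v \<Longrightarrow> \<exists>a\<in>arcs Q. \<exists>b\<in>arcs Q. a \<noteq> b \<and> head Q a = v \<and> head Q b = v" if "i \<in> G" for i v
    using tG that by blast+
  let ?D = "mod_family_sum G (\<lambda>i. right_ideal_gen R (kind_elt (t i)))"
  have U: "right_module R (F\<lparr>carrier := U\<rparr>)" by (rule right_module_submodule[OF F.right_module_axioms submodule_U])
  have D: "right_module R ?D" by (rule right_module_family[OF ring_R kind_module[OF G(1)]])
  have uD: "uniserial R ?D" by (rule uniserial_iso[OF U D iso uni])
  obtain i where i: "G = {i}"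
    using uniserial_family_index[OF ring_R kind_module[OF G(1)] kind_module_nonzero[OF G(1)] uD] .
  have iG: "i \<in> G" by (simp add: i)
  note Y = kind_module[OF G(1)[OF iG]]
  have "mod_isomorphic R (right_ideal_gen R (kind_elt (t i))) ?D"
    unfolding i by (rule family_singleton_iso[where L = "\<lambda>i. right_ideal_gen R (kind_elt (t i))", OF ring_R Y])
  then have DY: "mod_isomorphic R ?D (right_ideal_gen R (kind_elt (t i)))"
    by (rule mod_isomorphic_sym[OF Y D])
  have "uniserial R (right_ideal_gen R (kind_elt (t i)))" by (rule uniserial_iso[OF D Y DY uD])
  from uniserial_kind_module[OF G(1)[OF iG] G(2)[OF iG] this] obtain a where a: "a \<in> arcs Q"
    and ia: "mod_isomorphic R (right_ideal_gen R (kind_elt (t i))) (RA a)" by blast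
  have "mod_isomorphic R (F\<lparr>carrier := U\<rparr>) (RA a)"
    by (rule mod_isomorphic_trans[OF U mod_isomorphic_trans[OF U iso DY] ia])
  then show ?thesis using a by blast
qed

context gentle_algebra
begin

lemma syzygy_in_radical:
  fixes M :: "(('v \<times> 'a list \<Rightarrow> 'k) set, 'm) module"
  assumes M: "fg_module R M"
  obtains J u U where "radical_submodule Q S I J u U"
    "mod_isomorphic R (syzygy R M) ((FV J u)\<lparr>carrier := U\<rparr>)"
proof -
  obtain J u p where J: "finite J" "\<And>j. j \<in> J \<Longrightarrow> u j \<in> verts Q" and c: "proj_cover R M (FV J u) p"
    and rad: "\<And>x. x \<in> carrier (FV J u) \<Longrightarrow> p x = \<zero>\<^bsub>M\<^esub> \<Longrightarrow> x \<in> radical_part J u"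
    using radical_cover_exists[OF M] by metis
  note pres = presentsD[OF proj_cover_presents[OF c]]
  obtain P :: "(('v \<times> 'a list \<Rightarrow> 'k) set, ('v \<times> 'a list \<Rightarrow> 'k) set univ) module" and q
    where P: "proj_cover R M P q" and syz: "syzygy R M = kernel_module P q M"
    using syzygy_cover[OF M] .
  let ?U = "{x \<in> carrier (FV J u). p x = \<zero>\<^bsub>M\<^esub>}"
  have "radical_submodule Q S I J u ?U"
  proof (rule radical_submodule.intro[OF gentle_algebra_axioms], rule radical_submodule_axioms.intro)
    show "submodule ?U R (FV J u)" by (rule kernel_submodule[OF pres(3) fg_right_module[OF M] pres(4)])
    show "?U \<subseteq> radical_part J u" using rad by blast
  qed (use J in auto)
  moreover have "mod_isomorphic R (syzygy R M) ((FV J u)\<lparr>carrier := ?U\<rparr>)"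
    using R.proj_cover_kernel_iso[OF P c M] by (simp only: syz kernel_module_def)
  ultimately show thesis by (rule that)
qed

text \<open>A summand of the syzygy embeds into the radical of a projective module.\<close>

lemma uniserial_syzygy_summand:
  fixes M :: "(('v \<times> 'a list \<Rightarrow> 'k) set, 'm) module" and L :: "nat \<Rightarrow> (('v \<times> 'a list \<Rightarrow> 'k) set, 'l) module"
  assumes M: "fg_module R M" and L: "\<And>i. i \<in> J \<Longrightarrow> right_module R (L i)"
    and iso: "mod_isomorphic R (syzygy R M) (mod_family_sum J L)"
    and i: "i \<in> J" "uniserial R (L i)"
  shows "\<exists>a\<in>arcs Q. mod_isomorphic R (L i) (RA a)"
proof -
  obtain J' u U where rs: "radical_submodule Q S I J' u U"
    and isoU: "mod_isomorphic R (syzygy R M) ((FV J' u)\<lparr>carrier := U\<rparr>)"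
    using syzygy_in_radical[OF M] .
  interpret U: radical_submodule Q S I J' u U by (rule rs)
  let ?U = "(FV J' u)\<lparr>carrier := U\<rparr>"
  have rU: "right_module R ?U" by (rule right_module_submodule[OF U.F.right_module_axioms U.submodule_U])
  have rS: "right_module R (syzygy R M)" by (rule fg_right_module[OF syzygy_fg[OF M]])
  have rL: "right_module R (mod_family_sum J L)" by (rule right_module_family[OF ring_R L])
  have "mod_isomorphic R (mod_family_sum J L) ?U"
    by (rule mod_isomorphic_trans[OF rL mod_isomorphic_sym[OF rS rL iso] isoU])
  then obtain g where g: "g \<in> mod_hom R (mod_family_sum J L) ?U"
    and gb: "bij_betw g (carrier (mod_family_sum J L)) (carrier ?U)"
    by (auto simp: mod_isomorphic_def)
  note rLi = L[OF i(1)]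
  have e: "family_in J L i \<in> mod_hom R (L i) (mod_family_sum J L)" by (rule hom_family_in[OF ring_R L i(1)])
  let ?f = "compose (carrier (L i)) g (family_in J L i)"
  have f: "?f \<in> mod_hom R (L i) ?U" by (rule hom_comp[OF rLi e g])
  have fF: "?f \<in> mod_hom R (L i) (FV J' u)" by (rule hom_codomainD[OF f U.U_carrier])
  let ?V = "?f ` carrier (L i)"
  have V: "submodule ?V R (FV J' u)"
    by (rule image_submodule[OF rLi U.F.right_module_axioms fF right_module.carrier_submodule[OF rLi]])
  have VU: "?V \<subseteq> U" using hom_closed[OF f] by auto
  have "?V \<subseteq> radical_part J' u" using VU U.radical_U by blast
  then interpret V: radical_submodule Q S I J' u ?V
    by (intro radical_submodule.intro[OF gentle_algebra_axioms] radical_submodule_axioms.intro U.finite_J U.verts_u V)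
  have isoV: "mod_isomorphic R (L i) ((FV J' u)\<lparr>carrier := ?V\<rparr>)"
  proof (rule mod_isomorphicI)
    show "right_module R (L i)" by (rule rLi)
    show "right_module R ((FV J' u)\<lparr>carrier := ?V\<rparr>)"
      by (rule right_module_submodule[OF U.F.right_module_axioms V])
    show "?f \<in> mod_hom R (L i) ((FV J' u)\<lparr>carrier := ?V\<rparr>)" by (rule hom_codomain[OF fF]) (rule imageI)
    show "?f ` carrier (L i) = carrier ((FV J' u)\<lparr>carrier := ?V\<rparr>)" by simp
    fix x assume x: "x \<in> carrier (L i)" "?f x = \<zero>\<^bsub>(FV J' u)\<lparr>carrier := ?V\<rparr>\<^esub>"
    interpret D: right_module R "mod_family_sum J L" by (rule rL)
    have "g (family_in J L i x) = \<zero>\<^bsub>?U\<^esub>" using x by (simp add: compose_eq)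
    then have "g (family_in J L i x) = g \<zero>\<^bsub>mod_family_sum J L\<^esub>" by (simp only: hom_zero[OF rL rU g])
    then have z: "family_in J L i x = \<zero>\<^bsub>mod_family_sum J L\<^esub>"
      using inj_onD[OF bij_betw_imp_inj_on[OF gb] _ hom_closed[OF e x(1)] D.M.zero_closed] by blast
    from fun_cong[OF z, of i] show "x = \<zero>\<^bsub>L i\<^esub>" using x(1) i(1) by (simp add: family_in_def zero_family)
  qed
  have rV: "right_module R ((FV J' u)\<lparr>carrier := ?V\<rparr>)" by (rule right_module_submodule[OF U.F.right_module_axioms V])
  have "uniserial R ((FV J' u)\<lparr>carrier := ?V\<rparr>)" by (rule uniserial_iso[OF rLi rV isoV i(2)])
  from V.uniserial_radical_submodule[OF this] obtain a where "a \<in> arcs Q"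
    "mod_isomorphic R ((FV J' u)\<lparr>carrier := ?V\<rparr>) (RA a)" by blast
  then show ?thesis using mod_isomorphic_trans[OF rLi isoV] by blast
qed

section \<open>Extensions over gentle algebras\<close>

text \<open>
  The summands of the syzygy other than \<open>L 0\<close> and \<open>L k\<close> are projective and hence stably zero.
\<close>

theorem Ext_of_two_ends:
  fixes M :: "(('v \<times> 'a list \<Rightarrow> 'k) set, 'm) module" and N :: "(('v \<times> 'a list \<Rightarrow> 'k) set, 'n) module"
    and L :: "nat \<Rightarrow> (('v \<times> 'a list \<Rightarrow> 'k) set, ('v \<times> 'a list \<Rightarrow> 'k) set univ) module"
  assumes M: "fg_module R M" and N: "right_module R N" and k: "1 \<le> k"
    and L: "\<And>i. i \<le> k \<Longrightarrow> fg_module R (L i)"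
    and iso: "mod_isomorphic R (syzygy R M) (mod_family_sum {..k} L)"
    and proj: "\<And>i. i \<in> {1..k - 1} \<Longrightarrow> projective R (L i)"
    and ends: "\<And>i. i \<in> {0, k} \<Longrightarrow> uniserial R (L i) \<or> zero_module (L i)"
  shows "vs_isomorphic (Ext R (Suc (Suc n)) M N)
      (mod_sum (Ext R 1 (syzygy_pow R n (L 0)) N) (Ext R 1 (syzygy_pow R n (L k)) N))"
    and "i \<in> {0, k} \<Longrightarrow> arrow_or_zero (syzygy_pow R n (L i))"
proof -
  have az: "arrow_or_zero (L i)" if i: "i \<in> {0, k}" for i
  proof -
    have ik: "i \<le> k" using i by auto
    have "\<exists>a\<in>arcs Q. mod_isomorphic R (L i) (RA a)" if "uniserial R (L i)"
      by (rule uniserial_syzygy_summand[OF M _ iso _ that]) (use fg_right_module[OF L] ik in auto)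
    then show ?thesis using ends[OF i] L[OF ik] by (auto simp: arrow_or_zero_def)
  qed
  then show p: "arrow_or_zero (syzygy_pow R n (L i))" if "i \<in> {0, k}" for i n
    using that arrow_or_zero_syzygy_pow by blast
  have fgS: "fg_module R (syzygy R M)" by (rule syzygy_fg[OF M])
  have fgL: "fg_module R (mod_family_sum {..k} L)" by (rule fg_family[OF ring_R]) (use L in auto)
  have fgE: "fg_module R (mod_family_sum {0, k} L)" by (rule fg_family[OF ring_R]) (use L in auto)
  have "stably_equivalent R (mod_family_sum {..k} L) (mod_family_sum {0, k} L)"
  proof (rule R.stably_equivalent_drop_projectives)
    fix i assume "i \<in> {..k} - {0, k}"
    then have "i \<in> {1..k - 1}" by auto
    then show "projective R (L i)" by (rule proj)
  qed (use L in auto)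
  then have st: "stably_equivalent R (syzygy R M) (mod_family_sum {0, k} L)"
    by (rule R.stably_equivalent_trans[OF fgS fgL fgE R.stably_equivalent_iso[OF fgS fg_right_module[OF fgL] iso]])
  have "vs_isomorphic (Ext R (Suc (Suc n)) M N)
      (mod_sum (Ext R (Suc 0) (syzygy_pow R n (L 0)) N) (Ext R (Suc 0) (syzygy_pow R n (L k)) N))"
  proof (rule R.Ext_split[OF M N _ syzygy_of_syzygy[OF M], where W = "\<lambda>n i. syzygy_pow R n (L i)"])
    show "0 \<noteq> k" using k by simp
    show "stably_equivalent R (syzygy R M) (mod_family_sum {0, k} (\<lambda>i. syzygy_pow R 0 (L i)))"
      using st by (simp add: syzygy_pow_def)
    show "fg_module R (syzygy_pow R 0 (L i))" if "i \<in> {0, k}" for i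
      using p[OF that] by (simp add: arrow_or_zero_def)
    show "syzygy_of R (syzygy_pow R n (L i)) (syzygy_pow R (Suc n) (L i))" if "i \<in> {0, k}" for n i
    proof -
      have "fg_module R (syzygy_pow R n (L i))" using p[OF that] by (simp add: arrow_or_zero_def)
      from syzygy_of_syzygy[OF this] show ?thesis by (simp add: syzygy_pow_def)
    qed
  qed
  then show "vs_isomorphic (Ext R (Suc (Suc n)) M N)
      (mod_sum (Ext R 1 (syzygy_pow R n (L 0)) N) (Ext R 1 (syzygy_pow R n (L k)) N))" by simp
qed

text \<open>Three consecutive syzygies that lead back to \<open>Y\<close>, up to projective summands.\<close>

definition triangle_resolution ::
  "(('v \<times> 'a list \<Rightarrow> 'k) set, 'm) module \<Rightarrow> (nat \<Rightarrow> (('v \<times> 'a list \<Rightarrow> 'k) set, 'm) module) \<Rightarrow> bool" where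
  "triangle_resolution Y y \<longleftrightarrow> y 0 = Y \<and> (\<forall>n. fg_module R (y n)) \<and>
     (\<forall>n<3. syzygy_of R (y n) (y (Suc n))) \<and> stably_equivalent R (y 3) (y 0)"

text \<open>The identity presents a projective module, so all its syzygies can be taken to be zero.\<close>

lemma triangle_resolution_projective:
  assumes Y: "projective R Y"
  shows "\<exists>y. triangle_resolution Y y"
proof -
  have fg: "fg_module R Y" by (rule projective_fg[OF Y])
  interpret Y: right_module R Y by (rule fg_right_module[OF fg])
  let ?Z = "Y\<lparr>carrier := {\<zero>\<^bsub>Y\<^esub>}\<rparr>"
  have fgZ: "fg_module R ?Z" by (rule R.fg_submodule[OF fg Y.zero_submodule])
  have PZ: "projective R ?Z" by (rule projective_zero_module[OF fgZ]) (simp add: zero_module_def)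
  have id: "syzygy_of R P (kernel_module P (\<lambda>x\<in>carrier P. x) P)" if "projective R P"
    for P :: "(('v \<times> 'a list \<Rightarrow> 'k) set, 'm) module"
  proof -
    have "presents R P (\<lambda>x\<in>carrier P. x) P"
      using hom_id[OF fg_right_module[OF projective_fg[OF that]]] that by (simp add: presents_def)
    then show ?thesis unfolding syzygy_of_def by blast
  qed
  have "kernel_module Y (\<lambda>x\<in>carrier Y. x) Y = ?Z"
    unfolding kernel_module_def by (rule arg_cong[where f = "\<lambda>B. Y\<lparr>carrier := B\<rparr>"]) auto
  then have Y1: "syzygy_of R Y ?Z" using id[OF Y] by simp
  have "kernel_module ?Z (\<lambda>x\<in>carrier ?Z. x) ?Z = ?Z"
    unfolding kernel_module_def by (simp cong: conj_cong)
  then have Z1: "syzygy_of R ?Z ?Z" using id[OF PZ] by simp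
  let ?y = "\<lambda>n. if n = 0 then Y else ?Z"
  have "triangle_resolution Y ?y"
    using fg fgZ Y1 Z1 R.stably_equivalent_projective[OF PZ Y] by (simp add: triangle_resolution_def)
  then show ?thesis by blast
qed

end

text \<open>
  Every relation is one of three that form a cycle, like the relations inside an internal
  triangle.
\<close>

locale triangular_gentle_algebra = gentle_algebra Q S I
  for Q :: "('v, 'a) pre_digraph" and S and I :: "('v \<times> 'a list \<Rightarrow> 'k :: field) set" +
  assumes triangles: "(tail Q a, [a, b]) \<in> S \<Longrightarrow> \<exists>c. (tail Q b, [b, c]) \<in> S \<and> (tail Q c, [c, a]) \<in> S"
begin

text \<open>
  If \<open>ab\<close>, \<open>bc\<close> and \<open>ca\<close> are relations, the syzygies of \<open>aR\<close> are \<open>bR\<close>, \<open>cR\<close> and \<open>aR\<close> again. If no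
  relation starts with \<open>a\<close>, then \<open>aR\<close> is projective.
\<close>

lemma triangle_resolution_kind:
  assumes t: "valid_kind Q t"
  shows "\<exists>y. triangle_resolution (right_ideal_gen R (kind_elt t)) y"
proof (cases t)
  case (At_vertex w)
  then show ?thesis using t triangle_resolution_projective[OF projective_PV] by simp
next
  case (At_arrow a)
  have a: "a \<in> arcs Q" using t At_arrow by simp
  have syz: "syzygy_of R (RA a) (RA b)" if "(tail Q a, [a, b]) \<in> S" for a b
    unfolding syzygy_of_def
    using arrow_cover_presents[OF relation_arrows(1)[OF that]] arrow_cover_kernel_relation[OF that, symmetric] by blast
  show ?thesis
  proof (cases "\<exists>b. (tail Q a, [a, b]) \<in> S")
    case True
    then obtain b c where abc: "(tail Q a, [a, b]) \<in> S" "(tail Q b, [b, c]) \<in> S" "(tail Q c, [c, a]) \<in> S"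
      using triangles by blast
    let ?y = "\<lambda>n::nat. if n = 1 then RA b else if n = 2 then RA c else RA a"
    have "syzygy_of R (?y n) (?y (Suc n))" if "n < 3" for n
    proof -
      from that consider "n = 0" | "n = 1" | "n = 2" by linarith
      then show ?thesis by cases (use syz[OF abc(1)] syz[OF abc(2)] syz[OF abc(3)] in simp_all)
    qed
    then have "triangle_resolution (RA a) ?y"
      using fg_RA[OF a] fg_RA[OF relation_arrows(2)[OF abc(1)]] fg_RA[OF relation_arrows(2)[OF abc(2)]]
        R.stably_equivalent_refl[OF fg_RA[OF a]] by (simp add: triangle_resolution_def)
    then show ?thesis by (auto simp: At_arrow)
  next
    case False
    then show ?thesis using triangle_resolution_projective[OF arrow_module_free(2)[OF a]] by (simp add: At_arrow)
  qed
qed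

text \<open>
  The syzygy of \<open>M\<close> is a submodule of the radical of a projective module, and each of its summands
  has period three up to projective modules.
\<close>

theorem Ext_three_periodic:
  fixes M :: "(('v \<times> 'a list \<Rightarrow> 'k) set, 'm) module" and N :: "(('v \<times> 'a list \<Rightarrow> 'k) set, 'n) module"
  assumes M: "fg_module R M" and N: "right_module R N"
  shows "vs_isomorphic (Ext R (Suc (Suc n)) M N) (Ext R (Suc (Suc (n + 3))) M N)"
proof -
  obtain J u U where rs: "radical_submodule Q S I J u U"
    and isoU: "mod_isomorphic R (syzygy R M) ((FV J u)\<lparr>carrier := U\<rparr>)"
    using syzygy_in_radical[OF M] .
  obtain G t where G: "finite G" "\<forall>i\<in>G. valid_kind Q (t i)"
    "\<forall>i\<in>G. \<forall>v. t i = At_vertex v \<longrightarrow> (\<exists>a\<in>arcs Q. \<exists>b\<in>arcs Q. a \<noteq> b \<and> head Q a = v \<and> head Q b = v)"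
    and iso: "mod_isomorphic R ((FV J u)\<lparr>carrier := U\<rparr>) (mod_family_sum G (\<lambda>i. right_ideal_gen R (kind_elt (t i))))"
    using radical_submodule.radical_submodule_decomposition[OF rs] .
  have fgS: "fg_module R (syzygy R M)" by (rule syzygy_fg[OF M])
  have "\<exists>y. \<forall>i\<in>G. triangle_resolution (right_ideal_gen R (kind_elt (t i))) (y i)"
    by (rule bchoice) (intro ballI triangle_resolution_kind, use G(2) in blast)
  then obtain y where y: "\<And>i. i \<in> G \<Longrightarrow> triangle_resolution (right_ideal_gen R (kind_elt (t i))) (y i)" by blast
  have y0: "y i 0 = right_ideal_gen R (kind_elt (t i))" and yfg: "fg_module R (y i m)"
    and ysyz: "m < 3 \<Longrightarrow> syzygy_of R (y i m) (y i (Suc m))" and yst: "stably_equivalent R (y i 3) (y i 0)"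
    if "i \<in> G" for i m
  proof -
    note d = y[OF that, unfolded triangle_resolution_def]
    show "y i 0 = right_ideal_gen R (kind_elt (t i))" by (rule d[THEN conjunct1])
    show "fg_module R (y i m)" using d[THEN conjunct2, THEN conjunct1] by (rule spec)
    show "syzygy_of R (y i m) (y i (Suc m))" if "m < 3"
      using d[THEN conjunct2, THEN conjunct2, THEN conjunct1] that by blast
    show "stably_equivalent R (y i 3) (y i 0)" by (rule d[THEN conjunct2, THEN conjunct2, THEN conjunct2])
  qed
  let ?V = "\<lambda>m. mod_family_sum G (\<lambda>i. y i m)"
  have fgV: "fg_module R (?V m)" for m by (rule fg_family[OF ring_R G(1) yfg])
  have "mod_family_sum G (\<lambda>i. right_ideal_gen R (kind_elt (t i))) = ?V 0"
    by (rule family_cong) (rule y0[symmetric])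
  then have "mod_isomorphic R (syzygy R M) (?V 0)"
    using mod_isomorphic_trans[OF fg_right_module[OF fgS] isoU iso] by (simp only:)
  then have st: "stably_equivalent R (syzygy R M) (?V 0)"
    by (rule R.stably_equivalent_iso[OF fgS fg_right_module[OF fgV]])
  show ?thesis
  proof (rule R.Ext_periodic[where V = ?V, OF M N syzygy_of_syzygy[OF M] st fgV])
    show "syzygy_of R (?V m) (?V (Suc m))" if "m < 3" for m
      by (rule syzygy_of_family[OF ring_R G(1) fg_right_module[OF yfg] ysyz[OF _ that]])
    show "stably_equivalent R (?V 3) (?V 0)"
      by (rule R.stably_equivalent_family[OF G(1) yfg yfg yst])
  qed
qed

end

section \<open>String modules\<close>

lemma string_arrow_act_zero: "string_arrow_act w a (\<lambda>j. 0) = (\<lambda>j. 0)"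
  by (auto simp: string_arrow_act_def)

lemma fold_string_arrow_act_zero: "fold (string_arrow_act w) p (\<lambda>j. 0) = (\<lambda>j. 0)"
  by (induction p) (simp_all add: string_arrow_act_zero)

text \<open>
  The letters by which \<open>a\<close> and \<open>b\<close> act would have to be consecutive in the word and point in the
  same direction. Their product would be a relation, which a string does not contain.
\<close>

lemma string_arrow_act_relation:
  assumes w: "is_string Q I v w" and ab: "arrow_prod Q a b \<in> I"
  shows "string_arrow_act w b (string_arrow_act w a m) = (\<lambda>j. 0)"
proof
  fix j
  have s: "\<And>i. Suc i < length w \<Longrightarrow> \<not> (w ! i = Arr a \<and> w ! Suc i = Arr b)"
      "\<And>i. Suc i < length w \<Longrightarrow> \<not> (w ! i = Inv b \<and> w ! Suc i = Inv a)"
    using w ab unfolding is_string_def by blast+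
  have 1: "string_arrow_act w a m (j - 1) = 0" if "0 < j" "j \<le> length w" "w ! (j - 1) = Arr b"
    using that s(1)[of "j - 2"] by (cases "j = 1") (auto simp: string_arrow_act_def numeral_2_eq_2 Suc_diff_Suc)
  have 2: "string_arrow_act w a m (j + 1) = 0" if "j < length w" "w ! j = Inv b"
    using that s(2)[of j] by (auto simp: string_arrow_act_def)
  show "string_arrow_act w b (string_arrow_act w a m) j = 0"
    using 1 2 by (simp add: string_arrow_act_def[of w b])
qed

context monomial_algebra
begin

lemma fold_string_arrow_act_bad:
  assumes w: "is_string Q I v w" and q: "(u, p) \<in> qpaths Q" "\<not> nonzero_path (u, p)"
  shows "fold (string_arrow_act w) p m = (\<lambda>j. 0)"
proof -
  have "\<not> successively (\<lambda>a b. (tail Q a, [a, b]) \<notin> S) p" using q by (simp add: nonzero_path_def)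
  then obtain i where i: "Suc i < length p" "(tail Q (p ! i), [p ! i, p ! Suc i]) \<in> S"
    by (auto simp: successively_conv_nth)
  have p: "p = take i p @ p ! i # p ! Suc i # drop (Suc (Suc i)) p"
    using i(1) by (simp add: Cons_nth_drop_Suc)
  have arr: "p ! i \<in> arcs Q" "p ! Suc i \<in> arcs Q" "head Q (p ! i) = tail Q (p ! Suc i)"
    using quadratic i(2) by (auto simp: qpaths_Cons)
  have "arrow_prod Q (p ! i) (p ! Suc i) \<in> I"
    using arrow_prod_in_ideal_iff[OF arr] i(2) by (simp add: I_def)
  note z = string_arrow_act_relation[OF w this]
  show ?thesis by (subst p) (simp add: z fold_string_arrow_act_zero)
qed

text \<open>
  The action is defined through a representative of the coset. Its coefficients at nonzero paths
  are determined by the coset, and all other paths act as zero.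
\<close>

lemma string_module_act:
  assumes w: "is_string Q I v w" and r: "r \<in> carrier R"
  shows "(r \<odot>\<^bsub>string_module Q v w\<^esub> m) j =
    (\<Sum>(u, p)\<in>{q. nonzero_path q}. cf r (u, p) * fold (string_arrow_act w) p (string_vertex_act Q v w u m) j)"
proof -
  define x where "x = (SOME x. x \<in> r)"
  obtain x0 where x0: "x0 \<in> carrier A" "r = I +>\<^bsub>A\<^esub> x0" by (rule R_cases[OF r])
  interpret A: ring A by (rule ring_path_algebra)
  interpret I: ideal I A by (rule ideal_I)
  have "x0 \<in> r" unfolding x0(2) by (rule I.a_rcos_self) (rule x0(1))
  then have xr: "x \<in> r" unfolding x_def by (rule someI[of "\<lambda>x. x \<in> r"])
  have "r \<subseteq> carrier A" unfolding x0(2) by (rule A.a_r_coset_subset_G[OF I.a_subset x0(1)])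
  then have x: "finite {q. x q \<noteq> 0}" "{q. x q \<noteq> 0} \<subseteq> qpaths Q"
    using xr by (auto simp: path_algebra_simps)
  have cf: "cf r q = (if nonzero_path q then x q else 0)" for q by (simp add: cf_def x_def)
  let ?f = "\<lambda>(u, p). fold (string_arrow_act w) p (string_vertex_act Q v w u m) j"
  have "(r \<odot>\<^bsub>string_module Q v w\<^esub> m) j = (\<Sum>q\<in>{q. x q \<noteq> 0}. x q * ?f q)"
    by (simp add: string_module_def string_act_def x_def case_prod_unfold)
  also have "\<dots> = (\<Sum>q\<in>{q. x q \<noteq> 0} \<inter> {q. nonzero_path q}. x q * ?f q)"
  proof (rule sum.mono_neutral_right[OF x(1)])
    show "\<forall>q\<in>{q. x q \<noteq> 0} - {q. x q \<noteq> 0} \<inter> {q. nonzero_path q}. x q * ?f q = 0"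
    proof
      fix q assume q: "q \<in> {q. x q \<noteq> 0} - {q. x q \<noteq> 0} \<inter> {q. nonzero_path q}"
      obtain u p where up: "q = (u, p)" by (cases q)
      have "(u, p) \<in> qpaths Q" "\<not> nonzero_path (u, p)" using q x(2) up by auto
      from fun_cong[OF fold_string_arrow_act_bad[OF w this, of "string_vertex_act Q v w u m"], of j]
      show "x q * ?f q = 0" by (simp add: up)
    qed
  qed simp
  also have "\<dots> = (\<Sum>q\<in>{q. nonzero_path q}. x q * ?f q)"
    by (rule sum.mono_neutral_left[OF finite_nonzero_paths]) auto
  also have "\<dots> = (\<Sum>q\<in>{q. nonzero_path q}. cf r q * ?f q)"
    by (rule sum.cong[OF refl]) (simp add: cf)
  finally show ?thesis by (simp add: case_prod_unfold)
qed

lemma word_vertex_verts: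
  assumes w: "is_string Q I v w" and j: "j \<le> length w"
  shows "word_vertex Q v w j \<in> verts Q"
proof (cases j)
  case 0 then show ?thesis using w by (simp add: is_string_def word_vertex_def)
next
  case (Suc i)
  then have "letter_arrow (w ! i) \<in> arcs Q" using w j by (simp add: is_string_def)
  then show ?thesis by (cases "w ! i") (simp_all add: Suc word_vertex_def letter_end_def)
qed

lemma string_module_scal:
  assumes w: "is_string Q I v w" and m: "m \<in> carrier (string_module Q v w)"
  shows "(c \<odot>\<^bsub>R\<^esub> \<one>\<^bsub>R\<^esub>) \<odot>\<^bsub>string_module Q v w\<^esub> m = (\<lambda>j. c * m j)"
proof
  fix j
  let ?r = "c \<odot>\<^bsub>R\<^esub> \<one>\<^bsub>R\<^esub>"
  let ?f = "\<lambda>(u, p). fold (string_arrow_act w) p (string_vertex_act Q v w u m) j"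
  have r: "?r \<in> carrier R" by (rule R.smult_closed[OF R.one_closed])
  have cf: "cf ?r (u, p) = (if u \<in> verts Q \<and> p = [] then c else 0)" for u p
    by (simp add: cf_smult[OF R.one_closed] cf_one)
  have "(?r \<odot>\<^bsub>string_module Q v w\<^esub> m) j = (\<Sum>q\<in>{q. nonzero_path q}. cf ?r q * ?f q)"
    unfolding string_module_act[OF w r] by (simp add: case_prod_unfold)
  also have "\<dots> = (\<Sum>q\<in>(\<lambda>u. (u, [])) ` verts Q. cf ?r q * ?f q)"
    by (rule sum.mono_neutral_right[OF finite_nonzero_paths]) (auto simp: nonzero_path_Nil cf simp del: cf_smult)
  also have "\<dots> = (\<Sum>u\<in>verts Q. c * string_vertex_act Q v w u m j)"
    by (subst sum.reindex) (auto simp: inj_on_def cf simp del: cf_smult)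
  also have "\<dots> = (\<Sum>u\<in>verts Q. if u = word_vertex Q v w j then c * (if j \<le> length w then m j else 0) else 0)"
    by (rule sum.cong) (auto simp: string_vertex_act_def)
  also have "\<dots> = c * m j"
    using m word_vertex_verts[OF w, of j] finite_verts by (auto simp: string_module_def)
  finally show "(?r \<odot>\<^bsub>string_module Q v w\<^esub> m) j = c * m j" .
qed

text \<open>
  The preimages of the basis elements \<open>z\<^sub>i\<close> generate: the coordinates of an element can be cleared
  one after the other by subtracting scalar multiples of them.
\<close>

theorem fg_string_module:
  fixes M :: "(('v \<times> 'a list \<Rightarrow> 'k) set, 'm) module"
  assumes "is_string_module Q I M"
  shows "fg_module R M"
proof -
  obtain v w where M: "right_module R M" and w: "is_string Q I v w"
    and iso: "mod_isomorphic R M (string_module Q v w :: (('v \<times> 'a list \<Rightarrow> 'k) set, nat \<Rightarrow> 'k) module)"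
    using assms by (auto simp: is_string_module_def)
  let ?W = "string_module Q v w :: (('v \<times> 'a list \<Rightarrow> 'k) set, nat \<Rightarrow> 'k) module"
  obtain f where f: "f \<in> mod_hom R M ?W" and b: "bij_betw f (carrier M) (carrier ?W)"
    using iso by (auto simp: mod_isomorphic_def)
  interpret M: right_module R M by (rule M)
  have inj: "inj_on f (carrier M)" by (rule bij_betw_imp_inj_on[OF b])
  have add: "f (x \<oplus>\<^bsub>M\<^esub> y) = (\<lambda>j. f x j + f y j)" if "x \<in> carrier M" "y \<in> carrier M" for x y
    using hom_add[OF f that] by (simp add: string_module_def)
  have "f \<zero>\<^bsub>M\<^esub> = (\<lambda>j. f \<zero>\<^bsub>M\<^esub> j + f \<zero>\<^bsub>M\<^esub> j)" using add[of "\<zero>\<^bsub>M\<^esub>" "\<zero>\<^bsub>M\<^esub>"] by simp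
  then have zero: "f \<zero>\<^bsub>M\<^esub> = (\<lambda>j. 0)" by (metis add_cancel_right_left)
  define z :: "nat \<Rightarrow> nat \<Rightarrow> 'k" where "z i = (\<lambda>j. if j = i then 1 else 0)" for i
  define e where "e i = inv_into (carrier M) f (z i)" for i
  have zW: "z i \<in> carrier ?W" if "i \<le> length w" for i using that by (simp add: z_def string_module_def)
  have e: "e i \<in> carrier M" "f (e i) = z i" if "i \<le> length w" for i
    using zW[OF that] b unfolding e_def by (simp_all add: bij_betw_def inv_into_into f_inv_into_f)
  have fW: "f x j = 0" if "x \<in> carrier M" "length w < j" for x j
    using hom_closed[OF f that(1)] that(2) by (simp add: string_module_def)
  have scal: "f (R.scal c \<odot>\<^bsub>M\<^esub> x) = (\<lambda>j. c * f x j)" if "x \<in> carrier M" for c x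
    using hom_act[OF f R.smult_closed[OF R.one_closed] that] string_module_scal[OF w hom_closed[OF f that]] by simp
  show ?thesis
  proof (rule fg_moduleI[OF M, of "e ` {..length w}"])
    fix U assume U: "submodule U R M" "e ` {..length w} \<subseteq> U"
    have "x \<in> U" if "k \<le> Suc (length w)" "x \<in> carrier M" "\<forall>j\<ge>k. f x j = 0" for k x
      using that
    proof (induction k arbitrary: x)
      case 0
      then have "f x = f \<zero>\<^bsub>M\<^esub>" by (auto simp: zero)
      then have "x = \<zero>\<^bsub>M\<^esub>" using inj_onD[OF inj] 0(2) M.M.zero_closed by blast
      then show ?case using submodule_zero[OF U(1)] by simp
    next
      case (Suc k)
      have k: "k \<le> length w" using Suc.prems(1) by simp
      have x: "x \<in> carrier M" by (rule Suc.prems(2))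
      have sc: "R.scal c \<odot>\<^bsub>M\<^esub> e k \<in> carrier M" for c
        by (rule M.act_closed[OF R.smult_closed[OF R.one_closed] e(1)[OF k]])
      have eU: "R.scal c \<odot>\<^bsub>M\<^esub> e k \<in> U" for c
        by (rule submodule_act[OF U(1) R.smult_closed[OF R.one_closed]]) (use U(2) k in blast)
      let ?y = "x \<oplus>\<^bsub>M\<^esub> R.scal (- f x k) \<odot>\<^bsub>M\<^esub> e k"
      have y: "?y \<in> carrier M" by (rule M.M.a_closed[OF x sc])
      have fy: "f ?y = (\<lambda>j. f x j - f x k * z k j)" by (simp add: add[OF x sc] scal[OF e(1)[OF k]] e(2)[OF k])
      have "\<forall>j\<ge>k. f ?y j = 0" using Suc.prems(3) by (auto simp: fy z_def)
      then have yU: "?y \<in> U" using Suc.IH[OF _ y] k by simp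
      have "f (?y \<oplus>\<^bsub>M\<^esub> R.scal (f x k) \<odot>\<^bsub>M\<^esub> e k) = f x"
        by (simp add: add[OF y sc] fy scal[OF e(1)[OF k]] e(2)[OF k])
      then have "?y \<oplus>\<^bsub>M\<^esub> R.scal (f x k) \<odot>\<^bsub>M\<^esub> e k = x"
        using inj_onD[OF inj] M.M.a_closed[OF y sc] x by blast
      then show ?case using submodule_add[OF U(1) yU eU[of "f x k"]] by simp
    qed
    from this[OF order_refl] show "carrier M \<subseteq> U" using fW by (auto simp: Suc_le_eq)
  qed (use e in auto)
qed

end

section \<open>Gentle algebras and triangulations\<close>

text \<open>
  The bound on the length of nonzero paths comes from admissibility. The uniqueness of relations
  with a given first or second arrow is part of the definition of gentle algebras.
\<close>

lemma gentle_algebra_exists: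
  fixes I :: "('v \<times> 'a list \<Rightarrow> 'k :: field) set"
  assumes g: "gentle Q I"
  obtains S where "gentle_algebra Q S I"
proof -
  interpret fin_digraph Q using g by (simp add: gentle_def)
  obtain S where S: "S \<subseteq> {p \<in> qpaths Q. length (snd p) = 2}"
    and I: "I = Idl\<^bsub>path_algebra Q\<^esub> (path_elt ` S)"
    using g by (auto simp: gentle_def)
  interpret monomial_quiver Q S by unfold_locales (use S in simp_all)
  let ?A = "path_algebra Q :: ('k, 'v \<times> 'a list \<Rightarrow> 'k) module"
  interpret A: ring ?A by (rule ring_path_algebra)
  obtain m where m: "(arrow_ideal_pow Q m :: ('v \<times> 'a list \<Rightarrow> 'k) set) \<subseteq> I"
    using g by (auto simp: gentle_def admissible_def)
  have short: "length p < m" if p: "nonzero_path (v, p)" for v p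
  proof (rule ccontr)
    assume "\<not> length p < m"
    have q: "nonzero_path (v, take m p)" by (rule nonzero_path_take_drop(1)[OF p])
    have "path_elt ` {p \<in> qpaths Q. length (snd p) = m} \<subseteq> carrier ?A"
      using path_elt_carrier by blast
    from A.genideal_self[OF this] have "(path_elt (v, take m p) :: _ \<Rightarrow> 'k) \<in> arrow_ideal_pow Q m"
      using nonzero_path_qpath[OF q] \<open>\<not> length p < m\<close> by (auto simp: arrow_ideal_pow_def)
    then have "(path_elt (v, take m p) :: _ \<Rightarrow> 'k) \<in> relation_ideal" using m I by auto
    then have "(path_elt (v, take m p) :: _ \<Rightarrow> 'k) (v, take m p) = 0"
      unfolding relation_ideal_eq using q by blast
    then show False by (simp add: path_elt_def)
  qed
  have inI: "arrow_prod Q a b \<in> I" "a \<in> arcs Q" "b \<in> arcs Q" "head Q a = tail Q b" if "(tail Q a, [a, b]) \<in> S" for a b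
  proof -
    show arr: "a \<in> arcs Q" "b \<in> arcs Q" "head Q a = tail Q b" using that quadratic by (auto simp: qpaths_Cons)
    show "arrow_prod Q a b \<in> I" using arrow_prod_in_ideal_iff[OF arr] that by (simp add: I)
  qed
  have out1: "card {\<beta> \<in> arcs Q. head Q a = tail Q \<beta> \<and> arrow_prod Q a \<beta> \<in> I} \<le> Suc 0"
    and in1: "card {\<gamma> \<in> arcs Q. head Q \<gamma> = tail Q a \<and> arrow_prod Q \<gamma> a \<in> I} \<le> Suc 0" if "a \<in> arcs Q" for a
    using g that by (simp_all add: gentle_def)
  have "gentle_algebra Q S I"
  proof (intro gentle_algebra.intro monomial_algebra.intro monomial_algebra_axioms.intro gentle_algebra_axioms.intro)
    show "monomial_quiver Q S" by unfold_locales
    show "\<exists>m. \<forall>q. nonzero_path q \<longrightarrow> length (snd q) < m" using short by auto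
    show "b = b'" if "(tail Q a, [a, b]) \<in> S" "(tail Q a, [a, b']) \<in> S" for a b b'
      using out1[OF inI(2)[OF that(1)]] inI[OF that(1)] inI[OF that(2)]
      by (subst (asm) card_le_Suc0_iff_eq) auto
    show "a = a'" if "(tail Q a, [a, b]) \<in> S" "(tail Q a', [a', b]) \<in> S" for a a' b
      using in1[OF inI(3)[OF that(1)]] inI[OF that(1)] inI[OF that(2)]
      by (subst (asm) card_le_Suc0_iff_eq) auto
  qed (use I finite_arcs in auto)
  then show thesis by (rule that)
qed

lemma tri_side_periodic: "tri_side (l + 3) = tri_side l"
proof -
  have "tri_vertex (l + 3) = tri_vertex l" for l
  proof -
    have "2 * pi * real (l + 3) / 3 = 2 * pi * real l / 3 + 2 * pi" by (simp add: field_simps)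
    then show ?thesis unfolding tri_vertex_def by (simp only:) (simp add: complex_eq_iff)
  qed
  from this[of l] this[of "Suc l"] show ?thesis by (simp add: tri_side_def)
qed

text \<open>
  The sides of a triangle are numbered with period three, so the numbering may start at any side.
\<close>

lemma tri_relations_rotate:
  assumes "(i, [(D, i, j), (D, j, k)]) \<in> tri_relations S A Mk T"
  shows "(j, [(D, j, k), (D, k, i)]) \<in> tri_relations S A Mk T"
proof -
  obtain f l where f: "D \<in> triangles S A T" "triangle_map S A Mk T D f" "\<forall>m. f ` tri_side m \<in> T"
    "i = f ` tri_side l" "j = f ` tri_side (Suc l)" "k = f ` tri_side (Suc (Suc l))"
    using assms by (auto simp: tri_relations_def)
  have "i = f ` tri_side (Suc (Suc (Suc l)))" using tri_side_periodic[of l] f(4) by (simp add: numeral_3_eq_3)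
  then show ?thesis using f unfolding tri_relations_def by blast
qed

lemma tri_relations_cases:
  assumes "q \<in> tri_relations S A Mk T"
  obtains D i j k where "q = (i, [(D, i, j), (D, j, k)])" "(D, i, j) \<in> arcs (tri_quiver S A Mk T)"
    "(D, j, k) \<in> arcs (tri_quiver S A Mk T)"
proof -
  obtain D i j k f l where f: "q = (i, [(D, i, j), (D, j, k)])" "D \<in> triangles S A T"
    "triangle_map S A Mk T D f" "\<forall>m. f ` tri_side m \<in> T"
    "i = f ` tri_side l" "j = f ` tri_side (Suc l)" "k = f ` tri_side (Suc (Suc l))"
    using assms by (auto simp: tri_relations_def)
  have "(D, i, j) \<in> arcs (tri_quiver S A Mk T)" "(D, j, k) \<in> arcs (tri_quiver S A Mk T)"
    using f unfolding tri_quiver_def by auto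
  with f(1) show thesis by (rule that)
qed

lemma monomial_quiver_tri:
  assumes "finite T"
  shows "monomial_quiver (tri_quiver S A Mk T) (tri_relations S A Mk T)"
proof -
  interpret wf_digraph "tri_quiver S A Mk T" by unfold_locales (auto simp: tri_quiver_def)
  have "q \<in> qpaths (tri_quiver S A Mk T) \<and> length (snd q) = 2" if "q \<in> tri_relations S A Mk T" for q
    using that
  proof (rule tri_relations_cases)
    fix D i j k
    assume q: "q = (i, [(D, i, j), (D, j, k)])" and a: "(D, i, j) \<in> arcs (tri_quiver S A Mk T)"
      "(D, j, k) \<in> arcs (tri_quiver S A Mk T)"
    have "awalk i [(D, i, j), (D, j, k)] k"
      using a by (auto simp: awalk_Cons_iff awalk_Nil_iff) (auto simp: tri_quiver_def)
    then show ?thesis by (auto simp: q qpaths_def)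
  qed
  then show ?thesis by unfold_locales (use assms in \<open>auto simp: tri_quiver_def\<close>)
qed

text \<open>
  A path of length two lies in the ideal iff it is one of the generators. So an isomorphism of
  bound quivers identifies the generating relations, and the rotation of the relations inside an
  internal triangle can be transported.
\<close>

lemma triangular_gentle_algebra_of_triangulation:
  fixes I :: "('v \<times> 'a list \<Rightarrow> 'k :: field) set"
  assumes gen: "gentle_algebra Q \<rho> I" and T: "finite T"
    and iso: "bound_quiver_iso Q I (tri_quiver S A Mk T) (tri_ideal S A Mk T)"
  shows "triangular_gentle_algebra Q \<rho> I"
proof -
  interpret gentle_algebra Q \<rho> I by (rule gen)
  let ?Q = "tri_quiver S A Mk T" and ?S = "tri_relations S A Mk T"
  let ?I = "tri_ideal S A Mk T :: (_ \<Rightarrow> 'k) set"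
  interpret T: monomial_quiver ?Q ?S by (rule monomial_quiver_tri[OF T])
  obtain h where h: "digraph_isomorphism h" "app_iso h Q = ?Q"
    and I: "I = {x \<in> carrier (path_algebra Q).
       \<exists>y\<in>?I. \<forall>(v, p)\<in>qpaths Q. x (v, p) = y (iso_verts h v, map (iso_arcs h) p)}"
    using iso by (auto simp: bound_quiver_iso_def)
  let ?v = "iso_verts h" and ?a = "iso_arcs h"
  have injv: "inj_on ?v (verts Q)" and inja: "inj_on ?a (arcs Q)" using h(1) by (auto simp: digraph_isomorphism_def)
  have arcsQ: "arcs ?Q = ?a ` arcs Q" by (simp flip: h(2))
  have vQ: "?v v \<in> verts ?Q" if "v \<in> verts Q" for v using that by (simp flip: h(2))
  have th: "tail ?Q (?a a) = ?v (tail Q a)" "head ?Q (?a a) = ?v (head Q a)" if "a \<in> arcs Q" for a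
    using h(1) that by (simp_all flip: h(2) add: digraph_isomorphism_def)
  have inI: "(tail Q a, [a, b]) \<in> \<rho> \<longleftrightarrow> (?v (tail Q a), [?a a, ?a b]) \<in> ?S"
    if ab: "a \<in> arcs Q" "b \<in> arcs Q" "head Q a = tail Q b" for a b
  proof -
    have q: "(tail Q a, [a, b]) \<in> qpaths Q" using ab by (simp add: qpaths_Cons qpaths_Nil)
    have q': "(?v (tail Q a), [?a a, ?a b]) \<in> qpaths ?Q"
      using ab vQ[of "head Q b"] by (simp add: T.qpaths_Cons T.qpaths_Nil arcsQ th)
    have I': "?I = {x \<in> carrier (path_algebra ?Q). \<forall>q. T.nonzero_path q \<longrightarrow> x q = 0}"
      unfolding tri_ideal_def by (rule T.relation_ideal_eq)
    have "(tail Q a, [a, b]) \<in> \<rho> \<longleftrightarrow> (arrow_prod Q a b :: _ \<Rightarrow> 'k) \<in> I"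
      using arrow_prod_in_ideal_iff[OF ab, symmetric] by (simp only: I_def)
    also have "\<dots> \<longleftrightarrow> (?v (tail Q a), [?a a, ?a b]) \<in> ?S"
    proof
      assume "(arrow_prod Q a b :: _ \<Rightarrow> 'k) \<in> I"
      then obtain y where y: "y \<in> ?I"
        "\<forall>(v, p)\<in>qpaths Q. (arrow_prod Q a b :: _ \<Rightarrow> 'k) (v, p) = y (?v v, map ?a p)"
        unfolding I by blast
      have "y (?v (tail Q a), [?a a, ?a b]) = 1" using bspec[OF y(2) q] by (simp add: path_elt_def)
      then have "\<not> T.nonzero_path (?v (tail Q a), [?a a, ?a b])" using y(1) unfolding I' by auto
      then show "(?v (tail Q a), [?a a, ?a b]) \<in> ?S"
        using q' by (simp add: T.nonzero_path_def th(1)[OF ab(1)])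
    next
      assume S: "(?v (tail Q a), [?a a, ?a b]) \<in> ?S"
      let ?y = "path_elt (?v (tail Q a), [?a a, ?a b]) :: _ \<Rightarrow> 'k"
      have "?y \<in> ?I"
        unfolding I' using T.path_elt_carrier[OF q'] S
        by (auto simp: path_elt_def T.nonzero_path_def th(1)[OF ab(1)])
      moreover have "(arrow_prod Q a b :: _ \<Rightarrow> 'k) (v, p) = ?y (?v v, map ?a p)" if vp: "(v, p) \<in> qpaths Q" for v p
      proof -
        have "v \<in> verts Q" by (rule qpaths_start[OF vp])
        moreover have "tail Q a \<in> verts Q" using ab by simp
        moreover have "set p \<subseteq> arcs Q" using vp by (auto simp: qpaths_def awalk_def)
        ultimately have "?v v = ?v (tail Q a) \<and> map ?a p = map ?a [a, b] \<longleftrightarrow> v = tail Q a \<and> p = [a, b]"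
          using inj_on_eq_iff[OF injv] inj_on_map_eq_map[of ?a p "[a, b]"] inj_on_subset[OF inja, of "set p \<union> {a, b}"] ab
          by auto
        then show ?thesis by (auto simp: path_elt_def)
      qed
      ultimately show "(arrow_prod Q a b :: _ \<Rightarrow> 'k) \<in> I"
        unfolding I using path_elt_carrier[OF q] by blast
    qed
    finally show ?thesis .
  qed
  have "\<exists>c. (tail Q b, [b, c]) \<in> \<rho> \<and> (tail Q c, [c, a]) \<in> \<rho>" if ab: "(tail Q a, [a, b]) \<in> \<rho>" for a b
  proof -
    note arr = relation_arrows[OF ab]
    have S: "(?v (tail Q a), [?a a, ?a b]) \<in> ?S" using inI[OF arr] ab by simp
    from S obtain D i j k where ijk: "?v (tail Q a) = i" "?a a = (D, i, j)" "?a b = (D, j, k)"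
      by (rule tri_relations_cases) auto
    have S1: "(i, [(D, i, j), (D, j, k)]) \<in> ?S" using S by (simp only: ijk)
    note S2 = tri_relations_rotate[OF S1]
    note S3 = tri_relations_rotate[OF S2]
    have "(D, k, i) \<in> arcs ?Q" using S2 by (rule tri_relations_cases) auto
    then obtain c where c: "c \<in> arcs Q" "?a c = (D, k, i)" unfolding arcsQ by force
    have tl: "tail ?Q (D', x, y) = x" "head ?Q (D', x, y) = y" for D' x y by (simp_all add: tri_quiver_def)
    have "?v (head Q b) = ?v (tail Q c)" "?v (head Q c) = ?v (tail Q a)"
      using th[OF arr(1)] th[OF arr(2)] th[OF c(1)] by (simp_all add: ijk c(2) tl)
    then have hc: "head Q b = tail Q c" "head Q c = tail Q a"
      using inj_onD[OF injv] arr c(1) by auto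
    have "(tail Q b, [b, c]) \<in> \<rho>"
      using inI[OF arr(2) c(1) hc(1)] th(1)[OF arr(2)] S2 by (simp add: ijk c(2) tl)
    moreover have "(tail Q c, [c, a]) \<in> \<rho>"
      using inI[OF c(1) arr(1) hc(2)] th(1)[OF c(1)] S3 by (simp add: ijk c(2) tl)
    ultimately show ?thesis by blast
  qed
  then show ?thesis by (intro triangular_gentle_algebra.intro gen triangular_gentle_algebra_axioms.intro)
qed

section \<open>Extensions between string modules\<close>

theorem corollary3p3:
  fixes Q :: "('v, 'a) pre_digraph"
    and I :: "('v \<times> 'a list \<Rightarrow> 'k :: alg_closed_field) set"
    and M :: "(('v \<times> 'a list \<Rightarrow> 'k) set, 'm) module"
    and N :: "(('v \<times> 'a list \<Rightarrow> 'k) set, 'n) module"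
  assumes "gentle Q I"
    and "is_string_module Q I M" and "indecomposable (bound_algebra Q I) M"
    and "is_string_module Q I N" and "indecomposable (bound_algebra Q I) N"
  shows
    "(\<forall>(k :: nat) (L :: nat \<Rightarrow> (('v \<times> 'a list \<Rightarrow> 'k) set, ('v \<times> 'a list \<Rightarrow> 'k) set univ) module).
        1 \<le> k \<and>
        (\<forall>i\<le>k. fg_module (bound_algebra Q I) (L i)) \<and>
        mod_isomorphic (bound_algebra Q I) (syzygy (bound_algebra Q I) M) (mod_family_sum {..k} L) \<and>
        (\<forall>i\<in>{1..k-1}. projective (bound_algebra Q I) (L i)) \<and>
        (\<forall>i\<in>{0, k}. uniserial (bound_algebra Q I) (L i) \<or> zero_module (L i))
        \<longrightarrow>
        vs_isomorphic (Ext (bound_algebra Q I) 2 M N)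
          (mod_sum (Ext (bound_algebra Q I) 1 (L 0) N) (Ext (bound_algebra Q I) 1 (L k) N)) \<and>
        (\<forall>n\<ge>2.
          vs_isomorphic (Ext (bound_algebra Q I) n M N)
            (mod_sum (Ext (bound_algebra Q I) 1 (syzygy_pow (bound_algebra Q I) (n - 2) (L 0)) N)
                     (Ext (bound_algebra Q I) 1 (syzygy_pow (bound_algebra Q I) (n - 2) (L k)) N)) \<and>
          (\<forall>i\<in>{0, k}.
             zero_module (syzygy_pow (bound_algebra Q I) (n - 2) (L i)) \<or>
             (\<exists>\<alpha>\<in>arcs Q. mod_isomorphic (bound_algebra Q I)
                (syzygy_pow (bound_algebra Q I) (n - 2) (L i)) (arrow_module Q I \<alpha>))))) \<and>
     (\<forall>(S :: 's topology) A Mk T.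
        ideal_triangulation S A Mk T \<and>
        bound_quiver_iso Q I (tri_quiver S A Mk T) (tri_ideal S A Mk T)
        \<longrightarrow>
        (\<forall>n\<ge>2. vs_isomorphic (Ext (bound_algebra Q I) n M N)
                  (Ext (bound_algebra Q I) (n + 3) M N)))"
proof -
  obtain \<rho> where g: "gentle_algebra Q \<rho> I" by (rule gentle_algebra_exists[OF assms(1)])
  interpret gentle_algebra Q \<rho> I by (rule g)
  let ?\<Lambda> = "bound_algebra Q I"
  have M: "fg_module ?\<Lambda> M" by (rule fg_string_module[OF assms(2)])
  have N: "right_module ?\<Lambda> N" using assms(4) by (simp add: is_string_module_def)
  show ?thesis
  proof (intro conjI allI impI)
    fix k :: nat and L :: "nat \<Rightarrow> (('v \<times> 'a list \<Rightarrow> 'k) set, ('v \<times> 'a list \<Rightarrow> 'k) set univ) module"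
    assume L: "1 \<le> k \<and> (\<forall>i\<le>k. fg_module ?\<Lambda> (L i)) \<and> mod_isomorphic ?\<Lambda> (syzygy ?\<Lambda> M) (mod_family_sum {..k} L) \<and>
        (\<forall>i\<in>{1..k-1}. projective ?\<Lambda> (L i)) \<and> (\<forall>i\<in>{0, k}. uniserial ?\<Lambda> (L i) \<or> zero_module (L i))"
    then have Lk: "1 \<le> k" "\<And>i. i \<le> k \<Longrightarrow> fg_module ?\<Lambda> (L i)" "mod_isomorphic ?\<Lambda> (syzygy ?\<Lambda> M) (mod_family_sum {..k} L)"
      "\<And>i. i \<in> {1..k-1} \<Longrightarrow> projective ?\<Lambda> (L i)" "\<And>i. i \<in> {0, k} \<Longrightarrow> uniserial ?\<Lambda> (L i) \<or> zero_module (L i)"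
      by blast+
    note two = Ext_of_two_ends[where L = L, OF M N Lk]
    show "vs_isomorphic (Ext ?\<Lambda> 2 M N) (mod_sum (Ext ?\<Lambda> 1 (L 0) N) (Ext ?\<Lambda> 1 (L k) N))"
      using two(1)[of 0] by (simp add: syzygy_pow_def numeral_2_eq_2)
    fix n :: nat assume "2 \<le> n"
    then obtain j where n: "n = Suc (Suc j)" by (metis add_2_eq_Suc le_Suc_ex)
    show "vs_isomorphic (Ext ?\<Lambda> n M N)
        (mod_sum (Ext ?\<Lambda> 1 (syzygy_pow ?\<Lambda> (n - 2) (L 0)) N) (Ext ?\<Lambda> 1 (syzygy_pow ?\<Lambda> (n - 2) (L k)) N))"
      using two(1)[of j] by (simp add: n)
    show "\<forall>i\<in>{0, k}. zero_module (syzygy_pow ?\<Lambda> (n - 2) (L i)) \<or>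
        (\<exists>\<alpha>\<in>arcs Q. mod_isomorphic ?\<Lambda> (syzygy_pow ?\<Lambda> (n - 2) (L i)) (arrow_module Q I \<alpha>))"
      using two(2)[of _ j] unfolding n arrow_or_zero_def arrow_module_RA by (metis diff_Suc_Suc diff_zero numeral_2_eq_2)
  next
    fix S :: "'s topology" and A Mk T n
    assume T: "ideal_triangulation S A Mk T \<and> bound_quiver_iso Q I (tri_quiver S A Mk T) (tri_ideal S A Mk T)"
      and "2 \<le> (n :: nat)"
    then obtain j where n: "n = Suc (Suc j)" by (metis add_2_eq_Suc le_Suc_ex)
    have "finite T" using T by (simp add: ideal_triangulation_def)
    then interpret triangular_gentle_algebra Q \<rho> I
      using triangular_gentle_algebra_of_triangulation[OF g] T by blast
    show "vs_isomorphic (Ext ?\<Lambda> n M N) (Ext ?\<Lambda> (n + 3) M N)"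
      using Ext_three_periodic[OF M N, of j] by (simp add: n)
  qed
qed

end
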